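(* Let $\{\lambda_n;n\ge1\}$ be an increasing sequence of positive real numbers that increases to infinity, and let $X^n=\{X^n_t,t\ge0;\mathbb{P}^n_x,x\in E\}$ be the Hunt process associated with the regular Dirichlet form $(\mathcal{E}^{(\lambda_n)},\mathcal{F})$ on $L^2(E;m)$. Let $Y$ be the sticky Markov process with darning, i.e. the Hunt process on $E^*$ associated with the regular Dirichlet form $(\mathcal{E}^*,\mathcal{F}^* )$ on $L^2(E^*;\mu)$. Then for every $0=t_0<t_1<\cdots<t_k<\infty$ and bounded $\{f_j;0\le j\le k\}\subset\overline{\widetilde{\mathcal{F}}}$, $$\lim_{n\to\infty}\mathbb{E}^n_m\Big[\prod_{j=0}^k f_j(X^n_{t_j})\Big]=\mathbb{E}^*_\mu\Big[\prod_{j=0}^k f_j^*(Y_{t_j})\Big].$$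
   Context: Setting. $E$ is a locally compact separable metric space, $m$ is a Radon measure on $E$ with full support, $(\mathcal{E},\mathcal{F})$ is a regular symmetric Dirichlet form on $L^2(E;m)$, and $X$ is the $m$-symmetric Hunt process on $E$ associated with it. Every $f\in\mathcal{F}$ is represented by its $\mathcal{E}$-quasi-continuous version; "$\mathcal{E}$-q.e." means except on an $\mathcal{E}$-polar set. Collapsed space. $K_1,\dots,K_N$ are separated (disjoint), non-$\mathcal{E}$-polar compact subsets of $E$; $F=\bigcup_{j=1}^N K_j$, $D=E\setminus F$. Identifying each $K_j$ with a single point $a_j^*$ gives the topological space $E^*:=D\cup\{a_1^*,\dots,a_N^*\}$, a neighborhood of $a_j^*$ being $(U\cap D)\cup\{a_j^*\}$ for some neighborhood $U$ of $K_j$ in $E$. Let $m^*=m$ on $D$, $m^*(\{a_1^*,\dots,a_N^*\})=0$, and $\mu:=m^*+\sum_{j=1}^N m(K_j)\delta_{a_j^*}$. The form $(\mathcal{E}^*,\mathcal{F}^* )$. Let $\sigma_F:=\inf\{t\ge0:X_t\in F\}$ and, for $\alpha>0$, $u_\alpha^{(j)}(x):=\mathbb{E}_x[e^{-\alpha\sigma_F};X_{\sigma_F}\in K_j]\in\mathcal{F}$; $\mathcal{H}_\alpha$ is the linear span of $u_\alpha^{(1)},\dots,u_\alpha^{(N)}$ and $\mathcal{F}^D=\{f\in\mathcal{F}:f=0\ \mathcal{E}\text{-q.e. on }E\setminus D\}$. Define $\mathcal{F}^*=\mathcal{F}^D\oplus\mathcal{H}_\alpha$ (independent of $\alpha>0$)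 and $\mathcal{E}^*=\mathcal{E}$ on $\mathcal{F}^*$; $\mathcal{F}^*$ consists of the functions in $\mathcal{F}$ that are constant $\mathcal{E}$-q.e. on each $K_j$, regarded as functions on $E^*$ with value at $a_j^*$ equal to the constant on $K_j$. $(\mathcal{E}^*,\mathcal{F}^* )$ is a regular Dirichlet form on $L^2(E^*;m^* )$ (with Hunt process $X^*$, the Markov process with darning) and also on $L^2(E^*;\mu)$; its Hunt process $Y$ for the latter is the time change of $X^*$ by the positive continuous additive functional with Revuz measure $\mu$. $\widetilde{\mathcal{F}}=\{f\in\mathcal{F}: f=\text{constant }\mathcal{E}\text{-q.e. on }K_j\text{ for each }1\le j\le N\}$, and $\overline{\widetilde{\mathcal{F}}}$ is its closure in $L^2(E;m)$. For $f\in L^2(E;m)$, $f^*$ is the function on $E^*$ with $f^*=f$ on $D$, and $f^*(a_j^* )=\frac{1}{m(K_j)}\int_{K_j}f(y)\,m(dy)$ when $m(K_j)>0$, $f^*(a_j^* )=0$ when $m(K_j)=0$. Approximating forms. For each $j$, $\mu_j$ is a finite smooth measure (with respect to $(\mathcal{E},\mathcal{F})$) whose quasi-support is $K_j$ and having bounded 1-potential $G_1\mu_j$. For $\lambda>0$ and $u,v\in\mathcal{F}$, $$\mathcal{E}^{(\lambda)}(u,v)=\mathcal{E}(u,v)+\lambda\sum_{j=1}^N\int_{K_j\times K_j}(u(x)-u(y))(v(x)-v(y))\,\mu_j(dx)\mu_j(dy);$$ $(\mathcal{E}^{(\lambda)},\mathcal{F})$ is a regular Dirichlet form on $L^2(E;m)$.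 Notation. $\mathbb{E}^n_m[\cdot]=\int_E\mathbb{E}^n_x[\cdot]\,m(dx)$ and $\mathbb{E}^*_\mu[\cdot]=\int_{E^*}\mathbb{E}^*_x[\cdot]\,\mu(dx)$, with $\mathbb{E}^*_x$ the expectation for $Y$ started at $x$. Functions are extended by $0$ to the cemetery point. *)

theory Defs
  imports "HOL-Probability.Probability"
begin

section \<open>Borel sets, Radon measures, square-integrable functions\<close>

definition borel_of :: "'s topology \<Rightarrow> 's measure" where
  "borel_of T = sigma (topspace T) {U. openin T U}"

definition radon_measure :: "'s topology \<Rightarrow> 's measure \<Rightarrow> bool" where
  "radon_measure T m \<longleftrightarrow>
     sets m = sets (borel_of T) \<and>
     (\<forall>C. compactin T C \<longrightarrow> emeasure m C < \<infinity>) \<and>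
     (\<forall>A\<in>sets m. emeasure m A = (SUP C\<in>{C. compactin T C \<and> C \<subseteq> A}. emeasure m C))"

definition full_support :: "'s topology \<Rightarrow> 's measure \<Rightarrow> bool" where
  "full_support T m \<longleftrightarrow> (\<forall>U. openin T U \<and> U \<noteq> {} \<longrightarrow> emeasure m U > 0)"

text \<open>\<open>L\<^sup>2\<close> is represented by Borel functions rather than by equivalence classes; sets of elements
  of \<open>L\<^sup>2\<close> are sets of functions closed under a.e. equality.\<close>

definition L2 :: "'s measure \<Rightarrow> ('s \<Rightarrow> real) set" where
  "L2 m = {f \<in> borel_measurable m. integrable m (\<lambda>x. (f x)\<^sup>2)}"

definition l2_inner :: "'s measure \<Rightarrow> ('s \<Rightarrow> real) \<Rightarrow> ('s \<Rightarrow> real) \<Rightarrow> real" where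
  "l2_inner m f g = (\<integral>x. f x * g x \<partial>m)"

definition l2_closure :: "'s measure \<Rightarrow> ('s \<Rightarrow> real) set \<Rightarrow> ('s \<Rightarrow> real) set" where
  "l2_closure m A = {f \<in> L2 m. \<forall>\<epsilon>>0. \<exists>g\<in>A. (\<integral>x. (f x - g x)\<^sup>2 \<partial>m) < \<epsilon>}"

definition ess_bounded :: "'s measure \<Rightarrow> ('s \<Rightarrow> real) \<Rightarrow> bool" where
  "ess_bounded m f \<longleftrightarrow> (\<exists>B. AE x in m. \<bar>f x\<bar> \<le> B)"

definition compactly_supported :: "'s topology \<Rightarrow> ('s \<Rightarrow> real) set" where
  "compactly_supported T = {f. continuous_map T euclideanreal f \<and>
     (\<exists>C. compactin T C \<and> (\<forall>x\<in>topspace T - C. f x = 0))}"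

section \<open>Symmetric Dirichlet forms\<close>

record 's form_data =
  base :: "'s topology"
  refm :: "'s measure"
  fdom :: "('s \<Rightarrow> real) set"
  energy :: "('s \<Rightarrow> real) \<Rightarrow> ('s \<Rightarrow> real) \<Rightarrow> real"

definition energy_at :: "'s form_data \<Rightarrow> real \<Rightarrow> ('s \<Rightarrow> real) \<Rightarrow> ('s \<Rightarrow> real) \<Rightarrow> real" where
  "energy_at D \<alpha> u v = energy D u v + \<alpha> * l2_inner (refm D) u v"

definition energy1_dist :: "'s form_data \<Rightarrow> ('s \<Rightarrow> real) \<Rightarrow> ('s \<Rightarrow> real) \<Rightarrow> real" where
  "energy1_dist D u v = sqrt (energy_at D 1 (\<lambda>x. u x - v x) (\<lambda>x. u x - v x))"

definition energy1_dense :: "'s form_data \<Rightarrow> ('s \<Rightarrow> real) set \<Rightarrow> bool" where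
  "energy1_dense D A \<longleftrightarrow> (\<forall>u\<in>fdom D. \<forall>\<epsilon>>0. \<exists>v\<in>A. energy1_dist D u v < \<epsilon>)"

definition symmetric_form :: "'s form_data \<Rightarrow> bool" where
  "symmetric_form D \<longleftrightarrow>
     fdom D \<subseteq> L2 (refm D) \<and> (\<lambda>x. 0) \<in> fdom D \<and>
     (\<forall>u\<in>fdom D. \<forall>v\<in>fdom D. \<forall>a b. (\<lambda>x. a * u x + b * v x) \<in> fdom D) \<and>
     (\<forall>u\<in>fdom D. \<forall>v\<in>borel_measurable (refm D). (AE x in refm D. v x = u x) \<longrightarrow>
        v \<in> fdom D \<and> (\<forall>w\<in>fdom D. energy D v w = energy D u w)) \<and>
     L2 (refm D) \<subseteq> l2_closure (refm D) (fdom D) \<and>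
     (\<forall>u\<in>fdom D. \<forall>v\<in>fdom D. energy D u v = energy D v u) \<and>
     (\<forall>u\<in>fdom D. \<forall>v\<in>fdom D. \<forall>w\<in>fdom D. \<forall>a b.
        energy D (\<lambda>x. a * u x + b * v x) w = a * energy D u w + b * energy D v w) \<and>
     (\<forall>u\<in>fdom D. energy D u u \<ge> 0)"

definition closed_form :: "'s form_data \<Rightarrow> bool" where
  "closed_form D \<longleftrightarrow>
     (\<forall>u. (\<forall>n. u n \<in> fdom D) \<and>
        (\<forall>\<epsilon>>0. \<exists>n0::nat. \<forall>p\<ge>n0. \<forall>q\<ge>n0. energy1_dist D (u p) (u q) < \<epsilon>) \<longrightarrow>
        (\<exists>v\<in>fdom D. (\<lambda>n. energy1_dist D (u n) v) \<longlonglongrightarrow> 0))"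

definition markovian_form :: "'s form_data \<Rightarrow> bool" where
  "markovian_form D \<longleftrightarrow>
     (\<forall>u\<in>fdom D. (\<lambda>x. min 1 (max 0 (u x))) \<in> fdom D \<and>
        energy D (\<lambda>x. min 1 (max 0 (u x))) (\<lambda>x. min 1 (max 0 (u x))) \<le> energy D u u)"

definition dirichlet_form :: "'s form_data \<Rightarrow> bool" where
  "dirichlet_form D \<longleftrightarrow> sets (refm D) = sets (borel_of (base D)) \<and>
     symmetric_form D \<and> closed_form D \<and> markovian_form D"

definition regular_dirichlet_form :: "'s form_data \<Rightarrow> bool" where
  "regular_dirichlet_form D \<longleftrightarrow> dirichlet_form D \<and>
     energy1_dense D (fdom D \<inter> compactly_supported (base D)) \<and>
     (\<forall>f\<in>compactly_supported (base D). \<forall>\<epsilon>>0. \<exists>g\<in>fdom D \<inter> compactly_supported (base D).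
        \<forall>x\<in>topspace (base D). \<bar>f x - g x\<bar> < \<epsilon>)"

subsection \<open>Nests, polar sets, quasi-continuity\<close>

definition nest :: "'s form_data \<Rightarrow> (nat \<Rightarrow> 's set) \<Rightarrow> bool" where
  "nest D C \<longleftrightarrow> (\<forall>k. closedin (base D) (C k)) \<and> (\<forall>k. C k \<subseteq> C (Suc k)) \<and>
     energy1_dense D (\<Union>k. {f \<in> fdom D. AE x in refm D. x \<notin> C k \<longrightarrow> f x = 0})"

definition polar :: "'s form_data \<Rightarrow> 's set \<Rightarrow> bool" where
  "polar D A \<longleftrightarrow> (\<exists>C. nest D C \<and> A \<subseteq> topspace (base D) - (\<Union>k. C k))"

definition qe_on :: "'s form_data \<Rightarrow> 's set \<Rightarrow> ('s \<Rightarrow> bool) \<Rightarrow> bool" where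
  "qe_on D A P \<longleftrightarrow> (\<exists>Z. polar D Z \<and> (\<forall>x\<in>A - Z. P x))"

definition quasi_continuous :: "'s form_data \<Rightarrow> ('s \<Rightarrow> real) \<Rightarrow> bool" where
  "quasi_continuous D f \<longleftrightarrow>
     (\<exists>C. nest D C \<and> (\<forall>k. continuous_map (subtopology (base D) (C k)) euclideanreal f))"

definition qc_version :: "'s form_data \<Rightarrow> ('s \<Rightarrow> real) \<Rightarrow> ('s \<Rightarrow> real) \<Rightarrow> bool" where
  "qc_version D f g \<longleftrightarrow> quasi_continuous D g \<and> (AE x in refm D. g x = f x)"

definition quasi_closed :: "'s form_data \<Rightarrow> 's set \<Rightarrow> bool" where
  "quasi_closed D A \<longleftrightarrow> A \<subseteq> topspace (base D) \<and>
     (\<exists>C. nest D C \<and> (\<forall>k. closedin (subtopology (base D) (C k)) (A \<inter> C k)))"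

subsection \<open>Smooth measures\<close>

text \<open>A polar set is contained in a Borel polar set (the complement of a nest), so it is enough
  to consider Borel ones.\<close>

definition smooth_measure :: "'s form_data \<Rightarrow> 's measure \<Rightarrow> bool" where
  "smooth_measure D \<nu> \<longleftrightarrow> sets \<nu> = sets (borel_of (base D)) \<and>
     (\<forall>A\<in>sets \<nu>. polar D A \<longrightarrow> emeasure \<nu> A = 0) \<and>
     (\<exists>C. nest D C \<and> (\<forall>k. emeasure \<nu> (C k) < \<infinity>))"

text \<open>The quasi-support is the smallest (up to polar sets) quasi-closed set carrying the measure.\<close>

definition quasi_support :: "'s form_data \<Rightarrow> 's measure \<Rightarrow> 's set \<Rightarrow> bool" where
  "quasi_support D \<nu> S \<longleftrightarrow> quasi_closed D S \<and> (AE x in \<nu>. x \<in> S) \<and>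
     (\<forall>S'. quasi_closed D S' \<and> (AE x in \<nu>. x \<in> S') \<longrightarrow> qe_on D S (\<lambda>x. x \<in> S'))"

text \<open>\<open>g\<close> is the \<open>\<alpha>\<close>-potential \<open>G\<^sub>\<alpha>\<nu>\<close>.\<close>

definition potential :: "'s form_data \<Rightarrow> real \<Rightarrow> 's measure \<Rightarrow> ('s \<Rightarrow> real) \<Rightarrow> bool" where
  "potential D \<alpha> \<nu> g \<longleftrightarrow> g \<in> fdom D \<and>
     (\<forall>v\<in>fdom D \<inter> compactly_supported (base D).
        integrable \<nu> v \<and> energy_at D \<alpha> g v = (\<integral>x. v x \<partial>\<nu>))"

definition bounded_1_potential :: "'s form_data \<Rightarrow> 's measure \<Rightarrow> bool" where
  "bounded_1_potential D \<nu> \<longleftrightarrow> (\<exists>g. potential D 1 \<nu> g \<and> ess_bounded (refm D) g)"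

section \<open>Hunt processes\<close>

text \<open>The one-point compactification of \<open>T\<close>; the added point \<open>None\<close> is the cemetery.  It is
  isolated if \<open>T\<close> is already compact.\<close>

definition cemetery_topology :: "'s topology \<Rightarrow> 's option topology" where
  "cemetery_topology T = topology (\<lambda>W. W \<subseteq> insert None (Some ` topspace T) \<and>
     openin T (Some -` W) \<and> (None \<in> W \<longrightarrow> compactin T (topspace T - Some -` W)))"

lemma openin_cemetery_topology:
  "openin (cemetery_topology T) W \<longleftrightarrow> W \<subseteq> insert None (Some ` topspace T) \<and>
     openin T (Some -` W) \<and> (None \<in> W \<longrightarrow> compactin T (topspace T - Some -` W))"
proof -
  let ?P = "\<lambda>W. W \<subseteq> insert None (Some ` topspace T) \<and>
     openin T (Some -` W) \<and> (None \<in> W \<longrightarrow> compactin T (topspace T - Some -` W))"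
  have "istopology ?P"
    unfolding istopology_def
  proof (intro conjI allI impI)
    fix S W assume S: "?P S" and W: "?P W"
    have eq: "topspace T - Some -` (S \<inter> W) = (topspace T - Some -` S) \<union> (topspace T - Some -` W)"
      by auto
    show "S \<inter> W \<subseteq> insert None (Some ` topspace T)" using S by auto
    show "openin T (Some -` (S \<inter> W))" using S W by (simp add: vimage_Int openin_Int)
    show "compactin T (topspace T - Some -` (S \<inter> W))" if "None \<in> S \<inter> W"
      using S W that unfolding eq by (intro compactin_Un) auto
  next
    fix \<K> assume K: "\<forall>W\<in>\<K>. ?P W"
    show "\<Union>\<K> \<subseteq> insert None (Some ` topspace T)" using K by blast
    show op: "openin T (Some -` \<Union>\<K>)" using K by (auto simp: vimage_Union)
    show "compactin T (topspace T - Some -` \<Union>\<K>)" if N: "None \<in> \<Union>\<K>"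
    proof -
      obtain W where W: "W \<in> \<K>" "None \<in> W" using N by auto
      have "compactin T (topspace T - Some -` W)" using K W by auto
      moreover have "closedin T (topspace T - Some -` \<Union>\<K>)" using op by auto
      ultimately show ?thesis using W by (elim closed_compactin) auto
    qed
  qed
  then show ?thesis unfolding cemetery_topology_def by (simp add: topology_inverse')
qed

lemma topspace_cemetery_topology: "topspace (cemetery_topology T) = insert None (Some ` topspace T)"
proof -
  have eq: "Some -` insert None (Some ` topspace T) = topspace T" by auto
  have "openin (cemetery_topology T) (insert None (Some ` topspace T))"
    unfolding openin_cemetery_topology eq by simp
  then show ?thesis using openin_cemetery_topology[of T "topspace (cemetery_topology T)"]
    by (metis openin_subset openin_topspace subset_antisym)
qed

text \<open>Times are nonnegative reals; \<open>path\<close> is irrelevant at negative arguments.\<close>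

record ('s, 'w) process =
  sample :: "'w set"
  path :: "real \<Rightarrow> 'w \<Rightarrow> 's option"
  law :: "'s option \<Rightarrow> 'w measure"

definition filtration :: "'s topology \<Rightarrow> ('s, 'w) process \<Rightarrow> ennreal \<Rightarrow> 'w measure" where
  "filtration T X t = sigma (sample X)
     {path X s -` B \<inter> sample X |s B. 0 \<le> s \<and> ennreal s \<le> t \<and> B \<in> sets (borel_of (cemetery_topology T))}"

abbreviation initial_laws :: "'s topology \<Rightarrow> 's option measure set" where
  "initial_laws T \<equiv> space (prob_algebra (borel_of (cemetery_topology T)))"

abbreviation law_from :: "('s, 'w) process \<Rightarrow> 's option measure \<Rightarrow> 'w measure" where
  "law_from X \<nu> \<equiv> \<nu> \<bind> law X"

text \<open>The minimum augmented filtration: for every initial law, the event agrees with an event of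
  the natural filtration up to a null set.\<close>

definition augmented :: "'s topology \<Rightarrow> ('s, 'w) process \<Rightarrow> ennreal \<Rightarrow> 'w set set" where
  "augmented T X t = {A. A \<subseteq> sample X \<and>
     (\<forall>\<nu>\<in>initial_laws T. \<exists>A'\<in>sets (filtration T X t). AE \<omega> in law_from X \<nu>. \<omega> \<in> A \<longleftrightarrow> \<omega> \<in> A')}"

definition stopping :: "'s topology \<Rightarrow> ('s, 'w) process \<Rightarrow> ('w \<Rightarrow> ennreal) \<Rightarrow> bool" where
  "stopping T X \<sigma> \<longleftrightarrow> (\<forall>t. {\<omega> \<in> sample X. \<sigma> \<omega> \<le> t} \<in> augmented T X t)"

definition stopped_events :: "'s topology \<Rightarrow> ('s, 'w) process \<Rightarrow> ('w \<Rightarrow> ennreal) \<Rightarrow> 'w set set" where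
  "stopped_events T X \<sigma> =
     {A \<in> augmented T X \<infinity>. \<forall>t. A \<inter> {\<omega> \<in> sample X. \<sigma> \<omega> \<le> t} \<in> augmented T X t}"

definition path_at :: "('s, 'w) process \<Rightarrow> ennreal \<Rightarrow> 'w \<Rightarrow> 's option" where
  "path_at X t \<omega> = (if t = \<infinity> then None else path X (enn2real t) \<omega>)"

definition normal_process :: "'s topology \<Rightarrow> ('s, 'w) process \<Rightarrow> bool" where
  "normal_process T X \<longleftrightarrow>
     law X \<in> measurable (borel_of (cemetery_topology T)) (prob_algebra (filtration T X \<infinity>)) \<and>
     (\<forall>x\<in>topspace (cemetery_topology T). AE \<omega> in law X x. path X 0 \<omega> = x)"

definition cadlag_paths :: "'s topology \<Rightarrow> ('s, 'w) process \<Rightarrow> bool" where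
  "cadlag_paths T X \<longleftrightarrow>
     (\<forall>\<omega>\<in>sample X. \<forall>t\<ge>0. path X t \<omega> \<in> topspace (cemetery_topology T) \<and>
        limitin (cemetery_topology T) (\<lambda>s. path X s \<omega>) (path X t \<omega>) (at_right t) \<and>
        (t > 0 \<longrightarrow> (\<exists>x. limitin (cemetery_topology T) (\<lambda>s. path X s \<omega>) x (at_left t))))"

definition absorbing_cemetery :: "('s, 'w) process \<Rightarrow> bool" where
  "absorbing_cemetery X \<longleftrightarrow>
     (\<forall>\<omega>\<in>sample X. \<forall>t\<ge>0. path X t \<omega> = None \<longrightarrow> (\<forall>s\<ge>t. path X s \<omega> = None))"

definition has_shifts :: "('s, 'w) process \<Rightarrow> bool" where
  "has_shifts X \<longleftrightarrow>
     (\<forall>s\<ge>0. \<exists>\<theta>. \<forall>\<omega>\<in>sample X. \<theta> \<omega> \<in> sample X \<and> (\<forall>t\<ge>0. path X t (\<theta> \<omega>) = path X (t + s) \<omega>))"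

text \<open>The simple Markov property is the case of constant \<open>\<sigma>\<close>.  Laws are completed because
  events of the augmented filtration need not be measurable for the law itself.\<close>

definition strong_markov :: "'s topology \<Rightarrow> ('s, 'w) process \<Rightarrow> bool" where
  "strong_markov T X \<longleftrightarrow>
     (\<forall>t<\<infinity>. (\<Inter>s\<in>{t<..}. augmented T X s) = augmented T X t) \<and>
     (\<forall>\<nu>\<in>initial_laws T. \<forall>\<sigma>. stopping T X \<sigma> \<longrightarrow>
        (\<forall>s\<ge>0. \<forall>B\<in>sets (borel_of (cemetery_topology T)). \<forall>A\<in>stopped_events T X \<sigma>.
           emeasure (completion (law_from X \<nu>)) {\<omega> \<in> A. path_at X (\<sigma> \<omega> + ennreal s) \<omega> \<in> B} =
           (\<integral>\<^sup>+\<omega>. indicator A \<omega> *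
              emeasure (law X (path_at X (\<sigma> \<omega>) \<omega>)) {\<omega>' \<in> sample X. path X s \<omega>' \<in> B}
            \<partial>completion (law_from X \<nu>))))"

definition quasi_left_continuous :: "'s topology \<Rightarrow> ('s, 'w) process \<Rightarrow> bool" where
  "quasi_left_continuous T X \<longleftrightarrow>
     (\<forall>\<nu>\<in>initial_laws T. \<forall>\<sigma> \<tau>. (\<forall>n. stopping T X (\<tau> n)) \<and> stopping T X \<sigma> \<and>
        (\<forall>\<omega>\<in>sample X. incseq (\<lambda>n. \<tau> n \<omega>) \<and> (\<lambda>n. \<tau> n \<omega>) \<longlonglongrightarrow> \<sigma> \<omega>) \<longrightarrow>
        (AE \<omega> in law_from X \<nu>. \<sigma> \<omega> < \<infinity> \<longrightarrow>
           limitin (cemetery_topology T) (\<lambda>n. path_at X (\<tau> n \<omega>) \<omega>) (path_at X (\<sigma> \<omega>) \<omega>) sequentially))"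

definition hunt_process :: "'s topology \<Rightarrow> ('s, 'w) process \<Rightarrow> bool" where
  "hunt_process T X \<longleftrightarrow> normal_process T X \<and> cadlag_paths T X \<and> absorbing_cemetery X \<and>
     has_shifts X \<and> strong_markov T X \<and> quasi_left_continuous T X"

abbreviation ext0 :: "('s \<Rightarrow> 'b::zero) \<Rightarrow> 's option \<Rightarrow> 'b" where
  "ext0 f \<equiv> case_option 0 f"

definition transition :: "('s, 'w) process \<Rightarrow> real \<Rightarrow> ('s \<Rightarrow> real) \<Rightarrow> 's \<Rightarrow> real" where
  "transition X t f x = (\<integral>\<omega>. ext0 f (path X t \<omega>) \<partial>law X (Some x))"

definition symmetric_process :: "'s measure \<Rightarrow> ('s, 'w) process \<Rightarrow> bool" where
  "symmetric_process m X \<longleftrightarrow>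
     (\<forall>t\<ge>0. \<forall>f\<in>borel_measurable m. \<forall>g\<in>borel_measurable m.
       (\<integral>\<^sup>+x. f x * (\<integral>\<^sup>+\<omega>. ext0 g (path X t \<omega>) \<partial>law X (Some x)) \<partial>m) =
       (\<integral>\<^sup>+x. (\<integral>\<^sup>+\<omega>. ext0 f (path X t \<omega>) \<partial>law X (Some x)) * g x \<partial>m))"

text \<open>A Hunt process is associated with a form on \<open>L\<^sup>2\<close> of the reference measure if it is symmetric
  and its transition semigroup \<open>P\<^sub>t\<close> generates the form: the domain consists of those \<open>u\<close> for which
  \<open>(u - P\<^sub>t u, u) / t\<close> has a finite limit as \<open>t \<down> 0\<close>, and the form is the limit of
  \<open>(u - P\<^sub>t u, v) / t\<close>.\<close>

definition associated_hunt_process :: "'s form_data \<Rightarrow> ('s, 'w) process \<Rightarrow> bool" where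
  "associated_hunt_process D X \<longleftrightarrow>
     hunt_process (base D) X \<and> symmetric_process (refm D) X \<and>
     fdom D = {u \<in> L2 (refm D). \<exists>l.
        ((\<lambda>t. l2_inner (refm D) (\<lambda>x. u x - transition X t u x) u / t) \<longlongrightarrow> l) (at_right 0)} \<and>
     (\<forall>u\<in>fdom D. \<forall>v\<in>fdom D.
        ((\<lambda>t. l2_inner (refm D) (\<lambda>x. u x - transition X t u x) v / t) \<longlongrightarrow> energy D u v) (at_right 0))"

definition hitting_time :: "('s, 'w) process \<Rightarrow> 's set \<Rightarrow> 'w \<Rightarrow> ennreal" where
  "hitting_time X A \<omega> = Inf {ennreal t |t. 0 \<le> t \<and> path X t \<omega> \<in> Some ` A}"

section \<open>Collapsing the sets \<open>K\<^sub>1, \<dots>, K\<^sub>N\<close> to points\<close>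

definition hole :: "(nat \<Rightarrow> 's set) \<Rightarrow> nat \<Rightarrow> 's set" where
  "hole K N = (\<Union>j\<in>{1..N}. K j)"

text \<open>In the collapsed space, \<open>Inl x\<close> is the point \<open>x\<close> of \<open>D\<close> and \<open>Inr j\<close> is the point \<open>a\<^sub>j\<^sup>*\<close>.\<close>

definition collapsed_topology :: "'s topology \<Rightarrow> (nat \<Rightarrow> 's set) \<Rightarrow> nat \<Rightarrow> ('s + nat) topology" where
  "collapsed_topology T K N = topology (\<lambda>W. W \<subseteq> Inl ` (topspace T - hole K N) \<union> Inr ` {1..N} \<and>
     openin (subtopology T (topspace T - hole K N)) (Inl -` W) \<and>
     (\<forall>j. Inr j \<in> W \<longrightarrow> (\<exists>U. openin T U \<and> K j \<subseteq> U \<and> U - hole K N \<subseteq> Inl -` W)))"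

lemma openin_collapsed_topology:
  "openin (collapsed_topology T K N) W \<longleftrightarrow> W \<subseteq> Inl ` (topspace T - hole K N) \<union> Inr ` {1..N} \<and>
     openin (subtopology T (topspace T - hole K N)) (Inl -` W) \<and>
     (\<forall>j. Inr j \<in> W \<longrightarrow> (\<exists>U. openin T U \<and> K j \<subseteq> U \<and> U - hole K N \<subseteq> Inl -` W))"
proof -
  let ?D = "subtopology T (topspace T - hole K N)"
  let ?N = "\<lambda>W j. \<exists>U. openin T U \<and> K j \<subseteq> U \<and> U - hole K N \<subseteq> Inl -` W"
  let ?P = "\<lambda>W. W \<subseteq> Inl ` (topspace T - hole K N) \<union> Inr ` {1..N} \<and>
     openin ?D (Inl -` W) \<and> (\<forall>j. Inr j \<in> W \<longrightarrow> ?N W j)"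
  have "istopology ?P"
    unfolding istopology_def
  proof (intro conjI allI impI)
    fix S W assume S: "?P S" and W: "?P W"
    show "S \<inter> W \<subseteq> Inl ` (topspace T - hole K N) \<union> Inr ` {1..N}" using S by blast
    show "openin ?D (Inl -` (S \<inter> W))" using S W by (simp add: vimage_Int openin_Int)
    fix j assume "Inr j \<in> S \<inter> W"
    then have "Inr j \<in> S" "Inr j \<in> W" by (rule IntD1, rule IntD2)
    with S W have "?N S j" "?N W j" by presburger+
    then obtain U V where U: "openin T U" "K j \<subseteq> U" "U - hole K N \<subseteq> Inl -` S"
      and V: "openin T V" "K j \<subseteq> V" "V - hole K N \<subseteq> Inl -` W" by (elim exE conjE)
    have "openin T (U \<inter> V)" "K j \<subseteq> U \<inter> V" "U \<inter> V - hole K N \<subseteq> Inl -` (S \<inter> W)"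
      using U V by (simp_all add: openin_Int) blast+
    then show "?N (S \<inter> W) j" by (intro exI conjI)
  next
    fix \<K> assume K: "\<forall>W\<in>\<K>. ?P W"
    show "\<Union>\<K> \<subseteq> Inl ` (topspace T - hole K N) \<union> Inr ` {1..N}" using K by blast
    show "openin ?D (Inl -` \<Union>\<K>)" using K unfolding vimage_Union by (intro openin_Union) auto
    fix j assume "Inr j \<in> \<Union>\<K>"
    then obtain W where W: "W \<in> \<K>" "Inr j \<in> W" by (rule UnionE)
    have "?P W" by (rule bspec[OF K W(1)])
    then have "?N W j" using W(2) by presburger
    then obtain U where U: "openin T U" "K j \<subseteq> U" "U - hole K N \<subseteq> Inl -` W" by (elim exE conjE)
    have "W \<subseteq> \<Union>\<K>" using W(1) by (rule Union_upper)
    then have "Inl -` W \<subseteq> Inl -` \<Union>\<K>" by (rule vimage_mono)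
    with U show "?N (\<Union>\<K>) j" by (meson subset_trans)
  qed
  then show ?thesis unfolding collapsed_topology_def by (simp add: topology_inverse')
qed

lemma topspace_collapsed_topology:
  assumes "\<And>j. j \<in> {1..N} \<Longrightarrow> K j \<subseteq> topspace T"
  shows "topspace (collapsed_topology T K N) = Inl ` (topspace T - hole K N) \<union> Inr ` {1..N}"
proof -
  let ?W = "Inl ` (topspace T - hole K N) \<union> Inr ` {1..N}"
  have eq: "Inl -` ?W = topspace T - hole K N" by auto
  have "openin (subtopology T (topspace T - hole K N)) (topspace T - hole K N)"
    by (metis Diff_subset inf.absorb_iff2 openin_topspace topspace_subtopology)
  moreover have "\<exists>U. openin T U \<and> K j \<subseteq> U \<and> U - hole K N \<subseteq> topspace T - hole K N"
    if "Inr j \<in> ?W" for j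
  proof -
    have "j \<in> {1..N}" using that by blast
    from assms[OF this] show ?thesis by (intro exI[of _ "topspace T"] conjI) simp_all
  qed
  ultimately have "openin (collapsed_topology T K N) ?W"
    unfolding openin_collapsed_topology eq by blast
  moreover have "topspace (collapsed_topology T K N) \<subseteq> ?W"
    using openin_topspace[of "collapsed_topology T K N"] unfolding openin_collapsed_topology by blast
  ultimately show ?thesis by (metis openin_subset subset_antisym)
qed

definition collapse :: "(nat \<Rightarrow> 's set) \<Rightarrow> nat \<Rightarrow> 's \<Rightarrow> 's + nat" where
  "collapse K N x = (if x \<in> hole K N then Inr (THE j. j \<in> {1..N} \<and> x \<in> K j) else Inl x)"

text \<open>\<open>m\<^sup>*\<close> does not charge the points \<open>a\<^sub>j\<^sup>*\<close>; the measure \<open>\<mu> = m\<^sup>* + \<Sum>\<^sub>j m(K\<^sub>j) \<delta>\<close> is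
  \<open>sticky_measure\<close> below.\<close>

definition darning_measure ::
    "'s topology \<Rightarrow> 's measure \<Rightarrow> (nat \<Rightarrow> 's set) \<Rightarrow> nat \<Rightarrow> ('s + nat) measure" where
  "darning_measure T m K N =
     distr (restrict_space m (topspace T - hole K N)) (borel_of (collapsed_topology T K N)) Inl"

lemma space_borel_of [simp]: "space (borel_of T) = topspace T"
  unfolding borel_of_def by (rule space_measure_of) (auto dest: openin_subset)

lemma emeasure_darning_measure:
  assumes m: "sets m = sets (borel_of T)"
    and D: "openin T (topspace T - hole K N)"
    and A: "A \<in> sets (borel_of (collapsed_topology T K N))"
  shows "emeasure (darning_measure T m K N) A = emeasure m {x \<in> topspace T - hole K N. Inl x \<in> A}"
proof -
  let ?D = "topspace T - hole K N"
  have sp: "space m = topspace T" using sets_eq_imp_space_eq[OF m] by simp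
  have op: "U \<in> sets m" if "openin T U" for U
    unfolding m borel_of_def using that by (subst sets_measure_of) (auto dest: openin_subset)
  have spD: "space (restrict_space m ?D) = ?D" by (simp add: space_restrict_space sp Int_absorb2)
  have meas: "Inl \<in> measurable (restrict_space m ?D) (borel_of (collapsed_topology T K N))"
    unfolding borel_of_def
  proof (rule measurable_measure_of)
    show "{U. openin (collapsed_topology T K N) U} \<subseteq> Pow (topspace (collapsed_topology T K N))"
      by (auto dest: openin_subset)
    have "openin (collapsed_topology T K N) (Inl ` ?D)"
    proof -
      have "(Inl :: 'a \<Rightarrow> 'a + nat) -` (Inl ` ?D) = ?D" by auto
      moreover have "openin (subtopology T ?D) ?D"
        by (metis Diff_subset inf.absorb_iff2 openin_topspace topspace_subtopology)
      ultimately show ?thesis unfolding openin_collapsed_topology by auto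
    qed
    from openin_subset[OF this]
    show "Inl \<in> space (restrict_space m ?D) \<rightarrow> topspace (collapsed_topology T K N)"
      unfolding spD by auto
    fix W assume "W \<in> {U. openin (collapsed_topology T K N) U}"
    then have "openin (subtopology T ?D) (Inl -` W)" by (simp add: openin_collapsed_topology)
    then have W: "openin T (Inl -` W)" "Inl -` W \<subseteq> ?D"
      using D by (auto simp: openin_open_subtopology)
    show "Inl -` W \<inter> space (restrict_space m ?D) \<in> sets (restrict_space m ?D)"
      unfolding spD sets_restrict_space using op[OF W(1)] by (intro image_eqI) auto
  qed
  have eq: "Inl -` A \<inter> ?D = {x \<in> ?D. Inl x \<in> A}" by auto
  have "emeasure (darning_measure T m K N) A = emeasure (restrict_space m ?D) (Inl -` A \<inter> ?D)"
    unfolding darning_measure_def using emeasure_distr[OF meas A] by (simp add: spD)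
  also have "\<dots> = emeasure m (Inl -` A \<inter> ?D)"
    by (rule emeasure_restrict_space) (use op[OF D] sp in \<open>auto simp: Int_absorb2\<close>)
  finally show ?thesis by (simp add: eq)
qed

definition sticky_measure ::
    "'s topology \<Rightarrow> 's measure \<Rightarrow> (nat \<Rightarrow> 's set) \<Rightarrow> nat \<Rightarrow> ('s + nat) measure" where
  "sticky_measure T m K N =
     measure_of (topspace (collapsed_topology T K N)) (sets (borel_of (collapsed_topology T K N)))
       (\<lambda>A. emeasure (darning_measure T m K N) A + (\<Sum>j\<in>{1..N}. emeasure m (K j) * indicator A (Inr j)))"

lemma emeasure_sticky_measure:
  assumes "A \<in> sets (borel_of (collapsed_topology T K N))"
  shows "emeasure (sticky_measure T m K N) A =
    emeasure (darning_measure T m K N) A + (\<Sum>j\<in>{1..N}. emeasure m (K j) * indicator A (Inr j))"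
proof -
  let ?B = "borel_of (collapsed_topology T K N)"
  have ss: "sets (darning_measure T m K N) = sets ?B" by (simp add: darning_measure_def)
  have st: "sets (sticky_measure T m K N) = sets ?B"
    unfolding sticky_measure_def space_borel_of[symmetric] by (rule sets.sets_measure_of_eq)
  show ?thesis
  proof (rule emeasure_measure_of[OF sticky_measure_def])
    show "sets ?B \<subseteq> Pow (topspace (collapsed_topology T K N))"
      using sets.space_closed[of ?B] by simp
    show "A \<in> sets (sticky_measure T m K N)"
      using assms by (simp add: st)
    show "positive (sets (sticky_measure T m K N)) (\<lambda>A. emeasure (darning_measure T m K N) A +
        (\<Sum>j\<in>{1..N}. emeasure m (K j) * indicator A (Inr j)))"
      by (simp add: positive_def)
    show "countably_additive (sets (sticky_measure T m K N)) (\<lambda>A. emeasure (darning_measure T m K N) A +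
        (\<Sum>j\<in>{1..N}. emeasure m (K j) * indicator A (Inr j)))"
    proof (rule countably_additiveI)
      fix F :: "nat \<Rightarrow> _"
      assume F: "range F \<subseteq> sets (sticky_measure T m K N)" "disjoint_family F"
      have F': "range F \<subseteq> sets (darning_measure T m K N)"
        using F(1) by (simp add: ss st)
      have "(\<Sum>i. \<Sum>j\<in>{1..N}. emeasure m (K j) * indicator (F i) (Inr j)) =
          (\<Sum>j\<in>{1..N}. \<Sum>i. emeasure m (K j) * indicator (F i) (Inr j))"
        by (rule suminf_sum) simp
      also have "\<dots> = (\<Sum>j\<in>{1..N}. emeasure m (K j) * indicator (\<Union>i. F i) (Inr j))"
        by (simp add: suminf_indicator[OF F(2)])
      finally show "(\<Sum>i. emeasure (darning_measure T m K N) (F i) +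
            (\<Sum>j\<in>{1..N}. emeasure m (K j) * indicator (F i) (Inr j))) =
          emeasure (darning_measure T m K N) (\<Union>i. F i) +
            (\<Sum>j\<in>{1..N}. emeasure m (K j) * indicator (\<Union>i. F i) (Inr j))"
        by (subst suminf_add[symmetric]) (simp_all add: suminf_emeasure[OF F' F(2)])
    qed
  qed
qed

section \<open>The form with darning and the approximating forms\<close>

definition hitting_function ::
    "('s, 'w) process \<Rightarrow> (nat \<Rightarrow> 's set) \<Rightarrow> nat \<Rightarrow> real \<Rightarrow> nat \<Rightarrow> 's \<Rightarrow> real" where
  "hitting_function X K N \<alpha> j x =
     (\<integral>\<omega>. exp (- \<alpha> * enn2real (hitting_time X (hole K N) \<omega>)) *
        indicator {\<omega>. path_at X (hitting_time X (hole K N) \<omega>) \<omega> \<in> Some ` K j} \<omega>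
      \<partial>completion (law X (Some x)))"

definition part_domain :: "'s form_data \<Rightarrow> 's set \<Rightarrow> ('s \<Rightarrow> real) set" where
  "part_domain D G = {f \<in> fdom D. \<exists>g. qc_version D f g \<and> qe_on D (topspace (base D) - G) (\<lambda>x. g x = 0)}"

text \<open>\<open>\<F>\<^sup>D \<oplus> \<H>\<^sub>\<alpha>\<close>, as a space of (a.e. classes of) functions on the original space.\<close>

definition darning_domain ::
    "'s form_data \<Rightarrow> ('s, 'w) process \<Rightarrow> (nat \<Rightarrow> 's set) \<Rightarrow> nat \<Rightarrow> real \<Rightarrow> ('s \<Rightarrow> real) set" where
  "darning_domain D X K N \<alpha> = {f \<in> L2 (refm D).
     \<exists>h\<in>part_domain D (topspace (base D) - hole K N). \<exists>c :: nat \<Rightarrow> real.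
       AE x in refm D. f x = h x + (\<Sum>j\<in>{1..N}. c j * hitting_function X K N \<alpha> j x)}"

text \<open>The form \<open>(\<E>\<^sup>*, \<F>\<^sup>*)\<close> on \<open>L\<^sup>2(E\<^sup>*; \<mu>)\<close>: a function \<open>g\<close> on the collapsed space is identified with
  the function \<open>g \<circ> collapse K N\<close> on the original space, which has the constant value \<open>g a\<^sub>j\<^sup>*\<close>
  on \<open>K\<^sub>j\<close>.\<close>

definition sticky_form ::
    "'s form_data \<Rightarrow> ('s, 'w) process \<Rightarrow> (nat \<Rightarrow> 's set) \<Rightarrow> nat \<Rightarrow> real \<Rightarrow> ('s + nat) form_data" where
  "sticky_form D X K N \<alpha> = \<lparr>
     base = collapsed_topology (base D) K N,
     refm = sticky_measure (base D) (refm D) K N,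
     fdom = {g \<in> L2 (sticky_measure (base D) (refm D) K N).
       g \<circ> collapse K N \<in> darning_domain D X K N \<alpha>},
     energy = (\<lambda>g h. energy D (g \<circ> collapse K N) (h \<circ> collapse K N))\<rparr>"

definition constant_domain :: "'s form_data \<Rightarrow> (nat \<Rightarrow> 's set) \<Rightarrow> nat \<Rightarrow> ('s \<Rightarrow> real) set" where
  "constant_domain D K N = {f \<in> fdom D. \<exists>g. qc_version D f g \<and>
     (\<forall>j\<in>{1..N}. \<exists>c. qe_on D (K j) (\<lambda>x. g x = c))}"

definition star_fun :: "'s measure \<Rightarrow> (nat \<Rightarrow> 's set) \<Rightarrow> ('s \<Rightarrow> real) \<Rightarrow> 's + nat \<Rightarrow> real" where
  "star_fun m K f y = (case y of
     Inl x \<Rightarrow> f x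
   | Inr j \<Rightarrow> if measure m (K j) > 0 then (LINT x:K j|m. f x) / measure m (K j) else 0)"

text \<open>Quasi-continuous versions agree outside a polar set, which a smooth measure does not charge,
  so the integrals below do not depend on the choice of (Borel) version.\<close>

definition the_qc_version :: "'s form_data \<Rightarrow> ('s \<Rightarrow> real) \<Rightarrow> 's \<Rightarrow> real" where
  "the_qc_version D f = (SOME g. g \<in> borel_measurable (refm D) \<and> qc_version D f g)"

definition approx_form ::
    "'s form_data \<Rightarrow> (nat \<Rightarrow> 's set) \<Rightarrow> nat \<Rightarrow> (nat \<Rightarrow> 's measure) \<Rightarrow> real \<Rightarrow> 's form_data" where
  "approx_form D K N \<nu> l = D\<lparr>energy := (\<lambda>u v. energy D u v +
     l * (\<Sum>j\<in>{1..N}. LINT (x, y):K j \<times> K j|\<nu> j \<Otimes>\<^sub>M \<nu> j.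
       (the_qc_version D u x - the_qc_version D u y) * (the_qc_version D v x - the_qc_version D v y)))\<rparr>"

end

theory Submission
 imports Defs
begin

text \<open>For a symmetric semigroup \<open>P\<^sub>t\<close> with form \<open>\<E>\<close>, the Laplace transform of \<open>(P\<^sub>t f, f)\<close> at \<open>b\<close> is the
 supremum of \<open>2 (f, v) - b (v, v) - \<E>(v, v)\<close> over the form domain. The approximating forms increase
 with \<open>n\<close>, and their supremum is finite exactly on the functions that are quasi-everywhere constant on
 each \<open>K\<^sub>j\<close>, where it is \<open>\<E>\<close>; by strong convexity the suprema over \<open>v\<close> converge to the one for
 \<open>\<E>\<^sup>*\<close>. As \<open>(P\<^sub>t f, f)\<close> decreases in \<open>t\<close>, its Laplace transform can be inverted; polarisation gives
 strong convergence of the semigroups, and induction on the number of times that of the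
 finite-dimensional distributions.

 That \<open>\<F>\<^sup>D \<oplus> \<H>\<^sub>\<alpha>\<close> is the space of functions quasi-everywhere constant on each \<open>K\<^sub>j\<close> requires that the
 hitting functions lie in \<open>\<F>\<close> with the right boundary values. Hitting distributions of an open set are
 limits of discrete-time ones and minimise \<open>\<E>\<^sub>\<alpha>\<close>; by quasi-left continuity those of neighbourhoods
 shrinking to the compact set converge to the hitting distribution of the set itself.\<close>

text \<open>Elements of L2 are functions, not classes, and transition operators obey the semigroup
  law only almost everywhere; hence semigroup identities are stated through inner products.
  \<open>Y\<close> and the \<open>Xn n\<close> are compared inside one space: \<mu> is the image of
  m under the collapsing map c, so composition with c embeds L2(\<mu>) isometrically into L2(m),
  onto functions constant on each \<open>K j\<close>. The closure hypothesis on the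
  \<open>f j\<close> serves to write each of them, almost everywhere, as its starred function
  composed with c. Convergence of the semigroups is claimed only on the image of this embedding. As
  m may be infinite, the expectation is read as an inner product of the factor at time 0 with a
  square-integrable function; \<open>k >= 1\<close> supplies the second factor. Two default values
  shape the details: the Bochner integral of a non-integrable function is 0, so a vanishing jump
  integral is informative only after clipping; and \<open>enn2real\<close> sends an infinite hitting
  time to 0, so such paths must be killed by the value at the cemetery.\<close>

abbreviation (input) tends_seq (infix "--->" 60) where
 "f ---> l == (f \<longlonglongrightarrow> l)"

section \<open>Square-integrable functions\<close>

lemma L2_measurable [measurable_dest]: "u \<in> L2 m ==> u \<in> borel_measurable m"
 by (simp add: L2_def)

lemma L2_integrable_square: "u \<in> L2 m ==> integrable m (%x. u x * u x)"
 by (simp add: L2_def power2_eq_square)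

text \<open>The scalar sits inside the absolute value so that one domination lemma settles scalar
  multiples, truncations, lattice operations and changes on null sets, each by a choice of
  \<open>c\<close> and of the dominating \<open>u\<close>.\<close>

lemma L2_dominated:
 assumes u: "u \<in> L2 m" and v: "v \<in> borel_measurable m" and le: "AE x in m. \<bar>v x\<bar> <= \<bar>c * u x\<bar>"
 shows "v \<in> L2 m"
proof -
 have "integrable m (%x. (v x)^2)"
 proof (rule Bochner_Integration.integrable_bound)
  show "integrable m (%x. c^2 * (u x)^2)" using u by (simp add: L2_def)
  show "AE x in m. norm ((v x)^2) <= norm (c^2 * (u x)^2)"
   using le by eventually_elim (simp add: power_mult_distrib[symmetric] abs_le_square_iff)
 qed (use v in measurable)
 with v show ?thesis by (simp add: L2_def)
qed

lemma L2_zero [simp, intro]: "(%x. 0) \<in> L2 m"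
 by (simp add: L2_def)

lemma L2_cmult [simp, intro]: "u \<in> L2 m ==> (%x. c * u x) \<in> L2 m"
 by (rule L2_dominated[where c=c]) auto

lemma L2_add [simp, intro]:
 assumes u: "u \<in> L2 m" and v: "v \<in> L2 m" shows "(%x. u x + v x) \<in> L2 m"
proof -
 have [measurable]: "u \<in> borel_measurable m" "v \<in> borel_measurable m" using u v by (auto simp: L2_def)
 have "integrable m (%x. (u x + v x)^2)"
 proof (rule Bochner_Integration.integrable_bound)
  show "integrable m (%x. 2 * (u x)^2 + 2 * (v x)^2)" using u v by (simp add: L2_def)
  have "(a + b)^2 <= 2 * a^2 + 2 * b^2" for a b :: real
   using zero_le_power2[of "a - b"] by (simp add: power2_eq_square algebra_simps)
  thus "AE x in m. norm ((u x + v x)^2) <= norm (2 * (u x)^2 + 2 * (v x)^2)"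
   by (intro AE_I2) simp
 qed simp
 thus ?thesis by (simp add: L2_def)
qed

lemma L2_uminus [simp, intro]: "u \<in> L2 m ==> (%x. - u x) \<in> L2 m"
 using L2_cmult[of u m "-1"] by simp

lemma L2_diff [simp, intro]: "u \<in> L2 m ==> v \<in> L2 m ==> (%x. u x - v x) \<in> L2 m"
 using L2_add[of u m "%x. - v x"] by simp

lemma L2_divide [simp, intro]: "u \<in> L2 m ==> (%x. u x / c) \<in> L2 m"
 using L2_cmult[of u m "1/c"] by simp

lemma L2_sum [simp, intro]: "(!!i. i \<in> I ==> u i \<in> L2 m) ==> (%x. \<Sum>i\<in>I. u i x) \<in> L2 m"
 by (induction I rule: infinite_finite_induct) auto

lemma L2_abs [simp, intro]: "u \<in> L2 m ==> (%x. \<bar>u x\<bar>) \<in> L2 m"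
 by (rule L2_dominated[where c=1]) auto

lemma L2_max [simp, intro]: "u \<in> L2 m ==> v \<in> L2 m ==> (%x. max (u x) (v x)) \<in> L2 m"
 by (rule L2_dominated[where c=1 and u="%x. \<bar>u x\<bar> + \<bar>v x\<bar>"]) (auto simp: max_def)

lemma L2_min [simp, intro]: "u \<in> L2 m ==> v \<in> L2 m ==> (%x. min (u x) (v x)) \<in> L2 m"
 by (rule L2_dominated[where c=1 and u="%x. \<bar>u x\<bar> + \<bar>v x\<bar>"]) (auto simp: min_def)

lemma L2_min_const [simp, intro]: "u \<in> L2 m ==> c >= 0 ==> (%x. min (u x) c) \<in> L2 m"
 by (rule L2_dominated[where c=1 and u=u]) (auto simp: min_def)

lemma L2_max_const [simp, intro]: "u \<in> L2 m ==> c <= 0 ==> (%x. max (u x) c) \<in> L2 m"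
 by (rule L2_dominated[where c=1 and u=u]) (auto simp: max_def)

lemma L2_pos_part [simp, intro]: "u \<in> L2 m ==> c >= 0 ==> (%x. max (u x - c) 0) \<in> L2 m"
 by (rule L2_dominated[where c=1 and u=u]) (auto simp: max_def)

lemma L2_indicator_times:
 assumes "u \<in> L2 m" "A \<in> sets m" shows "(%x. indicator A x * u x) \<in> L2 m"
 by (rule L2_dominated[where c=1 and u=u]) (use assms in "auto split: split_indicator")

lemma L2_bounded_times:
 assumes "u \<in> L2 m" "g \<in> borel_measurable m" "!!x. \<bar>g x\<bar> <= c" shows "(%x. g x * u x) \<in> L2 m"
 by (rule L2_dominated[where c=c and u=u]) (use assms(1,2) abs_ge_zero order_trans[OF assms(3) abs_ge_self]
  in "auto simp: abs_mult intro!: mult_right_mono AE_I2")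

lemma L2_AE_cong: "u \<in> L2 m ==> v \<in> borel_measurable m ==> AE x in m. v x = u x ==> v \<in> L2 m"
 by (rule L2_dominated[where c=1]) auto

lemma L2_mult_integrable:
 assumes u: "u \<in> L2 m" and v: "v \<in> L2 m" shows "integrable m (%x. u x * v x)"
proof (rule Bochner_Integration.integrable_bound)
 have [measurable]: "u \<in> borel_measurable m" "v \<in> borel_measurable m" using u v by (auto simp: L2_def)
 show "integrable m (%x. (u x)^2 + (v x)^2)" using u v by (simp add: L2_def)
 have "\<bar>a * b\<bar> <= a^2 + b^2" for a b :: real
 proof -
  have "2 * \<bar>a * b\<bar> <= a^2 + b^2"
   using zero_le_power2[of "\<bar>a\<bar> - \<bar>b\<bar>"] by (simp add: power2_eq_square algebra_simps abs_mult)
  thus ?thesis by (smt (verit) abs_ge_zero)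
 qed
 thus "AE x in m. norm (u x * v x) <= norm ((u x)^2 + (v x)^2)"
  by (intro AE_I2) (auto intro: order_trans)
 show "(%x. u x * v x) \<in> borel_measurable m" by simp
qed

section \<open>Inner product and norm of square-integrable functions\<close>

lemma l2_inner_commute: "l2_inner m u v = l2_inner m v u"
 by (simp add: l2_inner_def mult.commute)

lemma l2_inner_zero [simp]: "l2_inner m (%x. 0) v = 0" "l2_inner m v (%x. 0) = 0"
 by (simp_all add: l2_inner_def)

lemma l2_inner_cmult [simp]: "l2_inner m (%x. c * u x) v = c * l2_inner m u v"
 "l2_inner m v (%x. c * u x) = c * l2_inner m v u"
 by (simp_all add: l2_inner_def mult.assoc mult.left_commute)

lemma l2_inner_uminus [simp]: "l2_inner m (%x. - u x) v = - l2_inner m u v"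
 "l2_inner m v (%x. - u x) = - l2_inner m v u"
 using l2_inner_cmult[where c="-1"] by simp_all

lemma l2_inner_add [simp]:
 assumes "u \<in> L2 m" "v \<in> L2 m" "w \<in> L2 m"
 shows "l2_inner m (%x. u x + v x) w = l2_inner m u w + l2_inner m v w"
  "l2_inner m w (%x. u x + v x) = l2_inner m w u + l2_inner m w v"
 using assms by (simp_all add: l2_inner_def algebra_simps L2_mult_integrable)

lemma l2_inner_diff [simp]:
 assumes "u \<in> L2 m" "v \<in> L2 m" "w \<in> L2 m"
 shows "l2_inner m (%x. u x - v x) w = l2_inner m u w - l2_inner m v w"
  "l2_inner m w (%x. u x - v x) = l2_inner m w u - l2_inner m w v"
 using assms by (simp_all add: l2_inner_def algebra_simps L2_mult_integrable)

lemma l2_inner_sum: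
 assumes "!!i. i \<in> I ==> u i \<in> L2 m" "w \<in> L2 m"
 shows "l2_inner m (%x. \<Sum>i\<in>I. u i x) w = (\<Sum>i\<in>I. l2_inner m (u i) w)"
 using assms by (induction I rule: infinite_finite_induct) simp_all

lemma l2_inner_self_nonneg [simp]: "l2_inner m u u >= 0"
 by (simp add: l2_inner_def)

lemma l2_inner_AE_cong:
 assumes "AE x in m. u x = u' x" "AE x in m. v x = v' x"
  "u \<in> borel_measurable m" "v \<in> borel_measurable m" "u' \<in> borel_measurable m" "v' \<in> borel_measurable m"
 shows "l2_inner m u v = l2_inner m u' v'"
 unfolding l2_inner_def by (rule integral_cong_AE) (use assms in auto)

lemma l2_inner_mono:
 assumes "u \<in> L2 m" "v \<in> L2 m" "w \<in> L2 m" "AE x in m. u x * w x <= v x * w x"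
 shows "l2_inner m u w <= l2_inner m v w"
 unfolding l2_inner_def by (rule integral_mono_AE) (use assms in "auto simp: L2_mult_integrable")

lemma l2_inner_self_mono:
 assumes "u \<in> L2 m" "v \<in> L2 m" "AE x in m. \<bar>u x\<bar> <= \<bar>v x\<bar>"
 shows "l2_inner m u u <= l2_inner m v v"
 unfolding l2_inner_def
proof (rule integral_mono_AE)
 show "AE x in m. u x * u x <= v x * v x"
  using assms(3) by eventually_elim (metis abs_le_square_iff power2_eq_square)
qed (use assms in "auto simp: L2_mult_integrable")

lemma l2_inner_self_eq_0:
 assumes "u \<in> L2 m" "l2_inner m u u = 0" shows "AE x in m. u x = 0"
proof -
 have "AE x in m. u x * u x = 0"
  by (rule integral_nonneg_eq_0_iff_AE[THEN iffD1])
   (use assms in "auto simp: l2_inner_def L2_integrable_square")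
 thus ?thesis by simp
qed

text \<open>A quadratic polynomial in s without negative values has nonpositive discriminant. The
  sign of \<open>c\<close> is not given, so \<open>c = 0\<close> is treated separately and
  \<open>c < 0\<close> is excluded before the minimum at -b/c is inserted.\<close>

lemma discriminant_bound:
 fixes a b c :: real
 assumes "!!s. 0 <= a + 2 * s * b + s^2 * c"
 shows "b^2 <= a * c"
proof (cases "c = 0")
 case True
 have "b = 0"
 proof (rule ccontr)
  assume "b ~= 0"
  \<comment> \<open>At this s the remaining linear polynomial has the value -1.\<close>
  with assms[of "- (a + 1) / (2 * b)"] True show False by (simp add: field_simps)
 qed
 thus ?thesis using True by simp
next
 case False
 have c: "c > 0"
 proof (rule ccontr)
  assume "\<not> c > 0"
  with False have c: "c < 0" by simp
  \<comment> \<open>With \<open>s >= 1\<close> and \<open>s * \<bar>c\<bar>\<close> above the sum of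
    the other two coefficients in absolute value, the negative square term outweighs both lower
    terms.\<close>
  define s where "s = (\<bar>a\<bar> + \<bar>2 * b\<bar> + 1) / \<bar>c\<bar> + 1"
  have s: "s >= 1" unfolding s_def by simp
  have "s * \<bar>c\<bar> > \<bar>a\<bar> + \<bar>2 * b\<bar>" unfolding s_def using c by (simp add: field_simps)
  hence "s * (\<bar>a\<bar> + \<bar>2 * b\<bar>) < s * (s * \<bar>c\<bar>)" using s by simp
  moreover have "\<bar>a\<bar> <= s * \<bar>a\<bar>" using s by (simp add: mult_le_cancel_right1)
  moreover have "2 * s * b <= s * \<bar>2 * b\<bar>" using s by (simp add: abs_mult mult_left_mono)
  ultimately have "a + 2 * s * b + s^2 * c < 0"
   using c by (simp add: power2_eq_square algebra_simps)
  with assms[of s] show False by simp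
 qed
 have "0 <= a + 2 * (- b / c) * b + (- b / c)^2 * c" by (rule assms)
 thus ?thesis using c by (simp add: field_simps power2_eq_square)
qed

lemma l2_Cauchy_Schwarz:
 assumes "u \<in> L2 m" "v \<in> L2 m"
 shows "(l2_inner m u v)^2 <= l2_inner m u u * l2_inner m v v"
proof (rule discriminant_bound)
 fix s
 have "0 <= l2_inner m (%x. u x + s * v x) (%x. u x + s * v x)" by simp
 also have "... = l2_inner m u u + 2 * s * l2_inner m u v + s^2 * l2_inner m v v"
  using assms by (simp add: power2_eq_square algebra_simps l2_inner_commute[of m v u])
 finally show "0 <= l2_inner m u u + 2 * s * l2_inner m u v + s^2 * l2_inner m v v" .
qed

definition l2_norm :: "'s measure => ('s => real) => real" where
 "l2_norm m u = sqrt (l2_inner m u u)"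

lemma l2_norm_nonneg [simp]: "l2_norm m u >= 0"
 by (simp add: l2_norm_def)

lemma l2_norm_square: "(l2_norm m u)^2 = l2_inner m u u"
 by (simp add: l2_norm_def)

lemma l2_inner_le_norm:
 assumes "u \<in> L2 m" "v \<in> L2 m" shows "\<bar>l2_inner m u v\<bar> <= l2_norm m u * l2_norm m v"
proof (rule power2_le_imp_le)
 show "\<bar>l2_inner m u v\<bar>^2 <= (l2_norm m u * l2_norm m v)^2"
  using l2_Cauchy_Schwarz[OF assms] by (simp add: power_mult_distrib l2_norm_square)
qed simp

lemma l2_norm_triangle:
 assumes "u \<in> L2 m" "v \<in> L2 m" shows "l2_norm m (%x. u x + v x) <= l2_norm m u + l2_norm m v"
proof (rule power2_le_imp_le)
 have "l2_inner m u v <= l2_norm m u * l2_norm m v" using l2_inner_le_norm[OF assms] by linarith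
 thus "(l2_norm m (%x. u x + v x))^2 <= (l2_norm m u + l2_norm m v)^2"
  using assms by (simp add: l2_norm_square power2_sum l2_inner_commute[of m v u])
qed simp

lemma l2_norm_cmult: "l2_norm m (%x. c * u x) = \<bar>c\<bar> * l2_norm m u"
proof -
 have "l2_inner m (%x. c * u x) (%x. c * u x) = c^2 * l2_inner m u u"
  by (simp add: power2_eq_square)
 thus ?thesis by (simp add: l2_norm_def real_sqrt_mult)
qed

lemma l2_norm_zero [simp]: "l2_norm m (%x. 0) = 0"
 by (simp add: l2_norm_def)

lemma l2_norm_minus_commute: "l2_norm m (%x. u x - v x) = l2_norm m (%x. v x - u x)"
 using l2_norm_cmult[of m "-1" "%x. u x - v x"] by simp

lemma l2_norm_triangle_diff:
 assumes "u \<in> L2 m" "v \<in> L2 m" "w \<in> L2 m"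
 shows "l2_norm m (%x. u x - w x) <= l2_norm m (%x. u x - v x) + l2_norm m (%x. v x - w x)"
 using l2_norm_triangle[of "%x. u x - v x" m "%x. v x - w x"] assms by simp

lemma l2_norm_sum:
 assumes "!!i. i \<in> I ==> u i \<in> L2 m"
 shows "l2_norm m (%x. \<Sum>i\<in>I. u i x) <= (\<Sum>i\<in>I. l2_norm m (u i))"
 using assms
proof (induction I rule: infinite_finite_induct)
 case (insert i I)
 have "l2_norm m (%x. u i x + (\<Sum>i\<in>I. u i x)) <= l2_norm m (u i) + l2_norm m (%x. \<Sum>i\<in>I. u i x)"
  using insert by (intro l2_norm_triangle) auto
 with insert show ?case by simp
qed simp_all

lemma l2_norm_mono:
 assumes "u \<in> L2 m" "v \<in> L2 m" "AE x in m. \<bar>u x\<bar> <= \<bar>v x\<bar>"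
 shows "l2_norm m u <= l2_norm m v"
 using l2_inner_self_mono[OF assms] by (simp add: l2_norm_def)

subsection \<open>Convergence in mean square\<close>

text \<open>Membership is part of the notion because the Bochner integral makes
  \<open>l2_norm\<close> equal to 0 on a function whose square is not integrable, so a small norm
  alone carries no information.\<close>

definition l2_tendsto :: "'s measure => (nat => 's => real) => ('s => real) => bool" where
 "l2_tendsto m u w \<longleftrightarrow> (\<forall>n. u n \<in> L2 m) \<and> w \<in> L2 m \<and> (%n. l2_norm m (%x. u n x - w x)) ---> 0"

lemma l2_tendstoD:
 assumes "l2_tendsto m u w"
 shows "u n \<in> L2 m" "w \<in> L2 m" "(%n. l2_norm m (%x. u n x - w x)) ---> 0"
 using assms by (auto simp: l2_tendsto_def)

lemma l2_tendstoI:
 assumes "!!n. u n \<in> L2 m" "w \<in> L2 m" "!!n. l2_norm m (%x. u n x - w x) <= r n" "r ---> 0"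
 shows "l2_tendsto m u w"
 unfolding l2_tendsto_def using assms
 by (auto intro: tendsto_sandwich[OF _ _ tendsto_const assms(4)])

lemma l2_tendsto_const [simp]: "w \<in> L2 m ==> l2_tendsto m (%n. w) w"
 by (simp add: l2_tendsto_def)

lemma l2_tendsto_add:
 assumes "l2_tendsto m u w" "l2_tendsto m v z"
 shows "l2_tendsto m (%n x. u n x + v n x) (%x. w x + z x)"
proof (rule l2_tendstoI)
 note a = l2_tendstoD[OF assms(1)] and b = l2_tendstoD[OF assms(2)]
 show "l2_norm m (%x. u n x + v n x - (w x + z x)) \<le>
   l2_norm m (%x. u n x - w x) + l2_norm m (%x. v n x - z x)" for n
  using l2_norm_triangle[of "%x. u n x - w x" m "%x. v n x - z x"] a b by (simp add: algebra_simps)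
 show "(%n. l2_norm m (%x. u n x - w x) + l2_norm m (%x. v n x - z x)) ---> 0"
  using tendsto_add[OF a(3) b(3)] by simp
qed (use l2_tendstoD[OF assms(1)] l2_tendstoD[OF assms(2)] in auto)

lemma l2_tendsto_cmult:
 assumes "l2_tendsto m u w" shows "l2_tendsto m (%n x. c * u n x) (%x. c * w x)"
proof (rule l2_tendstoI)
 note a = l2_tendstoD[OF assms(1)]
 show "l2_norm m (%x. c * u n x - c * w x) <= \<bar>c\<bar> * l2_norm m (%x. u n x - w x)" for n
  by (simp add: l2_norm_cmult[symmetric] algebra_simps)
 show "(%n. \<bar>c\<bar> * l2_norm m (%x. u n x - w x)) ---> 0"
  using tendsto_mult_left[OF a(3), of "\<bar>c\<bar>"] by simp
qed (use l2_tendstoD[OF assms(1)] in auto)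

lemma l2_tendsto_diff:
 assumes "l2_tendsto m u w" "l2_tendsto m v z"
 shows "l2_tendsto m (%n x. u n x - v n x) (%x. w x - z x)"
 using l2_tendsto_add[OF assms(1) l2_tendsto_cmult[OF assms(2), of "-1"]] by simp

text \<open>Carries mean-square convergence through operations that are Lipschitz pointwise:
  truncation, the minimum with a fixed function, multiplication by a bounded function, a change on a
  null set.\<close>

lemma l2_tendsto_dominated:
 assumes u: "l2_tendsto m u w" and "!!n. a n \<in> L2 m" "b \<in> L2 m"
  and le: "!!n. AE x in m. \<bar>a n x - b x\<bar> <= c * \<bar>u n x - w x\<bar>"
 shows "l2_tendsto m a b"
proof (rule l2_tendstoI)
 note a = l2_tendstoD[OF u]
 show "l2_norm m (%x. a n x - b x) <= l2_norm m (%x. c * (u n x - w x))" for n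
 proof (rule l2_norm_mono)
  show "AE x in m. \<bar>a n x - b x\<bar> <= \<bar>c * (u n x - w x)\<bar>"
   using le[of n] by eventually_elim (simp add: abs_mult order_trans[OF _ mult_right_mono])
 qed (use assms a in auto)
 show "(%n. l2_norm m (%x. c * (u n x - w x))) ---> 0"
  using tendsto_mult_left[OF a(3), of "\<bar>c\<bar>"] by (simp add: l2_norm_cmult)
qed (use assms in auto)

lemma l2_tendsto_subseq: "l2_tendsto m u w ==> strict_mono r ==> l2_tendsto m (%n. u (r n)) w"
 using LIMSEQ_subseq_LIMSEQ[of "%n. l2_norm m (%x. u n x - w x)" 0 r] by (auto simp: l2_tendsto_def o_def)

lemma l2_tendsto_inner:
 assumes u: "l2_tendsto m u w" and v: "l2_tendsto m v z"
 shows "(%n. l2_inner m (u n) (v n)) ---> l2_inner m w z"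
proof -
 note a = l2_tendstoD[OF u] and b = l2_tendstoD[OF v]
 have eq: "l2_inner m (u n) (v n) - l2_inner m w z =
   l2_inner m (%x. u n x - w x) (%x. v n x - z x) + l2_inner m (%x. u n x - w x) z
   + l2_inner m w (%x. v n x - z x)" for n
  using a b by simp
 let ?r = "%n. l2_norm m (%x. u n x - w x) * l2_norm m (%x. v n x - z x)
   + l2_norm m (%x. u n x - w x) * l2_norm m z + l2_norm m w * l2_norm m (%x. v n x - z x)"
 have "?r ---> 0 * 0 + 0 * l2_norm m z + l2_norm m w * 0"
  using a(3) b(3) by (intro tendsto_intros)
 hence r: "?r ---> 0" by simp
 have "norm (l2_inner m (u n) (v n) - l2_inner m w z) <= ?r n" for n
  unfolding eq real_norm_def using a b
  by (intro order_trans[OF abs_triangle_ineq] add_mono l2_inner_le_norm) auto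
 hence "(%n. l2_inner m (u n) (v n) - l2_inner m w z) ---> 0"
  by (intro Lim_null_comparison[OF _ r]) auto
 thus ?thesis by (simp add: LIM_zero_iff)
qed

text \<open>The squared differences tend to 0 in L1, where almost everywhere convergence of a
  subsequence is known; taking roots returns to the differences.\<close>

lemma l2_tendsto_AE_subseq:
 assumes u: "l2_tendsto m u w"
 shows "\<exists>r. strict_mono r \<and> (AE x in m. (%n. u (r n) x) ---> w x)"
proof -
 note a = l2_tendstoD[OF u]
 have "\<exists>r. strict_mono r \<and> (AE x in m. (%n. (u (r n) x - w x) * (u (r n) x - w x)) ---> 0)"
 proof (rule tendsto_L1_AE_subseq)
  show "integrable m (%x. (u n x - w x) * (u n x - w x))" for n
   using a by (intro L2_integrable_square) auto
  have "(%n. (l2_norm m (%x. u n x - w x))^2) ---> 0^2" using a(3) by (intro tendsto_intros)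
  thus "(%n. \<integral>x. norm ((u n x - w x) * (u n x - w x)) \<partial>m) ---> 0"
   by (simp add: l2_norm_square l2_inner_def)
 qed
 then obtain r where r: "strict_mono r" and ae: "AE x in m. (%n. (u (r n) x - w x) * (u (r n) x - w x)) ---> 0"
  by auto
 from ae have "AE x in m. (%n. u (r n) x) ---> w x"
 proof eventually_elim
  case (elim x)
  hence "(%n. sqrt ((u (r n) x - w x) * (u (r n) x - w x))) ---> sqrt 0" by (rule tendsto_real_sqrt)
  thus ?case by (simp add: tendsto_rabs_zero_iff LIM_zero_iff)
 qed
 with r show ?thesis by auto
qed

lemma l2_tendsto_AE_le:
 assumes u: "l2_tendsto m u w" and le: "\<forall>\<^sub>F n in sequentially. AE x in m. g x <= u n x"
 shows "AE x in m. g x <= w x"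
proof -
 obtain r where r: "strict_mono r" and ae: "AE x in m. (%n. u (r n) x) ---> w x"
  using l2_tendsto_AE_subseq[OF u] by auto
 obtain n0 where n0: "!!n. n >= n0 ==> AE x in m. g x <= u n x" using le by (auto simp: eventually_sequentially)
 have "AE x in m. \<forall>n\<in>{n0..}. g x <= u n x" using n0 by (subst AE_ball_countable) auto
 with ae show ?thesis
 proof eventually_elim
  case (elim x)
  have "\<exists>N. \<forall>n\<ge>N. g x <= u (r n) x"
   using elim(2) seq_suble[OF r] by (intro exI[of _ n0]) (auto intro: order_trans)
  thus ?case using elim(1) LIMSEQ_le_const by blast
 qed
qed

lemma l2_tendsto_AE_cong:
 assumes "l2_tendsto m u w" "w' \<in> borel_measurable m" "AE x in m. w' x = w x"
 shows "l2_tendsto m u w'"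
 by (rule l2_tendsto_dominated[OF assms(1), where c=1])
  (use l2_tendstoD[OF assms(1)] assms(2,3) in "auto intro: L2_AE_cong")

section \<open>Cauchy sequences and completeness\<close>

definition l2_Cauchy :: "'s measure => (nat => 's => real) => bool" where
 "l2_Cauchy m u \<longleftrightarrow> (\<forall>n. u n \<in> L2 m) \<and>
   (\<forall>e>0. \<exists>N. \<forall>p\<ge>N. \<forall>q\<ge>N. l2_norm m (%x. u p x - u q x) < e)"

text \<open>Fatou's lemma for the squares, run with nonnegative integrals so that
  square-integrability of the limit is a conclusion and not an assumption.\<close>

lemma L2_Fatou:
 assumes u: "!!n. u n \<in> L2 m" and [measurable]: "w \<in> borel_measurable m"
  and lim: "AE x in m. (%n. u n x) ---> w x"
  and bd: "!!n. l2_norm m (u n) <= B"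
 shows "w \<in> L2 m \<and> l2_norm m w <= B"
proof -
 have [measurable]: "!!n. u n \<in> borel_measurable m" using u by auto
 have B: "B >= 0" using bd[of 0] l2_norm_nonneg[of m "u 0"] by linarith
 have nn: "(\<integral>\<^sup>+x. ennreal ((u n x)^2) \<partial>m) <= ennreal (B^2)" for n
 proof -
  have "(\<integral>\<^sup>+x. ennreal ((u n x)^2) \<partial>m) = ennreal (\<integral>x. (u n x)^2 \<partial>m)"
   using u[of n] by (intro nn_integral_eq_integral) (auto simp: L2_def)
  also have "... = ennreal ((l2_norm m (u n))^2)"
   by (simp only: l2_norm_square l2_inner_def power2_eq_square[of "u n _"])
  also have "... <= ennreal (B^2)" using bd[of n] by (intro ennreal_leI power_mono) auto
  finally show ?thesis .
 qed
 have le: "(\<integral>\<^sup>+x. ennreal ((w x)^2) \<partial>m) <= ennreal (B^2)"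
 proof -
  have "(\<integral>\<^sup>+x. ennreal ((w x)^2) \<partial>m) = (\<integral>\<^sup>+x. liminf (%n. ennreal ((u n x)^2)) \<partial>m)"
  proof (rule nn_integral_cong_AE, use lim in eventually_elim)
   case (elim x)
   hence "(%n. ennreal ((u n x)^2)) ---> ennreal ((w x)^2)" by (intro tendsto_intros)
   thus ?case by (intro lim_imp_Liminf[symmetric]) auto
  qed
  also have "... <= liminf (%n. \<integral>\<^sup>+x. ennreal ((u n x)^2) \<partial>m)"
   by (rule nn_integral_liminf) simp
  also have "... <= liminf (%n::nat. ennreal (B^2))"
   by (intro Liminf_mono always_eventually allI nn)
  finally show ?thesis by (simp add: Liminf_const)
 qed
 have int: "integrable m (%x. (w x)^2)"
  by (rule integrableI_nonneg) (use le in "auto intro: le_less_trans")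
 hence w: "w \<in> L2 m" by (simp add: L2_def)
 have "ennreal ((l2_norm m w)^2) = (\<integral>\<^sup>+x. ennreal ((w x)^2) \<partial>m)"
  using int by (subst nn_integral_eq_integral) (auto simp: l2_norm_square l2_inner_def power2_eq_square[of "w _"])
 with le have "ennreal ((l2_norm m w)^2) <= ennreal (B^2)" by simp
 hence "(l2_norm m w)^2 <= B^2" by (subst (asm) ennreal_le_iff) auto
 hence "l2_norm m w <= B" using B by (rule power2_le_imp_le)
 with w show ?thesis by simp
qed

text \<open>Fatou's lemma, applied to \<open>u n - u p\<close> as n grows, bounds
  \<open>w - u p\<close> by the Cauchy modulus. The lemma identifies a mean-square limit with a
  pointwise limit that is already known, later a hitting expectation.\<close>

lemma l2_Cauchy_pointwise_limit:
 assumes c: "l2_Cauchy m u" and w: "w \<in> borel_measurable m" and lim: "AE x in m. (%n. u n x) ---> w x"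
 shows "l2_tendsto m u w"
proof -
 have u: "!!n. u n \<in> L2 m" using c by (auto simp: l2_Cauchy_def)
 have small: "\<exists>N. \<forall>p\<ge>N. (%x. w x - u p x) \<in> L2 m \<and> l2_norm m (%x. w x - u p x) <= e" if e: "e > 0" for e
 proof -
  obtain N where N: "!!p q. p >= N ==> q >= N ==> l2_norm m (%x. u p x - u q x) < e"
   using c e unfolding l2_Cauchy_def by blast
  have "(%x. w x - u p x) \<in> L2 m \<and> l2_norm m (%x. w x - u p x) <= e" if p: "p >= N" for p
  proof (rule L2_Fatou)
   show "(%x. u (n + N) x - u p x) \<in> L2 m" for n using u by auto
   show "l2_norm m (%x. u (n + N) x - u p x) <= e" for n using N[of "n + N" p] p by simp
   show "AE x in m. (%n. u (n + N) x - u p x) ---> w x - u p x"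
    using lim by eventually_elim (intro tendsto_intros LIMSEQ_ignore_initial_segment)
  qed (use w u L2_measurable in auto)
  thus ?thesis by blast
 qed
 obtain p where p: "(%x. w x - u p x) \<in> L2 m" using small[of 1] by auto
 have wL: "w \<in> L2 m" using L2_add[OF p u[of p]] by simp
 have "(%n. l2_norm m (%x. u n x - w x)) ---> 0"
 proof (rule LIMSEQ_I)
  fix r :: real assume "r > 0"
  then obtain N where "\<forall>p\<ge>N. l2_norm m (%x. w x - u p x) <= r / 2" using small[of "r/2"] by auto
  thus "\<exists>no. \<forall>n\<ge>no. norm (l2_norm m (%x. u n x - w x) - 0) < r"
   using \<open>r > 0\<close> by (intro exI[of _ N]) (fastforce simp: l2_norm_minus_commute[of m _ w])
 qed
 with u wL show ?thesis by (simp add: l2_tendsto_def)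
qed

lemma fast_subseq:
 fixes d :: "nat => nat => real"
 assumes "\<forall>e>0. \<exists>N. \<forall>p\<ge>N. \<forall>q\<ge>N. d p q < e" and g: "!!n. g n > 0"
 shows "\<exists>r. strict_mono r \<and> (\<forall>n. d (r (Suc n)) (r n) < g n)"
proof -
 have "\<exists>N. \<forall>n. \<forall>p\<ge>N n. \<forall>q\<ge>N n. d p q < g n"
  using assms(1) g by (intro choice) auto
 then obtain N where N: "!!n p q. p >= N n ==> q >= N n ==> d p q < g n" by auto
 \<comment> \<open>The partial sums make \<open>r\<close> monotone and the summand \<open>n\<close>
   makes it strictly so, while \<open>r n\<close> is still at least the threshold
   \<open>N n\<close>.\<close>
 define r where "r n = (\<Sum>i\<le>n. N i) + n" for n
 have "strict_mono r" unfolding strict_mono_Suc_iff r_def by simp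
 moreover have "r n >= N n" for n unfolding r_def using member_le_sum[of n "{..n}" N] by simp
 moreover have "r (Suc n) >= N n" for n
  using \<open>!!n. r n >= N n\<close>[of n] \<open>strict_mono r\<close> by (meson lessI less_imp_le order_trans strict_mono_less)
 ultimately show ?thesis using N by blast
qed

text \<open>Riesz--Fischer: along a subsequence with increments below \<open>(1/2)^n\<close> the
  series of absolute increments has finite square integral, hence converges almost everywhere, and
  the pointwise limit is also the mean-square limit.\<close>

theorem L2_complete:
 assumes c: "l2_Cauchy m u" shows "\<exists>w. l2_tendsto m u w"
proof -
 have u: "!!n. u n \<in> L2 m" using c by (auto simp: l2_Cauchy_def)
 have [measurable]: "!!n. u n \<in> borel_measurable m" using u by auto
 obtain r where r: "strict_mono r" and fast: "!!n. l2_norm m (%x. u (r (Suc n)) x - u (r n) x) < (1/2)^n"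
  using fast_subseq[of "%p q. l2_norm m (%x. u p x - u q x)" "%n. (1/2)^n"] c
  unfolding l2_Cauchy_def by auto
 define d where "d n x = \<bar>u (r (Suc n)) x - u (r n) x\<bar>" for n x
 have dL: "d n \<in> L2 m" for n unfolding d_def using u by auto
 have [measurable]: "!!n. d n \<in> borel_measurable m" using dL by auto
 have dn: "l2_norm m (d n) <= (1/2)^n" for n
  using fast[of n] unfolding d_def l2_norm_def l2_inner_def by simp
 have part: "l2_norm m (%x. \<Sum>i<n. d i x) <= 2" for n
 proof -
  have "l2_norm m (%x. \<Sum>i<n. d i x) <= (\<Sum>i<n. l2_norm m (d i))" by (rule l2_norm_sum) (rule dL)
  also have "... <= (\<Sum>i<n. (1/2)^i)" by (intro sum_mono dn)
  also have "... <= 2" by (simp add: sum_gp_strict)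
  finally show ?thesis .
 qed
 \<comment> \<open>The partial sums have norm at most 2, so monotone convergence bounds the square
   integral of the whole series by 4.\<close>
 have nn: "(\<integral>\<^sup>+x. (\<Sum>i. ennreal (d i x))^2 \<partial>m) <= 4"
 proof -
  have "(\<integral>\<^sup>+x. (\<Sum>i. ennreal (d i x))^2 \<partial>m) = (\<integral>\<^sup>+x. (SUP n. ennreal ((\<Sum>i<n. d i x)^2)) \<partial>m)"
  proof (rule nn_integral_cong)
   fix x
   have nonneg: "d i x >= 0" for i by (simp add: d_def)
   have "(%n. (\<Sum>i<n. ennreal (d i x))^2) ---> (\<Sum>i. ennreal (d i x))^2"
    unfolding power2_eq_square by (intro tendsto_mult_ennreal summable_LIMSEQ summableI) auto
   hence "(%n. ennreal ((\<Sum>i<n. d i x)^2)) ---> (\<Sum>i. ennreal (d i x))^2"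
    using nonneg by (simp add: sum_ennreal ennreal_power sum_nonneg)
   moreover have "(%n. ennreal ((\<Sum>i<n. d i x)^2)) ---> (SUP n. ennreal ((\<Sum>i<n. d i x)^2))"
    using nonneg by (intro LIMSEQ_SUP incseq_SucI ennreal_leI power_mono) (auto intro: sum_nonneg)
   ultimately show "(\<Sum>i. ennreal (d i x))^2 = (SUP n. ennreal ((\<Sum>i<n. d i x)^2))"
    by (rule LIMSEQ_unique)
  qed
  also have "... = (SUP n. \<integral>\<^sup>+x. ennreal ((\<Sum>i<n. d i x)^2) \<partial>m)"
  proof (rule nn_integral_monotone_convergence_SUP)
   show "incseq (%n x. ennreal ((\<Sum>i<n. d i x)^2))"
    by (intro incseq_SucI le_funI ennreal_leI power_mono) (auto intro!: sum_nonneg simp: d_def)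
  qed simp
  also have "... <= 4"
  proof (rule SUP_least)
   fix n
   have "(%x. \<Sum>i<n. d i x) \<in> L2 m" using dL by auto
   hence "(\<integral>\<^sup>+x. ennreal ((\<Sum>i<n. d i x)^2) \<partial>m) = ennreal ((l2_norm m (%x. \<Sum>i<n. d i x))^2)"
    by (subst nn_integral_eq_integral) (auto simp: L2_def l2_norm_square l2_inner_def power2_eq_square[of "sum _ _"])
   also have "... <= ennreal (2^2)" using part[of n] by (intro ennreal_leI power_mono) auto
   finally show "(\<integral>\<^sup>+x. ennreal ((\<Sum>i<n. d i x)^2) \<partial>m) <= 4" by simp
  qed
  finally show ?thesis .
 qed
 have "AE x in m. (\<Sum>i. ennreal (d i x))^2 ~= \<infinity>"
 proof (rule nn_integral_PInf_AE)
  show "(\<integral>\<^sup>+x. (\<Sum>i. ennreal (d i x))^2 \<partial>m) ~= \<infinity>"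
   using nn by (auto simp: top_unique)
 qed measurable
 hence conv: "AE x in m. (%n. u (r n) x) ---> lim (%n. u (r n) x)"
 proof eventually_elim
  case (elim x)
  hence "(\<Sum>i. ennreal (d i x)) ~= \<infinity>" by (auto simp: power2_eq_square ennreal_top_mult)
  hence "summable (%i. d i x)" by (intro summable_suminf_not_top) (auto simp: d_def)
  hence "summable (%i. u (r (Suc i)) x - u (r i) x)" unfolding d_def by (rule summable_rabs_cancel)
  hence "convergent (%n. (\<Sum>i<n. u (r (Suc i)) x - u (r i) x) + u (r 0) x)"
   by (intro convergent_add convergent_const) (simp add: summable_iff_convergent)
  hence "convergent (%n. u (r n) x)" by (simp add: sum_lessThan_telescope[where f="%i. u (r i) x"])
  thus ?case by (simp add: convergent_LIMSEQ_iff)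
 qed
 define w where "w x = lim (%n. u (r n) x)" for x
 have [measurable]: "w \<in> borel_measurable m" unfolding w_def by measurable
 have "l2_Cauchy m (%n. u (r n))" unfolding l2_Cauchy_def
 proof (intro conjI allI impI)
  fix e :: real assume "e > 0"
  then obtain N where "\<forall>p\<ge>N. \<forall>q\<ge>N. l2_norm m (%x. u p x - u q x) < e"
   using c unfolding l2_Cauchy_def by auto
  thus "\<exists>N. \<forall>p\<ge>N. \<forall>q\<ge>N. l2_norm m (%x. u (r p) x - u (r q) x) < e"
   using seq_suble[OF r] by (intro exI[of _ N]) (meson order_trans)
 qed (rule u)
 hence lw: "l2_tendsto m (%n. u (r n)) w"
  using conv by (intro l2_Cauchy_pointwise_limit) (auto simp: w_def)
 have wL: "w \<in> L2 m" using lw by (rule l2_tendstoD)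
 have "(%n. l2_norm m (%x. u n x - w x)) ---> 0"
 proof (rule LIMSEQ_I)
  fix e :: real assume e: "e > 0"
  then obtain N where N: "!!p q. p >= N ==> q >= N ==> l2_norm m (%x. u p x - u q x) < e / 2"
   using c unfolding l2_Cauchy_def by (meson half_gt_zero)
  obtain M where M: "!!n. n >= M ==> norm (l2_norm m (%x. u (r n) x - w x) - 0) < e / 2"
   using LIMSEQ_D[OF l2_tendstoD(3)[OF lw], of "e / 2"] e by auto
  have "l2_norm m (%x. u n x - w x) < e" if n: "n >= N" for n
  proof -
   let ?k = "max N M"
   have "r ?k >= N" using seq_suble[OF r, of ?k] by linarith
   hence "l2_norm m (%x. u n x - u (r ?k) x) < e / 2" using n by (intro N)
   moreover have "l2_norm m (%x. u (r ?k) x - w x) < e / 2" using M[of ?k] by simp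
   ultimately show ?thesis
    using l2_norm_triangle_diff[OF u[of n] u[of "r ?k"] wL] by linarith
  qed
  thus "\<exists>no. \<forall>n\<ge>no. norm (l2_norm m (%x. u n x - w x) - 0) < e" by auto
 qed
 with u wL show ?thesis by (auto simp: l2_tendsto_def)
qed

section \<open>Increasing sequences of quadratic forms\<close>

text \<open>Near maximisers of \<open>2 (f, w) - a\<^sub>n w\<close> form a Cauchy sequence by strong convexity, which is
 what allows the supremum over \<open>w\<close> and the limit in \<open>n\<close> to be interchanged.\<close>

lemma increasing_forms_sup:
 fixes a :: "nat => ('s => real) => real" and c :: real
 assumes f: "f \<in> L2 m" and V: "V \<subseteq> L2 m" and c: "c > 0"
  and mid: "!!u v. u \<in> V ==> v \<in> V ==> (%x. (u x + v x) / 2) \<in> V"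
  and convex: "!!n u v. u \<in> V ==> v \<in> V ==>
    a n (%x. (u x + v x) / 2) <= (a n u + a n v) / 2 - c * (l2_norm m (%x. u x - v x))^2"
  and mono: "!!n w. w \<in> V ==> a n w <= a (Suc n) w"
  and lsc: "!!n u w C. l2_tendsto m u w ==> (!!i. u i \<in> V) ==> (!!i. a n (u i) <= C) ==> w \<in> V \<and> a n w <= C"
  and ub: "!!n w. w \<in> V ==> 2 * l2_inner m f w - a n w <= s n"
  and near: "!!n e. e > 0 ==> \<exists>w\<in>V. 2 * l2_inner m f w - a n w > s n - e"
  and pos: "!!n. s n >= 0"
 shows "\<exists>S. s ---> S \<and> (\<exists>w\<in>V. \<forall>n. 2 * l2_inner m f w - a n w >= S)"
proof -
 have amono: "a n w <= a p w" if "n <= p" "w \<in> V" for n p w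
  by (rule lift_Suc_mono_le[where f="%n. a n w"]) (use mono that in auto)
 \<comment> \<open>Raising the form can only lower the supremum; being nonnegative, the suprema then
   converge.\<close>
 have dec: "s (Suc n) <= s n" for n
 proof (rule field_le_epsilon)
  fix e :: real assume "e > 0"
  from near[OF this, of "Suc n"] obtain w where w: "w \<in> V" "2 * l2_inner m f w - a (Suc n) w > s (Suc n) - e" by auto
  with mono[OF w(1), of n] ub[OF w(1), of n] show "s (Suc n) <= s n + e" by linarith
 qed
 hence "decseq s" by (simp add: decseq_Suc_iff)
 then obtain S where S: "s ---> S" "!!n. S <= s n" using decseq_convergent[of s 0] pos by metis
 have "\<exists>w. \<forall>n. w n \<in> V \<and> 2 * l2_inner m f (w n) - a n (w n) > s n - 1 / real (Suc n)"
 proof (rule choice, rule allI)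
  fix n
  have "1 / real (Suc n) > 0" by simp
  from near[OF this, of n] show "\<exists>w. w \<in> V \<and> 2 * l2_inner m f w - a n w > s n - 1 / real (Suc n)"
   by (elim bexE) (intro exI conjI)
 qed
 then obtain w where w: "!!n. w n \<in> V" "!!n. 2 * l2_inner m f (w n) - a n (w n) > s n - 1 / real (Suc n)" by auto
 have wL: "!!n. w n \<in> L2 m" using w(1) V by auto
 \<comment> \<open>A near maximiser at stage p is one at every earlier stage n, because
   \<open>a n\<close> lies below \<open>a p\<close>. So members with different indices can be
   compared under the same form.\<close>
 have good: "2 * l2_inner m f (w p) - a n (w p) >= S - 1 / real (Suc n)" if "n <= p" for n p
 proof -
  have "1 / real (Suc p) <= 1 / real (Suc n)" using that by (simp add: frac_le)
  thus ?thesis using w(2)[of p] amono[OF that w(1)[of p]] S(2)[of p] by linarith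
 qed
 \<comment> \<open>The midpoint is admissible, so its value is at most \<open>s n\<close>; strong
   convexity makes it exceed the average of the two values, both close to \<open>S\<close>, by a
   multiple of the squared distance.\<close>
 have close: "c * (l2_norm m (%x. w p x - w q x))^2 <= s n - S + 1 / real (Suc n)" if "n <= p" "n <= q" for n p q
 proof -
  let ?z = "%x. (w p x + w q x) / 2"
  have "2 * l2_inner m f ?z - a n ?z <= s n" by (intro ub mid w(1))
  moreover have "2 * l2_inner m f ?z = l2_inner m f (w p) + l2_inner m f (w q)"
   using l2_inner_cmult(2)[of m f "1/2" "%x. w p x + w q x"] f wL by simp
  ultimately show ?thesis
   using convex[OF w(1)[of p] w(1)[of q], of n] good[OF that(1)] good[OF that(2)] by argo
 qed
 have "l2_Cauchy m w" unfolding l2_Cauchy_def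
 proof (intro conjI allI impI)
  fix e :: real assume e: "e > 0"
  have "(%n. s n - S + 1 / real (Suc n)) ---> S - S + 0"
   by (intro tendsto_intros S LIMSEQ_Suc[OF lim_1_over_n])
  hence "\<forall>\<^sub>F n in sequentially. s n - S + 1 / real (Suc n) < c * e^2"
   using e c by (intro order_tendstoD) auto
  then obtain n where n: "s n - S + 1 / real (Suc n) < c * e^2" by (auto simp: eventually_sequentially)
  have "l2_norm m (%x. w p x - w q x) < e" if "p >= n" "q >= n" for p q
  proof (rule power2_less_imp_less)
   have "c * (l2_norm m (%x. w p x - w q x))^2 < c * e^2" using close[OF that] n by linarith
   thus "(l2_norm m (%x. w p x - w q x))^2 < e^2" using c by simp
  qed (use e in simp)
  thus "\<exists>N. \<forall>p\<ge>N. \<forall>q\<ge>N. l2_norm m (%x. w p x - w q x) < e" by blast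
 qed (rule wL)
 then obtain z where z: "l2_tendsto m w z" using L2_complete by blast
 \<comment> \<open>For fixed n all late members satisfy the same bound up to e, so lower
   semicontinuity of \<open>a n\<close> transfers it to \<open>z\<close>.\<close>
 have fin: "z \<in> V \<and> a n z <= 2 * l2_inner m f z - S + e" if e: "e > 0" for n e
 proof -
  have "(%p. 2 * l2_inner m f (w p) - (S - 1 / real (Suc p))) ---> 2 * l2_inner m f z - (S - 0)"
   by (intro tendsto_intros l2_tendsto_inner z l2_tendsto_const f LIMSEQ_Suc[OF lim_1_over_n])
  hence "\<forall>\<^sub>F p in sequentially. 2 * l2_inner m f (w p) - (S - 1 / real (Suc p)) < 2 * l2_inner m f z - S + e"
   using e by (intro order_tendstoD) auto
  then obtain N where N: "!!p. p >= N ==> 2 * l2_inner m f (w p) - (S - 1 / real (Suc p)) < 2 * l2_inner m f z - S + e"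
   by (auto simp: eventually_sequentially)
  show ?thesis
  proof (rule lsc)
   show "l2_tendsto m (%i. w (i + (n + N))) z" by (rule l2_tendsto_subseq[OF z]) (simp add: strict_mono_def)
   fix i
   have "a n (w (i + (n + N))) <= a (i + (n + N)) (w (i + (n + N)))" by (rule amono) (simp_all add: w)
   thus "a n (w (i + (n + N))) <= 2 * l2_inner m f z - S + e"
    using N[of "i + (n + N)"] good[of "i + (n + N)" "i + (n + N)"] by auto
  qed (rule w(1))
 qed
 have "2 * l2_inner m f z - a n z >= S" for n
 proof (rule field_le_epsilon)
  fix e :: real assume "e > 0"
  thus "S <= 2 * l2_inner m f z - a n z + e" using fin[of e n] by linarith
 qed
 moreover have "z \<in> V" using fin[of 1] by simp
 ultimately show ?thesis using S(1) by blast
qed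

section \<open>Symmetric contraction semigroups and their forms\<close>

text \<open>The identities are tested against inner products, since the operators act on functions
  and the identities hold only up to null sets. \<open>P_semigroup\<close> contains symmetry: one
  factor is moved to the other side, and \<open>s = 0\<close> gives the symmetry back.\<close>

locale l2_semigroup =
 fixes m :: "'s measure" and P :: "real => ('s => real) => 's => real"
 assumes P_L2 [simp, intro]: "t >= 0 ==> u \<in> L2 m ==> P t u \<in> L2 m"
  and P_linear: "t >= 0 ==> u \<in> L2 m ==> v \<in> L2 m ==> w \<in> L2 m ==>
   l2_inner m (P t (%x. a * u x + b * v x)) w = a * l2_inner m (P t u) w + b * l2_inner m (P t v) w"
  and P_semigroup: "s >= 0 ==> t >= 0 ==> u \<in> L2 m ==> v \<in> L2 m ==>
   l2_inner m (P (s + t) u) v = l2_inner m (P s u) (P t v)"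
  and P_0: "u \<in> L2 m ==> v \<in> L2 m ==> l2_inner m (P 0 u) v = l2_inner m u v"
  and P_contract: "t >= 0 ==> u \<in> L2 m ==> l2_norm m (P t u) <= l2_norm m u"
begin

lemma P_symmetric: "t >= 0 ==> u \<in> L2 m ==> v \<in> L2 m ==> l2_inner m (P t u) v = l2_inner m u (P t v)"
 using P_semigroup[of 0 t u v] P_0[of u "P t v"] by simp

lemma P_comp: "s >= 0 ==> t >= 0 ==> u \<in> L2 m ==> v \<in> L2 m ==>
  l2_inner m (P s (P t u)) v = l2_inner m (P (s + t) u) v"
 using P_symmetric[of s "P t u" v] P_semigroup[of t s u v] by (simp add: add.commute)

lemma P_diff:
 assumes "t >= 0" "u \<in> L2 m" "v \<in> L2 m" "w \<in> L2 m"
 shows "l2_inner m (P t (%x. u x - v x)) w = l2_inner m (P t u) w - l2_inner m (P t v) w"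
 using P_linear[OF assms, of 1 "-1"] by simp

lemma P_add:
 assumes "t >= 0" "u \<in> L2 m" "v \<in> L2 m" "w \<in> L2 m"
 shows "l2_inner m (P t (%x. u x + v x)) w = l2_inner m (P t u) w + l2_inner m (P t v) w"
 using P_linear[OF assms, of 1 1] by simp

lemma P_cmult:
 assumes "t >= 0" "u \<in> L2 m" "w \<in> L2 m"
 shows "l2_inner m (P t (%x. a * u x)) w = a * l2_inner m (P t u) w"
 using P_linear[OF assms(1,2) _ assms(3), of "%x. 0" a 0] by simp

lemma P_sum:
 assumes "t >= 0" "!!i. i \<in> I ==> u i \<in> L2 m" "w \<in> L2 m" "finite I"
 shows "l2_inner m (P t (%x. \<Sum>i\<in>I. u i x)) w = (\<Sum>i\<in>I. l2_inner m (P t (u i)) w)"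
 using assms(4,2)
proof (induction I)
 case empty
 show ?case using P_cmult[OF assms(1) _ assms(3), of "%x. 0" 0] by simp
next
 case (insert i I)
 thus ?case using P_add[OF assms(1), of "u i" "%x. \<Sum>i\<in>I. u i x" w] assms(3) by simp
qed

text \<open>Linearity is available only inside an inner product, so the squared norm of the
  difference z is written as the inner product of z with itself, one copy is traded for
  \<open>P t\<close> of the difference of arguments, and Cauchy--Schwarz cancels a factor.\<close>

lemma P_norm_diff:
 assumes t: "t >= 0" and u: "u \<in> L2 m" and v: "v \<in> L2 m"
 shows "l2_norm m (%x. P t u x - P t v x) <= l2_norm m (%x. u x - v x)"
proof -
 let ?z = "%x. P t u x - P t v x"
 have z: "?z \<in> L2 m" using assms by auto
 have "(l2_norm m ?z)^2 = l2_inner m (P t (%x. u x - v x)) ?z"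
  unfolding l2_norm_square using P_diff[OF assms z] assms z by simp
 also have "... <= l2_norm m (P t (%x. u x - v x)) * l2_norm m ?z"
  using l2_inner_le_norm[of "P t (%x. u x - v x)" m ?z] assms by auto
 also have "... <= l2_norm m (%x. u x - v x) * l2_norm m ?z"
  using assms by (intro mult_right_mono P_contract) auto
 finally have *: "l2_norm m ?z * l2_norm m ?z <= l2_norm m (%x. u x - v x) * l2_norm m ?z"
  by (simp add: power2_eq_square)
 show ?thesis
 proof (cases "l2_norm m ?z = 0")
  case False
  hence "l2_norm m ?z > 0" using l2_norm_nonneg[of m ?z] by linarith
  thus ?thesis using * by simp
 qed simp
qed

lemma P_tendsto: "t >= 0 ==> l2_tendsto m u w ==> l2_tendsto m (%n. P t (u n)) (P t w)"
 using l2_tendstoD[of m u w] by (intro l2_tendstoI[where r="%n. l2_norm m (%x. u n x - w x)"] P_norm_diff) auto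

text \<open>Equality almost everywhere means distance 0, which the contraction estimate preserves;
  so \<open>P t\<close> acts on classes although it is given on functions.\<close>

lemma P_AE_cong:
 assumes t: "t >= 0" and u: "u \<in> L2 m" and v: "v \<in> borel_measurable m" and eq: "AE x in m. v x = u x"
 shows "AE x in m. P t v x = P t u x"
proof -
 have vL: "v \<in> L2 m" by (rule L2_AE_cong[OF u v eq])
 have "l2_norm m (%x. v x - u x) <= l2_norm m (%x. 0)"
  by (rule l2_norm_mono) (use u vL eq in auto)
 hence "l2_norm m (%x. P t v x - P t u x) <= 0"
  using P_norm_diff[OF t vL u] by simp
 hence "l2_norm m (%x. P t v x - P t u x) = 0" using l2_norm_nonneg by (rule antisym)
 hence "AE x in m. P t v x - P t u x = 0"
  using t u vL by (intro l2_inner_self_eq_0) (auto simp: l2_norm_def)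
 thus ?thesis by simp
qed

lemma P_inner_bound: "t >= 0 ==> u \<in> L2 m ==> v \<in> L2 m ==> \<bar>l2_inner m (P t u) v\<bar> <= l2_norm m u * l2_norm m v"
 using l2_inner_le_norm[of "P t u" m v] P_contract[of t u] mult_right_mono[OF P_contract, of t u "l2_norm m v"]
 by fastforce

subsection \<open>The autocorrelation function\<close>

text \<open>Spectrally the Laplace transform of a positive measure. Positivity, monotonicity and
  convexity in t are read off from the semigroup law instead of a spectral resolution.\<close>

definition corr :: "('s => real) => real => real" where
 "corr u t = l2_inner m (P t u) u"

lemma corr_0: "u \<in> L2 m ==> corr u 0 = l2_inner m u u"
 by (simp add: corr_def P_0)

lemma corr_half: "t >= 0 ==> u \<in> L2 m ==> corr u t = (l2_norm m (P (t/2) u))^2"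
 using P_semigroup[of "t/2" "t/2" u u] by (simp add: corr_def l2_norm_square)

lemma corr_nonneg: "t >= 0 ==> u \<in> L2 m ==> corr u t >= 0"
 by (simp add: corr_half)

text \<open>Half of the earlier time goes into \<open>w = P (s/2) u\<close>; the value at s is then
  the inner product of w with itself and the value at t that of w with \<open>P (t - s) w\<close>,
  and contraction applies.\<close>

lemma corr_antimono:
 assumes st: "0 <= s" "s <= t" and u: "u \<in> L2 m" shows "corr u t <= corr u s"
proof -
 let ?w = "P (s/2) u"
 have w: "?w \<in> L2 m" using st u by auto
 have "corr u t = l2_inner m (P (s/2 + (t - s/2)) u) u" by (simp add: corr_def)
 also have "... = l2_inner m ?w (P (t - s/2) u)" using st u by (intro P_semigroup) auto
 also have "... = l2_inner m (P (s/2 + (t - s)) u) ?w" by (simp add: l2_inner_commute field_simps)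
 also have "... = l2_inner m ?w (P (t - s) ?w)" using st u w by (intro P_semigroup) auto
 also have "... <= l2_norm m ?w * l2_norm m ?w"
  using P_inner_bound[of "t - s" ?w ?w] st w by (simp add: l2_inner_commute)
 also have "... = corr u s" using st u by (simp add: corr_half power2_eq_square)
 finally show ?thesis .
qed

lemma corr_le: "t >= 0 ==> u \<in> L2 m ==> corr u t <= l2_inner m u u"
 using corr_antimono[of 0 t u] by (simp add: corr_0)

text \<open>The second difference is the value at t of the autocorrelation of
  \<open>u - P h u\<close>, hence nonnegative: convexity in discrete form.\<close>

lemma corr_second_difference:
 assumes t: "t >= 0" and h: "h >= 0" and u: "u \<in> L2 m"
 shows "corr u t - 2 * corr u (t + h) + corr u (t + 2 * h) >= 0"
proof -
 let ?w = "P h u" let ?z = "%x. u x - P h u x"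
 have w: "?w \<in> L2 m" and z: "?z \<in> L2 m" using u h by auto
 have a: "l2_inner m (P t u) ?w = corr u (t + h)" using P_semigroup[of t h u u] t h u by (simp add: corr_def)
 have b: "l2_inner m (P t ?w) u = corr u (t + h)" using P_comp[of t h u u] t h u by (simp add: corr_def)
 have "l2_inner m (P t ?w) ?w = l2_inner m (P (t + h) ?w) u" using P_semigroup[of t h ?w u] t h u by simp
 also have "... = corr u (t + 2 * h)" using P_comp[of "t + h" h u u] t h u by (simp add: corr_def algebra_simps)
 finally have c: "l2_inner m (P t ?w) ?w = corr u (t + 2 * h)" .
 have "0 <= l2_inner m (P t ?z) ?z" using corr_nonneg[OF t z] by (simp add: corr_def)
 also have "... = l2_inner m (P t u) ?z - l2_inner m (P t ?w) ?z" using t u w z by (simp add: P_diff)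
 also have "... = corr u t - 2 * corr u (t + h) + corr u (t + 2 * h)"
  using t u w z a b c by (simp add: corr_def)
 finally show ?thesis .
qed

lemma corr_decrement_antimono:
 assumes h: "h >= 0" and u: "u \<in> L2 m" and ij: "i <= j"
 shows "corr u (real j * h) - corr u (real (Suc j) * h) <= corr u (real i * h) - corr u (real (Suc i) * h)"
proof -
 have "decseq (%i. corr u (real i * h) - corr u (real (Suc i) * h))"
  unfolding decseq_Suc_iff
 proof
  fix n
  show "corr u (real (Suc n) * h) - corr u (real (Suc (Suc n)) * h) <= corr u (real n * h) - corr u (real (Suc n) * h)"
   using corr_second_difference[of "real n * h" h u] h u by (simp add: algebra_simps)
 qed
 thus ?thesis using ij by (simp add: decseq_def)
qed

text \<open>Decrements along a grid decrease and telescope to at most the squared norm, so the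
  decrement after n steps is at most one n-th of it. This is the quantitative source of continuity
  away from 0.\<close>

lemma corr_decrement_bound:
 assumes h: "h >= 0" and u: "u \<in> L2 m"
 shows "real n * (corr u (real n * h) - corr u (real (Suc n) * h)) <= l2_inner m u u"
proof -
 have "real n * (corr u (real n * h) - corr u (real (Suc n) * h)) \<le>
   (\<Sum>i<n. corr u (real i * h) - corr u (real (Suc i) * h))"
  using sum_mono[of "{..<n}" "%i. corr u (real n * h) - corr u (real (Suc n) * h)"
   "%i. corr u (real i * h) - corr u (real (Suc i) * h)"] corr_decrement_antimono[OF h u] by simp
 also have "... = corr u 0 - corr u (real n * h)"
  using sum_lessThan_telescope'[where f="%i. corr u (real i * h)"] by simp
 also have "... <= l2_inner m u u" using corr_nonneg[of "real n * h" u] h u by (simp add: corr_0)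
 finally show ?thesis .
qed

lemma corr_isCont:
 assumes t: "t > 0" and u: "u \<in> L2 m" shows "isCont (corr u) t"
 unfolding continuous_at_eps_delta
proof (intro allI impI)
 fix e :: real assume e: "e > 0"
 define B where "B = l2_inner m u u"
 obtain n :: nat where n: "real n > B / e" using reals_Archimedean2 by blast
 define k where "k = Suc n"
 have k: "B / real k < e" "k > 0" unfolding k_def
  using n e by (auto simp: field_simps intro: less_le_trans[of B "e * real n"])
 \<comment> \<open>The mesh makes t the grid point with index k + 1, so \<open>t - d\<close> and
   \<open>t + d\<close> are its grid neighbours and the decrement bound applies on both sides, at
   worst with the factor 1/k.\<close>
 define d where "d = t / real (Suc k)"
 have d: "d > 0" "real (Suc k) * d = t" using t by (simp_all add: d_def)
 have right: "corr u t - corr u (t + d) < e"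
 proof -
  have "real (Suc k) * (corr u (real (Suc k) * d) - corr u (real (Suc (Suc k)) * d)) <= B"
   unfolding B_def by (rule corr_decrement_bound) (use d u in auto)
  moreover have "real (Suc (Suc k)) * d = t + d" using d(2) by (simp add: algebra_simps)
  ultimately have "real (Suc k) * (corr u t - corr u (t + d)) <= B" using d(2) by simp
  moreover have "real k * (corr u t - corr u (t + d)) <= real (Suc k) * (corr u t - corr u (t + d))"
   using corr_antimono[of t "t + d" u] t d u by (intro mult_right_mono) auto
  ultimately have "corr u t - corr u (t + d) <= B / real k" using k(2) by (simp add: field_simps)
  with k show ?thesis by linarith
 qed
 have left: "corr u (t - d) - corr u t < e"
 proof -
  have "real k * (corr u (real k * d) - corr u (real (Suc k) * d)) <= B"
   unfolding B_def by (rule corr_decrement_bound) (use d u in auto)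
  moreover have "real k * d = t - d" using d(2) by (simp add: algebra_simps)
  ultimately have "real k * (corr u (t - d) - corr u t) <= B" using d(2) by simp
  hence "corr u (t - d) - corr u t <= B / real k" using k(2) by (simp add: field_simps)
  with k show ?thesis by linarith
 qed
 have "d <= t" using t by (simp add: d_def field_simps)
 have "dist (corr u s) (corr u t) < e" if "dist s t < d" for s
 proof (cases "s <= t")
  case True
  have "t - d <= s" using that True by (auto simp: dist_real_def)
  hence "corr u s <= corr u (t - d)" "corr u t <= corr u s"
   using True \<open>d <= t\<close> u by (auto intro!: corr_antimono)
  with left show ?thesis by (simp add: dist_real_def)
 next
  case False
  have "s <= t + d" using that False by (auto simp: dist_real_def)
  hence "corr u (t + d) <= corr u s" "corr u s <= corr u t"
   using False t u by (auto intro!: corr_antimono)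
  with right show ?thesis by (simp add: dist_real_def)
 qed
 thus "\<exists>d>0. \<forall>x'. dist x' t < d --> dist (corr u x') (corr u t) < e" using d(1) by blast
qed

subsection \<open>The approximating forms and the form\<close>

definition aform :: "real => ('s => real) => ('s => real) => real" where
 "aform t u v = (l2_inner m u v - l2_inner m (P t u) v) / t"

text \<open>Written like the domain in the definition of association, so that for a Hunt process the
  two domains agree almost by unfolding.\<close>

definition form_dom :: "('s => real) set" where
 "form_dom = {u \<in> L2 m. \<exists>l. ((%t. aform t u u) \<longlongrightarrow> l) (at_right 0)}"

definition form :: "('s => real) => ('s => real) => real" where
 "form u v = Lim (at_right 0) (%t. aform t u v)"

lemma form_eqI: "((%t. aform t u v) \<longlongrightarrow> l) (at_right 0) ==> form u v = l"
 unfolding form_def by (rule tendsto_Lim[OF trivial_limit_at_right_real])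

lemma aform_linear:
 assumes "t >= 0" "u \<in> L2 m" "v \<in> L2 m" "w \<in> L2 m"
 shows "aform t (%x. a * u x + b * v x) w = a * aform t u w + b * aform t v w"
 using assms by (simp add: aform_def P_linear diff_divide_distrib add_divide_distrib algebra_simps)

lemma aform_sym: "t >= 0 ==> u \<in> L2 m ==> v \<in> L2 m ==> aform t u v = aform t v u"
 using P_symmetric[of t u v] by (simp add: aform_def l2_inner_commute[of m v u] l2_inner_commute[of m "P t v" u])

lemma aform_self: "aform t u u = (l2_inner m u u - corr u t) / t"
 by (simp add: aform_def corr_def)

lemma aform_nonneg: "t >= 0 ==> u \<in> L2 m ==> aform t u u >= 0"
 unfolding aform_self using corr_le[of t u] by simp

lemma aform_quadratic:
 assumes t: "t >= 0" and u: "u \<in> L2 m" and v: "v \<in> L2 m"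
 shows "aform t (%x. a * u x + b * v x) (%x. a * u x + b * v x) =
  a^2 * aform t u u + 2 * a * b * aform t u v + b^2 * aform t v v"
proof -
 let ?z = "%x. a * u x + b * v x"
 have z: "?z \<in> L2 m" using u v by auto
 have "aform t ?z ?z = a * aform t ?z u + b * aform t ?z v"
  using aform_linear[OF t u v z, of a b] aform_sym[OF t z u] aform_sym[OF t z v] by simp
 also have "... = a * (a * aform t u u + b * aform t v u) + b * (a * aform t u v + b * aform t v v)"
  using aform_linear[OF t u v u, of a b] aform_linear[OF t u v v, of a b] by simp
 finally show ?thesis using aform_sym[OF t v u] by (simp add: power2_eq_square algebra_simps)
qed

lemma aform_tendsto:
 assumes "t >= 0" "l2_tendsto m u w" "l2_tendsto m v z"
 shows "(%n. aform t (u n) (v n)) ---> aform t w z"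
 unfolding aform_def using assms
 by (cases "t = 0") (auto intro!: tendsto_intros l2_tendsto_inner P_tendsto)

text \<open>Replaces monotonicity in t for times that are not multiples of each other. With n the
  least number of steps of length s that cover t, the loss over t is at most n times the first
  decrement, and \<open>n * s <= t + s\<close>; the error s disappears as s tends to 0.\<close>

lemma aform_compare:
 assumes s: "s > 0" and t: "t > 0" and u: "u \<in> L2 m"
 shows "t * aform t u u <= (t + s) * aform s u u"
proof -
 define n where "n = nat \<lceil>t / s\<rceil>"
 have n1: "t <= real n * s"
 proof -
  have "t / s <= real n" unfolding n_def using s t by linarith
  thus ?thesis using s by (simp add: field_simps)
 qed
 have n2: "real n * s <= t + s"
 proof -
  have "t / s >= 0" using s t by simp
  hence "real n <= t / s + 1" unfolding n_def by linarith
  hence "real n * s <= (t / s + 1) * s" using s by (intro mult_right_mono) auto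
  also have "... = t + s" using s by (simp add: field_simps)
  finally show ?thesis .
 qed
 have "t * aform t u u = corr u 0 - corr u t" unfolding aform_self using t u by (simp add: corr_0)
 also have "... <= corr u 0 - corr u (real n * s)" using corr_antimono[OF _ n1 u] t by simp
 also have "... = (\<Sum>i<n. corr u (real i * s) - corr u (real (Suc i) * s))"
  using sum_lessThan_telescope'[where f="%i. corr u (real i * s)"] by simp
 also have "... <= (\<Sum>i<n. corr u 0 - corr u s)"
 proof (rule sum_mono)
  fix i
  show "corr u (real i * s) - corr u (real (Suc i) * s) <= corr u 0 - corr u s"
   using corr_decrement_antimono[of s u 0 i] s u by simp
 qed
 also have "... = (real n * s) * aform s u u" unfolding aform_self using s u by (simp add: corr_0)
 also have "... <= (t + s) * aform s u u" using n2 aform_nonneg[of s u] s u by (intro mult_right_mono) auto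
 finally show ?thesis .
qed

lemma aform_le_of_small:
 assumes u: "u \<in> L2 m" and r: "r ---> 0" "!!k. r k > 0" and C: "!!k::nat. aform (r k) u u <= C" and t: "t > 0"
 shows "aform t u u <= C"
proof -
 have "t * aform t u u <= (t + r k) * C" for k
  using aform_compare[OF r(2)[of k] t u] mult_left_mono[OF C[of k], of "t + r k"] t r(2)[of k] by linarith
 moreover have "(%k. (t + r k) * C) ---> (t + 0) * C" by (intro tendsto_intros r)
 ultimately have "t * aform t u u <= (t + 0) * C" by (intro LIMSEQ_le_const) auto
 thus ?thesis using t by simp
qed

text \<open>By \<open>aform_compare\<close> the values increase as the time falls, up to a factor t
  / (t + s) that tends to 1; so the limit exists and is the supremum.\<close>

lemma aform_bounded_tendsto:
 assumes u: "u \<in> L2 m" and C: "!!t. t > 0 ==> aform t u u <= C"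
 shows "\<exists>l. ((%t. aform t u u) \<longlongrightarrow> l) (at_right 0) \<and> l <= C \<and> (\<forall>t>0. aform t u u <= l)"
proof -
 define l where "l = (SUP t\<in>{0<..}. aform t u u)"
 have bdd: "bdd_above ((%t. aform t u u) ` {0<..})" using C by (intro bdd_aboveI2) auto
 have le: "aform t u u <= l" if "t > 0" for t unfolding l_def by (rule cSUP_upper[OF _ bdd]) (use that in auto)
 have "l <= C" unfolding l_def using C by (intro cSUP_least) (auto intro: exI[of _ 1])
 have "((%t. aform t u u) \<longlongrightarrow> l) (at_right 0)"
 proof (rule order_tendstoI)
  fix a assume "a < l"
  then obtain t where t: "t > 0" "a < aform t u u"
   unfolding l_def using less_cSUP_iff[OF _ bdd] by (force intro: exI[of _ 1])
  have "((%s. t * aform t u u / (t + s)) \<longlongrightarrow> t * aform t u u / (t + 0)) (at_right 0)"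
   using t by (intro tendsto_intros) auto
  hence "\<forall>\<^sub>F s in at_right 0. a < t * aform t u u / (t + s)" using t by (intro order_tendstoD) auto
  moreover have "\<forall>\<^sub>F s in at_right 0. s > (0::real)" by (simp add: eventually_at_right_less)
  ultimately show "\<forall>\<^sub>F s in at_right 0. a < aform s u u"
  proof eventually_elim
   case (elim s)
   have "t * aform t u u / (t + s) <= aform s u u"
    using aform_compare[OF elim(2) t(1) u] t elim(2) by (simp add: field_simps)
   with elim show ?case by linarith
  qed
 next
  fix a assume a: "l < a"
  have "\<forall>\<^sub>F s in at_right 0. s > (0::real)" by (simp add: eventually_at_right_less)
  thus "\<forall>\<^sub>F s in at_right 0. aform s u u < a" by eventually_elim (use a le in "force intro: le_less_trans")
 qed
 with le \<open>l <= C\<close> show ?thesis by blast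
qed

lemma form_dom_L2 [simp, intro]: "u \<in> form_dom ==> u \<in> L2 m"
 by (simp add: form_dom_def)

text \<open>Membership and the energy bound can be tested along a single sequence of times tending
  to 0; comparison of different times turns this into a bound for all t.\<close>

lemma form_domI:
 assumes u: "u \<in> L2 m" and r: "r ---> 0" "!!k. r k > 0" and C: "!!k::nat. aform (r k) u u <= C"
 shows "u \<in> form_dom" "form u u <= C"
proof -
 have bd: "aform t u u <= C" if "t > 0" for t
  using aform_le_of_small[where u=u and r=r and C=C and t=t] u r C that by blast
 have "\<exists>l. ((%t. aform t u u) \<longlongrightarrow> l) (at_right 0) \<and> l <= C \<and> (\<forall>t>0. aform t u u <= l)"
  using u bd by (intro aform_bounded_tendsto)
 then obtain l where l: "((%t. aform t u u) \<longlongrightarrow> l) (at_right 0)" "l <= C" by (elim exE conjE)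
 show "u \<in> form_dom" unfolding form_dom_def using u l(1) by blast
 have "form u u = l" by (rule form_eqI[OF l(1)])
 with l show "form u u <= C" by simp
qed

lemma aform_le_form:
 assumes u: "u \<in> form_dom" and t: "t > 0" shows "aform t u u <= form u u"
proof -
 obtain l where l: "((%t. aform t u u) \<longlongrightarrow> l) (at_right 0)" using u unfolding form_dom_def by blast
 have f: "form u u = l" by (rule form_eqI[OF l])
 have "t * aform t u u <= (t + 0) * l"
 proof (rule tendsto_le[OF _ _ tendsto_const])
  show "((%s. (t + s) * aform s u u) \<longlongrightarrow> (t + 0) * l) (at_right 0)" by (intro tendsto_intros l)
  have "\<forall>\<^sub>F s in at_right 0. s > (0::real)" by (simp add: eventually_at_right_less)
  thus "\<forall>\<^sub>F s in at_right 0. t * aform t u u <= (t + s) * aform s u u"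
   by eventually_elim (intro aform_compare t form_dom_L2 u)
 qed simp
 with t f show ?thesis by simp
qed

lemma form_dom_lin:
 assumes u: "u \<in> form_dom" and v: "v \<in> form_dom" shows "(%x. a * u x + b * v x) \<in> form_dom"
proof (rule form_domI(1))
 have uv: "u \<in> L2 m" "v \<in> L2 m" using u v by auto
 thus "(%x. a * u x + b * v x) \<in> L2 m" by auto
 fix k
 have t: "(0::real) < 1 / real (Suc k)" by simp
 \<comment> \<open>Nonnegativity at \<open>a * u - b * v\<close> bounds the mixed term as in the
   parallelogram law; the limit of the mixed term itself is not yet available.\<close>
 have "0 <= aform (1 / real (Suc k)) (%x. a * u x + (- b) * v x) (%x. a * u x + (- b) * v x)"
  using uv by (intro aform_nonneg) auto
 also have "... = a^2 * aform (1 / real (Suc k)) u u - 2 * a * b * aform (1 / real (Suc k)) u v + b^2 * aform (1 / real (Suc k)) v v"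
  by (subst aform_quadratic) (use uv in auto)
 finally have "aform (1 / real (Suc k)) (%x. a * u x + b * v x) (%x. a * u x + b * v x)
   <= 2 * (a^2 * aform (1 / real (Suc k)) u u) + 2 * (b^2 * aform (1 / real (Suc k)) v v)"
  by (subst aform_quadratic) (use uv in auto)
 also have "... <= 2 * (a^2 * form u u) + 2 * (b^2 * form v v)"
  using aform_le_form[OF u t] aform_le_form[OF v t] by (intro add_mono mult_left_mono) auto
 finally show "aform (1 / real (Suc k)) (%x. a * u x + b * v x) (%x. a * u x + b * v x)
   <= 2 * (a^2 * form u u) + 2 * (b^2 * form v v)" .
next
 show "(%k. 1 / real (Suc k)) ---> 0" by (rule LIMSEQ_Suc[OF lim_1_over_n])
qed simp

text \<open>The domain provides limits on the diagonal only; polarisation with the sum and the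
  difference supplies the others.\<close>

lemma form_tendsto:
 assumes u: "u \<in> form_dom" and v: "v \<in> form_dom"
 shows "((%t. aform t u v) \<longlongrightarrow> form u v) (at_right 0)"
proof -
 have conv: "((%t. aform t u u) \<longlongrightarrow> form u u) (at_right 0)" if "u \<in> form_dom" for u
 proof -
  obtain l where l: "((%t. aform t u u) \<longlongrightarrow> l) (at_right 0)" using \<open>u \<in> form_dom\<close> unfolding form_dom_def by blast
  have f: "form u u = l" by (rule form_eqI[OF l])
  show ?thesis unfolding f by (rule l)
 qed
 have uv: "u \<in> L2 m" "v \<in> L2 m" using u v by auto
 let ?p = "%x. 1 * u x + 1 * v x" and ?q = "%x. 1 * u x + (-1) * v x"
 have "((%t. (aform t ?p ?p - aform t ?q ?q) / 4) \<longlongrightarrow> (form ?p ?p - form ?q ?q) / 4) (at_right 0)"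
  by (intro tendsto_intros conv form_dom_lin u v) simp
 moreover have "\<forall>\<^sub>F t in at_right 0. (aform t ?p ?p - aform t ?q ?q) / 4 = aform t u v"
  using eventually_at_right_less[of "0::real"]
 proof eventually_elim
  case (elim t)
  thus ?case
   using aform_quadratic[of t u v 1 1] aform_quadratic[of t u v 1 "-1"] uv by simp
 qed
 ultimately have *: "((%t. aform t u v) \<longlongrightarrow> (form ?p ?p - form ?q ?q) / 4) (at_right 0)"
  by (rule Lim_transform_eventually)
 hence "form u v = (form ?p ?p - form ?q ?q) / 4" by (rule form_eqI)
 with * show ?thesis by (simp only:)
qed

lemma form_linear:
 assumes u: "u \<in> form_dom" and v: "v \<in> form_dom" and w: "w \<in> form_dom"
 shows "form (%x. a * u x + b * v x) w = a * form u w + b * form v w"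
proof (rule form_eqI, rule Lim_transform_eventually)
 show "((%t. a * aform t u w + b * aform t v w) \<longlongrightarrow> a * form u w + b * form v w) (at_right 0)"
  by (intro tendsto_intros form_tendsto assms)
 show "\<forall>\<^sub>F t in at_right 0. a * aform t u w + b * aform t v w = aform t (%x. a * u x + b * v x) w"
  using eventually_at_right_less[of "0::real"] by eventually_elim (use assms in "simp add: aform_linear")
qed

lemma form_sym:
 assumes u: "u \<in> form_dom" and v: "v \<in> form_dom" shows "form u v = form v u"
proof (rule form_eqI, rule Lim_transform_eventually[OF form_tendsto[OF v u]])
 show "\<forall>\<^sub>F t in at_right 0. aform t v u = aform t u v"
  using eventually_at_right_less[of "0::real"] by eventually_elim (use assms in "simp add: aform_sym")
qed

lemma form_nonneg: "u \<in> form_dom ==> form u u >= 0"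
 using aform_le_form[of u 1] aform_nonneg[of 1 u] by auto

lemma form_quadratic:
 assumes u: "u \<in> form_dom" and v: "v \<in> form_dom"
 shows "form (%x. a * u x + b * v x) (%x. a * u x + b * v x) =
  a^2 * form u u + 2 * a * b * form u v + b^2 * form v v"
proof -
 let ?z = "%x. a * u x + b * v x"
 have z: "?z \<in> form_dom" by (rule form_dom_lin[OF u v])
 have "form ?z ?z = a * form ?z u + b * form ?z v"
  using form_linear[OF u v z, of a b] form_sym[OF z u] form_sym[OF z v] by simp
 also have "... = a * (a * form u u + b * form v u) + b * (a * form u v + b * form v v)"
  using form_linear[OF u v u, of a b] form_linear[OF u v v, of a b] by simp
 finally show ?thesis using form_sym[OF v u] by (simp add: power2_eq_square algebra_simps)
qed

text \<open>Every \<open>aform\<close> is continuous in mean square, and the form is their supremum;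
  a supremum of continuous functionals is lower semicontinuous.\<close>

lemma form_lsc:
 assumes lim: "l2_tendsto m u w" and u: "!!n. u n \<in> form_dom" and C: "!!n. form (u n) (u n) <= C"
 shows "w \<in> form_dom \<and> form w w <= C"
proof -
 have "aform (1 / real (Suc k)) w w <= C" for k
 proof (rule LIMSEQ_le_const2)
  show "(%n. aform (1 / real (Suc k)) (u n) (u n)) ---> aform (1 / real (Suc k)) w w"
   using lim by (intro aform_tendsto) auto
  show "\<exists>N. \<forall>n\<ge>N. aform (1 / real (Suc k)) (u n) (u n) <= C"
   using aform_le_form[OF u, of "1 / real (Suc k)"] C by (intro exI[of _ 0]) (auto intro: order_trans)
 qed
 thus ?thesis
  using form_domI[of w "%k. 1 / real (Suc k)" C] l2_tendstoD(2)[OF lim] LIMSEQ_Suc[OF lim_1_over_n] by auto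
qed

text \<open>Membership of the modified function is lower semicontinuity along the constant sequence
  \<open>u\<close>, whose mean-square limit is \<open>v\<close> as well.\<close>

lemma form_AE_cong:
 assumes u: "u \<in> form_dom" and v: "v \<in> borel_measurable m" and eq: "AE x in m. v x = u x"
 shows "v \<in> form_dom" "w \<in> form_dom ==> form v w = form u w"
proof -
 have lim: "l2_tendsto m (%n. u) v"
  using u eq by (intro l2_tendsto_AE_cong[OF l2_tendsto_const v]) auto
 show vd: "v \<in> form_dom" using form_lsc[OF lim u order.refl] by simp
 assume w: "w \<in> form_dom"
 have *: "aform t v w = aform t u w" if "t > 0" for t
 proof -
  have L: "u \<in> L2 m" "v \<in> L2 m" "w \<in> L2 m" using u vd w by auto
  have "l2_inner m v w = l2_inner m u w" using L eq by (intro l2_inner_AE_cong) auto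
  moreover have "l2_inner m (P t v) w = l2_inner m (P t u) w"
   using P_AE_cong[OF _ L(1) v eq, of t] L that by (intro l2_inner_AE_cong) (auto intro!: L2_measurable)
  ultimately show ?thesis by (simp add: aform_def)
 qed
 have "\<forall>\<^sub>F t in at_right 0. aform t u w = aform t v w"
  using eventually_at_right_less[of "0::real"] by eventually_elim (simp add: *)
 thus "form v w = form u w" by (intro form_eqI Lim_transform_eventually[OF form_tendsto[OF u w]])
qed

text \<open>Damping by exp (- b t) adds b times the inner product to the form, so statements about
  the form with such a term become statements about the bare form of another semigroup.\<close>

lemma scaled_semigroup:
 assumes "b >= 0" shows "l2_semigroup m (%t u x. exp (- b * t) * P t u x)"
proof
 show "l2_norm m (%x. exp (- b * t) * P t u x) <= l2_norm m u" if "t >= 0" "u \<in> L2 m" for t u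
 proof -
  have "exp (- b * t) * l2_norm m (P t u) <= 1 * l2_norm m u"
   using P_contract[OF that] assms that by (intro mult_mono) auto
  thus ?thesis by (simp add: l2_norm_cmult)
 qed
 show "l2_inner m (%x. exp (- b * (s + t)) * P (s + t) u x) v =
   l2_inner m (%x. exp (- b * s) * P s u x) (%x. exp (- b * t) * P t v x)"
  if "s >= 0" "t >= 0" "u \<in> L2 m" "v \<in> L2 m" for s t u v
  using P_semigroup[OF that] by (simp add: distrib_left exp_add[symmetric] mult.assoc[symmetric])
qed (simp_all add: P_linear P_0 distrib_left mult.left_commute)

end

section \<open>Laplace transforms of autocorrelations\<close>

text \<open>For a decreasing function the upper and the lower sum of mesh h differ by exactly
  \<open>h * g 0\<close>, which makes the error of the Riemann sum explicit.\<close>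

lemma riemann_sum_decreasing:
 fixes g :: "real => real"
 assumes anti: "!!s t. 0 <= s ==> s <= t ==> g t <= g s" and pos: "!!t. 0 <= t ==> 0 <= g t"
  and h: "h > 0" and sm: "summable (%i. g (real i * h))"
 shows "set_integrable lborel {0..} g"
  "(LINT t:{0..}|lborel. g t) <= h * (\<Sum>i. g (real i * h))"
  "h * (\<Sum>i. g (real i * h)) - h * g 0 <= (LINT t:{0..}|lborel. g t)"
proof -
 \<comment> \<open>Extended constantly to the left, the function is monotone on the whole line and
   therefore Borel.\<close>
 define G where "G t = g (max 0 t)" for t
 have "(%t. - G t) \<in> borel_measurable borel"
  by (rule borel_measurable_mono) (auto simp: mono_def G_def intro!: anti)
 hence [measurable]: "G \<in> borel_measurable borel" by simp
 have GS: "indicator {0..} t * G t = indicator {0..} t * g t" for t :: real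
  by (auto simp: G_def split: split_indicator)
 let ?I = "%i. {real i * h..<real (Suc i) * h}"
 have UN: "(\<Union>i. ?I i) = {0..}"
 proof (intro set_eqI iffI)
  fix t :: real assume "t \<in> {0..}"
  hence t: "t / h >= 0" using h by simp
  define i where "i = nat \<lfloor>t / h\<rfloor>"
  have "real i <= t / h" "t / h < real (Suc i)" unfolding i_def using t by linarith+
  hence "t \<in> ?I i" using h by (simp add: field_simps)
  thus "t \<in> (\<Union>i. ?I i)" by blast
 next
  fix t :: real assume "t \<in> (\<Union>i. ?I i)"
  then obtain i where "t \<in> ?I i" by blast
  moreover have "0 <= real i * h" using h by simp
  ultimately show "t \<in> {0..}" by simp
 qed
 have disj: "disjoint_family ?I"
  unfolding disjoint_family_on_def
 proof (intro ballI impI)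
  fix i j :: nat assume "i ~= j"
  have *: "?I i \<inter> ?I j = {}" if "i < j" for i j
  proof -
   have "real (Suc i) * h <= real j * h" using that h by (intro mult_right_mono) auto
   thus ?thesis by force
  qed
  show "?I i \<inter> ?I j = {}" using *[of i j] *[of j i] \<open>i ~= j\<close> by (cases "i < j") auto
 qed
 have em: "emeasure lborel (?I i) = ennreal h" for i using h by (simp add: algebra_simps)
 have nn: "(\<integral>\<^sup>+t\<in>{0..}. ennreal (G t) \<partial>lborel) = (\<Sum>i. \<integral>\<^sup>+t\<in>?I i. ennreal (G t) \<partial>lborel)"
  unfolding UN[symmetric] by (rule nn_integral_disjoint_family) (use disj in auto)
 have posh: "0 <= real i * h" for i using h by simp
 have eqm: "ennreal a * ennreal h = ennreal (h * a)" if "a >= 0" for a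
  using h that by (simp add: ennreal_mult' mult.commute)
 have up: "(\<integral>\<^sup>+t\<in>?I i. ennreal (G t) \<partial>lborel) <= ennreal (h * g (real i * h))" for i
 proof -
  have "(\<integral>\<^sup>+t\<in>?I i. ennreal (G t) \<partial>lborel) <= (\<integral>\<^sup>+t. ennreal (g (real i * h)) * indicator (?I i) t \<partial>lborel)"
   by (rule nn_integral_mono) (use posh[of i] in "auto simp: G_def split: split_indicator intro!: ennreal_leI anti")
  also have "... = ennreal (h * g (real i * h))"
   by (subst nn_integral_cmult_indicator) (simp, simp only: em eqm[OF pos[OF posh]])
  finally show ?thesis .
 qed
 have lo: "ennreal (h * g (real (Suc i) * h)) <= (\<integral>\<^sup>+t\<in>?I i. ennreal (G t) \<partial>lborel)" for i
 proof -
  have "ennreal (h * g (real (Suc i) * h)) = (\<integral>\<^sup>+t. ennreal (g (real (Suc i) * h)) * indicator (?I i) t \<partial>lborel)"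
   by (subst nn_integral_cmult_indicator) (simp, simp only: em eqm[OF pos[OF posh]])
  also have "... <= (\<integral>\<^sup>+t\<in>?I i. ennreal (G t) \<partial>lborel)"
   by (rule nn_integral_mono)
    (use posh[of i] in "auto simp: G_def max_def split: split_indicator intro!: ennreal_leI anti")
  finally show ?thesis .
 qed
 let ?S = "\<Sum>i. g (real i * h)"
 have sm': "summable (%i. h * g (real i * h))" by (rule summable_mult[OF sm])
 have upper: "(\<integral>\<^sup>+t\<in>{0..}. ennreal (G t) \<partial>lborel) <= ennreal (h * ?S)"
 proof -
  have "(\<Sum>i. \<integral>\<^sup>+t\<in>?I i. ennreal (G t) \<partial>lborel) <= (\<Sum>i. ennreal (h * g (real i * h)))"
   by (intro suminf_le summableI up)
  also have "... = ennreal (\<Sum>i. h * g (real i * h))"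
   using h pos[OF posh] by (intro suminf_ennreal2 sm') auto
  finally show ?thesis using suminf_mult[OF sm, of h] by (simp add: nn)
 qed
 have lower: "ennreal (h * ?S - h * g 0) <= (\<integral>\<^sup>+t\<in>{0..}. ennreal (G t) \<partial>lborel)"
 proof -
  have sm2: "summable (%i. h * g (real (Suc i) * h))"
   using sm' by (subst summable_Suc_iff[of "%i. h * g (real i * h)"])
  have "(\<Sum>i. h * g (real (Suc i) * h)) = (\<Sum>i. h * g (real i * h)) - h * g 0"
   using suminf_split_head[OF sm'] by simp
  hence "ennreal (h * ?S - h * g 0) = ennreal (\<Sum>i. h * g (real (Suc i) * h))"
   using suminf_mult[OF sm, of h] by simp
  also have "... = (\<Sum>i. ennreal (h * g (real (Suc i) * h)))"
   using h pos[OF posh] by (intro suminf_ennreal2[symmetric] sm2) (auto simp del: of_nat_Suc)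
  also have "... <= (\<Sum>i. \<integral>\<^sup>+t\<in>?I i. ennreal (G t) \<partial>lborel)" by (intro suminf_le summableI lo)
  finally show ?thesis by (simp add: nn)
 qed
 have nneq: "(\<integral>\<^sup>+t\<in>{0..}. ennreal (G t) \<partial>lborel) = (\<integral>\<^sup>+t. ennreal (indicator {0..} t * G t) \<partial>lborel)"
  by (intro nn_integral_cong) (auto split: split_indicator)
 have int: "integrable lborel (%t. indicator {0..} t * G t)"
 proof (rule integrableI_nonneg)
  show "AE t in lborel. 0 <= indicator {0..} t * G t"
   by (auto simp: G_def pos split: split_indicator)
  show "(\<integral>\<^sup>+t. ennreal (indicator {0..} t * G t) \<partial>lborel) < \<infinity>"
   using upper by (auto simp: nneq intro: le_less_trans)
 qed simp
 thus "set_integrable lborel {0..} g" by (simp add: set_integrable_def GS)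
 have Leq: "ennreal (LINT t:{0..}|lborel. g t) = (\<integral>\<^sup>+t\<in>{0..}. ennreal (G t) \<partial>lborel)"
  unfolding set_lebesgue_integral_def real_scaleR_def GS[symmetric] nneq
  by (rule nn_integral_eq_integral[OF int, symmetric]) (auto simp: G_def pos split: split_indicator)
 have Lpos: "(LINT t:{0..}|lborel. g t) >= 0"
  unfolding set_lebesgue_integral_def by (rule integral_nonneg_AE) (auto simp: pos split: split_indicator)
 have Spos: "h * ?S >= 0" using h pos posh by (intro mult_nonneg_nonneg suminf_nonneg[OF sm]) auto
 show "(LINT t:{0..}|lborel. g t) <= h * ?S" using upper Spos unfolding Leq[symmetric] by simp
 show "h * ?S - h * g 0 <= (LINT t:{0..}|lborel. g t)" using lower Lpos unfolding Leq[symmetric] by simp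
qed

context l2_semigroup
begin

definition laplace :: "('s => real) => real => real" where
 "laplace f b = (LINT t:{0..}|lborel. exp (- b * t) * corr f t)"

text \<open>Under halving of the time the approximating forms increase exactly, without the error
  term of \<open>aform_compare\<close>. This is why dyadic times are used wherever an increasing
  sequence of forms is required.\<close>

lemma aform_halve:
 assumes h: "h > 0" and u: "u \<in> L2 m" shows "aform h u u <= aform (h / 2) u u"
proof -
 have "corr u 0 - 2 * corr u (h / 2) + corr u h >= 0"
  using corr_second_difference[of 0 "h/2" u] h u by simp
 hence "l2_inner m u u - corr u h <= 2 * (l2_inner m u u - corr u (h / 2))" using u by (simp add: corr_0)
 from divide_right_mono[OF this, of h] h show ?thesis by (simp add: aform_self mult.commute)
qed

lemma aform_dyadic_mono:
 assumes u: "u \<in> L2 m" and "i <= j"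
 shows "aform ((1/2)^i) u u <= aform ((1/2)^j) u u"
proof (rule lift_Suc_mono_le[where f="%i. aform ((1/2)^i) u u"])
 fix n show "aform ((1/2)^n) u u <= aform ((1/2)^Suc n) u u"
  using aform_halve[of "(1/2)^n" u] u by simp
qed (rule assms)

lemma aform_midpoint:
 assumes t: "t >= 0" and u: "u \<in> L2 m" and v: "v \<in> L2 m"
 shows "aform t (%x. (u x + v x) / 2) (%x. (u x + v x) / 2) =
  (aform t u u + aform t v v) / 2 - aform t (%x. u x - v x) (%x. u x - v x) / 4"
proof -
 have "aform t (%x. 1/2 * u x + 1/2 * v x) (%x. 1/2 * u x + 1/2 * v x) =
   (1/2)^2 * aform t u u + 2 * (1/2) * (1/2) * aform t u v + (1/2)^2 * aform t v v"
  by (rule aform_quadratic[OF assms])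
 moreover have "(%x. 1/2 * u x + 1/2 * v x) = (%x. (u x + v x) / 2)" by (simp add: add_divide_distrib)
 moreover have "aform t (%x. u x - v x) (%x. u x - v x) = aform t u u - 2 * aform t u v + aform t v v"
  using aform_quadratic[OF assms, of 1 "-1"] by simp
 ultimately show ?thesis by (simp add: power2_eq_square field_simps)
qed

text \<open>The damped quotient is exp (- b t) times the old one plus (1 - exp (- b t)) / t times
  the squared norm, and the last factor tends to b. The decomposition can be solved for either
  quotient, so the domains agree in both directions.\<close>

lemma scaled_form:
 assumes b: "b >= 0" and Q: "Q = (%t u x. exp (- b * t) * P t u x)"
 shows "l2_semigroup.form_dom m Q = form_dom"
  "u \<in> form_dom ==> l2_semigroup.form m Q u u = form u u + b * l2_inner m u u"
proof -
 interpret Q: l2_semigroup m Q unfolding Q by (rule scaled_semigroup[OF b])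
 have Qcorr: "Q.corr u t = exp (- b * t) * corr u t" for u t unfolding Q.corr_def corr_def unfolding Q by simp
 have decomp: "Q.aform t u u = exp (- b * t) * aform t u u + (1 - exp (- b * t)) / t * l2_inner m u u" if "t > 0" for t u
  using that by (simp add: Q.aform_self aform_self Qcorr field_simps)
 have "((%x. 1 - exp (- b * x)) has_real_derivative b) (at 0)" by (auto intro!: derivative_eq_intros)
 hence "((%y. (1 - exp (- b * y)) / y) \<longlongrightarrow> b) (at 0)" by (simp add: has_field_derivative_iff)
 hence 2: "((%y. (1 - exp (- b * y)) / y) \<longlongrightarrow> b) (at_right 0)" by (rule tendsto_mono[rotated]) (simp add: at_le)
 have 3: "((%t. exp (- b * t)) \<longlongrightarrow> exp (- b * 0)) (at_right 0)" by (intro tendsto_intros)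
 have 4: "((%t. exp (b * t)) \<longlongrightarrow> exp (b * 0)) (at_right 0)" by (intro tendsto_intros)
 have lim: "((%t. Q.aform t u u) \<longlongrightarrow> form u u + b * l2_inner m u u) (at_right 0)" if u: "u \<in> form_dom" for u
 proof -
  have "((%t. exp (- b * t) * aform t u u + (1 - exp (- b * t)) / t * l2_inner m u u) \<longlongrightarrow>
    exp (- b * 0) * form u u + b * l2_inner m u u) (at_right 0)"
   by (intro tendsto_add tendsto_mult 2 3 tendsto_const form_tendsto u)
  moreover have "\<forall>\<^sub>F t in at_right 0. exp (- b * t) * aform t u u + (1 - exp (- b * t)) / t * l2_inner m u u = Q.aform t u u"
   using eventually_at_right_less[of "0::real"] by eventually_elim (simp add: decomp)
  ultimately show ?thesis using Lim_transform_eventually by fastforce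
 qed
 show "Q.form u u = form u u + b * l2_inner m u u" if "u \<in> form_dom" by (rule Q.form_eqI[OF lim[OF that]])
 have "u \<in> form_dom" if u: "u \<in> Q.form_dom" for u
 proof -
  have "((%t. exp (b * t) * (Q.aform t u u - (1 - exp (- b * t)) / t * l2_inner m u u)) \<longlongrightarrow>
    exp (b * 0) * (Q.form u u - b * l2_inner m u u)) (at_right 0)"
   by (intro tendsto_mult tendsto_diff 2 4 tendsto_const Q.form_tendsto u)
  moreover have "\<forall>\<^sub>F t in at_right 0. exp (b * t) * (Q.aform t u u - (1 - exp (- b * t)) / t * l2_inner m u u) = aform t u u"
   using eventually_at_right_less[of "0::real"]
  proof eventually_elim
   case (elim t)
   have "exp (b * t) * exp (- b * t) = 1" by (simp add: exp_add[symmetric])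
   thus ?case using decomp[OF elim, of u] by (simp add: mult.assoc[symmetric])
  qed
  ultimately have "((%t. aform t u u) \<longlongrightarrow> exp (b * 0) * (Q.form u u - b * l2_inner m u u)) (at_right 0)"
   by (rule Lim_transform_eventually)
  thus ?thesis unfolding form_dom_def using Q.form_dom_L2[OF u] by blast
 qed
 moreover have "u \<in> Q.form_dom" if u: "u \<in> form_dom" for u
  unfolding Q.form_dom_def using lim[OF u] form_dom_L2[OF u] by blast
 ultimately show "Q.form_dom = form_dom" by blast
qed

text \<open>At mesh h the functional 2 (f, v) - \<open>aform\<close> v v of the damped semigroup Q
  is maximised, in the limit, by partial sums of the discrete resolvent, and its supremum is the
  Riemann sum of the damped autocorrelation. As h is halved the forms increase and the Riemann sums
  tend to the Laplace transform, so the interchange lemma for increasing forms applies.\<close>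

lemma laplace_eq_sup:
 assumes b: "b > 0" and f: "f \<in> L2 m"
 shows "v \<in> form_dom ==> 2 * l2_inner m f v - b * l2_inner m v v - form v v <= laplace f b"
  and "\<exists>w\<in>form_dom. 2 * l2_inner m f w - b * l2_inner m w w - form w w >= laplace f b"
proof -
 define Q where "Q t u x = exp (- b * t) * P t u x" for t u x
 have Q_eq: "Q = (%t u x. exp (- b * t) * P t u x)" by (simp add: Q_def fun_eq_iff)
 interpret Q: l2_semigroup m Q unfolding Q_eq by (rule scaled_semigroup) (use b in simp)
 have Qcorr: "Q.corr u t = exp (- b * t) * corr u t" for u t
  unfolding Q.corr_def corr_def unfolding Q_eq by simp
 define h where "h k = (1/2::real)^k" for k :: nat
 have h: "h k > 0" for k by (simp add: h_def)
 have h0: "h ---> 0" unfolding h_def by (intro LIMSEQ_realpow_zero) auto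
 have sm: "summable (%i. Q.corr f (real i * h k))" for k
 proof (rule summable_comparison_test')
  show "summable (%i. (exp (- b * h k))^i * l2_inner m f f)"
   using b h[of k] by (intro summable_mult2 summable_geometric) simp
  fix i :: nat
  have "exp (- b * (real i * h k)) = exp (- b * h k)^i"
   by (simp add: exp_of_nat_mult[symmetric] algebra_simps)
  thus "norm (Q.corr f (real i * h k)) <= (exp (- b * h k))^i * l2_inner m f f"
   using corr_le[of "real i * h k" f] corr_nonneg[of "real i * h k" f] f h[of k] by (simp add: Qcorr)
 qed
 define s where "s k = h k * (\<Sum>i. Q.corr f (real i * h k))" for k
 have s_lim: "s ---> laplace f b"
 proof -
  have anti: "Q.corr f t <= Q.corr f s" if "0 <= s" "s <= t" for s t by (rule Q.corr_antimono[OF that f])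
  have pos: "0 <= Q.corr f t" if "0 <= t" for t by (rule Q.corr_nonneg[OF that f])
  note R = riemann_sum_decreasing[of "Q.corr f", OF anti pos h sm]
  have L: "laplace f b = (LINT t:{0..}|lborel. Q.corr f t)" by (simp add: laplace_def Qcorr)
  have up: "s k <= laplace f b + h k * Q.corr f 0" for k using R(3)[of k] unfolding s_def L by linarith
  have lo: "laplace f b <= s k" for k using R(2)[of k] unfolding s_def L by linarith
  have "(%k. laplace f b + h k * Q.corr f 0) ---> laplace f b + 0 * Q.corr f 0" by (intro tendsto_intros h0)
  thus ?thesis by (intro tendsto_sandwich[OF _ _ tendsto_const, of "laplace f b" s]) (use up lo in auto)
 qed
 \<comment> \<open>Partial sums of the discrete resolvent; stopping at n avoids infinite sums of
   functions at the cost of the remainder Q(n h) f.\<close>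
 define U where "U k n x = (\<Sum>i<n. h k * (Q (real i * h k) f x))" for k n x
 have UL: "U k n \<in> L2 m" for k n unfolding U_def using f h[of k] by (intro L2_sum L2_cmult) auto
 have innerU: "l2_inner m (U k n) v = h k * (\<Sum>i<n. l2_inner m (Q (real i * h k) f) v)"
  if v: "v \<in> L2 m" for k n v
  unfolding U_def using f h[of k] v by (subst l2_inner_sum) (auto simp: sum_distrib_left)
 \<comment> \<open>Telescoping: up to the remainder, \<open>U k n\<close> solves the Euler equation
   of the functional.\<close>
 have aU: "Q.aform (h k) (U k n) v = l2_inner m f v - l2_inner m (Q (real n * h k) f) v"
  if v: "v \<in> L2 m" for k n v
 proof -
  let ?b = "%i. l2_inner m (Q (real i * h k) f) v"
  have "l2_inner m (Q (h k) (U k n)) v =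
    (\<Sum>i<n. l2_inner m (Q (h k) (%x. h k * Q (real i * h k) f x)) v)"
   unfolding U_def using f h[of k] v by (intro Q.P_sum) auto
  also have "... = (\<Sum>i<n. h k * ?b (Suc i))"
  proof (rule sum.cong)
   fix i
   have "l2_inner m (Q (h k) (%x. h k * Q (real i * h k) f x)) v
     = h k * l2_inner m (Q (h k) (Q (real i * h k) f)) v"
    using f h[of k] v by (intro Q.P_cmult) auto
   also have "... = h k * l2_inner m (Q (h k + real i * h k) f) v"
    using Q.P_comp[of "h k" "real i * h k" f v] f h[of k] v by (simp add: less_imp_le)
   also have "h k + real i * h k = real (Suc i) * h k" by (simp add: algebra_simps)
   finally show "l2_inner m (Q (h k) (%x. h k * Q (real i * h k) f x)) v
     = h k * ?b (Suc i)" .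
  qed simp
  finally have e: "l2_inner m (Q (h k) (U k n)) v = (\<Sum>i<n. h k * ?b (Suc i))" .
  have "l2_inner m (U k n) v - l2_inner m (Q (h k) (U k n)) v = h k * (\<Sum>i<n. ?b i - ?b (Suc i))"
   unfolding e innerU[OF v] by (simp add: sum_subtractf right_diff_distrib sum_distrib_left)
  also have "(\<Sum>i<n. ?b i - ?b (Suc i)) = ?b 0 - ?b n" by (rule sum_lessThan_telescope')
  finally show ?thesis using h[of k] f v by (simp add: Q.aform_def Q.P_0)
 qed
 have fU: "l2_inner m f (U k n) = h k * (\<Sum>i<n. Q.corr f (real i * h k))" for k n
  using innerU[OF f, of k n] by (simp add: l2_inner_commute[of m f] Q.corr_def)
 have rU: "l2_inner m (Q (real n * h k) f) (U k n) >= 0" for k n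
 proof -
  have "l2_inner m (Q (real i * h k) f)
    (Q (real n * h k) f) >= 0" for i
  proof -
   have "l2_inner m (Q (real i * h k) f)
    (Q (real n * h k) f) = Q.corr f (real i * h k + real n * h k)"
    using Q.P_semigroup[of "real i * h k" "real n * h k" f f] f h[of k] by (simp add: Q.corr_def less_imp_le)
   thus ?thesis using Q.corr_nonneg[of "real i * h k + real n * h k" f] f h[of k] by simp
  qed
  thus ?thesis
   using innerU[of "Q (real n * h k) f" k n] f h[of k]
   by (subst l2_inner_commute) (auto intro!: mult_nonneg_nonneg sum_nonneg)
 qed
 have fU_le: "l2_inner m f (U k n) <= s k" for k n
  unfolding fU s_def using h[of k] f
  by (intro mult_left_mono sum_le_suminf sm) (auto intro!: Q.corr_nonneg)
 have fU_lim: "(%n. l2_inner m f (U k n)) ---> s k" for k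
  unfolding fU s_def by (intro tendsto_mult_left summable_LIMSEQ sm)
 \<comment> \<open>Expand the nonnegative quadratic form at \<open>U k n - v\<close>; the remainder
   decays geometrically in n by the damping.\<close>
 have ub: "2 * l2_inner m f v - Q.aform (h k) v v <= s k" if v: "v \<in> L2 m" for v k
 proof -
  let ?r = "%n. l2_inner m (Q (real n * h k) f) v"
  have main: "2 * l2_inner m f v - Q.aform (h k) v v <= 2 * ?r n + s k" for n
  proof -
   have "0 <= Q.aform (h k) (%x. 1 * U k n x + (-1) * v x) (%x. 1 * U k n x + (-1) * v x)"
    using UL[of k n] v h[of k] by (intro Q.aform_nonneg) auto
   also have "... = Q.aform (h k) (U k n) (U k n) - 2 * Q.aform (h k) (U k n) v + Q.aform (h k) v v"
    using UL[of k n] v h[of k] by (subst Q.aform_quadratic) auto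
   finally have "2 * Q.aform (h k) (U k n) v <= Q.aform (h k) (U k n) (U k n) + Q.aform (h k) v v" by simp
   thus ?thesis using aU[OF v, of k n] aU[OF UL, of k n k n] rU[of n k] fU_le[of k n] by simp
  qed
  have r0: "?r ---> 0"
  proof (rule Lim_null_comparison)
   have e: "exp (- b * (real n * h k)) = exp (- b * h k)^n" for n
    by (simp add: exp_of_nat_mult[symmetric] algebra_simps)
   have "norm (?r n) <= exp (- b * h k)^n * (l2_norm m f * l2_norm m v)" for n
    using P_inner_bound[of "real n * h k" f v] f v h[of k] unfolding Q_eq e by (simp add: abs_mult)
   thus "\<forall>\<^sub>F n in sequentially. norm (?r n) <= exp (- b * h k)^n * (l2_norm m f * l2_norm m v)" by simp
   have "(%n. exp (- b * h k)^n) ---> 0" using b h[of k] by (intro LIMSEQ_realpow_zero) auto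
   thus "(%n. exp (- b * h k)^n * (l2_norm m f * l2_norm m v)) ---> 0" by (rule tendsto_mult_left_zero)
  qed
  have "(%n. 2 * ?r n + s k) ---> 2 * 0 + s k" by (intro tendsto_intros r0)
  thus ?thesis using main by (intro LIMSEQ_le_const[where X="%n. 2 * ?r n + s k"]) auto
 qed
 have near: "\<exists>w\<in>L2 m. 2 * l2_inner m f w - Q.aform (h k) w w > s k - e" if e: "e > 0" for k e
 proof -
  have "\<forall>\<^sub>F n in sequentially. s k - e < l2_inner m f (U k n)"
   using e by (intro order_tendstoD(1)[OF fU_lim]) simp
  then obtain n where n: "s k - e < l2_inner m f (U k n)" by (auto simp: eventually_sequentially)
  have "2 * l2_inner m f (U k n) - Q.aform (h k) (U k n) (U k n) >= l2_inner m f (U k n)"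
   using aU[OF UL, of k n k n] rU[of n k] by simp
  with n UL show ?thesis by (intro bexI[of _ "U k n"]) auto
 qed
 \<comment> \<open>At time 1 the damped form dominates (1 - exp (- b)) times the squared norm, and
   smaller dyadic times only increase it; the division by 4 comes from the midpoint
   identity.\<close>
 define c where "c = (1 - exp (- b)) / 4"
 have c: "c > 0" and c4: "4 * c = 1 - exp (- b)" unfolding c_def using b by simp_all
 have coer: "4 * c * (l2_norm m z)^2 <= Q.aform (h k) z z" if z: "z \<in> L2 m" for z k
 proof -
  have "exp (- b) * corr z 1 <= exp (- b) * l2_inner m z z" using corr_le[of 1 z] z by simp
  hence "4 * c * (l2_norm m z)^2 <= Q.aform ((1/2)^0) z z"
   unfolding c4 l2_norm_square Q.aform_self Qcorr by (simp add: algebra_simps)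
  also have "... <= Q.aform (h k) z z" unfolding h_def by (rule Q.aform_dyadic_mono[OF z]) simp
  finally show ?thesis .
 qed
 have "\<exists>S. s ---> S \<and> (\<exists>w\<in>L2 m. \<forall>k. 2 * l2_inner m f w - Q.aform (h k) w w >= S)"
 proof (rule increasing_forms_sup[OF f order.refl c])
  fix n u v assume uv: "u \<in> L2 m" "v \<in> L2 m"
  hence "(%x. u x - v x) \<in> L2 m" by auto
  from coer[OF this, of n] Q.aform_midpoint[OF _ uv, of "h n"] h[of n]
  show "Q.aform (h n) (%x. (u x + v x) / 2) (%x. (u x + v x) / 2) \<le>
    (Q.aform (h n) u u + Q.aform (h n) v v) / 2 - c * (l2_norm m (%x. u x - v x))^2" by simp
 next
  fix n w assume "w \<in> L2 m"
  thus "Q.aform (h n) w w <= Q.aform (h (Suc n)) w w" unfolding h_def by (intro Q.aform_dyadic_mono) auto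
 next
  fix n u w C assume lim: "l2_tendsto m u w" and C: "!!i. Q.aform (h n) (u i) (u i) <= C"
  have "(%i. Q.aform (h n) (u i) (u i)) ---> Q.aform (h n) w w" using h[of n] by (intro Q.aform_tendsto lim) auto
  hence "Q.aform (h n) w w <= C" by (rule LIMSEQ_le_const2) (use C in auto)
  thus "w \<in> L2 m \<and> Q.aform (h n) w w <= C" using l2_tendstoD(2)[OF lim] by simp
 next
  fix k show "s k >= 0" unfolding s_def using h[of k] f
   by (intro mult_nonneg_nonneg suminf_nonneg[OF sm]) (auto intro!: Q.corr_nonneg)
 qed (use ub near in auto)
 then obtain S w where S: "s ---> S" and w: "w \<in> L2 m" and wS: "!!k. 2 * l2_inner m f w - Q.aform (h k) w w >= S" by blast
 have S_eq: "S = laplace f b" by (rule LIMSEQ_unique[OF S s_lim])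
 have hr: "filterlim h (at_right 0) sequentially"
  using h0 h by (intro tendsto_imp_filterlim_at_right) auto
 have b0: "b >= 0" using b by simp
 note sf = scaled_form[OF b0 Q_eq]
 have lim: "(%k. Q.aform (h k) v v) ---> form v v + b * l2_inner m v v" if v: "v \<in> form_dom" for v
 proof -
  have "v \<in> Q.form_dom" using v sf(1) by simp
  from filterlim_compose[OF Q.form_tendsto[OF this this] hr] show ?thesis unfolding sf(2)[OF v] .
 qed
 show "2 * l2_inner m f v - b * l2_inner m v v - form v v <= laplace f b" if v: "v \<in> form_dom"
 proof (rule LIMSEQ_le[OF _ s_lim])
  have "(%k. 2 * l2_inner m f v - Q.aform (h k) v v) ---> 2 * l2_inner m f v - (form v v + b * l2_inner m v v)"
   by (intro tendsto_intros lim v)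
  thus "(%k. 2 * l2_inner m f v - Q.aform (h k) v v) ---> 2 * l2_inner m f v - b * l2_inner m v v - form v v"
   by (simp add: algebra_simps)
 qed (use ub v in auto)
 have "w \<in> Q.form_dom"
 proof (rule Q.form_domI(1)[OF w h0 h])
  show "Q.aform (h k) w w <= 2 * l2_inner m f w - S" for k using wS[of k] by simp
 qed
 hence wd: "w \<in> form_dom" using sf(1) by simp
 have "2 * l2_inner m f w - (form w w + b * l2_inner m w w) >= S"
 proof (rule LIMSEQ_le_const)
  show "(%k. 2 * l2_inner m f w - Q.aform (h k) w w) ---> 2 * l2_inner m f w - (form w w + b * l2_inner m w w)"
   by (intro tendsto_intros lim wd)
 qed (use wS in auto)
 thus "\<exists>w\<in>form_dom. 2 * l2_inner m f w - b * l2_inner m w w - form w w >= laplace f b"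
  using wd S_eq by (intro bexI[of _ w]) auto
qed

end

text \<open>In the variable x = exp (- t) the transforms at positive integers are moments with
  respect to a finite measure. Weierstrass approximation extends convergence from moments to all
  continuous test functions of x, and monotonicity together with continuity of the limit at
  \<open>t0\<close> upgrades averages to values.\<close>

lemma laplace_inversion:
 fixes \<phi> :: "nat => real => real" and \<psi> :: "real => real"
 assumes anti: "!!n s t. 0 <= s ==> s <= t ==> \<phi> n t <= \<phi> n s" and anti': "!!s t. 0 <= s ==> s <= t ==> \<psi> t <= \<psi> s"
  and bd: "!!n t. 0 <= t ==> \<phi> n t \<in> {0..B}" and bd': "!!t. 0 <= t ==> \<psi> t \<in> {0..B}"
  and lim: "!!p::nat. p > 0 ==> (%n. LINT t:{0..}|lborel. exp (- real p * t) * \<phi> n t)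
    ---> (LINT t:{0..}|lborel. exp (- real p * t) * \<psi> t)"
  and cont: "isCont \<psi> t0" and t0: "t0 > 0"
 shows "(%n. \<phi> n t0) ---> \<psi> t0"
proof -
 \<comment> \<open>One factor exp (- t) is spent on making the measure finite, so the moment of
   order i corresponds to the transform at i + 1.\<close>
 define M where "M = density lborel (%t::real. ennreal (indicator {0..} t * exp (- t)))"
 have expmeas[measurable]: "(%t::real. indicator {0..} t * exp (- t)) \<in> borel_measurable borel" by measurable
 have intexp: "integrable lborel (%t::real. indicator {0..} t * exp (- t))"
  using riemann_sum_decreasing(1)[of "%t. exp (- t)" 1]
  by (simp add: set_integrable_def exp_of_nat_mult[of _ "-1", simplified] summable_geometric)
 have sets_M[simp, measurable_cong]: "sets M = sets borel" by (simp add: M_def)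
 have space_M[simp]: "space M = UNIV" by (simp add: M_def)
 interpret M: finite_measure M
 proof
  have "emeasure M (space M) = (\<integral>\<^sup>+t. ennreal (indicator {0..} t * exp (- t)) \<partial>lborel)"
   unfolding M_def by (subst emeasure_density) (auto intro!: nn_integral_cong)
  also have "... = ennreal (\<integral>t. indicator {0..} t * exp (- t) \<partial>lborel)"
   using intexp by (intro nn_integral_eq_integral) auto
  finally show "emeasure M (space M) ~= \<infinity>" by simp
 qed
 have intM: "(\<integral>t. g t \<partial>M) = (LINT t:{0..}|lborel. exp (- t) * g t)" if "g \<in> borel_measurable borel" for g :: "real => real"
  unfolding M_def set_lebesgue_integral_def
  by (subst integral_density) (use that in "auto simp: mult.assoc")
 have pos_M: "AE t in M. t >= 0"
  unfolding M_def by (subst AE_density) (auto split: split_indicator)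
 define F where "F n t = \<phi> n (max 0 t)" for n t
 define G where "G t = \<psi> (max 0 t)" for t
 have meas_anti: "H \<in> borel_measurable borel" if "!!s t. s <= t ==> H t <= H s" for H :: "real => real"
 proof -
  have "(%t. - H t) \<in> borel_measurable borel"
   by (rule borel_measurable_mono) (auto simp: mono_def intro!: that)
  thus ?thesis by simp
 qed
 have Fm[measurable]: "F n \<in> borel_measurable borel" for n
  by (rule meas_anti) (auto simp: F_def intro!: anti)
 have Gm[measurable]: "G \<in> borel_measurable borel"
  by (rule meas_anti) (auto simp: G_def intro!: anti')
 have Fb: "0 <= F n t" "F n t <= B" for n t using bd[of "max 0 t" n] by (auto simp: F_def)
 have Gb: "0 <= G t" "G t <= B" for t using bd'[of "max 0 t"] by (auto simp: G_def)
 have B: "B >= 0" using Gb[of 0] by linarith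
 have Icont: "continuous_on UNIV (%t::real. exp (- t))" by (intro continuous_intros)
 have intb: "integrable M g" if [measurable]: "g \<in> borel_measurable borel" and "!!t. 0 <= t ==> \<bar>g t\<bar> <= c" for g :: "real => real" and c
  by (rule M.integrable_const_bound[where B=c]) (use pos_M in "auto elim!: eventually_mono intro: that(2)")
 have pow: "(\<integral>t. exp (- t)^i * H (max 0 t) \<partial>M) = (LINT t:{0..}|lborel. exp (- real (Suc i) * t) * H t)"
  if "(%t. H (max 0 t)) \<in> borel_measurable borel" for i and H :: "real => real"
 proof -
  have "(\<integral>t. exp (- t)^i * H (max 0 t) \<partial>M) = (LINT t:{0..}|lborel. exp (- t) * (exp (- t)^i * H (max 0 t)))"
   using that by (intro intM) measurable
  also have "... = (LINT t:{0..}|lborel. exp (- real (Suc i) * t) * H t)"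
   unfolding set_lebesgue_integral_def
  proof (intro Bochner_Integration.integral_cong refl)
   fix t :: real
   have "exp (- real (Suc i) * t) = exp (- t) * exp (- t)^i"
    by (simp add: exp_of_nat_mult[symmetric] exp_add[symmetric] algebra_simps)
   thus "indicat_real {0..} t *\<^sub>R (exp (- t) * (exp (- t) ^ i * H (max 0 t))) =
     indicat_real {0..} t *\<^sub>R (exp (- real (Suc i) * t) * H t)"
    by (simp split: split_indicator)
  qed
  finally show ?thesis .
 qed
 have lim_pow: "(%n. \<integral>t. exp (- t)^i * F n t \<partial>M) ---> (\<integral>t. exp (- t)^i * G t \<partial>M)" for i
  unfolding F_def G_def using lim[of "Suc i"] Fm Gm by (subst (1 2) pow) (auto simp: F_def[abs_def] G_def[abs_def])
 have pw: "\<bar>exp (- t)^i\<bar> <= 1" if "0 <= t" for t :: real and i using that by (auto intro!: power_le_one)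
 have lim_poly: "(%n. \<integral>t. (\<Sum>i\<le>d. a i * exp (- t)^i) * F n t \<partial>M) ---> (\<integral>t. (\<Sum>i\<le>d. a i * exp (- t)^i) * G t \<partial>M)" for a d
 proof -
  have e: "(\<integral>t. (\<Sum>i\<le>d. a i * exp (- t)^i) * H t \<partial>M) = (\<Sum>i\<le>d. a i * (\<integral>t. exp (- t)^i * H t \<partial>M))"
   if [measurable]: "H \<in> borel_measurable borel" and H: "!!t. 0 <= H t" "!!t. H t <= B" for H :: "real => real"
  proof -
   have int: "integrable M (%t. exp (- t)^i * H t)" for i
   proof (rule intb)
    fix t :: real assume "0 <= t"
    from mult_mono[OF pw[OF this, of i], of "\<bar>H t\<bar>" B] H[of t]
    show "\<bar>exp (- t)^i * H t\<bar> <= B" by (simp add: abs_mult)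
   qed measurable
   have "(\<integral>t. (\<Sum>i\<le>d. a i * exp (- t)^i) * H t \<partial>M) = (\<integral>t. (\<Sum>i\<le>d. a i * (exp (- t)^i * H t)) \<partial>M)"
    by (simp add: sum_distrib_right mult.assoc)
   also have "... = (\<Sum>i\<le>d. a i * (\<integral>t. exp (- t)^i * H t \<partial>M))"
    using int by (subst Bochner_Integration.integral_sum) auto
   finally show ?thesis .
  qed
  show ?thesis unfolding e[OF Fm Fb] e[OF Gm Gb] by (intro tendsto_intros lim_pow)
 qed
 have lim_cont: "(%n. \<integral>t. q (exp (- t)) * F n t \<partial>M) ---> (\<integral>t. q (exp (- t)) * G t \<partial>M)"
  if q: "continuous_on UNIV q" for q :: "real => real"
 proof (rule LIMSEQ_I)
  fix e :: real assume e: "e > 0"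
  define m0 where "m0 = measure M UNIV * B"
  have m0: "m0 >= 0" unfolding m0_def using B by simp
  \<comment> \<open>The summand 1 keeps the denominator positive if the measure or the bound
    vanishes; one third of e is kept for each of the three comparisons.\<close>
  define e' where "e' = e / (3 * (m0 + 1))"
  have e': "e' > 0" "e' * m0 < e / 3" unfolding e'_def using e m0 by (auto simp: field_simps)
  obtain g where "real_polynomial_function g" and g: "!!x. x \<in> {0..1} ==> \<bar>q x - g x\<bar> < e'"
   using Stone_Weierstrass_real_polynomial_function[of "{0..1::real}" q e'] e' q
   by (auto intro: continuous_on_subset)
  then obtain a d where gad: "g = (%x. \<Sum>i\<le>d. a i * x^i)" using real_polynomial_function_imp_sum by blast
  have [measurable]: "q \<in> borel_measurable borel" using q by (rule borel_measurable_continuous_onI)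
  have [measurable]: "g \<in> borel_measurable borel" unfolding gad by measurable
  have qcomp: "compact (q ` {0..1})" by (intro compact_continuous_image continuous_on_subset[OF q]) auto
  then obtain b where b: "!!x. x \<in> {0..1} ==> \<bar>q x\<bar> <= b"
   using compact_imp_bounded[of "q ` {0..1}"] unfolding bounded_iff by force
  have close: "\<bar>(\<integral>t. q (exp (- t)) * H t \<partial>M) - (\<integral>t. g (exp (- t)) * H t \<partial>M)\<bar> <= e' * m0"
   if [measurable]: "H \<in> borel_measurable borel" and H: "!!t. 0 <= H t" "!!t. H t <= B" for H
  proof -
   have i1: "integrable M (%t. q (exp (- t)) * H t)"
   proof (rule intb)
    fix t :: real assume "0 <= t"
    thus "\<bar>q (exp (- t)) * H t\<bar> <= b * B"
     using mult_mono[OF b[of "exp (- t)"], of "\<bar>H t\<bar>" B] H[of t] abs_ge_zero[of "q (exp (- t))"] b[of "exp (- t)"] by (auto simp: abs_mult)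
   qed measurable
   have le: "\<bar>(q (exp (- t)) - g (exp (- t))) * H t\<bar> <= e' * B" if "0 <= t" for t
    using that mult_mono[OF less_imp_le[OF g[of "exp (- t)"]], of "\<bar>H t\<bar>" B] H[of t] e' by (auto simp: abs_mult)
   have i2: "integrable M (%t. (q (exp (- t)) - g (exp (- t))) * H t)" by (rule intb[OF _ le]) auto
   have i3: "integrable M (%t. g (exp (- t)) * H t)"
    using Bochner_Integration.integrable_diff[OF i1 i2] by (simp add: algebra_simps)
   have "\<bar>(\<integral>t. q (exp (- t)) * H t \<partial>M) - (\<integral>t. g (exp (- t)) * H t \<partial>M)\<bar> = \<bar>\<integral>t. (q (exp (- t)) - g (exp (- t))) * H t \<partial>M\<bar>"
    using i1 i3 by (simp add: algebra_simps)
   also have "... <= (\<integral>t. \<bar>(q (exp (- t)) - g (exp (- t))) * H t\<bar> \<partial>M)" by (rule integral_abs_bound)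
   also have "... <= (\<integral>t. e' * B \<partial>M)"
    by (rule integral_mono_AE) (use i2 pos_M le in "auto elim!: eventually_mono")
   also have "... = e' * m0" by (simp add: m0_def)
   finally show ?thesis .
  qed
  have "(%n. \<integral>t. g (exp (- t)) * F n t \<partial>M) ---> (\<integral>t. g (exp (- t)) * G t \<partial>M)"
   unfolding gad by (rule lim_poly)
  from LIMSEQ_D[OF this, of "e / 3"] e obtain N where
   N: "!!n. n >= N ==> \<bar>(\<integral>t. g (exp (- t)) * F n t \<partial>M) - (\<integral>t. g (exp (- t)) * G t \<partial>M)\<bar> < e / 3" by auto
  have "norm ((\<integral>t. q (exp (- t)) * F n t \<partial>M) - (\<integral>t. q (exp (- t)) * G t \<partial>M)) < e" if "n >= N" for n
   using N[OF that] close[OF Fm Fb, of n] close[OF Gm Gb] e'(2) unfolding real_norm_def by linarith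
  thus "\<exists>N. \<forall>n\<ge>N. norm ((\<integral>t. q (exp (- t)) * F n t \<partial>M) - (\<integral>t. q (exp (- t)) * G t \<partial>M)) < e" by blast
 qed
 text \<open>Average against a tent function supported in \<open>[a, b]\<close>, on either side of \<open>t\<^sub>0\<close>.\<close>
 have tent: "\<exists>I>0. \<exists>A. \<exists>A'. (A ---> A') \<and> (\<forall>n. \<phi> n b * I <= A n \<and> A n <= \<phi> n a * I) \<and> \<psi> b * I <= A' \<and> A' <= \<psi> a * I"
  if ab: "0 <= a" "a < b" for a b
 proof -
  define q where "q x = max 0 (min (x - exp (- b)) (exp (- a) - x))" for x :: real
  have q: "continuous_on UNIV q" unfolding q_def by (intro continuous_intros)
  have [measurable]: "q \<in> borel_measurable borel" using q by (rule borel_measurable_continuous_onI)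
  have q0: "0 <= q x" for x by (simp add: q_def)
  have q1: "q (exp (- t)) <= 1" if "0 <= t" for t
  proof -
   have "exp (- t) <= 1" "exp (- b) > 0" using that by simp_all
   thus ?thesis unfolding q_def by linarith
  qed
  have qz: "q (exp (- t)) = 0" if "t \<notin> {a..b}" for t
  proof -
   have "exp (- t) >= exp (- a) \<or> exp (- t) <= exp (- b)" using that by auto
   thus ?thesis unfolding q_def by linarith
  qed
  have qp: "q (exp (- t)) > 0" if "t \<in> {a<..<b}" for t
  proof -
   have "exp (- t) < exp (- a)" "exp (- t) > exp (- b)" using that by auto
   thus ?thesis unfolding q_def by linarith
  qed
  define I where "I = (\<integral>t. q (exp (- t)) \<partial>M)"
  have qint: "integrable M (%t. q (exp (- t)))" by (rule intb[where c=1]) (use q0 q1 in auto)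
  have I: "I > 0"
  proof (rule ccontr)
   assume "\<not> I > 0"
   moreover have "I >= 0" unfolding I_def by (rule integral_nonneg_AE) (simp add: q0)
   ultimately have "I = 0" by simp
   hence "AE t in M. q (exp (- t)) = 0"
    unfolding I_def using qint by (subst (asm) integral_nonneg_eq_0_iff_AE) (auto simp: q0)
   hence "AE t in lborel. 0 < indicator {0..} t * exp (- t) --> q (exp (- t)) = 0"
    unfolding M_def by (subst (asm) AE_density) auto
   hence "AE t in lborel. t \<notin> {a<..<b}"
   proof eventually_elim
    case (elim t)
    show ?case
    proof
     assume t: "t \<in> {a<..<b}"
     hence "q (exp (- t)) > 0" "t >= 0" using qp ab by auto
     with elim show False by (simp add: indicator_def)
    qed
   qed
   hence "emeasure lborel {a<..<b} = 0" by (subst (asm) AE_iff_measurable[of "{a<..<b}"]) auto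
   thus False using ab by simp
  qed
  have bnd: "H b * I <= (\<integral>t. q (exp (- t)) * H (max 0 t) \<partial>M) \<and> (\<integral>t. q (exp (- t)) * H (max 0 t) \<partial>M) <= H a * I"
   if [measurable]: "(%t. H (max 0 t)) \<in> borel_measurable borel" and H: "!!t. 0 <= t ==> H t \<in> {0..B}"
    and Ha: "!!s t. 0 <= s ==> s <= t ==> H t <= H s" for H :: "real => real"
  proof -
   have i: "integrable M (%t. q (exp (- t)) * H (max 0 t))"
   proof (rule intb)
    fix t :: real assume "0 <= t"
    thus "\<bar>q (exp (- t)) * H (max 0 t)\<bar> <= 1 * B"
     using mult_mono[OF q1[of t], of "H t" B] H[of t] q0[of "exp (- t)"] by (auto simp: abs_mult)
   qed measurable
   have "q (exp (- t)) * H b <= q (exp (- t)) * H (max 0 t)" "q (exp (- t)) * H (max 0 t) <= q (exp (- t)) * H a" for t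
    using qz[of t] q0[of "exp (- t)"] ab Ha[of "max 0 t" b] Ha[of a "max 0 t"]
    by (cases "t \<in> {a..b}"; auto intro!: mult_left_mono)+
   hence "(\<integral>t. q (exp (- t)) * H b \<partial>M) <= (\<integral>t. q (exp (- t)) * H (max 0 t) \<partial>M)"
    "(\<integral>t. q (exp (- t)) * H (max 0 t) \<partial>M) <= (\<integral>t. q (exp (- t)) * H a \<partial>M)"
    by - (intro integral_mono i integrable_mult_left qint impI; assumption)+
   thus ?thesis by (simp add: I_def mult.commute)
  qed
  have F: "\<phi> n b * I <= (\<integral>t. q (exp (- t)) * F n t \<partial>M) \<and> (\<integral>t. q (exp (- t)) * F n t \<partial>M) <= \<phi> n a * I" for n
   unfolding F_def by (rule bnd) (use Fm[of n] bd anti in "auto simp: F_def[abs_def]")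
  have G: "\<psi> b * I <= (\<integral>t. q (exp (- t)) * G t \<partial>M) \<and> (\<integral>t. q (exp (- t)) * G t \<partial>M) <= \<psi> a * I"
   unfolding G_def by (rule bnd) (use Gm bd' anti' in "auto simp: G_def[abs_def]")
  show ?thesis
   by (intro exI[of _ I] conjI I exI[of _ "%n. \<integral>t. q (exp (- t)) * F n t \<partial>M"] exI[of _ "\<integral>t. q (exp (- t)) * G t \<partial>M"]
     lim_cont[OF q] allI) (use F G in auto)
 qed
 show ?thesis
 proof (rule order_tendstoI)
  fix y assume y: "y < \<psi> t0"
  have "eventually (%t. y < \<psi> t) (at t0)"
   using cont y unfolding isCont_def by (rule order_tendstoD)
  then obtain d where d: "d > 0" "!!t. t ~= t0 ==> dist t t0 < d ==> y < \<psi> t" unfolding eventually_at by auto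
  \<comment> \<open>The tent lies to the right of \<open>t0\<close>, where the functions are below
    their value at \<open>t0\<close>, so its averages bound \<open>\<phi> n t0\<close> from
    below.\<close>
  define b where "b = t0 + d / 2"
  have b: "t0 < b" "y < \<psi> b" using d(1) d(2)[of b] by (auto simp: b_def dist_real_def)
  obtain I A A' where I: "I > 0" "A ---> A'" "!!n. A n <= \<phi> n t0 * I" "\<psi> b * I <= A'"
   using tent[of t0 b] t0 b by auto
  have "y * I < A'" using b(2) I(1,4) mult_strict_right_mono[OF b(2) I(1)] by linarith
  hence "\<forall>\<^sub>F n in sequentially. y * I < A n" by (rule order_tendstoD(1)[OF I(2)])
  thus "\<forall>\<^sub>F n in sequentially. y < \<phi> n t0"
  proof eventually_elim
   case (elim n)
   with I(3)[of n] have "y * I < \<phi> n t0 * I" by linarith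
   thus ?case using I(1) by simp
  qed
 next
  fix y assume y: "\<psi> t0 < y"
  have "eventually (%t. \<psi> t < y) (at t0)"
   using cont y unfolding isCont_def by (rule order_tendstoD)
  then obtain d where d: "d > 0" "!!t. t ~= t0 ==> dist t t0 < d ==> \<psi> t < y" unfolding eventually_at by auto
  \<comment> \<open>Half of the smaller of d and \<open>t0\<close> keeps the left tent both close to
    \<open>t0\<close> and at nonnegative times.\<close>
  define a where "a = t0 - min d t0 / 2"
  have a: "0 <= a" "a < t0" "\<psi> a < y" using t0 d(1) d(2)[of a] by (auto simp: a_def dist_real_def min_def)
  obtain I A A' where I: "I > 0" "A ---> A'" "!!n. \<phi> n t0 * I <= A n" "A' <= \<psi> a * I"
   using tent[of a t0] a by auto
  have "A' < y * I" using a(3) I(1,4) mult_strict_right_mono[OF a(3) I(1)] by linarith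
  hence "\<forall>\<^sub>F n in sequentially. A n < y * I" by (rule order_tendstoD(2)[OF I(2)])
  thus "\<forall>\<^sub>F n in sequentially. \<phi> n t0 < y"
  proof eventually_elim
   case (elim n)
   with I(3)[of n] have "\<phi> n t0 * I < y * I" by linarith
   thus ?case using I(1) by simp
  qed
 qed
qed

subsection \<open>The form norm and weak approximation\<close>

context l2_semigroup
begin

lemma form_dom_add: "u \<in> form_dom ==> v \<in> form_dom ==> (%x. u x + v x) \<in> form_dom"
 using form_dom_lin[of u v 1 1] by simp

lemma form_dom_diff: "u \<in> form_dom ==> v \<in> form_dom ==> (%x. u x - v x) \<in> form_dom"
 using form_dom_lin[of u v 1 "-1"] by simp

lemma form_dom_cmult: "u \<in> form_dom ==> (%x. a * u x) \<in> form_dom"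
 using form_dom_lin[of u u a 0] by simp

lemma form_dom_uminus: "u \<in> form_dom ==> (%x. - u x) \<in> form_dom"
 using form_dom_cmult[of u "-1"] by simp

lemma form_dom_zero: "(%x. 0) \<in> form_dom"
proof (rule form_domI(1))
 show "(%k. 1 / real (Suc k)) ---> 0" by (rule LIMSEQ_Suc[OF lim_1_over_n])
 show "aform (1 / real (Suc k)) (%x. 0) (%x. 0) <= 0" for k by (simp add: aform_def)
qed simp_all

lemma form_dom_sum: "(!!i. i \<in> I ==> u i \<in> form_dom) ==> (%x. \<Sum>i\<in>I. u i x) \<in> form_dom"
 by (induction I rule: infinite_finite_induct) (auto simp: form_dom_zero intro: form_dom_add)

lemma form_cmult: "u \<in> form_dom ==> form (%x. a * u x) (%x. a * u x) = a^2 * form u u"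
 using form_quadratic[of u u a 0] by simp

definition e1 :: "('s => real) => ('s => real) => real" where
 "e1 u v = form u v + l2_inner m u v"

lemma e1_nonneg: "u \<in> form_dom ==> e1 u u >= 0"
 by (simp add: e1_def form_nonneg)

lemma e1_quadratic:
 assumes "u \<in> form_dom" "v \<in> form_dom"
 shows "e1 (%x. a * u x + b * v x) (%x. a * u x + b * v x) = a^2 * e1 u u + 2 * a * b * e1 u v + b^2 * e1 v v"
proof -
 have "u \<in> L2 m" "v \<in> L2 m" using assms by auto
 hence "l2_inner m (%x. a * u x + b * v x) (%x. a * u x + b * v x) =
   a^2 * l2_inner m u u + 2 * a * b * l2_inner m u v + b^2 * l2_inner m v v"
  by (simp add: power2_eq_square algebra_simps l2_inner_commute[of m v u])
 thus ?thesis by (simp add: e1_def form_quadratic[OF assms] algebra_simps)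
qed

lemma e1_cmult: "u \<in> form_dom ==> e1 (%x. a * u x) (%x. a * u x) = a^2 * e1 u u"
 using e1_quadratic[of u u a 0] by simp

lemma e1_add_le:
 assumes "u \<in> form_dom" "v \<in> form_dom"
 shows "e1 (%x. u x + v x) (%x. u x + v x) <= 2 * e1 u u + 2 * e1 v v"
 using e1_quadratic[OF assms, of 1 1] e1_quadratic[OF assms, of 1 "-1"] e1_nonneg[OF form_dom_diff[OF assms]] by simp

lemma e1_diff_le:
 assumes "u \<in> form_dom" "v \<in> form_dom"
 shows "e1 (%x. u x - v x) (%x. u x - v x) <= 2 * e1 u u + 2 * e1 v v"
 using e1_quadratic[OF assms, of 1 1] e1_quadratic[OF assms, of 1 "-1"] e1_nonneg[OF form_dom_add[OF assms]] by simp

lemma form_add_le: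
 assumes "u \<in> form_dom" "v \<in> form_dom"
 shows "form (%x. u x + v x) (%x. u x + v x) <= 2 * form u u + 2 * form v v"
 using form_quadratic[OF assms, of 1 1] form_quadratic[OF assms, of 1 "-1"] form_nonneg[OF form_dom_diff[OF assms]] by simp

lemma form_diff_le:
 assumes "u \<in> form_dom" "v \<in> form_dom"
 shows "form (%x. u x - v x) (%x. u x - v x) <= 2 * form u u + 2 * form v v"
 using form_quadratic[OF assms, of 1 1] form_quadratic[OF assms, of 1 "-1"] form_nonneg[OF form_dom_add[OF assms]] by simp

lemma e1_minus_commute: "e1 (%x. u x - v x) (%x. u x - v x) = e1 (%x. v x - u x) (%x. v x - u x)"
 if "u \<in> form_dom" "v \<in> form_dom"
 using e1_cmult[OF form_dom_diff[OF that], of "-1"] by simp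

lemma form_le_e1: "form u u <= e1 u u"
 by (simp add: e1_def)

lemma l2_norm_le_e1: "u \<in> form_dom ==> (l2_norm m u)^2 <= e1 u u"
 by (simp add: e1_def l2_norm_square form_nonneg)

lemma e1_tendsto_l2:
 assumes u: "!!n. u n \<in> form_dom" "w \<in> form_dom" and lim: "(%n. e1 (%x. u n x - w x) (%x. u n x - w x)) ---> 0"
 shows "l2_tendsto m u w"
proof (rule l2_tendstoI)
 show "l2_norm m (%x. u n x - w x) <= sqrt (e1 (%x. u n x - w x) (%x. u n x - w x))" for n
  using u by (intro real_le_rsqrt l2_norm_le_e1 form_dom_diff)
 show "(%n. sqrt (e1 (%x. u n x - w x) (%x. u n x - w x))) ---> 0"
  using tendsto_real_sqrt[OF lim] by simp
qed (use u in auto)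

text \<open>Weak convergence in the energy space without compactness: otherwise, after fixing a sign
  and a subsequence, moving \<open>q\<close> slightly along the sequence would lower its energy by a
  definite amount while the mean-square limit stays \<open>q\<close>, against lower
  semicontinuity.\<close>

lemma form_weak_null:
 assumes q: "q \<in> form_dom" and z: "!!n. z n \<in> form_dom" and lim: "l2_tendsto m z (%x. 0)"
  and B: "!!n. form (z n) (z n) <= B"
 shows "(%n. form q (z n)) ---> 0"
proof (rule ccontr)
 assume "\<not> (%n. form q (z n)) ---> 0"
 then obtain e where e: "e > 0" and inf: "!!N. \<exists>n\<ge>N. \<bar>form q (z n)\<bar> >= e"
  unfolding lim_sequentially by (auto simp: dist_real_def not_less)
 have "\<exists>c\<in>{1, -1::real}. \<forall>N. \<exists>n\<ge>N. c * form q (z n) <= - e"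
 proof (rule ccontr)
  assume "\<not> ?thesis"
  hence "\<not> (\<forall>N. \<exists>n\<ge>N. 1 * form q (z n) <= - e)" "\<not> (\<forall>N. \<exists>n\<ge>N. (-1) * form q (z n) <= - e)" by blast+
  then obtain N1 N2 where N: "!!n. n >= N1 ==> \<not> 1 * form q (z n) <= - e" "!!n. n >= N2 ==> \<not> (-1) * form q (z n) <= - e"
   by blast
  obtain n where "n >= max N1 N2" "\<bar>form q (z n)\<bar> >= e" using inf by blast
  with N[of n] show False by auto
 qed
 then obtain c where c: "c \<in> {1, -1::real}" and infc: "!!N. \<exists>n\<ge>N. c * form q (z n) <= - e" by blast
 have "\<exists>r. \<forall>n. r n >= n \<and> c * form q (z (r n)) <= - e" using infc by (intro choice) auto
 then obtain r where r: "!!n. r n >= n" "!!n. c * form q (z (r n)) <= - e" by blast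
 have B0: "B >= 0" using form_nonneg[OF z] B order_trans by blast
 \<comment> \<open>The step is so short that the quadratic increase \<open>s^2 * B\<close> stays
   below the linear decrease \<open>2 * s * e\<close>.\<close>
 define s where "s = e / (B + 1)"
 have s: "s > 0" "s * B < e" unfolding s_def using e B0 by (auto simp: field_simps)
 have "l2_tendsto m (%n x. 1 * q x + (s * c) * z (r n) x) (%x. 1 * q x + (s * c) * 0)"
 proof (intro l2_tendsto_add l2_tendsto_cmult l2_tendsto_const)
  have "filterlim r at_top sequentially" using r(1) by (intro filterlim_at_top_mono[OF filterlim_ident]) auto
  thus "l2_tendsto m (%n. z (r n)) (%x. 0)"
   using lim filterlim_compose[OF l2_tendstoD(3)[OF lim]] unfolding l2_tendsto_def by blast
 qed (use q in auto)
 hence "l2_tendsto m (%n x. 1 * q x + (s * c) * z (r n) x) q" by simp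
 moreover have "form (%x. 1 * q x + (s * c) * z (r n) x) (%x. 1 * q x + (s * c) * z (r n) x) <= form q q - 2 * s * e + s * (s * B)" for n
 proof -
  have cc: "c^2 = 1" using c by auto
  have "form (%x. 1 * q x + (s * c) * z (r n) x) (%x. 1 * q x + (s * c) * z (r n) x) =
    form q q + 2 * s * (c * form q (z (r n))) + (s * s) * form (z (r n)) (z (r n))"
   by (subst form_quadratic[OF q z]) (simp add: power_mult_distrib cc power2_eq_square[of s])
  also have "... <= form q q + 2 * s * (- e) + (s * s) * B"
   using s r(2)[of n] B by (intro add_mono mult_left_mono order.refl) auto
  finally show ?thesis by (simp add: algebra_simps)
 qed
 ultimately have "form q q <= form q q - 2 * s * e + s * (s * B)"
  using form_lsc[of "%n x. 1 * q x + (s * c) * z (r n) x" q] form_dom_lin[OF q z] by blast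
 moreover have "s * (s * B) < s * e" using s by simp
 ultimately show False using s e by (simp add: mult.assoc)
qed

definition e1_closure :: "('s => real) set => ('s => real) set" where
 "e1_closure W = {u \<in> form_dom. \<forall>e>0. \<exists>w\<in>W. e1 (%x. u x - w x) (%x. u x - w x) < e}"

definition form_subspace :: "('s => real) set => bool" where
 "form_subspace W \<longleftrightarrow> W \<subseteq> form_dom \<and> W ~= {} \<and> (\<forall>u\<in>W. \<forall>v\<in>W. \<forall>a b. (%x. a * u x + b * v x) \<in> W)"

lemma e1_self_diff: "e1 (%x. u x - u x) (%x. u x - u x) = 0"
 using form_cmult[OF form_dom_zero, of 0] by (simp add: e1_def)

lemma e1_closure_superset: "W \<subseteq> form_dom ==> W \<subseteq> e1_closure W"
proof
 fix u assume "W \<subseteq> form_dom" "u \<in> W"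
 moreover have "e1 (%x. u x - u x) (%x. u x - u x) < e" if "e > 0" for e using that e1_self_diff[of u] by simp
 ultimately show "u \<in> e1_closure W" unfolding e1_closure_def by blast
qed

text \<open>A Banach--Saks type argument: moving from a near-minimiser towards the weakly convergent
 sequence would otherwise decrease the distance to \<open>W\<close>.\<close>

lemma e1_closure_weak_aux:
 assumes W: "form_subspace W" and u: "u \<in> form_dom" and uk: "!!k. v k \<in> W"
  and lim: "l2_tendsto m v u" and B: "!!k. form (v k) (v k) <= B"
 shows "u \<in> e1_closure W"
proof -
 have Wd: "W \<subseteq> form_dom" and Wl: "!!u v a b. u \<in> W ==> v \<in> W ==> (%x. a * u x + b * v x) \<in> W"
  using W by (auto simp: form_subspace_def)
 define D where "D w = e1 (%x. w x - u x) (%x. w x - u x)" for w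
 \<comment> \<open>The squared distance from \<open>u\<close> to \<open>W\<close>; it is to be shown
   that it vanishes.\<close>
 define d where "d = Inf (D ` W)"
 have Dpos: "D w >= 0" if "w \<in> W" for w unfolding D_def using that Wd u by (intro e1_nonneg form_dom_diff) auto
 have bdd: "bdd_below (D ` W)" using Dpos by (intro bdd_belowI2)
 have d_le: "d <= D w" if "w \<in> W" for w unfolding d_def by (rule cINF_lower[OF bdd that])
 define z where "z k x = v k x - u x" for k x
 have zd: "z k \<in> form_dom" for k unfolding z_def using uk Wd u by (intro form_dom_diff) auto
 have z0: "l2_tendsto m z (%x. 0)" unfolding z_def[abs_def]
  using l2_tendsto_diff[OF lim l2_tendsto_const[of u m]] u by auto
 define B' where "B' = 2 * B + 2 * form u u"
 have zB: "form (z k) (z k) <= B'" for k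
  unfolding z_def[abs_def] B'_def using form_diff_le[of "v k" u] uk[of k] Wd u B[of k] by auto
 \<comment> \<open>From a near minimiser a fraction s is moved towards \<open>v k\<close>; in the
   limit the mixed term disappears by \<open>form_weak_null\<close> and only \<open>s^2 * B'\<close>
   remains of the sequence.\<close>
 have key: "d <= (1 - s)^2 * (d + \<delta>) + s^2 * B'" if s: "0 < s" "s < 1" and \<delta>: "\<delta> > 0" for s \<delta>
 proof -
  have "D ` W ~= {}" using uk by auto
  from cInf_lessD[OF this, of "d + \<delta>"] \<delta> obtain w where w: "w \<in> W" "D w < d + \<delta>" by (auto simp: d_def)
  define q where "q x = w x - u x" for x
  have q: "q \<in> form_dom" unfolding q_def using w(1) Wd u by (intro form_dom_diff) auto
  have "d <= (1 - s)^2 * e1 q q + 2 * (1 - s) * s * e1 q (z k) + s^2 * (B' + l2_inner m (z k) (z k))" for k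
  proof -
   have "d <= D (%x. (1 - s) * w x + s * v k x)" by (intro d_le Wl w uk)
   also have "... = e1 (%x. (1 - s) * q x + s * z k x) (%x. (1 - s) * q x + s * z k x)"
    unfolding D_def q_def z_def by (simp add: algebra_simps)
   also have "... = (1 - s)^2 * e1 q q + 2 * (1 - s) * s * e1 q (z k) + s^2 * e1 (z k) (z k)"
    by (rule e1_quadratic[OF q zd])
   also have "... <= (1 - s)^2 * e1 q q + 2 * (1 - s) * s * e1 q (z k) + s^2 * (B' + l2_inner m (z k) (z k))"
    using zB[of k] by (simp add: e1_def mult_left_mono)
   finally show ?thesis .
  qed
  moreover have "(%k. (1 - s)^2 * e1 q q + 2 * (1 - s) * s * e1 q (z k) + s^2 * (B' + l2_inner m (z k) (z k)))
    ---> (1 - s)^2 * e1 q q + 2 * (1 - s) * s * (0 + l2_inner m q (%x. 0)) + s^2 * (B' + l2_inner m (%x. 0::real) (%x. 0))"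
   unfolding e1_def using q by (intro tendsto_intros form_weak_null[OF q zd z0 zB] l2_tendsto_inner z0 l2_tendsto_const) auto
  ultimately have "d <= (1 - s)^2 * e1 q q + s^2 * B'"
   by (intro LIMSEQ_le_const[where a=d]) auto
  moreover have "e1 q q < d + \<delta>" using w(2) by (simp add: D_def q_def[abs_def])
  moreover have "(1 - s)^2 * e1 q q <= (1 - s)^2 * (d + \<delta>)" using calculation(2) by (intro mult_left_mono) auto
  ultimately show ?thesis by linarith
 qed
 have key2: "d <= (1 - s)^2 * d + s^2 * B'" if s: "0 < s" "s < 1" for s
 proof (rule field_le_epsilon)
  fix e :: real assume e: "e > 0"
  have "d <= (1 - s)^2 * (d + e) + s^2 * B'" by (rule key[OF s e])
  also have "... = (1 - s)^2 * d + (1 - s)^2 * e + s^2 * B'" by (simp add: algebra_simps)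
  also have "(1 - s)^2 * e <= 1 * e" using e s by (intro mult_right_mono) (auto simp: power_le_one)
  finally show "d <= (1 - s)^2 * d + s^2 * B' + e" by simp
 qed
 \<comment> \<open>The terms free of s cancel and one factor s can be divided out; letting s tend to
   0 then leaves \<open>d <= 0\<close>.\<close>
 have key3: "2 * d <= s * (d + B')" if s: "0 < s" "s < 1" for s
 proof -
  have "s * (2 * d) <= s * (s * (d + B'))" using key2[OF s] by (simp add: power2_eq_square algebra_simps)
  thus ?thesis using s by simp
 qed
 have "2 * d <= 0 * (d + B')"
 proof (rule LIMSEQ_le_const)
  \<comment> \<open>Two successors keep the step strictly below 1, as \<open>key3\<close>
    demands.\<close>
  show "(%n. 1 / real (Suc (Suc n)) * (d + B')) ---> 0 * (d + B')"
   by (intro tendsto_intros LIMSEQ_Suc[OF LIMSEQ_Suc[OF lim_1_over_n]])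
  show "\<exists>N. \<forall>n\<ge>N. 2 * d <= 1 / real (Suc (Suc n)) * (d + B')"
   using key3 by (intro exI[of _ 0] allI impI) (rule key3, auto)
 qed
 hence d0: "d <= 0" by simp
 show ?thesis unfolding e1_closure_def
 proof (intro CollectI conjI allI impI u)
  fix e :: real assume "e > 0"
  moreover have "D ` W ~= {}" using uk by auto
  ultimately obtain w where w: "w \<in> W" "D w < e" using cInf_lessD[of "D ` W" e] d0 by (auto simp: d_def)
  thus "\<exists>w\<in>W. e1 (%x. u x - w x) (%x. u x - w x) < e"
   using e1_minus_commute[of u w] u Wd by (auto simp: D_def intro!: bexI[of _ w])
 qed
qed

text \<open>Each \<open>v k\<close> is replaced by a member of \<open>W\<close> closer than 1/(k +
  1); the replacements keep the limit and have bounded energies, so the previous case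
  applies.\<close>

lemma e1_closure_weak:
 assumes W: "form_subspace W" and v: "!!k. v k \<in> e1_closure W"
  and lim: "l2_tendsto m v u" and B: "!!k. form (v k) (v k) <= B"
 shows "u \<in> e1_closure W"
proof -
 have Wd: "W \<subseteq> form_dom" using W by (auto simp: form_subspace_def)
 have vd: "v k \<in> form_dom" for k using v by (auto simp: e1_closure_def)
 have "\<exists>w. \<forall>k. w k \<in> W \<and> e1 (%x. v k x - w k x) (%x. v k x - w k x) < 1 / real (Suc k)"
 proof (rule choice, rule allI)
  fix k
  have "1 / real (Suc k) > 0" by simp
  thus "\<exists>w. w \<in> W \<and> e1 (%x. v k x - w x) (%x. v k x - w x) < 1 / real (Suc k)"
   using v[of k] unfolding e1_closure_def by blast
 qed
 then obtain w where w: "!!k. w k \<in> W" "!!k. e1 (%x. v k x - w k x) (%x. v k x - w k x) < 1 / real (Suc k)" by blast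
 have wd: "w k \<in> form_dom" for k using w Wd by auto
 have diff0: "l2_tendsto m (%k x. v k x - w k x) (%x. 0)"
 proof (rule e1_tendsto_l2)
  show "(%n. e1 (%x. v n x - w n x - 0) (%x. v n x - w n x - 0)) ---> 0"
   by (rule tendsto_sandwich[OF _ _ tendsto_const LIMSEQ_Suc[OF lim_1_over_n]])
    (use less_imp_le[OF w(2)] e1_nonneg[OF form_dom_diff[OF vd wd]] in "simp_all del: of_nat_Suc")
 qed (auto simp: form_dom_zero intro: form_dom_diff vd wd)
 have "l2_tendsto m w u" using l2_tendsto_diff[OF lim diff0] by simp
 moreover have "u \<in> form_dom" using form_lsc[OF lim vd B] by blast
 moreover have "form (w k) (w k) <= 2 * B + 2" for k
 proof -
  have 1: "form (w k) (w k) <= 2 * form (v k) (v k) + 2 * form (%x. v k x - w k x) (%x. v k x - w k x)"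
   using form_diff_le[OF vd[of k] form_dom_diff[OF vd[of k] wd[of k]]] by simp
  have one: "1 / real (Suc k) <= 1" by simp
  have "form (%x. v k x - w k x) (%x. v k x - w k x) <= 1"
   using form_le_e1[of "%x. v k x - w k x"] w(2)[of k] one by linarith
  thus ?thesis using 1 B[of k] by linarith
 qed
 ultimately show ?thesis using w(1) by (intro e1_closure_weak_aux[OF W])
qed

lemma e1_closure_lin:
 assumes W: "form_subspace W" and u: "u \<in> e1_closure W" and v: "v \<in> e1_closure W"
 shows "(%x. a * u x + b * v x) \<in> e1_closure W"
proof -
 have Wd: "W \<subseteq> form_dom" using W by (auto simp: form_subspace_def)
 have ud: "u \<in> form_dom" and vd: "v \<in> form_dom" using u v by (auto simp: e1_closure_def)
 show ?thesis unfolding e1_closure_def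
 proof (intro CollectI conjI allI impI form_dom_lin ud vd)
  fix e :: real assume e: "e > 0"
  define c where "c = e / (4 * (a^2 + b^2 + 1))"
  have c: "c > 0" unfolding c_def using e by (intro divide_pos_pos) (auto simp: add_nonneg_pos)
  obtain w where w: "w \<in> W" "e1 (%x. u x - w x) (%x. u x - w x) < c" using u c by (auto simp: e1_closure_def)
  obtain z where z: "z \<in> W" "e1 (%x. v x - z x) (%x. v x - z x) < c" using v c by (auto simp: e1_closure_def)
  have d1: "(%x. u x - w x) \<in> form_dom" and d2: "(%x. v x - z x) \<in> form_dom"
   using w z Wd ud vd by (auto intro: form_dom_diff)
  have "e1 (%x. a * (u x - w x) + b * (v x - z x)) (%x. a * (u x - w x) + b * (v x - z x))
   <= 2 * (a^2 * e1 (%x. u x - w x) (%x. u x - w x)) + 2 * (b^2 * e1 (%x. v x - z x) (%x. v x - z x))"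
   using e1_add_le[OF form_dom_cmult[OF d1, of a] form_dom_cmult[OF d2, of b]] by (simp add: e1_cmult d1 d2)
  also have "... <= 2 * (a^2 * c) + 2 * (b^2 * c)" using w z by (intro add_mono mult_left_mono) auto
  also have "... < 4 * (a^2 + b^2 + 1) * c"
   using c by (simp add: algebra_simps) (smt (verit) mult_nonneg_nonneg zero_le_power2)
  also have "... = e"
  proof -
   have "a^2 + b^2 + 1 > 0" by (simp add: add_nonneg_pos)
   thus ?thesis unfolding c_def by simp
  qed
  finally show "\<exists>w\<in>W. e1 (%x. a * u x + b * v x - w x) (%x. a * u x + b * v x - w x) < e"
   using W w(1) z(1)
   by (intro bexI[of _ "%x. a * w x + b * z x"]) (auto simp: algebra_simps form_subspace_def)
 qed
qed

text \<open>The bound of the energy of a sum by twice the sum of the energies loses a factor 2 per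
  summand, so the energies must decay faster: with ratio 1/8 the induction closes, since 2 + 2 * 3/8
  <= 3.\<close>

lemma e1_sum_geometric:
 assumes z: "!!i. z i \<in> form_dom" and le: "!!i::nat. e1 (z i) (z i) <= C * (1/8)^i" and C: "C >= 0"
 shows "e1 (%x. \<Sum>i\<in>{k..<k+n}. z i x) (%x. \<Sum>i\<in>{k..<k+n}. z i x) <= 3 * C * (1/8)^k"
proof (induction n arbitrary: k)
 case 0
 have "e1 (%x. 0) (%x. 0) = 0" using e1_self_diff[of "%x. 0"] by simp
 thus ?case using C by simp
next
 case (Suc n)
 let ?S = "%x. \<Sum>i\<in>{Suc k..<Suc k + n}. z i x"
 have S: "?S \<in> form_dom" by (rule form_dom_sum) (rule z)
 have e: "(%x. \<Sum>i\<in>{k..<k + Suc n}. z i x) = (%x. z k x + ?S x)"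
  using sum.atLeast_Suc_lessThan[of k "k + Suc n" "%i. z i x" for x] by (simp del: sum.op_ivl_Suc)
 have "e1 (%x. z k x + ?S x) (%x. z k x + ?S x) <= 2 * e1 (z k) (z k) + 2 * e1 ?S ?S" by (rule e1_add_le[OF z S])
 also have "... <= 2 * (C * (1/8)^k) + 2 * (3 * C * (1/8)^Suc k)"
  by (intro add_mono mult_left_mono le Suc.IH) auto
 also have "... <= 3 * C * (1/8)^k" using C by simp
 finally show ?case unfolding e .
qed

text \<open>A function dominating the whole tail of a series with geometrically small energies, the
  substitute for adding up capacities of exceptional sets. The constant 6 is 3 for the form plus 3
  for the mean-square part.\<close>

lemma fast_sum:
 assumes z: "!!i. z i \<in> form_dom" and pos: "!!i x. z i x >= 0" and le: "!!i::nat. e1 (z i) (z i) <= C * (1/8)^i"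
 shows "\<exists>S. \<forall>k. S k \<in> form_dom \<and> e1 (S k) (S k) <= 6 * C * (1/8)^k \<and> (\<forall>i\<ge>k. AE x in m. z i x <= S k x)"
proof -
 have C: "C >= 0" using e1_nonneg[OF z[of 0]] le[of 0] by simp
 have "\<exists>S. S \<in> form_dom \<and> e1 S S <= 6 * C * (1/8)^k \<and> (\<forall>i\<ge>k. AE x in m. z i x <= S x)" for k
 proof -
  define p where "p n x = (\<Sum>i\<in>{k..<k+n}. z i x)" for n x
  have pd: "p n \<in> form_dom" for n unfolding p_def[abs_def] by (rule form_dom_sum) (rule z)
  have pe: "e1 (p n) (p n) <= 3 * C * (1/8)^k" for n
   unfolding p_def[abs_def] by (rule e1_sum_geometric[OF z le C])
  have cauchy: "l2_Cauchy m p" unfolding l2_Cauchy_def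
  proof (intro conjI allI impI)
   fix e :: real assume e: "e > 0"
   have "(%n. 3 * C * (1/8)^(k + n)) ---> 3 * C * ((1/8)^k * 0)"
    unfolding power_add by (intro tendsto_intros LIMSEQ_realpow_zero) auto
   hence "\<forall>\<^sub>F n in sequentially. 3 * C * (1/8)^(k + n) < e^2" using e by (intro order_tendstoD) auto
   then obtain N where N: "3 * C * (1/8)^(k + N) < e^2" by (auto simp: eventually_sequentially)
   have *: "l2_norm m (%x. p b x - p a x) < e" if "a >= N" "b >= a" for a b
   proof (rule power2_less_imp_less)
    have eq: "(%x. p b x - p a x) = (%x. \<Sum>i\<in>{k+a..<(k+a)+(b-a)}. z i x)"
    proof
     fix x
     have "p b x = p a x + (\<Sum>i\<in>{k+a..<k+b}. z i x)"
      unfolding p_def using that by (intro sum.atLeastLessThan_concat[symmetric]) auto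
     thus "p b x - p a x = (\<Sum>i\<in>{k+a..<(k+a)+(b-a)}. z i x)" using that by simp
    qed
    have "(l2_norm m (%x. p b x - p a x))^2 <= e1 (%x. p b x - p a x) (%x. p b x - p a x)"
     by (intro l2_norm_le_e1 form_dom_diff pd)
    also have "... <= 3 * C * (1/8)^(k + a)" unfolding eq by (rule e1_sum_geometric[OF z le C])
    also have "... <= 3 * C * (1/8)^(k + N)" using that C by (intro mult_left_mono power_decreasing) auto
    finally show "(l2_norm m (%x. p b x - p a x))^2 < e^2" using N by linarith
   qed (use e in simp)
   show "\<exists>N. \<forall>a\<ge>N. \<forall>b\<ge>N. l2_norm m (%x. p a x - p b x) < e"
   proof (intro exI[of _ N] allI impI)
    fix a b assume "a >= N" "b >= N"
    thus "l2_norm m (%x. p a x - p b x) < e"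
     using *[of a b] *[of b a] l2_norm_minus_commute[of m "p a" "p b"] by (cases "a <= b") auto
   qed
  qed (use pd in auto)
  then obtain S where S: "l2_tendsto m p S" using L2_complete by blast
  have "S \<in> form_dom \<and> form S S <= 3 * C * (1/8)^k"
   by (rule form_lsc[OF S pd]) (use pe form_le_e1 in "blast intro: order_trans")
  moreover have "l2_inner m S S <= 3 * C * (1/8)^k"
  proof (rule LIMSEQ_le_const2)
   show "(%n. l2_inner m (p n) (p n)) ---> l2_inner m S S" by (rule l2_tendsto_inner[OF S S])
   show "\<exists>N. \<forall>n\<ge>N. l2_inner m (p n) (p n) <= 3 * C * (1/8)^k"
    using l2_norm_le_e1[OF pd] pe by (intro exI[of _ 0]) (auto simp: l2_norm_square intro: order_trans)
  qed
  moreover have "AE x in m. z i x <= S x" if "i >= k" for i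
  proof (rule l2_tendsto_AE_le[OF S])
   have "z i x <= p n x" if n: "n >= Suc i" for n x
    unfolding p_def using n \<open>i >= k\<close> by (intro member_le_sum) (auto simp: pos)
   thus "\<forall>\<^sub>F n in sequentially. AE x in m. z i x <= p n x"
    unfolding eventually_sequentially by (intro exI[of _ "Suc i"]) auto
  qed
  ultimately show ?thesis by (intro exI[of _ S]) (auto simp: e1_def)
 qed
 thus ?thesis by (intro choice) blast
qed

end

subsection \<open>Markovian semigroups and truncation\<close>

locale markov_l2_semigroup = l2_semigroup +
 assumes P_upper: "t >= 0 ==> u \<in> L2 m ==> c >= 0 ==> (AE x in m. u x <= c) ==> AE x in m. P t u x <= c"
begin

text \<open>Split u into the part \<open>a\<close> above c and the part \<open>b\<close> below.
  Where \<open>a\<close> is positive, \<open>b\<close> equals c and \<open>P t b\<close> is at most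
  c, so the mixed term has a favourable sign and the energies of the two parts add up to at most
  that of u.\<close>

lemma aform_truncation:
 assumes t: "t > 0" and u: "u \<in> L2 m" and c: "c >= 0"
 defines "a \<equiv> %x. max (u x - c) 0" and "b \<equiv> %x. min (u x) c"
 shows "aform t a a + aform t b b <= aform t u u"
proof -
 have a: "a \<in> L2 m" and b: "b \<in> L2 m" unfolding a_def b_def using u c by auto
 have "AE x in m. P t b x <= c" by (rule P_upper) (use t b c in "auto simp: b_def")
 hence "AE x in m. P t b x * a x <= b x * a x"
 proof eventually_elim
  case (elim x)
  show ?case
  proof (cases "u x > c")
   case True
   hence "b x = c" "a x >= 0" by (auto simp: a_def b_def)
   thus ?thesis using elim by (simp add: mult_right_mono)
  qed (simp add: a_def)
 qed
 hence "l2_inner m (P t b) a <= l2_inner m b a" using t a b by (intro l2_inner_mono) auto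
 hence "aform t b a >= 0" using t by (simp add: aform_def)
 moreover have "u = (%x. 1 * a x + 1 * b x)" by (auto simp: a_def b_def fun_eq_iff max_def min_def)
 hence "aform t u u = aform t a a + 2 * aform t a b + aform t b b"
  using aform_quadratic[OF _ a b, of t 1 1] t by simp
 ultimately show ?thesis using aform_sym[OF _ a b, of t] t by simp
qed

lemma form_truncation:
 assumes u: "u \<in> form_dom" and c: "c >= 0"
 shows "(%x. max (u x - c) 0) \<in> form_dom" "form (%x. max (u x - c) 0) (%x. max (u x - c) 0) <= form u u"
  "(%x. min (u x) c) \<in> form_dom" "form (%x. min (u x) c) (%x. min (u x) c) <= form u u"
proof -
 let ?a = "%x. max (u x - c) 0" and ?b = "%x. min (u x) c"
 have uL: "u \<in> L2 m" using u by auto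
 have a: "?a \<in> L2 m" and b: "?b \<in> L2 m" using uL c by auto
 have r: "(%k. 1 / real (Suc k)) ---> 0" by (rule LIMSEQ_Suc[OF lim_1_over_n])
 have r0: "1 / real (Suc k) > 0" for k by simp
 have *: "aform (1 / real (Suc k)) ?a ?a <= form u u" "aform (1 / real (Suc k)) ?b ?b <= form u u" for k
  using aform_truncation[OF r0 uL c, of k] aform_nonneg[OF less_imp_le[OF r0] a, of k]
   aform_nonneg[OF less_imp_le[OF r0] b, of k] aform_le_form[OF u r0, of k] by linarith+
 show "?a \<in> form_dom" "form ?a ?a <= form u u" by (rule form_domI[OF a r r0 *(1)])+
 show "?b \<in> form_dom" "form ?b ?b <= form u u" by (rule form_domI[OF b r r0 *(2)])+
qed

lemma form_pos_part:
 assumes u: "u \<in> form_dom"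
 shows "(%x. max (u x) 0) \<in> form_dom" "form (%x. max (u x) 0) (%x. max (u x) 0) <= form u u"
 using form_truncation(1,2)[OF u, of 0] by simp_all

lemma form_neg_part:
 assumes u: "u \<in> form_dom"
 shows "(%x. max (- u x) 0) \<in> form_dom" "form (%x. max (- u x) 0) (%x. max (- u x) 0) <= form u u"
 using form_pos_part[OF form_dom_uminus[OF u]] form_cmult[OF u, of "-1"] by simp_all

lemma form_abs:
 assumes u: "u \<in> form_dom"
 shows "(%x. \<bar>u x\<bar>) \<in> form_dom" "form (%x. \<bar>u x\<bar>) (%x. \<bar>u x\<bar>) <= 4 * form u u"
proof -
 have e: "(%x. \<bar>u x\<bar>) = (%x. max (u x) 0 + max (- u x) 0)" by auto
 show "(%x. \<bar>u x\<bar>) \<in> form_dom" unfolding e by (intro form_dom_add form_pos_part form_neg_part u)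
 show "form (%x. \<bar>u x\<bar>) (%x. \<bar>u x\<bar>) <= 4 * form u u" unfolding e
  using form_add_le[OF form_pos_part(1)[OF u] form_neg_part(1)[OF u]] form_pos_part(2)[OF u] form_neg_part(2)[OF u] by linarith
qed

lemma e1_abs: "u \<in> form_dom ==> e1 (%x. \<bar>u x\<bar>) (%x. \<bar>u x\<bar>) <= 4 * e1 u u"
proof -
 assume u: "u \<in> form_dom"
 have "l2_inner m (%x. \<bar>u x\<bar>) (%x. \<bar>u x\<bar>) = l2_inner m u u" by (simp add: l2_inner_def)
 thus ?thesis using form_abs(2)[OF u] l2_inner_self_nonneg[of m u]
  by (simp add: e1_def del: l2_inner_self_nonneg)
qed

lemma form_min:
 assumes u: "u \<in> form_dom" and v: "v \<in> form_dom"
 shows "(%x. min (u x) (v x)) \<in> form_dom"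
  "form (%x. min (u x) (v x)) (%x. min (u x) (v x)) <= 2 * form u u + 2 * form (%x. u x - v x) (%x. u x - v x)"
proof -
 have e: "(%x. min (u x) (v x)) = (%x. u x - max (u x - v x) 0)" by auto
 have d: "(%x. u x - v x) \<in> form_dom" by (rule form_dom_diff[OF u v])
 show "(%x. min (u x) (v x)) \<in> form_dom" unfolding e by (intro form_dom_diff u form_pos_part(1) d)
 show "form (%x. min (u x) (v x)) (%x. min (u x) (v x)) <= 2 * form u u + 2 * form (%x. u x - v x) (%x. u x - v x)"
  unfolding e using form_diff_le[OF u form_pos_part(1)[OF d]] form_pos_part(2)[OF d] by linarith
qed

lemma form_clip:
 assumes u: "u \<in> form_dom" and c: "c >= 0"
 shows "(%x. max (- c) (min (u x) c)) \<in> form_dom"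
  "form (%x. max (- c) (min (u x) c)) (%x. max (- c) (min (u x) c)) <= form u u"
proof -
 let ?b = "%x. min (u x) c"
 let ?n = "%x. min (- ?b x) c"
 note b = form_truncation(3,4)[OF u c]
 note nb = form_truncation(3,4)[OF form_dom_uminus[OF b(1)] c]
 have e: "(%x. max (- c) (min (u x) c)) = (%x. - ?n x)" by (auto simp: fun_eq_iff max_def min_def)
 have f1: "form (%x. - ?b x) (%x. - ?b x) = form ?b ?b" using form_cmult[OF b(1), of "-1"] by simp
 have f2: "form (%x. - ?n x) (%x. - ?n x) = form ?n ?n" using form_cmult[OF nb(1), of "-1"] by simp
 show "(%x. max (- c) (min (u x) c)) \<in> form_dom" unfolding e by (rule form_dom_uminus[OF nb(1)])
 show "form (%x. max (- c) (min (u x) c)) (%x. max (- c) (min (u x) c)) <= form u u"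
  unfolding e f2 using nb(2) b(2) unfolding f1 by linarith
qed

lemma min_const_l2_tendsto:
 assumes u: "u \<in> L2 m" shows "l2_tendsto m (%n x. min (u x) (real n)) u"
proof -
 have [measurable]: "u \<in> borel_measurable m" using u by auto
 have "(%n. \<integral>x. (min (u x) (real n) - u x) * (min (u x) (real n) - u x) \<partial>m) ---> (\<integral>x. 0 \<partial>m)"
 proof (rule integral_dominated_convergence)
  show "integrable m (%x. u x * u x)" using u by (rule L2_integrable_square)
  show "AE x in m. (%n. (min (u x) (real n) - u x) * (min (u x) (real n) - u x)) ---> 0"
  proof (intro AE_I2 tendsto_eventually)
   fix x
   obtain N :: nat where "u x <= real N" using real_arch_simple by blast
   thus "\<forall>\<^sub>F n in sequentially. (min (u x) (real n) - u x) * (min (u x) (real n) - u x) = 0"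
    unfolding eventually_sequentially by (intro exI[of _ N]) auto
  qed
  fix n
  show "AE x in m. norm ((min (u x) (real n) - u x) * (min (u x) (real n) - u x)) <= u x * u x"
  proof (rule AE_I2)
   fix x
   have "\<bar>min (u x) (real n) - u x\<bar> <= \<bar>u x\<bar>" by (auto simp: min_def)
   from mult_mono[OF this this] show "norm ((min (u x) (real n) - u x) * (min (u x) (real n) - u x)) <= u x * u x"
    by (simp add: abs_mult)
  qed
 qed measurable
 hence "(%n. sqrt (l2_inner m (%x. min (u x) (real n) - u x) (%x. min (u x) (real n) - u x))) ---> sqrt 0"
  unfolding l2_inner_def by (intro tendsto_real_sqrt) simp
 thus ?thesis using u by (auto simp: l2_tendsto_def l2_norm_def)
qed

end

section \<open>Quasi-notions of a regular Dirichlet form\<close>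

lemma openin_borel_of: "openin T U ==> U \<in> sets (borel_of T)"
 unfolding borel_of_def by (subst sets_measure_of) (auto dest: openin_subset)

lemma closedin_borel_of: "closedin T C ==> C \<in> sets (borel_of T)"
proof -
 assume C: "closedin T C"
 hence "topspace T - (topspace T - C) \<in> sets (borel_of T)"
  using sets.compl_sets[of "topspace T - C" "borel_of T"] openin_borel_of[of T "topspace T - C"] by auto
 thus ?thesis using closedin_subset[OF C] by (simp add: Diff_Diff_Int Int_absorb1)
qed

lemma measurable_borel_ofI:
 assumes "f \<in> space M \<rightarrow> topspace T" "!!U. openin T U ==> f -` U \<inter> space M \<in> sets M"
 shows "f \<in> measurable M (borel_of T)"
 unfolding borel_of_def using assms
 by (intro measurable_measure_of) (auto dest: openin_subset)

lemma strictly_fast_subseq: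
 fixes d g :: "nat => real"
 assumes "d ---> 0" and g: "!!n. g n > 0"
 shows "\<exists>r. strict_mono r \<and> (\<forall>n. d (r n) < g n)"
proof -
 have "\<exists>N. \<forall>n. \<forall>p\<ge>N n. d p < g n"
 proof (rule choice, rule allI)
  fix n
  have "\<forall>\<^sub>F p in sequentially. d p < g n" by (rule order_tendstoD(2)[OF assms])
  thus "\<exists>N. \<forall>p\<ge>N. d p < g n" by (simp add: eventually_sequentially)
 qed
 then obtain N where N: "!!n p. p >= N n ==> d p < g n" by auto
 define r where "r n = (\<Sum>i\<le>n. N i) + n" for n
 have "strict_mono r" unfolding strict_mono_Suc_iff r_def by simp
 moreover have "r n >= N n" for n unfolding r_def using member_le_sum[of n "{..n}" N] by simp
 ultimately show ?thesis using N by blast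
qed

text \<open>\<open>dom\<close> and \<open>energy_form\<close> identify the form of \<open>D\<close>
  with the one generated by the semigroup, so that energy estimates come from the semigroup and only
  density statements are taken from \<open>D\<close>.\<close>

locale dirichlet_space = markov_l2_semigroup "refm D" P for D :: "'s form_data" and P +
 assumes borel_sets: "sets (refm D) = sets (borel_of (base D))"
  and second_countable_base: "second_countable (base D)"
  and sigma_finite: "sigma_finite_measure (refm D)"
  and regular: "regular_dirichlet_form D"
  and dom: "fdom D = form_dom"
  and energy_form: "u \<in> form_dom ==> v \<in> form_dom ==> energy D u v = form u v"
begin

lemma space_refm: "space (refm D) = topspace (base D)"
 using sets_eq_imp_space_eq[OF borel_sets] by simp

lemma openin_sets: "openin (base D) U ==> U \<in> sets (refm D)"
 by (simp add: borel_sets openin_borel_of)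

lemma closedin_sets: "closedin (base D) U ==> U \<in> sets (refm D)"
 by (simp add: borel_sets closedin_borel_of)

lemma energy_at_1: "u \<in> form_dom ==> v \<in> form_dom ==> energy_at D 1 u v = e1 u v"
 by (simp add: energy_at_def e1_def energy_form)

lemma energy1_dist_less:
 assumes "u \<in> form_dom" "v \<in> form_dom" "e > 0"
 shows "energy1_dist D u v < e \<longleftrightarrow> e1 (%x. u x - v x) (%x. u x - v x) < e^2"
 unfolding energy1_dist_def using assms form_dom_diff[OF assms(1,2)]
 by (simp add: energy_at_1 real_sqrt_less_iff[symmetric, of _ "e^2"] real_sqrt_unique[of e] del: real_sqrt_less_iff)

lemma energy1_dense_iff:
 assumes "A \<subseteq> form_dom" shows "energy1_dense D A \<longleftrightarrow> form_dom \<subseteq> e1_closure A"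
proof
 assume d: "energy1_dense D A"
 show "form_dom \<subseteq> e1_closure A"
 proof
  fix u assume u: "u \<in> form_dom"
  show "u \<in> e1_closure A" unfolding e1_closure_def
  proof (intro CollectI conjI allI impI u)
   fix e :: real assume e: "e > 0"
   hence "sqrt e > 0" by simp
   then obtain v where "v \<in> A" "energy1_dist D u v < sqrt e" using d u unfolding energy1_dense_def dom by blast
   thus "\<exists>w\<in>A. e1 (%x. u x - w x) (%x. u x - w x) < e"
    using energy1_dist_less[of u v "sqrt e"] assms u e by auto
  qed
 qed
next
 assume c: "form_dom \<subseteq> e1_closure A"
 show "energy1_dense D A" unfolding energy1_dense_def dom
 proof (intro ballI allI impI)
  fix u and e :: real assume u: "u \<in> form_dom" and e: "e > 0"
  hence "e^2 > 0" "u \<in> e1_closure A" using c by auto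
  then obtain v where "v \<in> A" "e1 (%x. u x - v x) (%x. u x - v x) < e^2"
   unfolding e1_closure_def by blast
  thus "\<exists>v\<in>A. energy1_dist D u v < e"
   using energy1_dist_less[OF u _ e, of v] assms by auto
 qed
qed

section \<open>Nests of closed sets\<close>

definition supp :: "'s set => ('s => real) set" where
 "supp C = {f \<in> form_dom. AE x in refm D. x \<notin> C --> f x = 0}"

lemma nest_alt:
 "nest D C \<longleftrightarrow> (\<forall>k. closedin (base D) (C k)) \<and> (\<forall>k. C k \<subseteq> C (Suc k)) \<and> form_dom \<subseteq> e1_closure (\<Union>k. supp (C k))"
proof -
 have "(\<Union>k. supp (C k)) \<subseteq> form_dom" by (auto simp: supp_def)
 thus ?thesis unfolding nest_def using energy1_dense_iff[of "\<Union>k. supp (C k)"] by (simp add: supp_def dom)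
qed

lemma supp_mono: "C \<subseteq> C' ==> supp C \<subseteq> supp C'"
 unfolding supp_def by (auto elim: eventually_mono)

lemma supp_lin: "u \<in> supp C ==> v \<in> supp C ==> (%x. a * u x + b * v x) \<in> supp C"
 unfolding supp_def by (auto intro: form_dom_lin elim: eventually_elim2)

lemma incr_mono: "(!!k. C k \<subseteq> C (Suc k)) ==> i <= j ==> C i \<subseteq> (C j :: 's set)" for C :: "nat => 's set"
 by (rule lift_Suc_mono_le)

lemma supp_subspace:
 assumes "!!k. C k \<subseteq> C (Suc k)" shows "form_subspace (\<Union>k. supp (C k))"
proof -
 have "(%x. a * u x + b * v x) \<in> (\<Union>k. supp (C k))" if "u \<in> supp (C i)" "v \<in> supp (C j)" for u v i j a b
 proof -
  have "u \<in> supp (C (max i j))" "v \<in> supp (C (max i j))"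
   using that supp_mono[OF incr_mono[of C i "max i j"]] supp_mono[OF incr_mono[of C j "max i j"]] assms by auto
  thus ?thesis using supp_lin by blast
 qed
 moreover have "(%x. 0) \<in> supp (C 0)" by (simp add: supp_def form_dom_zero)
 ultimately show ?thesis unfolding form_subspace_def by (auto simp: supp_def)
qed

lemma supp_pos_part: "u \<in> supp C ==> (%x. max (u x) 0) \<in> supp C"
 unfolding supp_def by (auto intro: form_pos_part elim: eventually_mono)

lemma supp_uminus: "u \<in> supp C ==> (%x. - u x) \<in> supp C"
 using supp_lin[of u C u "-1" 0] by simp

text \<open>Density of \<open>W\<close> needs checking only on bounded nonnegative functions carried
  by one set of a nest: truncation, splitting into positive and negative part, and the nest itself
  supply the rest through weak closure.\<close>

lemma nest_dense:
 assumes C: "nest D C" and W: "form_subspace W"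
  and sub: "!!j f M. f \<in> supp (C j) ==> (!!x. 0 <= f x) ==> (!!x. f x <= M) ==> f \<in> e1_closure W"
 shows "form_dom \<subseteq> e1_closure W"
proof -
 have pos: "f \<in> e1_closure W" if f: "f \<in> supp (C j)" and f0: "!!x. 0 <= f x" for f j
 proof -
  have fd: "f \<in> form_dom" using f by (simp add: supp_def)
  show ?thesis
  proof (rule e1_closure_weak[OF W])
   show "l2_tendsto (refm D) (%n x. min (f x) (real n)) f" using fd by (intro min_const_l2_tendsto) auto
   fix n
   show "form (%x. min (f x) (real n)) (%x. min (f x) (real n)) <= form f f" by (rule form_truncation(4)[OF fd]) simp
   have "(%x. min (f x) (real n)) \<in> supp (C j)"
    using f form_truncation(3)[OF fd, of "real n"] unfolding supp_def by (auto elim: eventually_mono)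
   thus "(%x. min (f x) (real n)) \<in> e1_closure W"
    by (rule sub[where M="real n"]) (use f0 in auto)
  qed
 qed
 have all: "f \<in> e1_closure W" if f: "f \<in> supp (C j)" for f j
 proof -
  have "(%x. max (f x) 0) \<in> e1_closure W" by (rule pos[OF supp_pos_part[OF f]]) simp
  moreover have "(%x. max (- f x) 0) \<in> e1_closure W" by (rule pos[OF supp_pos_part[OF supp_uminus[OF f]]]) simp
  ultimately have "(%x. 1 * max (f x) 0 + (-1) * max (- f x) 0) \<in> e1_closure W" by (rule e1_closure_lin[OF W])
  moreover have "(%x. 1 * max (f x) 0 + (-1) * max (- f x) 0) = f" by (auto simp: max_def)
  ultimately show ?thesis by simp
 qed
 show ?thesis
 proof
  fix u assume u: "u \<in> form_dom"
  have "\<exists>w. \<forall>k. w k \<in> (\<Union>j. supp (C j)) \<and> e1 (%x. u x - w k x) (%x. u x - w k x) < 1 / real (Suc k)"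
  proof (rule choice, rule allI)
   fix k
   have "u \<in> e1_closure (\<Union>j. supp (C j))" using C u unfolding nest_alt by blast
   moreover have "1 / real (Suc k) > 0" by simp
   ultimately show "\<exists>w. w \<in> (\<Union>j. supp (C j)) \<and> e1 (%x. u x - w x) (%x. u x - w x) < 1 / real (Suc k)"
    unfolding e1_closure_def by blast
  qed
  then obtain w where w: "!!k. w k \<in> (\<Union>j. supp (C j))" "!!k. e1 (%x. u x - w k x) (%x. u x - w k x) < 1 / real (Suc k)" by blast
  have wd: "w k \<in> form_dom" for k using w(1)[of k] by (auto simp: supp_def)
  show "u \<in> e1_closure W"
  proof (rule e1_closure_weak[OF W])
   show "w k \<in> e1_closure W" for k using w(1)[of k] all by blast
   have e: "e1 (%x. w n x - u x) (%x. w n x - u x) <= 1 / real (Suc n)" for n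
    using w(2)[of n] e1_minus_commute[OF u wd[of n]] by linarith
   show "l2_tendsto (refm D) w u"
   proof (rule e1_tendsto_l2[OF wd u])
    show "(%n. e1 (%x. w n x - u x) (%x. w n x - u x)) ---> 0"
     by (rule tendsto_sandwich[OF _ _ tendsto_const LIMSEQ_Suc[OF lim_1_over_n]])
      (use e e1_nonneg[OF form_dom_diff[OF wd u]] in "simp_all del: of_nat_Suc")
   qed
   fix k
   have "form (w k) (w k) <= 2 * form (%x. w k x - u x) (%x. w k x - u x) + 2 * form u u"
    using form_add_le[OF form_dom_diff[OF wd[of k] u] u] by simp
   moreover have "form (%x. w k x - u x) (%x. w k x - u x) <= 1 / real (Suc k)"
    by (rule order_trans[OF form_le_e1 e])
   moreover have "1 / real (Suc k) <= 1" by simp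
   ultimately show "form (w k) (w k) <= 2 + 2 * form u u" by linarith
  qed
 qed
qed

lemma nest_closed: "nest D C ==> closedin (base D) (C k)"
 by (simp add: nest_def)

lemma nest_Suc: "nest D C ==> C k \<subseteq> C (Suc k)"
 by (simp add: nest_def)

lemma nest_sets: "nest D C ==> C k \<in> sets (refm D)"
 by (rule closedin_sets[OF nest_closed])

lemma nest_trivial: "nest D (%k. topspace (base D))"
proof -
 have "supp (topspace (base D)) = form_dom"
 proof -
  have "(AE x in refm D. x \<notin> topspace (base D) --> f x = 0) \<longleftrightarrow> True" for f :: "'s => real"
   unfolding space_refm[symmetric] by (intro iffI TrueI AE_I2) simp
  thus ?thesis unfolding supp_def by (simp only: simp_thms Collect_mem_eq)
 qed
 thus ?thesis unfolding nest_alt using e1_closure_superset[of form_dom] by simp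
qed

text \<open>For f carried by one nest and approximants w carried by the other,
  \<open>min f (max w 0)\<close> is carried by an intersection. Convergence to f in energy is not
  clear, but the energies stay bounded and convergence in mean square holds, which weak closure
  accepts.\<close>

lemma nest_Int:
 assumes C: "nest D C" and C': "nest D C'" shows "nest D (%k. C k \<inter> C' k)"
proof -
 have cl: "!!k. closedin (base D) (C k)" "!!k. C k \<subseteq> C (Suc k)" "!!k. closedin (base D) (C' k)" "!!k. C' k \<subseteq> C' (Suc k)"
  using nest_closed[OF C] nest_Suc[OF C] nest_closed[OF C'] nest_Suc[OF C'] by simp_all
 define B where "B k = C k \<inter> C' k" for k
 have incr: "B k \<subseteq> B (Suc k)" for k unfolding B_def using cl(2,4)[of k] by auto
 let ?W = "\<Union>k. supp (B k)"
 have W: "form_subspace ?W" by (rule supp_subspace[of B, OF incr])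
 have "form_dom \<subseteq> e1_closure ?W"
 proof (rule nest_dense[OF C W])
  fix j f and M :: real assume f: "f \<in> supp (C j)" and f0: "!!x. 0 <= f x"
  have fd: "f \<in> form_dom" using f by (simp add: supp_def)
  have "\<exists>w. \<forall>k. w k \<in> (\<Union>j. supp (C' j)) \<and> e1 (%x. f x - w k x) (%x. f x - w k x) < 1 / real (Suc k)"
  proof (rule choice, rule allI)
   fix k
   have "f \<in> e1_closure (\<Union>j. supp (C' j))" using C' fd unfolding nest_alt by blast
   moreover have "1 / real (Suc k) > 0" by simp
   ultimately show "\<exists>w. w \<in> (\<Union>j. supp (C' j)) \<and> e1 (%x. f x - w x) (%x. f x - w x) < 1 / real (Suc k)"
    unfolding e1_closure_def by blast
  qed
  then obtain w where w: "!!k. w k \<in> (\<Union>j. supp (C' j))" "!!k. e1 (%x. f x - w k x) (%x. f x - w k x) < 1 / real (Suc k)" by blast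
  have wd: "w k \<in> form_dom" for k using w(1)[of k] by (auto simp: supp_def)
  have e: "e1 (%x. w n x - f x) (%x. w n x - f x) <= 1 / real (Suc n)" for n
   using w(2)[of n] e1_minus_commute[OF fd wd[of n]] by linarith
  have wf: "l2_tendsto (refm D) w f"
  proof (rule e1_tendsto_l2[OF wd fd])
   show "(%n. e1 (%x. w n x - f x) (%x. w n x - f x)) ---> 0"
    by (rule tendsto_sandwich[OF _ _ tendsto_const LIMSEQ_Suc[OF lim_1_over_n]])
     (use e e1_nonneg[OF form_dom_diff[OF wd fd]] in "simp_all del: of_nat_Suc")
  qed
  show "f \<in> e1_closure ?W"
  proof (rule e1_closure_weak_aux[OF W fd])
   fix k
   obtain i where i: "w k \<in> supp (C' i)" using w(1)[of k] by blast
   have "f \<in> supp (C (max i j))" "w k \<in> supp (C' (max i j))"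
    using f i supp_mono[OF incr_mono[of C j "max i j"]] supp_mono[OF incr_mono[of C' i "max i j"]] cl by auto
   hence "(%x. min (f x) (max (w k x) 0)) \<in> supp (C (max i j) \<inter> C' (max i j))"
    unfolding supp_def
   proof (intro CollectI conjI form_min(1) fd form_pos_part(1) wd)
    assume "f \<in> {f \<in> form_dom. AE x in refm D. x \<notin> C (max i j) --> f x = 0}"
     and "w k \<in> {f \<in> form_dom. AE x in refm D. x \<notin> C' (max i j) --> f x = 0}"
    hence "AE x in refm D. x \<notin> C (max i j) --> f x = 0" "AE x in refm D. x \<notin> C' (max i j) --> w k x = 0" by auto
    thus "AE x in refm D. x \<notin> C (max i j) \<inter> C' (max i j) --> min (f x) (max (w k x) 0) = 0"
    proof eventually_elim
     case (elim x)
     thus ?case using f0[of x] by (auto simp: min_def max_def)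
    qed
   qed
   thus "(%x. min (f x) (max (w k x) 0)) \<in> ?W" unfolding B_def by blast
  next
   show "l2_tendsto (refm D) (%k x. min (f x) (max (w k x) 0)) f"
   proof (rule l2_tendsto_dominated[OF wf, where c=1])
    show "(%x. min (f x) (max (w k x) 0)) \<in> L2 (refm D)" for k
     using fd wd by (intro L2_min L2_max_const) auto
    show "AE x in refm D. \<bar>min (f x) (max (w k x) 0) - f x\<bar> <= 1 * \<bar>w k x - f x\<bar>" for k
    proof (rule AE_I2)
     fix x show "\<bar>min (f x) (max (w k x) 0) - f x\<bar> <= 1 * \<bar>w k x - f x\<bar>"
      using f0[of x] by (auto simp: min_def max_def)
    qed
   qed (use fd in auto)
   fix k
   let ?p = "%x. max (w k x) 0"
   have "form (%x. w k x - f x) (%x. w k x - f x) <= 1 / real (Suc k)"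
    by (rule order_trans[OF form_le_e1 e])
   moreover have "1 / real (Suc k) <= 1" by simp
   moreover have "form (w k) (w k) <= 2 * form (%x. w k x - f x) (%x. w k x - f x) + 2 * form f f"
    using form_add_le[OF form_dom_diff[OF wd[of k] fd] fd] by simp
   moreover note form_pos_part(2)[OF wd[of k]] form_diff_le[OF fd form_pos_part(1)[OF wd[of k]]]
   \<comment> \<open>With F the energy of f and an approximation error at most 1, the positive part
     of \<open>w k\<close> has energy at most 2 F + 2, its difference from f at most 6 F + 4, and
     the minimum at most 14 F + 8.\<close>
   ultimately show "form (%x. min (f x) (max (w k x) 0)) (%x. min (f x) (max (w k x) 0)) <= 14 * form f f + 8"
    using form_min(2)[OF fd form_pos_part(1)[OF wd[of k]]] by linarith
  qed
 qed
 hence "nest D B" unfolding nest_alt using cl incr by (simp add: B_def closedin_Int)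
 thus ?thesis by (simp add: B_def[abs_def])
qed

text \<open>Outside the union of the nest every function of the domain vanishes, being a limit of
  functions that do. As the domain is dense in L2, the indicator of a piece of finite measure there
  is a limit of such functions too, so the piece is null.\<close>

lemma nest_AE:
 assumes C: "nest D C" shows "AE x in refm D. x \<in> (\<Union>k. C k)"
proof -
 interpret sigma_finite_measure "refm D" by (rule sigma_finite)
 obtain A :: "nat => 's set" where A: "range A \<subseteq> sets (refm D)" "(\<Union>i. A i) = space (refm D)" "!!i. emeasure (refm D) (A i) ~= \<infinity>"
  using sigma_finite by blast
 have Csets: "C k \<in> sets (refm D)" for k by (rule nest_sets[OF C])
 define Z where "Z = space (refm D) - (\<Union>k. C k)"
 have Z: "Z \<in> sets (refm D)" unfolding Z_def using Csets by auto
 have dirf: "symmetric_form D" using regular by (simp add: regular_dirichlet_form_def dirichlet_form_def)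
 have van: "AE x in refm D. x \<in> Z --> v x = 0" if v: "v \<in> form_dom" for v
 proof -
  have "\<exists>w. \<forall>k. w k \<in> (\<Union>j. supp (C j)) \<and> e1 (%x. v x - w k x) (%x. v x - w k x) < 1 / real (Suc k)"
  proof (rule choice, rule allI)
   fix k
   have "v \<in> e1_closure (\<Union>j. supp (C j))" using C v unfolding nest_alt by blast
   moreover have "1 / real (Suc k) > 0" by simp
   ultimately show "\<exists>w. w \<in> (\<Union>j. supp (C j)) \<and> e1 (%x. v x - w x) (%x. v x - w x) < 1 / real (Suc k)"
    unfolding e1_closure_def by blast
  qed
  then obtain w where w: "!!k. w k \<in> (\<Union>j. supp (C j))" "!!k. e1 (%x. v x - w k x) (%x. v x - w k x) < 1 / real (Suc k)" by blast
  have wd: "w k \<in> form_dom" for k using w(1)[of k] by (auto simp: supp_def)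
  have e: "e1 (%x. w n x - v x) (%x. w n x - v x) <= 1 / real (Suc n)" for n
   using w(2)[of n] e1_minus_commute[OF v wd[of n]] by linarith
  have "l2_tendsto (refm D) w v"
  proof (rule e1_tendsto_l2[OF wd v])
   show "(%n. e1 (%x. w n x - v x) (%x. w n x - v x)) ---> 0"
    by (rule tendsto_sandwich[OF _ _ tendsto_const LIMSEQ_Suc[OF lim_1_over_n]])
     (use e e1_nonneg[OF form_dom_diff[OF wd v]] in "simp_all del: of_nat_Suc")
  qed
  from l2_tendsto_AE_subseq[OF this] obtain r where r: "AE x in refm D. (%n. w (r n) x) ---> v x" by auto
  have "AE x in refm D. \<forall>n. x \<in> Z --> w n x = 0"
  proof (subst AE_all_countable, rule allI)
   fix n
   obtain j where "w n \<in> supp (C j)" using w(1) by blast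
   hence "AE x in refm D. x \<notin> C j --> w n x = 0" by (simp add: supp_def)
   thus "AE x in refm D. x \<in> Z --> w n x = 0" by eventually_elim (auto simp: Z_def)
  qed
  with r show ?thesis
  proof eventually_elim
   case (elim x)
   thus ?case using LIMSEQ_unique[OF elim(1), of 0] by auto
  qed
 qed
 have "emeasure (refm D) (A i \<inter> Z) = 0" for i
 proof -
  have AZ: "A i \<inter> Z \<in> sets (refm D)" using A(1) Z by auto
  have fin: "emeasure (refm D) (A i \<inter> Z) < \<infinity>"
   using emeasure_mono[of "A i \<inter> Z" "A i" "refm D"] A by (auto simp: less_top[symmetric] top_unique)
  have iL: "indicator (A i \<inter> Z) \<in> L2 (refm D)"
  proof -
   have "(%x. (indicator (A i \<inter> Z) x)^2 :: real) = indicator (A i \<inter> Z)" by (auto split: split_indicator)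
   thus ?thesis unfolding L2_def using AZ fin by auto
  qed
  have "measure (refm D) (A i \<inter> Z) <= 0 + e" if e: "e > 0" for e
  proof -
   have "indicator (A i \<inter> Z) \<in> l2_closure (refm D) (fdom D)"
    using dirf iL unfolding symmetric_form_def by blast
   then obtain v where v: "v \<in> form_dom" "(\<integral>x. (indicator (A i \<inter> Z) x - v x)^2 \<partial>refm D) < e"
    using e unfolding l2_closure_def dom by blast
   have vL: "v \<in> L2 (refm D)" using v by auto
   have "measure (refm D) (A i \<inter> Z) = (\<integral>x. indicator (A i \<inter> Z) x \<partial>refm D)"
    using AZ by (simp add: Int_absorb2[OF sets.sets_into_space])
   also have "... <= (\<integral>x. (indicator (A i \<inter> Z) x - v x)^2 \<partial>refm D)"
   proof (rule integral_mono_AE)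
    show "integrable (refm D) (%x. (indicator (A i \<inter> Z) x - v x)^2)"
     using L2_diff[OF iL vL] by (simp add: L2_def)
    show "AE x in refm D. indicator (A i \<inter> Z) x <= (indicator (A i \<inter> Z) x - v x)^2"
     using van[OF v(1)] by eventually_elim (auto split: split_indicator)
   qed (use AZ fin in auto)
   finally show ?thesis using v(2) by simp
  qed
  hence "measure (refm D) (A i \<inter> Z) <= 0" by (rule field_le_epsilon)
  hence "measure (refm D) (A i \<inter> Z) = 0" using measure_nonneg[of "refm D" "A i \<inter> Z"] by linarith
  thus ?thesis using fin by (simp add: emeasure_eq_ennreal_measure less_top)
 qed
 hence "AE x in refm D. \<forall>i. x \<notin> A i \<inter> Z"
  using A(1) Z by (subst AE_all_countable, intro allI AE_not_in null_setsI) auto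
 thus ?thesis using AE_space
 proof eventually_elim
  case (elim x)
  thus ?case using A(2) by (auto simp: Z_def)
 qed
qed

text \<open>A Borel--Cantelli principle for capacities: if points of \<open>C k\<close> are lost
  from \<open>B k\<close> only where some \<open>e n\<close> with n >= k reaches 1, the loss costs
  little energy. A function f between 0 and M is corrected to
  \<open>f - M * \<bar>S k\<bar>\<close>, cut off at 0, which vanishes at the lost points because
  there the tail function \<open>S k\<close> is at least 1.\<close>

lemma nest_fast:
 assumes C: "nest D C" and e: "!!n. e n \<in> form_dom" and e0: "!!n x. e n x >= 0"
  and le: "!!n::nat. e1 (e n) (e n) <= c * (1/8)^n"
  and B: "!!k. closedin (base D) (B k)" "!!k. B k \<subseteq> B (Suc k)"
  and out: "!!k. AE x in refm D. x \<in> C k --> x \<notin> B k --> (\<exists>n\<ge>k. e n x >= 1)"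
 shows "nest D B"
proof -
 obtain S where S: "!!k. S k \<in> form_dom" "!!k. e1 (S k) (S k) <= 6 * c * (1/8)^k"
  and Sge: "!!k i. i >= k ==> AE x in refm D. e i x <= S k x"
  using fast_sum[OF e e0 le] by blast
 have c: "c >= 0" using e1_nonneg[OF e[of 0]] le[of 0] by simp
 let ?W = "\<Union>k. supp (B k)"
 have W: "form_subspace ?W" by (rule supp_subspace[of B, OF B(2)])
 have cl: "!!k. C k \<subseteq> C (Suc k)" by (rule nest_Suc[OF C])
 have SgeAE: "AE x in refm D. \<forall>i\<in>{k..}. e i x <= S k x" for k
  using Sge by (subst AE_ball_countable) auto
 have S0: "l2_tendsto (refm D) S (%x. 0)"
 proof (rule e1_tendsto_l2[OF S(1) form_dom_zero])
  have "(%n. 6 * c * (1/8)^n) ---> 6 * c * 0" by (intro tendsto_intros LIMSEQ_realpow_zero) auto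
  hence lim: "(%n. 6 * c * (1/8)^n) ---> 0" by simp
  show "(%n. e1 (%x. S n x - 0) (%x. S n x - 0)) ---> 0"
  proof (rule tendsto_sandwich[OF _ _ tendsto_const lim])
   show "\<forall>\<^sub>F n in sequentially. 0 <= e1 (%x. S n x - 0) (%x. S n x - 0)"
    using e1_nonneg[OF S(1)] by (intro always_eventually) simp
   show "\<forall>\<^sub>F n in sequentially. e1 (%x. S n x - 0) (%x. S n x - 0) <= 6 * c * (1/8)^n"
    using S(2) by (intro always_eventually) simp
  qed
 qed
 have "form_dom \<subseteq> e1_closure ?W"
 proof (rule nest_dense[OF C W])
  fix j f and M :: real assume f: "f \<in> supp (C j)" and f0: "!!x. 0 <= f x" and fM: "!!x. f x <= M"
  have M: "M >= 0" using order_trans[OF f0 fM] .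
  have fd: "f \<in> form_dom" and fj: "AE x in refm D. x \<notin> C j --> f x = 0" using f by (auto simp: supp_def)
  define g where "g i x = max (f x - M * \<bar>S (j + i) x\<bar>) 0" for i x
  have MS: "(%x. M * \<bar>S (j + i) x\<bar>) \<in> form_dom" for i by (intro form_dom_cmult form_abs(1) S(1))
  have gd: "g i \<in> form_dom" for i unfolding g_def[abs_def] by (intro form_pos_part(1) form_dom_diff fd MS)
  show "f \<in> e1_closure ?W"
  proof (rule e1_closure_weak_aux[OF W fd])
   fix i
   have "g i \<in> supp (B (j + i))" unfolding supp_def
   proof (intro CollectI conjI gd)
    show "AE x in refm D. x \<notin> B (j + i) --> g i x = 0"
     using fj out[of "j + i"] SgeAE[of "j + i"]
    proof eventually_elim
     case (elim x)
     show ?case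
     proof
      assume x: "x \<notin> B (j + i)"
      show "g i x = 0"
      proof (cases "x \<in> C j")
       case False
       thus ?thesis using elim(1) M by (simp add: g_def)
      next
       case True
       hence "x \<in> C (j + i)" using incr_mono[of C j "j + i", OF cl] by auto
       then obtain n where "n >= j + i" "e n x >= 1" using elim(2) x by blast
       hence "S (j + i) x >= 1" using elim(3) by force
       hence "M * 1 <= M * \<bar>S (j + i) x\<bar>" using M by (intro mult_left_mono) auto
       thus ?thesis using fM[of x] by (simp add: g_def)
      qed
     qed
    qed
   qed
   thus "g i \<in> ?W" by blast
  next
   have "l2_tendsto (refm D) (%i. S (j + i)) (%x. 0)"
    by (rule l2_tendsto_subseq[OF S0]) (simp add: strict_mono_def)
   thus "l2_tendsto (refm D) g f"
   proof (rule l2_tendsto_dominated[where c=M])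
    fix i
    have "\<bar>g i x - f x\<bar> <= M * \<bar>S (j + i) x - 0\<bar>" for x
     using f0[of x] mult_nonneg_nonneg[OF M abs_ge_zero[of "S (j + i) x"]] by (auto simp: g_def max_def)
    thus "AE x in refm D. \<bar>g i x - f x\<bar> <= M * \<bar>S (j + i) x - 0\<bar>" by simp
   qed (use gd fd in auto)
   fix i
   have "form (g i) (g i) <= form (%x. f x - M * \<bar>S (j + i) x\<bar>) (%x. f x - M * \<bar>S (j + i) x\<bar>)"
    unfolding g_def[abs_def] by (intro form_pos_part(2) form_dom_diff fd MS)
   also have "... <= 2 * form f f + 2 * form (%x. M * \<bar>S (j + i) x\<bar>) (%x. M * \<bar>S (j + i) x\<bar>)"
    by (rule form_diff_le[OF fd MS])
   also have "form (%x. M * \<bar>S (j + i) x\<bar>) (%x. M * \<bar>S (j + i) x\<bar>) = M^2 * form (%x. \<bar>S (j + i) x\<bar>) (%x. \<bar>S (j + i) x\<bar>)"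
    by (rule form_cmult[OF form_abs(1)[OF S(1)]])
   also have "form (%x. \<bar>S (j + i) x\<bar>) (%x. \<bar>S (j + i) x\<bar>) <= 4 * (6 * c)"
   proof -
    have "6 * c * (1/8)^(j + i) <= 6 * c * 1" using c by (intro mult_left_mono) (auto simp: power_le_one)
    thus ?thesis using form_abs(2)[OF S(1), of "j + i"] form_le_e1[of "S (j + i)"] S(2)[of "j + i"] by linarith
   qed
   finally show "form (g i) (g i) <= 2 * form f f + 2 * (M^2 * (4 * (6 * c)))" by (simp add: mult_left_mono)
  qed
 qed
 thus ?thesis unfolding nest_alt using B by auto
qed

definition regular_part :: "(nat => 's set) => nat => 's set" where
 "regular_part C k = {x \<in> topspace (base D).
   \<forall>U. openin (base D) U \<and> x \<in> U --> emeasure (refm D) (C k \<inter> U) > 0}"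

text \<open>Replacing each set of a nest by the support of the restricted measure makes \<open>m\<close>-almost
 everywhere statements about quasi-continuous functions hold everywhere on the nest.\<close>

lemma nest_regular:
 assumes C: "nest D C"
 shows "nest D (regular_part C)" "!!k. regular_part C k \<subseteq> C k"
  "!!k U x. x \<in> regular_part C k ==> openin (base D) U ==> x \<in> U ==>
    emeasure (refm D) (regular_part C k \<inter> U) > 0"
proof -
 define C' where C'_eq: "C' = regular_part C"
 have C'_def: "C' k = {x \<in> topspace (base D). \<forall>U. openin (base D) U \<and> x \<in> U --> emeasure (refm D) (C k \<inter> U) > 0}" for k
  by (simp add: C'_eq regular_part_def)
 have cl: "!!k. closedin (base D) (C k)" "!!k. C k \<subseteq> C (Suc k)" by (rule nest_closed[OF C] nest_Suc[OF C])+
 have Cs: "C k \<in> sets (refm D)" for k using cl closedin_sets by auto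
 have cl': "closedin (base D) (C' k)" for k
 proof -
  have "openin (base D) (topspace (base D) - C' k)"
  proof (subst openin_subopen, intro ballI)
   fix x assume x: "x \<in> topspace (base D) - C' k"
   then obtain U where U: "openin (base D) U" "x \<in> U" "\<not> emeasure (refm D) (C k \<inter> U) > 0"
    unfolding C'_def by blast
   have "U \<subseteq> topspace (base D) - C' k"
    using U openin_subset[OF U(1)] unfolding C'_def by blast
   with U show "\<exists>T. openin (base D) T \<and> x \<in> T \<and> T \<subseteq> topspace (base D) - C' k" by blast
  qed
  thus ?thesis unfolding closedin_def C'_def by auto
 qed
 have sub: "C' k \<subseteq> C k" for k
 proof
  fix x assume x: "x \<in> C' k"
  show "x \<in> C k"
  proof (rule ccontr)
   assume "x \<notin> C k"
   hence "openin (base D) (topspace (base D) - C k)" "x \<in> topspace (base D) - C k"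
    using cl(1)[of k] x by (auto simp: C'_def)
   hence "emeasure (refm D) (C k \<inter> (topspace (base D) - C k)) > 0" using x unfolding C'_def by blast
   thus False by simp
  qed
 qed
 have incr: "C' k \<subseteq> C' (Suc k)" for k
 proof
  fix x assume x: "x \<in> C' k"
  have "emeasure (refm D) (C (Suc k) \<inter> U) > 0" if U: "openin (base D) U" "x \<in> U" for U
  proof -
   have "emeasure (refm D) (C k \<inter> U) > 0" using x U by (auto simp: C'_def)
   also have "emeasure (refm D) (C k \<inter> U) <= emeasure (refm D) (C (Suc k) \<inter> U)"
    using cl(2)[of k] Cs openin_sets[OF U(1)] by (intro emeasure_mono) auto
   finally show ?thesis .
  qed
  thus "x \<in> C' (Suc k)" using x by (auto simp: C'_def)
 qed
 \<comment> \<open>A countable base turns the points removed from \<open>C k\<close> into a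
   countable union of null pieces; the family of all null neighbourhoods would not be controlled by
   additivity.\<close>
 obtain \<B> where \<B>: "countable \<B>" "!!V. V \<in> \<B> ==> openin (base D) V"
  "!!U x. openin (base D) U ==> x \<in> U ==> \<exists>V\<in>\<B>. x \<in> V \<and> V \<subseteq> U"
 proof -
  from second_countable_base[unfolded second_countable_def]
  obtain \<B> where "countable \<B>" "\<forall>V\<in>\<B>. openin (base D) V"
   "\<forall>U x. openin (base D) U \<and> x \<in> U --> (\<exists>V\<in>\<B>. x \<in> V \<and> V \<subseteq> U)" by (elim exE conjE)
  thus thesis by (intro that[of \<B>]) simp_all
 qed
 have null: "C k - C' k \<in> null_sets (refm D)" for k
 proof -
  let ?N = "\<Union>V\<in>{V \<in> \<B>. emeasure (refm D) (C k \<inter> V) = 0}. C k \<inter> V"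
  have "?N \<in> null_sets (refm D)"
   using \<B>(1,2) Cs openin_sets by (intro null_sets_UN') (auto intro!: null_setsI)
  moreover have "C k - C' k \<subseteq> ?N"
  proof
   fix x assume x: "x \<in> C k - C' k"
   hence "x \<in> topspace (base D)" using closedin_subset[OF cl(1)] by auto
   then obtain U where U: "openin (base D) U" "x \<in> U" "emeasure (refm D) (C k \<inter> U) = 0"
    using x unfolding C'_def by (auto simp: not_gr_zero)
   obtain V where V: "V \<in> \<B>" "x \<in> V" "V \<subseteq> U" using \<B>(3)[OF U(1,2)] by blast
   have "emeasure (refm D) (C k \<inter> V) <= emeasure (refm D) (C k \<inter> U)"
    using V Cs openin_sets[OF U(1)] by (intro emeasure_mono) auto
   thus "x \<in> ?N" using V U x by auto
  qed
  moreover have "C k - C' k \<in> sets (refm D)" using Cs cl' closedin_sets by auto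
  ultimately show ?thesis using null_sets_subset by blast
 qed
 have "supp (C' k) = supp (C k)" for k
 proof
  show "supp (C' k) \<subseteq> supp (C k)" by (rule supp_mono[OF sub])
  show "supp (C k) \<subseteq> supp (C' k)"
  proof
   fix f assume "f \<in> supp (C k)"
   hence f: "f \<in> form_dom" "AE x in refm D. x \<notin> C k --> f x = 0" by (auto simp: supp_def)
   have "AE x in refm D. x \<notin> C' k --> f x = 0"
    using f(2) AE_not_in[OF null[of k]] by eventually_elim auto
   with f show "f \<in> supp (C' k)" by (simp add: supp_def)
  qed
 qed
 thus "nest D (regular_part C)" using C cl' incr unfolding nest_alt C'_eq by simp
 show "regular_part C k \<subseteq> C k" for k using sub unfolding C'_eq .
 have "emeasure (refm D) (C' k \<inter> U) > 0" if x: "x \<in> C' k" and U: "openin (base D) U" "x \<in> U" for k U x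
 proof -
  have "emeasure (refm D) (C k \<inter> U) = emeasure (refm D) (C' k \<inter> U)"
  proof (rule emeasure_eq_AE)
   show "AE y in refm D. (y \<in> C k \<inter> U) = (y \<in> C' k \<inter> U)"
    using AE_not_in[OF null[of k]] by eventually_elim (use sub in auto)
  qed (use Cs cl' closedin_sets openin_sets[OF U(1)] in auto)
  thus ?thesis using x U by (auto simp: C'_def)
 qed
 thus "emeasure (refm D) (regular_part C k \<inter> U) > 0"
  if "x \<in> regular_part C k" "openin (base D) U" "x \<in> U" for k U x using that unfolding C'_eq by simp
qed

section \<open>Polar sets and quasi-everywhere statements\<close>

lemma polar_mono: "polar D A ==> B \<subseteq> A ==> polar D B"
 unfolding polar_def by blast

lemma polar_empty: "polar D {}"
 unfolding polar_def using nest_trivial by blast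

lemma polar_nest: "nest D C ==> polar D (topspace (base D) - (\<Union>k. C k))"
 unfolding polar_def by blast

lemma polar_Un: assumes "polar D A" "polar D B" shows "polar D (A \<union> B)"
proof -
 obtain C C' where C: "nest D C" "A \<subseteq> topspace (base D) - (\<Union>k. C k)" and C': "nest D C'" "B \<subseteq> topspace (base D) - (\<Union>k. C' k)"
  using assms unfolding polar_def by blast
 have "A \<union> B \<subseteq> topspace (base D) - (\<Union>k. C k \<inter> C' k)" using C(2) C'(2) by blast
 thus ?thesis unfolding polar_def using nest_Int[OF C(1) C'(1)] by blast
qed

text \<open>The complement of a nest is Borel, so polar sets, measurable or not, can be dealt with
  by measures.\<close>

lemma polar_sets_superset: "polar D A ==> \<exists>B. A \<subseteq> B \<and> B \<in> sets (refm D) \<and> polar D B"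
proof -
 assume "polar D A"
 then obtain C where C: "nest D C" "A \<subseteq> topspace (base D) - (\<Union>k. C k)" unfolding polar_def by blast
 have "!!k. C k \<in> sets (refm D)" by (rule nest_sets[OF C(1)])
 hence "topspace (base D) - (\<Union>k. C k) \<in> sets (refm D)" unfolding space_refm[symmetric] by auto
 thus ?thesis using C polar_nest by blast
qed

lemma polar_AE: "polar D A ==> AE x in refm D. x \<notin> A"
proof -
 assume "polar D A"
 then obtain C where C: "nest D C" "A \<subseteq> topspace (base D) - (\<Union>k. C k)" unfolding polar_def by blast
 show ?thesis using nest_AE[OF C(1)] by eventually_elim (use C(2) in auto)
qed

text \<open>The definition asks for some polar exceptional set; passing to the set of failures makes
  conjunctions and unions a matter of \<open>polar_Un\<close>.\<close>

lemma qe_on_polar: "qe_on D A Q \<longleftrightarrow> polar D {x \<in> A. \<not> Q x}"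
proof
 assume "qe_on D A Q"
 then obtain Z where "polar D Z" "\<forall>x\<in>A - Z. Q x" unfolding qe_on_def by blast
 thus "polar D {x \<in> A. \<not> Q x}" by (elim polar_mono) auto
next
 assume "polar D {x \<in> A. \<not> Q x}"
 thus "qe_on D A Q" unfolding qe_on_def by blast
qed

lemma qe_on_mono: "qe_on D A Q ==> B \<subseteq> A ==> (!!x. x \<in> B ==> Q x ==> R x) ==> qe_on D B R"
 unfolding qe_on_polar by (erule polar_mono) auto

lemma qe_on_conj: "qe_on D A Q ==> qe_on D A R ==> qe_on D A (%x. Q x \<and> R x)"
 unfolding qe_on_polar by (drule (1) polar_Un, erule polar_mono) auto

lemma qe_on_AE: "qe_on D A Q ==> AE x in refm D. x \<in> A --> Q x"
 unfolding qe_on_polar by (drule polar_AE) (auto elim: eventually_mono)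

lemma qe_on_Un: "qe_on D A Q ==> qe_on D B Q ==> qe_on D (A \<union> B) Q"
 unfolding qe_on_polar by (drule (1) polar_Un, erule polar_mono) auto

end

context dirichlet_space
begin

subsection \<open>Quasi-continuous versions\<close>

lemma quasi_continuous_common:
 assumes f: "quasi_continuous D f" and g: "quasi_continuous D g"
 obtains C where "nest D C" "!!k. continuous_map (subtopology (base D) (C k)) euclideanreal f"
  "!!k. continuous_map (subtopology (base D) (C k)) euclideanreal g"
proof -
 obtain C where C: "nest D C" "!!k. continuous_map (subtopology (base D) (C k)) euclideanreal f"
  using f unfolding quasi_continuous_def by blast
 obtain C' where C': "nest D C'" "!!k. continuous_map (subtopology (base D) (C' k)) euclideanreal g"
  using g unfolding quasi_continuous_def by blast
 show thesis
 proof (rule that)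
  show "nest D (%k. C k \<inter> C' k)" by (rule nest_Int[OF C(1) C'(1)])
  show "continuous_map (subtopology (base D) (C k \<inter> C' k)) euclideanreal f" for k
   by (rule continuous_map_from_subtopology_mono[OF C(2)]) auto
  show "continuous_map (subtopology (base D) (C k \<inter> C' k)) euclideanreal g" for k
   by (rule continuous_map_from_subtopology_mono[OF C'(2)]) auto
 qed
qed

lemma quasi_continuousI: "nest D C ==> (!!k. continuous_map (subtopology (base D) (C k)) euclideanreal f) ==> quasi_continuous D f"
 unfolding quasi_continuous_def by blast

lemma quasi_continuous_lin:
 assumes f: "quasi_continuous D f" and g: "quasi_continuous D g"
 shows "quasi_continuous D (%x. a * f x + b * g x)"
proof -
 obtain C where C: "nest D C" "!!k. continuous_map (subtopology (base D) (C k)) euclideanreal f"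
  "!!k. continuous_map (subtopology (base D) (C k)) euclideanreal g"
  by (rule quasi_continuous_common[OF f g]) (rule that, assumption+)
 show ?thesis by (rule quasi_continuousI[OF C(1)]) (intro continuous_intros C(2,3))
qed

lemma quasi_continuous_clip:
 assumes f: "quasi_continuous D f" shows "quasi_continuous D (%x. max (- c) (min (f x) c))"
proof -
 obtain C where C: "nest D C" "!!k. continuous_map (subtopology (base D) (C k)) euclideanreal f"
  using f unfolding quasi_continuous_def by blast
 show ?thesis by (rule quasi_continuousI[OF C(1)]) (intro continuous_intros C(2))
qed

lemma quasi_continuous_continuous: "continuous_map (base D) euclideanreal f ==> quasi_continuous D f"
 by (rule quasi_continuousI[OF nest_trivial]) simp

text \<open>On a regularised nest a point where g is nonzero has a relative neighbourhood of
  positive measure on which g is nonzero. So vanishing almost everywhere on an open set forces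
  vanishing at each point of the nest in it; uniqueness of quasi-continuous versions
  follows.\<close>

lemma quasi_continuous_zero_open:
 assumes g: "quasi_continuous D g" and U: "openin (base D) U" and z: "AE x in refm D. x \<in> U --> g x = 0"
 shows "qe_on D U (%x. g x = 0)"
proof -
 obtain C where C: "nest D C" "!!k. continuous_map (subtopology (base D) (C k)) euclideanreal g"
  using g unfolding quasi_continuous_def by blast
 define C' where "C' = regular_part C"
 have reg: "nest D C'" "C' k \<subseteq> C k"
  "x \<in> C' k ==> openin (base D) V ==> x \<in> V ==> emeasure (refm D) (C' k \<inter> V) > 0" for k V x
  unfolding C'_def by (rule nest_regular[OF C(1)]; assumption)+
 have "g x = 0" if x: "x \<in> C' k" "x \<in> U" for x k
 proof (rule ccontr)
  assume gx: "g x ~= 0"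
  have "openin (subtopology (base D) (C k)) {y \<in> topspace (subtopology (base D) (C k)). g y \<in> - {0}}"
   by (rule openin_continuous_map_preimage[OF C(2)]) auto
  then obtain V where V: "openin (base D) V" "{y \<in> topspace (subtopology (base D) (C k)). g y \<in> - {0}} = V \<inter> C k"
   by (auto simp: openin_subtopology)
  have xC: "x \<in> C k" using x reg(2) by auto
  moreover have "x \<in> topspace (base D)" using x(2) openin_subset[OF U] by auto
  ultimately have "x \<in> V" using V(2) gx by auto
  hence "emeasure (refm D) (C' k \<inter> (V \<inter> U)) > 0" using x V(1) U by (intro reg(3)) auto
  moreover have "emeasure (refm D) (C' k \<inter> (V \<inter> U)) = 0"
  proof -
   have "AE y in refm D. y \<notin> C' k \<inter> (V \<inter> U)"
    using z
   proof eventually_elim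
    case (elim y)
    show ?case
    proof
     assume y: "y \<in> C' k \<inter> (V \<inter> U)"
     hence "y \<in> V \<inter> C k" using reg(2) by auto
     hence "g y ~= 0" unfolding V(2)[symmetric] by simp
     with elim y show False by simp
    qed
   qed
   moreover have "C' k \<inter> (V \<inter> U) \<in> sets (refm D)"
    using nest_sets[OF reg(1)] openin_sets[OF V(1)] openin_sets[OF U] by auto
   ultimately show ?thesis by (simp add: AE_iff_null_sets null_setsD1)
  qed
  ultimately show False by simp
 qed
 thus ?thesis unfolding qe_on_def using polar_nest[OF reg(1)] openin_subset[OF U] by blast
qed

lemma quasi_continuous_AE_eq:
 assumes f: "quasi_continuous D f" and g: "quasi_continuous D g" and eq: "AE x in refm D. f x = g x"
 shows "qe_on D (topspace (base D)) (%x. f x = g x)"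
proof -
 have "qe_on D (topspace (base D)) (%x. 1 * f x + (-1) * g x = 0)"
  by (rule quasi_continuous_zero_open[OF quasi_continuous_lin[OF f g]]) (use eq in auto)
 thus ?thesis by (rule qe_on_mono) auto
qed

lemma compactly_supported_continuous: "f \<in> compactly_supported (base D) ==> continuous_map (base D) euclideanreal f"
 by (simp add: compactly_supported_def)

lemma compactly_supported_dense: "form_dom \<subseteq> e1_closure (form_dom \<inter> compactly_supported (base D))"
 using regular energy1_dense_iff[of "form_dom \<inter> compactly_supported (base D)"]
 by (simp add: regular_dirichlet_form_def dom)

text \<open>Continuous approximants with rapidly decreasing increments converge uniformly on the
  sets of a nest. The version is set to 0 off the nest, which makes it Borel as well, as the jump
  integrals require.\<close>

lemma qc_version_exists:
 assumes u: "u \<in> form_dom" shows "\<exists>g\<in>borel_measurable (refm D). qc_version D u g"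
proof -
 \<comment> \<open>Chosen so that \<open>e n\<close>, the absolute increment scaled by 2^n, has
   energy at most 4 * 4^n * 4 * a n, that is (1/8)^n / 4: the ratio 1/8 is what
   \<open>nest_fast\<close> asks for.\<close>
 define a where "a n = (1/32)^n / (64::real)" for n :: nat
 have a0: "a n > 0" for n by (simp add: a_def)
 have "\<exists>v. \<forall>n. v n \<in> form_dom \<inter> compactly_supported (base D) \<and> e1 (%x. u x - v n x) (%x. u x - v n x) < a n"
 proof (rule choice, rule allI)
  fix n
  have "u \<in> e1_closure (form_dom \<inter> compactly_supported (base D))" using u compactly_supported_dense by blast
  thus "\<exists>v. v \<in> form_dom \<inter> compactly_supported (base D) \<and> e1 (%x. u x - v x) (%x. u x - v x) < a n"
   unfolding e1_closure_def using a0[of n] by blast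
 qed
 then obtain v where v: "!!n. v n \<in> form_dom" "!!n. v n \<in> compactly_supported (base D)"
  and va: "!!n. e1 (%x. u x - v n x) (%x. u x - v n x) < a n" by blast
 have vc: "continuous_map (base D) euclideanreal (v n)" for n by (rule compactly_supported_continuous[OF v(2)])
 define e where "e n x = \<bar>2^n * (v (Suc n) x - v n x)\<bar>" for n x
 have dd: "(%x. v (Suc n) x - v n x) \<in> form_dom" for n by (intro form_dom_diff v)
 have ed: "e n \<in> form_dom" for n unfolding e_def[abs_def] by (intro form_abs(1) form_dom_cmult dd)
 have ee: "e1 (e n) (e n) <= 1 * (1/8)^n" for n
 proof -
  have eq: "(%x. v (Suc n) x - v n x) = (%x. (u x - v n x) - (u x - v (Suc n) x))" by auto
  have "e1 (%x. v (Suc n) x - v n x) (%x. v (Suc n) x - v n x) \<le>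
    2 * e1 (%x. u x - v n x) (%x. u x - v n x) + 2 * e1 (%x. u x - v (Suc n) x) (%x. u x - v (Suc n) x)"
   unfolding eq by (intro e1_diff_le form_dom_diff u v)
  also have "... <= 2 * a n + 2 * a (Suc n)" using va[of n] va[of "Suc n"] by linarith
  also have "... <= 4 * a n" by (simp add: a_def)
  finally have 1: "e1 (%x. v (Suc n) x - v n x) (%x. v (Suc n) x - v n x) <= 4 * a n" .
  have "e1 (e n) (e n) <= 4 * e1 (%x. 2^n * (v (Suc n) x - v n x)) (%x. 2^n * (v (Suc n) x - v n x))"
   unfolding e_def[abs_def] by (rule e1_abs[OF form_dom_cmult[OF dd]])
  also have "... = 4 * ((2^n)^2 * e1 (%x. v (Suc n) x - v n x) (%x. v (Suc n) x - v n x))"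
   by (simp add: e1_cmult[OF dd])
  also have "... <= 4 * ((2^n)^2 * (4 * a n))" by (intro mult_left_mono 1) auto
  also have "... = (4 * (1/32))^n / 4" unfolding power_mult_distrib a_def
   by (simp add: power2_eq_square power_mult_distrib[symmetric])
  also have "... <= 1 * (1/8)^n" by simp
  finally show ?thesis .
 qed
 \<comment> \<open>On this set the increment of every index n >= k is at most (1/2)^n; the condition
   is closed and gives uniform convergence.\<close>
 define B where "B k = {x \<in> topspace (base D). \<forall>n\<ge>k. e n x <= 1}" for k
 have Bcl: "closedin (base D) (B k)" for k
 proof -
  have "closedin (base D) {x \<in> topspace (base D). e n x \<in> {..1}}" for n
   by (rule closedin_continuous_map_preimage) (auto simp: e_def intro!: continuous_intros vc)
  hence "closedin (base D) (\<Inter>n\<in>{k..}. {x \<in> topspace (base D). e n x \<in> {..1}})"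
   by (intro closedin_Inter) auto
  moreover have "(\<Inter>n\<in>{k..}. {x \<in> topspace (base D). e n x \<in> {..1}}) = B k" by (auto simp: B_def)
  ultimately show ?thesis by simp
 qed
 have Binc: "B k \<subseteq> B (Suc k)" for k by (auto simp: B_def)
 have nB: "nest D B"
 proof (rule nest_fast[where B=B and e=e, OF nest_trivial ed _ ee Bcl Binc])
  show "0 <= e n x" for n x by (simp add: e_def)
  show "AE x in refm D. x \<in> topspace (base D) --> x \<notin> B k --> (\<exists>n\<ge>k. 1 <= e n x)" for k
   by (rule AE_I2) (auto simp: B_def not_le intro: less_imp_le)
 qed
 have step: "\<bar>v p x - v n x\<bar> <= 2 * (1/2)^n" if x: "x \<in> B k" and n: "k <= n" "n <= p" for x k n p
 proof -
  have "\<bar>v p x - v n x\<bar> = \<bar>\<Sum>i\<in>{n..<p}. v (Suc i) x - v i x\<bar>" using sum_Suc_diff'[OF n(2), of "%i. v i x"] by simp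
  also have "... <= (\<Sum>i\<in>{n..<p}. \<bar>v (Suc i) x - v i x\<bar>)" by (rule sum_abs)
  also have "... <= (\<Sum>i\<in>{n..<p}. (1/2)^i)"
  proof (rule sum_mono)
   fix i assume "i \<in> {n..<p}"
   hence "e i x <= 1" using x n by (auto simp: B_def)
   hence "2^i * \<bar>v (Suc i) x - v i x\<bar> <= 1" by (simp add: e_def abs_mult)
   thus "\<bar>v (Suc i) x - v i x\<bar> <= (1/2)^i" by (simp add: power_one_over field_simps)
  qed
  also have "... = (\<Sum>i<p - n. (1/2)^(n + i))"
   by (rule sum.reindex_bij_witness[of _ "%i. n + i" "%i. i - n"]) auto
  also have "... = (1/2)^n * (\<Sum>i<p - n. (1/2)^i)" by (simp add: power_add sum_distrib_left)
  also have "... <= (1/2)^n * 2" by (intro mult_left_mono) (auto simp: sum_gp_strict)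
  finally show ?thesis by simp
 qed
 have half0: "(%n. 2 * (1/2)^n :: real) ---> 0" using tendsto_mult_left[OF LIMSEQ_realpow_zero[of "1/2::real"], of 2] by simp
 have conv: "convergent (%n. v n x)" if x: "x \<in> B k" for x k
 proof -
  have "Cauchy (%n. v n x)"
  proof (rule metric_CauchyI)
   fix r :: real assume r: "r > 0"
   have "\<forall>\<^sub>F n in sequentially. 2 * (1/2)^n < r / 2" using r by (intro order_tendstoD(2)[OF half0]) simp
   then obtain N0 where N0: "!!n. n >= N0 ==> 2 * (1/2)^n < r / 2" unfolding eventually_sequentially by blast
   define N where "N = max N0 k"
   have N: "2 * (1/2)^N < r / 2" "N >= k" using N0[of N] by (simp_all add: N_def)
   have "dist (v p x) (v q x) < r" if "p >= N" "q >= N" for p q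
    using step[OF x N(2) that(1)] step[OF x N(2) that(2)] N(1) by (simp add: dist_real_def)
   thus "\<exists>M. \<forall>p\<ge>M. \<forall>q\<ge>M. dist (v p x) (v q x) < r" by blast
  qed
  thus ?thesis by (rule Cauchy_convergent)
 qed
 define g where "g x = (if x \<in> (\<Union>k. B k) then lim (%n. v n x) else 0)" for x
 have lim: "(%n. v n x) ---> g x" if x: "x \<in> B k" for x k
 proof -
  have "g x = lim (%n. v n x)" using x by (auto simp: g_def)
  thus ?thesis using conv[OF x] by (simp add: convergent_LIMSEQ_iff)
 qed
 have unif: "\<bar>v n x - g x\<bar> <= 2 * (1/2)^n" if x: "x \<in> B k" and n: "k <= n" for x k n
 proof (rule LIMSEQ_le_const2)
  show "(%p. \<bar>v n x - v p x\<bar>) ---> \<bar>v n x - g x\<bar>" by (intro tendsto_intros lim[OF x])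
  show "\<exists>N. \<forall>p\<ge>N. \<bar>v n x - v p x\<bar> <= 2 * (1/2)^n"
   using step[OF x n] by (intro exI[of _ n]) (auto simp: abs_minus_commute)
 qed
 have vm: "v n \<in> borel_measurable (refm D)" for n using v(1)[of n] by (intro L2_measurable) auto
 have gm: "g \<in> borel_measurable (refm D)"
  unfolding g_def using vm nest_sets[OF nB] by (intro measurable_If_set borel_measurable_lim_metric) auto
 have gc: "continuous_map (subtopology (base D) (B k)) euclideanreal g" for k
 proof -
  have "continuous_map (subtopology (base D) (B k)) Met_TC.mtopology g"
  proof (rule Met_TC.continuous_map_uniform_limit[where F=sequentially and f=v])
   show "\<forall>\<^sub>F n in sequentially. continuous_map (subtopology (base D) (B k)) Met_TC.mtopology (v n)"
    using vc by (simp add: continuous_map_from_subtopology)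
   fix r :: real assume r: "r > 0"
   have "\<forall>\<^sub>F n in sequentially. 2 * (1/2)^n < r" using r by (intro order_tendstoD(2)[OF half0])
   thus "\<forall>\<^sub>F n in sequentially. \<forall>x\<in>topspace (subtopology (base D) (B k)). g x \<in> UNIV \<and> dist (v n x) (g x) < r"
    using eventually_ge_at_top[of k]
   proof eventually_elim
    case (elim n)
    show ?case
    proof (intro ballI conjI UNIV_I)
     fix x assume "x \<in> topspace (subtopology (base D) (B k))"
     hence "x \<in> B k" by simp
     from unif[OF this elim(2)] elim(1) show "dist (v n x) (g x) < r" by (simp add: dist_real_def)
    qed
   qed
  qed simp
  thus ?thesis by simp
 qed
 have "AE x in refm D. g x = u x"
 proof -
  have va': "e1 (%x. v n x - u x) (%x. v n x - u x) <= a n" for n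
   using va[of n] e1_minus_commute[OF u v(1)[of n]] by linarith
  have "(%n. (1/32)^n / 64 :: real) ---> 0 / 64" by (intro tendsto_intros LIMSEQ_realpow_zero) auto
  hence a0: "a ---> 0" by (simp add: a_def[abs_def])
  have "l2_tendsto (refm D) v u"
  proof (rule e1_tendsto_l2[OF v(1) u])
   show "(%n. e1 (%x. v n x - u x) (%x. v n x - u x)) ---> 0"
    by (rule tendsto_sandwich[OF _ _ tendsto_const a0])
     (use va' e1_nonneg[OF form_dom_diff[OF v(1) u]] in "simp_all")
  qed
  from l2_tendsto_AE_subseq[OF this] obtain r where r: "strict_mono r" "AE x in refm D. (%n. v (r n) x) ---> u x" by blast
  from r(2) nest_AE[OF nB] show ?thesis
  proof eventually_elim
   case (elim x)
   then obtain k where "x \<in> B k" by blast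
   from LIMSEQ_subseq_LIMSEQ[OF lim[OF this] r(1)] have "(%n. v (r n) x) ---> g x" by (simp add: o_def)
   thus ?case using elim(1) by (rule LIMSEQ_unique)
  qed
 qed
 moreover have "quasi_continuous D g" by (rule quasi_continuousI[OF nB gc])
 ultimately show ?thesis using gm unfolding qc_version_def by blast
qed

lemma the_qc_version:
 assumes u: "u \<in> form_dom"
 shows "the_qc_version D u \<in> borel_measurable (refm D)" "quasi_continuous D (the_qc_version D u)"
  "AE x in refm D. the_qc_version D u x = u x"
proof -
 have "\<exists>g. g \<in> borel_measurable (refm D) \<and> qc_version D u g" using qc_version_exists[OF u] by blast
 from someI_ex[OF this, folded the_qc_version_def]
 show "the_qc_version D u \<in> borel_measurable (refm D)" "quasi_continuous D (the_qc_version D u)"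
  "AE x in refm D. the_qc_version D u x = u x" unfolding qc_version_def by blast+
qed

lemma qc_version_unique:
 "qc_version D u g ==> qc_version D u h ==> qe_on D (topspace (base D)) (%x. g x = h x)"
 unfolding qc_version_def by (intro quasi_continuous_AE_eq) (auto elim: eventually_elim2)

text \<open>Transfers zero boundary values to a limit in energy. The approximants vanish almost
  everywhere on open sets, but the intersection of these may be a null set, so quasi-continuity has
  to carry the information there.\<close>

lemma quasi_continuous_zero_limit:
 assumes v: "v \<in> form_dom" and g: "qc_version D v g"
  and vn: "!!n. vn n \<in> form_dom" and U: "!!n::nat. openin (base D) (U n)" "!!n. U (Suc n) \<subseteq> U n"
  and zero: "!!n. AE x in refm D. x \<in> U n --> vn n x = 0"
  and lim: "(%n. e1 (%x. vn n x - v x) (%x. vn n x - v x)) ---> 0"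
 shows "qe_on D (\<Inter>n. U n) (%x. g x = 0)"
proof -
 have "(1/32::real)^n / 4 > 0" for n :: nat by simp
 from strictly_fast_subseq[where g="%n. (1/32)^n / 4", OF lim this] obtain r where r: "strict_mono r"
  and fast: "!!n. e1 (%x. vn (r n) x - v x) (%x. vn (r n) x - v x) < (1/32)^n / 4" by blast
 have Umono: "U j \<subseteq> U i" if "i <= j" for i j
  using that by (rule lift_Suc_antimono_le[of U, OF U(2)])
 define V where "V n = U (r n)" for n
 have V: "openin (base D) (V n)" "V (Suc n) \<subseteq> V n" for n
  using U(1) Umono[of "r n" "r (Suc n)"] r by (auto simp: V_def strict_mono_Suc_iff less_imp_le)
 define e where "e n x = \<bar>2^n * (vn (r n) x - v x)\<bar>" for n x
 have dd: "(%x. vn (r n) x - v x) \<in> form_dom" for n by (intro form_dom_diff v vn)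
 have ed: "e n \<in> form_dom" for n unfolding e_def[abs_def] by (intro form_abs(1) form_dom_cmult dd)
 have ee: "e1 (e n) (e n) <= 1 * (1/8)^n" for n
 proof -
  have "e1 (e n) (e n) <= 4 * e1 (%x. 2^n * (vn (r n) x - v x)) (%x. 2^n * (vn (r n) x - v x))"
   unfolding e_def[abs_def] by (rule e1_abs[OF form_dom_cmult[OF dd]])
  also have "... = 4 * ((2^n)^2 * e1 (%x. vn (r n) x - v x) (%x. vn (r n) x - v x))"
   by (simp add: e1_cmult[OF dd])
  also have "... <= 4 * ((2^n)^2 * ((1/32)^n / 4))" by (intro mult_left_mono less_imp_le[OF fast]) auto
  also have "... = (4 * (1/32))^n" unfolding power_mult_distrib
   by (simp add: power2_eq_square power_mult_distrib[symmetric])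
  also have "... <= 1 * (1/8)^n" by simp
  finally show ?thesis .
 qed
 have gq: "quasi_continuous D g" and gv: "AE x in refm D. g x = v x" using g by (auto simp: qc_version_def)
 obtain C where C: "nest D C" "!!k. continuous_map (subtopology (base D) (C k)) euclideanreal g"
  using gq unfolding quasi_continuous_def by blast
 \<comment> \<open>The bound on g is imposed only inside \<open>V n\<close>; since
   \<open>V n\<close> is open this is a closed condition. At almost every point violating it
   \<open>vn (r n)\<close> vanishes and g equals v, so \<open>e n\<close> exceeds 1.\<close>
 define B where "B k = {x \<in> C k. \<forall>n\<ge>k. x \<in> V n --> 2^n * \<bar>g x\<bar> <= 1}" for k
 have Bcl: "closedin (base D) (B k)" for k
 proof -
  have "closedin (base D) ({x \<in> C k. 2^n * \<bar>g x\<bar> \<in> {..1}} \<union> (C k - V n))" for n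
  proof (rule closedin_Un)
   have "closedin (subtopology (base D) (C k)) {x \<in> topspace (subtopology (base D) (C k)). 2^n * \<bar>g x\<bar> \<in> {..1}}"
    by (rule closedin_continuous_map_preimage) (auto intro!: continuous_intros C(2))
   moreover have "topspace (subtopology (base D) (C k)) = C k"
    using closedin_subset[OF nest_closed[OF C(1)], of k] by auto
   ultimately show "closedin (base D) {x \<in> C k. 2^n * \<bar>g x\<bar> \<in> {..1}}"
    using closedin_trans_full[OF _ nest_closed[OF C(1)]] by (simp only:)
   show "closedin (base D) (C k - V n)" by (intro closedin_diff nest_closed[OF C(1)] V)
  qed
  hence "closedin (base D) (\<Inter>n\<in>{k..}. {x \<in> C k. 2^n * \<bar>g x\<bar> \<in> {..1}} \<union> (C k - V n))"
   by (intro closedin_Inter) auto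
  moreover have "(\<Inter>n\<in>{k..}. {x \<in> C k. 2^n * \<bar>g x\<bar> \<in> {..1}} \<union> (C k - V n)) = B k" by (auto simp: B_def)
  ultimately show ?thesis by simp
 qed
 have Binc: "B k \<subseteq> B (Suc k)" for k using nest_Suc[OF C(1), of k] by (auto simp: B_def)
 have nB: "nest D B"
 proof (rule nest_fast[where B=B and e=e and C=C, OF C(1) ed _ ee Bcl Binc])
  show "0 <= e n x" for n x by (simp add: e_def)
  fix k
  have "AE x in refm D. \<forall>n. x \<in> V n --> vn (r n) x = 0"
   unfolding V_def using zero by (subst AE_all_countable) blast
  with gv show "AE x in refm D. x \<in> C k --> x \<notin> B k --> (\<exists>n\<ge>k. 1 <= e n x)"
  proof eventually_elim
   case (elim x)
   show ?case
   proof (intro impI)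
    assume "x \<in> C k" "x \<notin> B k"
    then obtain n where n: "n >= k" "x \<in> V n" "\<not> 2^n * \<bar>g x\<bar> <= 1" by (auto simp: B_def)
    hence "e n x = 2^n * \<bar>g x\<bar>" using elim by (simp add: e_def abs_mult)
    with n show "\<exists>n\<ge>k. 1 <= e n x" by (intro exI[of _ n]) auto
   qed
  qed
 qed
 have "g x = 0" if x: "x \<in> (\<Inter>n. U n)" "x \<in> B k" for x k
 proof -
  have "\<bar>g x\<bar> <= (1/2)^n" if "n >= k" for n
   using x that by (auto simp: B_def V_def power_one_over field_simps)
  moreover have "(%n. (1/2::real)^n) ---> 0" by (intro LIMSEQ_realpow_zero) auto
  ultimately have "\<bar>g x\<bar> <= 0" by (intro LIMSEQ_le_const) auto
  thus ?thesis by simp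
 qed
 thus ?thesis unfolding qe_on_def using polar_nest[OF nB] openin_subset[OF U(1)] by blast
qed

lemma smooth_AE_not_polar:
 assumes "smooth_measure D \<nu>" "polar D A" shows "AE x in \<nu>. x \<notin> A"
proof -
 obtain B where B: "A \<subseteq> B" "B \<in> sets (refm D)" "polar D B" using polar_sets_superset[OF assms(2)] by blast
 have "B \<in> sets \<nu>" using B(2) assms(1) by (simp add: smooth_measure_def borel_sets)
 hence "B \<in> null_sets \<nu>" using B(3) assms(1) by (auto simp: smooth_measure_def)
 from AE_not_in[OF this] show ?thesis by eventually_elim (use B in auto)
qed

lemma smooth_qe_AE:
 assumes "smooth_measure D \<nu>" "qe_on D A Q" shows "AE x in \<nu>. x \<in> A --> Q x"
 using smooth_AE_not_polar[OF assms(1) assms(2)[unfolded qe_on_polar]] by eventually_elim auto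

end

section \<open>Transition semigroups of Hunt processes\<close>

lemma measurable_Some: "Some \<in> measurable (borel_of T) (borel_of (cemetery_topology T))"
proof (rule measurable_borel_ofI)
 show "Some \<in> space (borel_of T) \<rightarrow> topspace (cemetery_topology T)" by (simp add: topspace_cemetery_topology)
 fix U assume U: "openin (cemetery_topology T) U"
 hence "openin T (Some -` U)" by (simp add: openin_cemetery_topology)
 moreover from this have "Some -` U \<inter> space (borel_of T) = Some -` U" using openin_subset by auto
 ultimately show "Some -` U \<inter> space (borel_of T) \<in> sets (borel_of T)" using openin_borel_of by simp
qed

lemma Some_image_sets:
 assumes "A \<in> sets (borel_of T)" shows "Some ` A \<in> sets (borel_of (cemetery_topology T))"
proof -
 let ?c = "borel_of (cemetery_topology T)"
 have op: "Some ` U \<in> sets ?c" if U: "openin T U" for U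
 proof (rule openin_borel_of)
  have "Some -` Some ` U = U" by auto
  thus "openin (cemetery_topology T) (Some ` U)"
   unfolding openin_cemetery_topology using U openin_subset[OF U] by auto
 qed
 have "A \<in> sigma_sets (topspace T) {U. openin T U}"
  using assms unfolding borel_of_def by (subst (asm) sets_measure_of) (auto dest: openin_subset)
 thus ?thesis
 proof induction
  case (Basic a) thus ?case using op by simp
 next
  case Empty thus ?case by simp
 next
  case (Compl a)
  have "Some ` (topspace T - a) = Some ` topspace T - Some ` a" by auto
  thus ?case using op[of "topspace T"] Compl by auto
 next
  case (Union a)
  have "Some ` (\<Union>i. a i) = (\<Union>i. Some ` a i)" by auto
  thus ?case using Union by auto
 qed
qed

lemma None_sets: "{None} \<in> sets (borel_of (cemetery_topology T))"
proof -
 have "space (borel_of (cemetery_topology T)) - Some ` topspace T \<in> sets (borel_of (cemetery_topology T))"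
  by (intro sets.compl_sets Some_image_sets openin_borel_of openin_topspace)
 moreover have "space (borel_of (cemetery_topology T)) - Some ` topspace T = {None}"
  by (auto simp: topspace_cemetery_topology)
 ultimately show ?thesis by simp
qed

lemma measurable_ext0:
 fixes f :: "'s => 'b :: {topological_space, zero}"
 assumes f: "f \<in> borel_measurable (borel_of T)"
 shows "ext0 f \<in> borel_measurable (borel_of (cemetery_topology T))"
proof (rule measurableI)
 fix B :: "'b set" assume B: "B \<in> sets borel"
 have "ext0 f -` B \<inter> space (borel_of (cemetery_topology T)) =
   (if 0 \<in> B then {None} else {}) \<union> Some ` (f -` B \<inter> space (borel_of T))"
  by (auto simp: topspace_cemetery_topology split: option.splits)
 also have "... \<in> sets (borel_of (cemetery_topology T))"
  using Some_image_sets[OF measurable_sets[OF f B]] sets.Un[OF None_sets Some_image_sets[OF measurable_sets[OF f B]]]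
  by auto
 finally show "ext0 f -` B \<inter> space (borel_of (cemetery_topology T)) \<in> sets (borel_of (cemetery_topology T))" .
qed simp

text \<open>Only a process and its symmetry enter, so that the same facts serve the original
  process, the approximating ones and the process on the collapsed space.\<close>

locale hunt =
 fixes T :: "'s topology" and m :: "'s measure" and X :: "('s, 'w) process"
 assumes hunt: "hunt_process T X" and sym: "symmetric_process m X" and sets_m: "sets m = sets (borel_of T)"
begin

abbreviation "cem \<equiv> borel_of (cemetery_topology T)"
abbreviation "filt \<equiv> filtration T X"

lemma space_m: "space m = topspace T"
 using sets_eq_imp_space_eq[OF sets_m] by simp

lemma meas_m: "borel_measurable m = borel_measurable (borel_of T)"
 using sets_m by (intro measurable_cong_sets) auto

lemma path_space: "om \<in> sample X ==> t >= 0 ==> path X t om \<in> topspace (cemetery_topology T)"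
 using hunt unfolding hunt_process_def cadlag_paths_def by blast

lemma right_limit: "om \<in> sample X ==> t >= 0 ==> limitin (cemetery_topology T) (%s. path X s om) (path X t om) (at_right t)"
 using hunt unfolding hunt_process_def cadlag_paths_def by blast

lemma absorbing: "om \<in> sample X ==> t >= 0 ==> path X t om = None ==> s >= t ==> path X s om = None"
 using hunt unfolding hunt_process_def absorbing_cemetery_def by blast

lemma space_filt: "space (filt t) = sample X"
 unfolding filtration_def by (rule space_measure_of) auto

lemma sets_filt: "sets (filt t) = sigma_sets (sample X)
   {path X s -` B \<inter> sample X |s B. 0 <= s \<and> ennreal s <= t \<and> B \<in> sets cem}"
 unfolding filtration_def by (rule sets_measure_of) auto

lemma path_measurable: "0 <= s ==> ennreal s <= t ==> path X s \<in> measurable (filt t) cem"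
proof (rule measurableI)
 assume s: "0 <= s" "ennreal s <= t"
 show "path X s om \<in> space cem" if "om \<in> space (filt t)" for om
  using path_space[of om s] that s by (simp add: space_filt)
 show "path X s -` B \<inter> space (filt t) \<in> sets (filt t)" if "B \<in> sets cem" for B
  unfolding space_filt sets_filt using s that by (intro sigma_sets.Basic) blast
qed

lemma path_measurable_inf [measurable]: "0 <= s ==> path X s \<in> measurable (filt \<infinity>) cem"
 by (rule path_measurable) auto

lemma path_measurable_top [measurable]: "0 <= s ==> path X s \<in> measurable (filt top) cem"
 by (rule path_measurable) auto

lemma filt_mono: "s <= t ==> sets (filt s) \<subseteq> sets (filt t)"
 unfolding sets_filt by (rule sigma_sets_mono') (auto intro: order_trans)

lemma filt_measurable: "s <= t ==> f \<in> measurable (filt s) N ==> f \<in> measurable (filt t) N"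
 using filt_mono[of s t] by (auto simp: measurable_def space_filt)

lemma law_prob_algebra: "law X \<in> measurable cem (prob_algebra (filt \<infinity>))"
 using hunt unfolding hunt_process_def normal_process_def by blast

lemma law_subprob [measurable]: "law X \<in> measurable cem (subprob_algebra (filt \<infinity>))"
 by (rule measurable_prob_algebraD[OF law_prob_algebra])

lemma law_prob: "y \<in> topspace (cemetery_topology T) ==> prob_space (law X y)"
 using measurable_space[OF law_prob_algebra, of y] by (simp add: space_prob_algebra)

lemma sets_law: "y \<in> topspace (cemetery_topology T) ==> sets (law X y) = sets (filt \<infinity>)"
 using measurable_space[OF law_prob_algebra, of y] by (simp add: space_prob_algebra)

lemma space_law: "y \<in> topspace (cemetery_topology T) ==> space (law X y) = sample X"
 using sets_eq_imp_space_eq[OF sets_law] by (simp add: space_filt)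

lemma measurable_law: "y \<in> topspace (cemetery_topology T) ==> measurable (law X y) N = measurable (filt \<infinity>) N"
 using sets_law by (intro measurable_cong_sets) auto

lemma Some_space: "x \<in> topspace T ==> Some x \<in> topspace (cemetery_topology T)"
 by (simp add: topspace_cemetery_topology)

lemma path_law [measurable]: "y \<in> topspace (cemetery_topology T) ==> 0 <= s ==> path X s \<in> measurable (law X y) cem"
 by (simp add: measurable_law path_measurable_top)

lemma start_AE: "y \<in> topspace (cemetery_topology T) ==> AE om in law X y. path X 0 om = y"
 using hunt unfolding hunt_process_def normal_process_def by blast

lemma AE_sample: "y \<in> topspace (cemetery_topology T) ==> AE om in law X y. om \<in> sample X"
 using AE_space[of "law X y"] by (simp add: space_law)

lemma nn_law_measurable [measurable]:
 "F \<in> borel_measurable (filt \<infinity>) ==> (%y. \<integral>\<^sup>+om. F om \<partial>law X y) \<in> borel_measurable cem"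
 by (rule measurable_compose[OF law_subprob nn_integral_measurable_subprob_algebra])

lemma law_measurable:
 "F \<in> borel_measurable (filt \<infinity>) ==> (%y. \<integral>om. F om \<partial>law X y :: real) \<in> borel_measurable cem"
 by (rule measurable_compose[OF law_subprob integral_measurable_subprob_algebra])

lemma law_Some_measurable:
 "F \<in> borel_measurable (filt \<infinity>) ==> (%x. \<integral>om. F om \<partial>law X (Some x) :: real) \<in> borel_measurable m"
 unfolding meas_m by (rule measurable_compose[OF measurable_Some law_measurable])

lemma nn_law_Some_measurable:
 "F \<in> borel_measurable (filt \<infinity>) ==> (%x. \<integral>\<^sup>+om. F om \<partial>law X (Some x)) \<in> borel_measurable m"
 unfolding meas_m by (rule measurable_compose[OF measurable_Some nn_law_measurable])

lemma ext0_path_measurable: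
 fixes f :: "'s => 'b :: {topological_space, zero}"
 assumes "f \<in> borel_measurable m" "0 <= s" "ennreal s <= t"
 shows "(%om. ext0 f (path X s om)) \<in> borel_measurable (filt t)"
 using assms unfolding meas_m by (intro measurable_compose[OF path_measurable measurable_ext0])

subsection \<open>The Markov property\<close>

lemma filt_augmented: "A \<in> sets (filt t) ==> A \<in> augmented T X t"
 unfolding augmented_def using sets.sets_into_space[of A "filt t"] by (auto simp: space_filt intro!: bexI[of _ A])

lemma law_from_return: "y \<in> topspace (cemetery_topology T) ==> law_from X (return cem y) = law X y"
 by (rule bind_return[OF law_subprob]) simp

lemma return_initial: "y \<in> topspace (cemetery_topology T) ==> return cem y \<in> initial_laws T"
 by (simp add: space_prob_algebra prob_space_return)

lemma markov_sets:
 assumes y: "y \<in> topspace (cemetery_topology T)" and s: "s >= 0" and r: "r >= 0"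
  and A: "A \<in> sets (filt (ennreal s))" and B: "B \<in> sets cem"
 shows "emeasure (law X y) {om \<in> A. path X (s + r) om \<in> B} =
  (\<integral>\<^sup>+om. indicator A om * emeasure (law X (path X s om)) {om' \<in> sample X. path X r om' \<in> B} \<partial>law X y)"
proof -
 have A_sub: "A \<subseteq> sample X" using sets.sets_into_space[OF A] by (simp add: space_filt)
 have A_inf: "A \<in> sets (filt \<infinity>)" using A filt_mono[of "ennreal s" \<infinity>] by auto
 have stop: "stopping T X (%om. ennreal s)" unfolding stopping_def
 proof
  fix t
  have "{om \<in> sample X. ennreal s <= t} \<in> sets (filt t)"
   using sets.top[of "filt t"] by (cases "ennreal s <= t") (auto simp: space_filt)
  thus "{om \<in> sample X. ennreal s <= t} \<in> augmented T X t" by (rule filt_augmented)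
 qed
 have "A \<inter> {om \<in> sample X. ennreal s <= t} \<in> sets (filt t)" for t
 proof (cases "ennreal s <= t")
  case True
  hence "A \<inter> {om \<in> sample X. ennreal s <= t} = A" using A_sub by auto
  thus ?thesis using A filt_mono[OF True] by auto
 qed simp
 hence stA: "A \<in> stopped_events T X (%om. ennreal s)"
  unfolding stopped_events_def using filt_augmented[OF A_inf] filt_augmented by blast
 have pa: "path_at X (ennreal s + ennreal r) om = path X (s + r) om" "path_at X (ennreal s) om = path X s om" for om
  using s r by (simp_all add: path_at_def ennreal_plus[symmetric] del: ennreal_plus)
 have "strong_markov T X" using hunt by (simp add: hunt_process_def)
 hence *: "emeasure (completion (law X y)) {om \<in> A. path X (s + r) om \<in> B} =
   (\<integral>\<^sup>+om. indicator A om * emeasure (law X (path X s om)) {om' \<in> sample X. path X r om' \<in> B} \<partial>completion (law X y))"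
  unfolding strong_markov_def using return_initial[OF y] stop stA r B
  by (auto simp: law_from_return[OF y] pa dest!: bspec[where x="return cem y"] spec[where x="%om. ennreal s"])
 have "{om \<in> A. path X (s + r) om \<in> B} = A \<inter> (path X (s + r) -` B \<inter> space (filt \<infinity>))"
  using A_sub by (auto simp: space_filt)
 hence "{om \<in> A. path X (s + r) om \<in> B} \<in> sets (law X y)"
  unfolding sets_law[OF y] using A_inf measurable_sets[OF path_measurable_inf B, of "s + r"] s r by auto
 thus ?thesis using * by (simp add: nn_integral_completion)
qed

text \<open>Two monotone-class inductions: the inner one builds \<open>g\<close> from indicators
  while \<open>Z\<close> is an indicator, the outer one then builds \<open>Z\<close>.\<close>

lemma markov_nn:
 assumes y: "y \<in> topspace (cemetery_topology T)" and s: "s >= 0" and r: "r >= 0"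
  and Z: "Z \<in> borel_measurable (filt (ennreal s))" and g: "g \<in> borel_measurable cem"
 shows "(\<integral>\<^sup>+om. Z om * g (path X (s + r) om) \<partial>law X y) =
  (\<integral>\<^sup>+om. Z om * (\<integral>\<^sup>+om'. g (path X r om') \<partial>law X (path X s om)) \<partial>law X y)"
proof -
 have sr: "s + r >= 0" using s r by simp
 have [measurable]: "path X (s + r) \<in> measurable (law X y) cem" "path X s \<in> measurable (law X y) cem"
  using y s sr by auto
 have pm [measurable]: "path X r \<in> measurable (filt \<infinity>) cem" by (rule path_measurable_inf[OF r])
 have Zlaw: "Z \<in> borel_measurable (law X y)" if "Z \<in> borel_measurable (filt (ennreal s))" for Z :: "_ => ennreal"
  using filt_measurable[OF _ that, of \<infinity>] by (simp add: measurable_law[OF y])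
 have inner [measurable]: "(%om. \<integral>\<^sup>+om'. h (path X r om') \<partial>law X (path X s om)) \<in> borel_measurable (law X y)"
  if "h \<in> borel_measurable cem" for h
  by (rule measurable_compose[where N=cem, OF _ nn_law_measurable]) (use that pm in measurable)
 have hm: "(%om'. h (path X r om')) \<in> borel_measurable (law X (path X s om))" if "h \<in> borel_measurable cem" "om \<in> sample X" for h om
  using that path_space[of om s] s r measurable_compose[OF path_law, of "path X s om" r h] by auto
 have ind: "(\<integral>\<^sup>+om. indicator A om * g (path X (s + r) om) \<partial>law X y) =
  (\<integral>\<^sup>+om. indicator A om * (\<integral>\<^sup>+om'. g (path X r om') \<partial>law X (path X s om)) \<partial>law X y)"
  if A: "A \<in> sets (filt (ennreal s))" for A
  using g
 proof (induction rule: borel_measurable_induct)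
  case (cong f g)
  have "(\<integral>\<^sup>+om. indicator A om * f (path X (s + r) om) \<partial>law X y) = (\<integral>\<^sup>+om. indicator A om * g (path X (s + r) om) \<partial>law X y)"
   using cong(3) path_space sr by (intro nn_integral_cong) (auto simp: space_law[OF y])
  moreover have "(\<integral>\<^sup>+om'. f (path X r om') \<partial>law X (path X s om)) = (\<integral>\<^sup>+om'. g (path X r om') \<partial>law X (path X s om))"
   if "om \<in> sample X" for om
   using cong(3) path_space[of _ r] path_space[OF that s] r by (intro nn_integral_cong) (auto simp: space_law)
  hence "(\<integral>\<^sup>+om. indicator A om * (\<integral>\<^sup>+om'. f (path X r om') \<partial>law X (path X s om)) \<partial>law X y) =
    (\<integral>\<^sup>+om. indicator A om * (\<integral>\<^sup>+om'. g (path X r om') \<partial>law X (path X s om)) \<partial>law X y)"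
   by (intro nn_integral_cong) (auto simp: space_law[OF y])
  ultimately show ?case using cong(4) by simp
 next
  case (set B)
  have A_sub: "A \<subseteq> sample X" using sets.sets_into_space[OF A] by (simp add: space_filt)
  have As: "A \<in> sets (law X y)" using A filt_mono[of "ennreal s" \<infinity>] by (auto simp: sets_law[OF y])
  have "(\<integral>\<^sup>+om. indicator A om * indicator B (path X (s + r) om) \<partial>law X y) =
    (\<integral>\<^sup>+om. indicator {om \<in> A. path X (s + r) om \<in> B} om \<partial>law X y)"
   by (intro nn_integral_cong) (auto split: split_indicator)
  also have "... = emeasure (law X y) {om \<in> A. path X (s + r) om \<in> B}"
  proof (rule nn_integral_indicator)
   have "{om \<in> A. path X (s + r) om \<in> B} = A \<inter> (path X (s + r) -` B \<inter> space (law X y))"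
    using A_sub by (auto simp: space_law[OF y])
   thus "{om \<in> A. path X (s + r) om \<in> B} \<in> sets (law X y)"
    using As measurable_sets[OF path_law[OF y sr] set] by auto
  qed
  also have "... = (\<integral>\<^sup>+om. indicator A om * (\<integral>\<^sup>+om'. indicator B (path X r om') \<partial>law X (path X s om)) \<partial>law X y)"
   unfolding markov_sets[OF y s r A set]
  proof (rule nn_integral_cong)
   fix om assume "om \<in> space (law X y)"
   hence w: "path X s om \<in> topspace (cemetery_topology T)" using path_space s by (simp add: space_law[OF y])
   have e: "{om' \<in> sample X. path X r om' \<in> B} = path X r -` B \<inter> space (law X (path X s om))" by (auto simp: space_law[OF w])
   have "emeasure (law X (path X s om)) {om' \<in> sample X. path X r om' \<in> B} =
     (\<integral>\<^sup>+om'. indicator {om' \<in> sample X. path X r om' \<in> B} om' \<partial>law X (path X s om))"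
    unfolding e using measurable_sets[OF path_law[OF w r] set] by (intro nn_integral_indicator[symmetric])
   also have "... = (\<integral>\<^sup>+om'. indicator B (path X r om') \<partial>law X (path X s om))"
    by (intro nn_integral_cong) (auto simp: space_law[OF w] split: split_indicator)
   finally show "indicator A om * emeasure (law X (path X s om)) {om' \<in> sample X. path X r om' \<in> B} =
     indicator A om * (\<integral>\<^sup>+om'. indicator B (path X r om') \<partial>law X (path X s om))" by simp
  qed
  finally show ?case .
 next
  case (mult u c)
  have [measurable]: "A \<in> sets (law X y)" using A filt_mono[of "ennreal s" \<infinity>] by (auto simp: sets_law[OF y])
  have [measurable]: "u \<in> borel_measurable cem" by fact
  have "(\<integral>\<^sup>+om'. c * u (path X r om') \<partial>law X (path X s om)) = c * (\<integral>\<^sup>+om'. u (path X r om') \<partial>law X (path X s om))"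
   if "om \<in> space (law X y)" for om
   using hm[of u om] that mult by (intro nn_integral_cmult) (simp add: space_law[OF y])
  hence "(\<integral>\<^sup>+om. indicator A om * (\<integral>\<^sup>+om'. c * u (path X r om') \<partial>law X (path X s om)) \<partial>law X y)
    = (\<integral>\<^sup>+om. c * (indicator A om * (\<integral>\<^sup>+om'. u (path X r om') \<partial>law X (path X s om))) \<partial>law X y)"
   by (intro nn_integral_cong) (simp add: mult.left_commute)
  also have "... = c * (\<integral>\<^sup>+om. indicator A om * u (path X (s + r) om) \<partial>law X y)"
   using mult by (subst nn_integral_cmult) auto
  also have "... = (\<integral>\<^sup>+om. indicator A om * (c * u (path X (s + r) om)) \<partial>law X y)"
   by (subst nn_integral_cmult[symmetric]) (auto simp: mult.left_commute)
  finally show ?case by simp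
 next
  case (add u v)
  have [measurable]: "A \<in> sets (law X y)" using A filt_mono[of "ennreal s" \<infinity>] by (auto simp: sets_law[OF y])
  have [measurable]: "u \<in> borel_measurable cem" "v \<in> borel_measurable cem" by fact+
  have "(\<integral>\<^sup>+om'. v (path X r om') + u (path X r om') \<partial>law X (path X s om)) =
    (\<integral>\<^sup>+om'. v (path X r om') \<partial>law X (path X s om)) + (\<integral>\<^sup>+om'. u (path X r om') \<partial>law X (path X s om))"
   if "om \<in> space (law X y)" for om
   using hm[of u om] hm[of v om] that add by (intro nn_integral_add) (simp_all add: space_law[OF y])
  hence "(\<integral>\<^sup>+om. indicator A om * (\<integral>\<^sup>+om'. v (path X r om') + u (path X r om') \<partial>law X (path X s om)) \<partial>law X y)
    = (\<integral>\<^sup>+om. indicator A om * (\<integral>\<^sup>+om'. v (path X r om') \<partial>law X (path X s om)) +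
      indicator A om * (\<integral>\<^sup>+om'. u (path X r om') \<partial>law X (path X s om)) \<partial>law X y)"
   by (intro nn_integral_cong) (simp add: distrib_left)
  also have "... = (\<integral>\<^sup>+om. indicator A om * v (path X (s + r) om) \<partial>law X y) + (\<integral>\<^sup>+om. indicator A om * u (path X (s + r) om) \<partial>law X y)"
   using add by (subst nn_integral_add) auto
  also have "... = (\<integral>\<^sup>+om. indicator A om * (v (path X (s + r) om) + u (path X (s + r) om)) \<partial>law X y)"
   by (subst nn_integral_add[symmetric]) (auto simp: distrib_left)
  finally show ?case by simp
 next
  case (seq U)
  have [measurable]: "A \<in> sets (law X y)" using A filt_mono[of "ennreal s" \<infinity>] by (auto simp: sets_law[OF y])
  have [measurable]: "!!i. U i \<in> borel_measurable cem" by fact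
  have inc: "U i z <= U (Suc i) z" for i z using seq by (simp add: incseq_Suc_iff le_fun_def)
  have "(\<integral>\<^sup>+om'. (SUP i. U i) (path X r om') \<partial>law X (path X s om)) = (SUP i. \<integral>\<^sup>+om'. U i (path X r om') \<partial>law X (path X s om))"
   if "om \<in> space (law X y)" for om
   unfolding SUP_apply using hm[of "U _" om] that inc
   by (intro nn_integral_monotone_convergence_SUP) (auto simp: space_law[OF y] incseq_Suc_iff le_fun_def)
  hence "(\<integral>\<^sup>+om. indicator A om * (\<integral>\<^sup>+om'. (SUP i. U i) (path X r om') \<partial>law X (path X s om)) \<partial>law X y)
    = (\<integral>\<^sup>+om. (SUP i. indicator A om * (\<integral>\<^sup>+om'. U i (path X r om') \<partial>law X (path X s om))) \<partial>law X y)"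
   by (intro nn_integral_cong) (simp add: SUP_mult_left_ennreal)
  also have "... = (SUP i. \<integral>\<^sup>+om. indicator A om * (\<integral>\<^sup>+om'. U i (path X r om') \<partial>law X (path X s om)) \<partial>law X y)"
   using inc by (intro nn_integral_monotone_convergence_SUP) (auto simp: incseq_Suc_iff le_fun_def intro!: mult_left_mono nn_integral_mono)
  also have "... = (SUP i. \<integral>\<^sup>+om. indicator A om * U i (path X (s + r) om) \<partial>law X y)" using seq by simp
  also have "... = (\<integral>\<^sup>+om. (SUP i. indicator A om * U i (path X (s + r) om)) \<partial>law X y)"
   using inc by (intro nn_integral_monotone_convergence_SUP[symmetric]) (auto simp: incseq_Suc_iff le_fun_def intro!: mult_left_mono)
  also have "... = (\<integral>\<^sup>+om. indicator A om * (SUP i. U i) (path X (s + r) om) \<partial>law X y)"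
   by (simp add: SUP_mult_left_ennreal SUP_apply image_image)
  finally show ?case by simp
 qed
 have [measurable]: "(%om. g (path X (s + r) om)) \<in> borel_measurable (law X y)" using g by measurable
 note [measurable] = inner[OF g]
 show ?thesis using Z
 proof (induction rule: borel_measurable_induct)
  case (cong f g')
  have "(\<integral>\<^sup>+om. f om * G om \<partial>law X y) = (\<integral>\<^sup>+om. g' om * G om \<partial>law X y)" for G
   using cong(3) by (intro nn_integral_cong) (simp add: space_law[OF y] space_filt)
  thus ?case using cong(4) by simp
 next
  case (set A) thus ?case by (rule ind)
 next
  case (mult u c)
  have [measurable]: "u \<in> borel_measurable (law X y)" by (rule Zlaw, fact)
  from mult show ?case by (simp add: mult.assoc nn_integral_cmult)
 next
  case (add u v)
  have [measurable]: "u \<in> borel_measurable (law X y)" "v \<in> borel_measurable (law X y)" by (rule Zlaw, fact)+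
  from add show ?case by (simp add: distrib_right nn_integral_add)
 next
  case (seq U)
  have [measurable]: "!!i. U i \<in> borel_measurable (law X y)" using seq Zlaw by blast
  have inc: "U i z <= U (Suc i) z" for i z using seq by (simp add: incseq_Suc_iff le_fun_def)
  have *: "(\<integral>\<^sup>+om. (SUP i. U i) om * G om \<partial>law X y) = (SUP i. \<integral>\<^sup>+om. U i om * G om \<partial>law X y)"
   if [measurable]: "G \<in> borel_measurable (law X y)" for G
  proof -
   have "(\<integral>\<^sup>+om. (SUP i. U i) om * G om \<partial>law X y) = (\<integral>\<^sup>+om. (SUP i. U i om * G om) \<partial>law X y)"
    by (simp add: SUP_apply SUP_mult_right_ennreal image_image)
   also have "... = (SUP i. \<integral>\<^sup>+om. U i om * G om \<partial>law X y)"
    using inc by (intro nn_integral_monotone_convergence_SUP) (auto simp: incseq_Suc_iff le_fun_def intro!: mult_right_mono)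
   finally show ?thesis .
  qed
  show ?case using seq.IH by (subst (1 2) *) auto
 qed
qed

end

context hunt
begin

text \<open>Adding the bounds \<open>a\<close> and \<open>b\<close> makes both factors nonnegative,
  so the version for nonnegative functions applies; the added terms are removed again by
  linearity.\<close>

lemma markov_real:
 fixes Z :: "'w => real" and g :: "'s option => real"
 assumes y: "y \<in> topspace (cemetery_topology T)" and s: "s >= 0" and r: "r >= 0"
  and Z: "Z \<in> borel_measurable (filt (ennreal s))" "!!om. om \<in> sample X ==> \<bar>Z om\<bar> <= a"
  and g: "g \<in> borel_measurable cem" "!!z. z \<in> topspace (cemetery_topology T) ==> \<bar>g z\<bar> <= b"
 shows "(\<integral>om. Z om * g (path X (s + r) om) \<partial>law X y) = (\<integral>om. Z om * (\<integral>om'. g (path X r om') \<partial>law X (path X s om)) \<partial>law X y)"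
proof -
 interpret prob_space "law X y" by (rule law_prob[OF y])
 have sr: "s + r >= 0" using s r by simp
 have [measurable]: "path X (s + r) \<in> measurable (law X y) cem" "path X s \<in> measurable (law X y) cem"
  using y s sr by auto
 have Zm [measurable]: "Z \<in> borel_measurable (law X y)"
  using filt_measurable[OF _ Z(1), of \<infinity>] by (simp add: measurable_law[OF y])
 have gp: "(%om'. g (path X r om')) \<in> borel_measurable (filt \<infinity>)"
  by (rule measurable_compose[OF path_measurable_inf[OF r] g(1)])
 note [measurable] = g(1)
 define G where "G om = g (path X (s + r) om)" for om
 define H where "H om = (\<integral>om'. g (path X r om') \<partial>law X (path X s om))" for om
 have [measurable]: "G \<in> borel_measurable (law X y)" unfolding G_def by measurable
 have [measurable]: "H \<in> borel_measurable (law X y)" unfolding H_def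
  by (rule measurable_compose[where N=cem, OF _ law_measurable[OF gp]]) measurable
 have ps: "path X s om \<in> topspace (cemetery_topology T)" if "om \<in> sample X" for om using path_space[OF that s] .
 have gb: "\<bar>g (path X r om')\<bar> <= b" if "om' \<in> sample X" for om' using g(2) path_space[OF that r] by simp
 have Gb: "\<bar>G om\<bar> <= b" if "om \<in> sample X" for om unfolding G_def using g(2) path_space[OF that sr] by simp
 have gint: "integrable (law X z) (%om'. g (path X r om'))" if z: "z \<in> topspace (cemetery_topology T)" for z
 proof -
  interpret z: prob_space "law X z" by (rule law_prob[OF z])
  show ?thesis
   by (rule z.integrable_const_bound[where B=b]) (use gb gp z in "auto simp: space_law measurable_law intro!: AE_I2")
 qed
 have Hb: "\<bar>H om\<bar> <= b" if w: "om \<in> sample X" for om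
 proof -
  interpret z: prob_space "law X (path X s om)" by (rule law_prob[OF ps[OF w]])
  have "\<bar>H om\<bar> <= (\<integral>om'. \<bar>g (path X r om')\<bar> \<partial>law X (path X s om))" unfolding H_def by (rule integral_abs_bound)
  also have "... <= (\<integral>om'. b \<partial>law X (path X s om))"
   using gint[OF ps[OF w]] gb by (intro integral_mono) (auto simp: space_law[OF ps[OF w]])
  finally show ?thesis using z.prob_space by simp
 qed
 have key: "(\<integral>om. U om * (G om + b) \<partial>law X y) = (\<integral>om. U om * (H om + b) \<partial>law X y)"
  if U: "U \<in> borel_measurable (filt (ennreal s))" and U0: "!!om. om \<in> sample X ==> 0 <= U om" for U :: "'w => real"
 proof -
  have [measurable]: "U \<in> borel_measurable (law X y)"
   using filt_measurable[OF _ U, of \<infinity>] by (simp add: measurable_law[OF y])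
  have "(\<integral>\<^sup>+om. ennreal (U om * (G om + b)) \<partial>law X y) = (\<integral>\<^sup>+om. ennreal (U om) * ennreal (g (path X (s + r) om) + b) \<partial>law X y)"
   using U0 by (intro nn_integral_cong) (simp add: space_law[OF y] ennreal_mult' G_def)
  also have "... = (\<integral>\<^sup>+om. ennreal (U om) * (\<integral>\<^sup>+om'. ennreal (g (path X r om') + b) \<partial>law X (path X s om)) \<partial>law X y)"
   by (rule markov_nn[OF y s r, where g="%z. ennreal (g z + b)"]) (use U in measurable)
  also have "... = (\<integral>\<^sup>+om. ennreal (U om * (H om + b)) \<partial>law X y)"
  proof (rule nn_integral_cong)
   fix om assume "om \<in> space (law X y)"
   hence w: "om \<in> sample X" by (simp add: space_law[OF y])
   interpret z: prob_space "law X (path X s om)" by (rule law_prob[OF ps[OF w]])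
   have "(\<integral>\<^sup>+om'. ennreal (g (path X r om') + b) \<partial>law X (path X s om)) = ennreal (\<integral>om'. g (path X r om') + b \<partial>law X (path X s om))"
   proof (rule nn_integral_eq_integral)
    show "AE om' in law X (path X s om). 0 <= g (path X r om') + b"
    proof (rule AE_I2)
     fix om' assume "om' \<in> space (law X (path X s om))"
     with gb[of om'] show "0 <= g (path X r om') + b" by (simp add: space_law[OF ps[OF w]])
    qed
   qed (use gint[OF ps[OF w]] in auto)
   also have "(\<integral>om'. g (path X r om') + b \<partial>law X (path X s om)) = H om + b"
    using gint[OF ps[OF w]] z.prob_space by (simp add: H_def)
   finally show "ennreal (U om) * (\<integral>\<^sup>+om'. ennreal (g (path X r om') + b) \<partial>law X (path X s om)) = ennreal (U om * (H om + b))"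
    using U0[OF w] by (simp add: ennreal_mult')
  qed
  finally have nn: "(\<integral>\<^sup>+om. ennreal (U om * (G om + b)) \<partial>law X y) = (\<integral>\<^sup>+om. ennreal (U om * (H om + b)) \<partial>law X y)" .
  have "AE om in law X y. 0 <= U om * (G om + b)" "AE om in law X y. 0 <= U om * (H om + b)"
  proof -
   have "0 <= G om + b" "0 <= H om + b" if "om \<in> sample X" for om using Gb[OF that] Hb[OF that] by linarith+
   thus "AE om in law X y. 0 <= U om * (G om + b)" "AE om in law X y. 0 <= U om * (H om + b)"
    using U0 by (auto intro!: AE_I2 mult_nonneg_nonneg simp: space_law[OF y])
  qed
  thus ?thesis using nn by (subst (1 2) integral_eq_nn_integral) auto
 qed
 have int: "integrable (law X y) (%om. U om * V om)"
  if [measurable]: "U \<in> borel_measurable (law X y)" "V \<in> borel_measurable (law X y)"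
   and le: "!!om. om \<in> sample X ==> \<bar>U om\<bar> <= c" "!!om. om \<in> sample X ==> \<bar>V om\<bar> <= d" for U V :: "'w => real" and c d :: real
 proof (rule integrable_const_bound[where B="c * d"])
  show "AE om in law X y. norm (U om * V om) <= c * d"
  proof (rule AE_I2)
   fix om assume "om \<in> space (law X y)"
   hence "om \<in> sample X" by (simp add: space_law[OF y])
   from mult_mono[OF le(1)[OF this] le(2)[OF this]] le(1)[OF this] show "norm (U om * V om) <= c * d"
    by (simp add: abs_mult order_trans[OF abs_ge_zero])
  qed
 qed measurable
 have iG: "integrable (law X y) (%om. Z om * G om)" by (rule int[OF _ _ Z(2) Gb]) auto
 have iH: "integrable (law X y) (%om. Z om * H om)" by (rule int[OF _ _ Z(2) Hb]) auto
 have i1: "integrable (law X y) (%om. Z om * 1)" by (rule int[of Z "%om. 1" a 1]) (use Z(2) in auto)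
 have i2: "integrable (law X y) (%om. 1 * G om)" "integrable (law X y) (%om. 1 * H om)"
  by (rule int[of "%om. 1" G 1 b]; use Gb in simp) (rule int[of "%om. 1" H 1 b]; use Hb in simp)
 have "(\<integral>om. (Z om + a) * (G om + b) \<partial>law X y) = (\<integral>om. (Z om + a) * (H om + b) \<partial>law X y)"
 proof (rule key)
  show "0 <= Z om + a" if "om \<in> sample X" for om using Z(2)[OF that] by linarith
 qed (use Z(1) in measurable)
 moreover have "(\<integral>om. 1 * (G om + b) \<partial>law X y) = (\<integral>om. 1 * (H om + b) \<partial>law X y)" by (rule key) auto
 ultimately show ?thesis using iG iH i1 i2 by (simp add: algebra_simps G_def H_def)
qed

section \<open>Transition operators on square-integrable functions\<close>

lemma transition_measurable: "f \<in> borel_measurable m ==> t >= 0 ==> transition X t f \<in> borel_measurable m"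
 unfolding transition_def[abs_def] by (intro law_Some_measurable ext0_path_measurable) auto

lemma None_law:
 fixes g :: "'s => 'b :: {topological_space, zero}"
 assumes "r >= 0" shows "AE om in law X None. ext0 g (path X r om) = 0"
proof -
 have N: "None \<in> topspace (cemetery_topology T)" by (simp add: topspace_cemetery_topology)
 show ?thesis using start_AE[OF N] AE_sample[OF N]
  by eventually_elim (use absorbing[of _ 0 r] assms in auto)
qed

lemma law_transition:
 assumes "r >= 0" and z: "z \<in> topspace (cemetery_topology T)" and f: "f \<in> borel_measurable m"
 shows "(\<integral>om. ext0 f (path X r om) \<partial>law X z) = ext0 (transition X r f) z"
proof (cases z)
 case None
 have "(\<integral>om. ext0 f (path X r om) \<partial>law X None) = (\<integral>om. 0 \<partial>law X None)"
  by (rule integral_cong_AE)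
   (use None z None_law[OF assms(1), of f] ext0_path_measurable[OF f assms(1), of \<infinity>] in "auto simp: measurable_law")
 thus ?thesis using None by simp
qed (simp add: transition_def)

text \<open>The transition operator on functions with values in [0, \<infinity>], where the
  semigroup law holds at every point and before any integrability is known.\<close>

definition ntr :: "real => ('s => ennreal) => 's => ennreal" where
 "ntr t g x = (\<integral>\<^sup>+om. ext0 g (path X t om) \<partial>law X (Some x))"

lemma ntr_measurable: "g \<in> borel_measurable m ==> t >= 0 ==> ntr t g \<in> borel_measurable m"
 unfolding ntr_def[abs_def] by (intro nn_law_Some_measurable ext0_path_measurable) auto

lemma law_ntr:
 assumes "r >= 0" shows "(\<integral>\<^sup>+om. ext0 g (path X r om) \<partial>law X z) = ext0 (ntr r g) z"
proof (cases z)
 case None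
 have "(\<integral>\<^sup>+om. ext0 g (path X r om) \<partial>law X None) = (\<integral>\<^sup>+om. 0 \<partial>law X None)"
  by (rule nn_integral_cong_AE[OF None_law[OF assms]])
 thus ?thesis using None by simp
qed (simp add: ntr_def)

lemma ntr_semigroup:
 assumes "s >= 0" "r >= 0" "x \<in> topspace T" "g \<in> borel_measurable m"
 shows "ntr (s + r) g x = ntr s (ntr r g) x"
proof -
 have "ntr (s + r) g x = (\<integral>\<^sup>+om. 1 * ext0 g (path X (s + r) om) \<partial>law X (Some x))" by (simp add: ntr_def)
 also have "... = (\<integral>\<^sup>+om. 1 * (\<integral>\<^sup>+om'. ext0 g (path X r om') \<partial>law X (path X s om)) \<partial>law X (Some x))"
  by (rule markov_nn) (use assms measurable_ext0[of g T] in "auto simp: meas_m Some_space")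
 also have "... = ntr s (ntr r g) x" by (simp add: law_ntr[OF assms(2)] ntr_def)
 finally show ?thesis .
qed

lemma ntr_sym:
 "t >= 0 ==> f \<in> borel_measurable m ==> g \<in> borel_measurable m ==>
  (\<integral>\<^sup>+x. f x * ntr t g x \<partial>m) = (\<integral>\<^sup>+x. ntr t f x * g x \<partial>m)"
 using sym unfolding symmetric_process_def ntr_def by blast

lemma ntr_one_le:
 assumes "x \<in> topspace T" shows "ntr t (%_. 1) x <= 1"
proof -
 interpret prob_space "law X (Some x)" by (rule law_prob[OF Some_space[OF assms]])
 have "ntr t (%_. 1) x <= (\<integral>\<^sup>+om. 1 \<partial>law X (Some x))"
  unfolding ntr_def by (intro nn_integral_mono) (auto split: option.split)
 thus ?thesis by (simp add: emeasure_space_1)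
qed

text \<open>Symmetry tested against the constant 1: the measure is subinvariant because the process
  can only lose mass.\<close>

lemma ntr_integral_le:
 assumes "t >= 0" "g \<in> borel_measurable m" shows "(\<integral>\<^sup>+x. ntr t g x \<partial>m) <= (\<integral>\<^sup>+x. g x \<partial>m)"
proof -
 have "(\<integral>\<^sup>+x. ntr t g x \<partial>m) = (\<integral>\<^sup>+x. 1 * ntr t g x \<partial>m)" by simp
 also have "... = (\<integral>\<^sup>+x. ntr t (%_. 1) x * g x \<partial>m)" by (rule ntr_sym) (use assms in auto)
 also have "... <= (\<integral>\<^sup>+x. 1 * g x \<partial>m)" by (intro nn_integral_mono mult_right_mono ntr_one_le) (auto simp: space_m)
 finally show ?thesis by simp
qed

text \<open>By subinvariance, from almost every starting point a null set is not charged at time t.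
  This is why functions may be altered on null sets inside expectations.\<close>

lemma AE_transition:
 assumes t: "t >= 0" and Q: "AE x in m. Q x"
 shows "AE x in m. AE om in law X (Some x). \<forall>z. path X t om = Some z --> Q z"
proof -
 obtain A where A: "A \<in> sets m" "emeasure m A = 0" "{x \<in> space m. \<not> Q x} \<subseteq> A" using AE_E[OF Q] by metis
 have iA: "(indicator A :: 's => ennreal) \<in> borel_measurable m" using A by simp
 have "(\<integral>\<^sup>+x. ntr t (indicator A) x \<partial>m) <= (\<integral>\<^sup>+x. indicator A x \<partial>m)" by (rule ntr_integral_le[OF t iA])
 also have "... = 0" using A by simp
 finally have "AE x in m. ntr t (indicator A) x = 0" using ntr_measurable[OF iA t] by (simp add: nn_integral_0_iff_AE)
 thus ?thesis using AE_space
 proof eventually_elim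
  case (elim x)
  hence x: "Some x \<in> topspace (cemetery_topology T)" by (simp add: space_m Some_space)
  have "AE om in law X (Some x). ext0 (indicator A) (path X t om) = (0::ennreal)"
   using elim(1) ext0_path_measurable[OF iA t, of \<infinity>] unfolding ntr_def
   by (subst (asm) nn_integral_0_iff_AE) (auto simp: measurable_law[OF x])
  thus ?case using AE_sample[OF x]
  proof eventually_elim
   case (elim om)
   show ?case
   proof (intro allI impI)
    fix z assume z: "path X t om = Some z"
    hence "z \<in> topspace T" using path_space[OF elim(2) t] by (auto simp: topspace_cemetery_topology)
    moreover have "z \<notin> A" using elim(1) z by (auto simp: indicator_def split: if_splits)
    ultimately show "Q z" using A(3) by (auto simp: space_m)
   qed
  qed
 qed
qed

text \<open>Jensen's inequality, as Cauchy--Schwarz against the constant 1 under the law started at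
  x. The finite second moment is a hypothesis because it is available for almost every x
  only.\<close>

lemma L2_path:
 assumes t: "t >= 0" and x: "x \<in> topspace T" and u: "u \<in> borel_measurable m"
  and fin: "ntr t (%z. ennreal ((u z)^2)) x < \<infinity>"
 shows "(%om. ext0 u (path X t om)) \<in> L2 (law X (Some x))"
  and "integrable (law X (Some x)) (%om. ext0 u (path X t om))"
  and "ennreal ((transition X t u x)^2) <= ntr t (%z. ennreal ((u z)^2)) x"
proof -
 have y: "Some x \<in> topspace (cemetery_topology T)" by (rule Some_space[OF x])
 interpret prob_space "law X (Some x)" by (rule law_prob[OF y])
 let ?F = "%om. ext0 u (path X t om)"
 have Fm [measurable]: "?F \<in> borel_measurable (law X (Some x))"
  using ext0_path_measurable[OF u t, of \<infinity>] by (simp add: measurable_law[OF y])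
 have sq: "ext0 (%z. ennreal ((u z)^2)) y = ennreal ((ext0 u y)^2)" for y by (cases y) auto
 have int: "integrable (law X (Some x)) (%om. (?F om)^2)"
  by (rule integrableI_nonneg) (use fin in "auto simp: ntr_def sq")
 show F: "?F \<in> L2 (law X (Some x))" using int Fm by (simp add: L2_def)
 have one: "(%om. 1) \<in> L2 (law X (Some x))" by (simp add: L2_def)
 show "integrable (law X (Some x)) ?F" using L2_mult_integrable[OF F one] by simp
 have "(transition X t u x)^2 <= l2_inner (law X (Some x)) ?F ?F"
  using l2_Cauchy_Schwarz[OF F one] prob_space by (simp add: l2_inner_def transition_def)
 also have "... = (\<integral>om. (?F om)^2 \<partial>law X (Some x))" by (simp add: l2_inner_def power2_eq_square)
 finally have "ennreal ((transition X t u x)^2) <= ennreal (\<integral>om. (?F om)^2 \<partial>law X (Some x))" by (rule ennreal_leI)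
 also have "... = ntr t (%z. ennreal ((u z)^2)) x"
  unfolding ntr_def sq by (rule nn_integral_eq_integral[symmetric]) (use int in auto)
 finally show "ennreal ((transition X t u x)^2) <= ntr t (%z. ennreal ((u z)^2)) x" .
qed

lemma L2_nn_finite:
 assumes t: "t >= 0" and u: "u \<in> L2 m"
 shows "(\<integral>\<^sup>+x. ntr t (%z. ennreal ((u z)^2)) x \<partial>m) <= ennreal (l2_inner m u u)"
  "AE x in m. ntr t (%z. ennreal ((u z)^2)) x < \<infinity>"
proof -
 have um: "u \<in> borel_measurable m" using u by auto
 have m2: "(%z. ennreal ((u z)^2)) \<in> borel_measurable m" using um by measurable
 have "(\<integral>\<^sup>+x. ntr t (%z. ennreal ((u z)^2)) x \<partial>m) <= (\<integral>\<^sup>+z. ennreal ((u z)^2) \<partial>m)" by (rule ntr_integral_le[OF t m2])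
 also have "... = ennreal (\<integral>z. (u z)^2 \<partial>m)" using u by (intro nn_integral_eq_integral) (auto simp: L2_def)
 also have "... = ennreal (l2_inner m u u)" by (simp add: l2_inner_def power2_eq_square)
 finally show *: "(\<integral>\<^sup>+x. ntr t (%z. ennreal ((u z)^2)) x \<partial>m) <= ennreal (l2_inner m u u)" .
 have "AE x in m. ntr t (%z. ennreal ((u z)^2)) x ~= \<infinity>"
  by (rule nn_integral_PInf_AE[OF ntr_measurable[OF m2 t]]) (use * in "auto simp: top_unique")
 thus "AE x in m. ntr t (%z. ennreal ((u z)^2)) x < \<infinity>" by (simp add: less_top)
qed

lemma integrable_path_AE:
 assumes t: "t >= 0" and u: "u \<in> L2 m"
 shows "AE x in m. integrable (law X (Some x)) (%om. ext0 u (path X t om))"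
 using L2_nn_finite(2)[OF assms] AE_space
 by eventually_elim (use L2_path(2)[OF t] u in "auto simp: space_m")

lemma transition_L2:
 assumes t: "t >= 0" and u: "u \<in> L2 m"
 shows "transition X t u \<in> L2 m" "l2_norm m (transition X t u) <= l2_norm m u"
proof -
 have um: "u \<in> borel_measurable m" using u by auto
 have tm [measurable]: "transition X t u \<in> borel_measurable m" by (rule transition_measurable[OF um t])
 have "(\<integral>\<^sup>+x. ennreal ((transition X t u x)^2) \<partial>m) <= (\<integral>\<^sup>+x. ntr t (%z. ennreal ((u z)^2)) x \<partial>m)"
 proof (rule nn_integral_mono)
  fix x assume "x \<in> space m"
  thus "ennreal ((transition X t u x)^2) <= ntr t (%z. ennreal ((u z)^2)) x"
   using L2_path(3)[OF t _ um, of x] by (cases "ntr t (%z. ennreal ((u z)^2)) x < \<infinity>") (auto simp: space_m less_top[symmetric])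
 qed
 also have "... <= ennreal (l2_inner m u u)" by (rule L2_nn_finite(1)[OF t u])
 finally have le: "(\<integral>\<^sup>+x. ennreal ((transition X t u x)^2) \<partial>m) <= ennreal (l2_inner m u u)" .
 have int: "integrable m (%x. (transition X t u x)^2)"
  by (rule integrableI_nonneg) (use le in "auto intro: le_less_trans")
 thus "transition X t u \<in> L2 m" by (simp add: L2_def)
 have "ennreal (l2_inner m (transition X t u) (transition X t u)) <= ennreal (l2_inner m u u)"
  using le int by (subst (asm) nn_integral_eq_integral) (auto simp: l2_inner_def power2_eq_square)
 thus "l2_norm m (transition X t u) <= l2_norm m u" unfolding l2_norm_def by simp
qed

lemma transition_lin_AE:
 assumes t: "t >= 0" and u: "u \<in> L2 m" and v: "v \<in> L2 m"
 shows "AE x in m. transition X t (%x. a * u x + b * v x) x = a * transition X t u x + b * transition X t v x"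
 using integrable_path_AE[OF t u] integrable_path_AE[OF t v]
proof eventually_elim
 case (elim x)
 have "ext0 (%x. a * u x + b * v x) y = a * ext0 u y + b * ext0 v y" for y by (cases y) auto
 thus ?case using elim by (simp add: transition_def)
qed

lemma transition_cong_AE:
 assumes t: "t >= 0" and u: "u \<in> borel_measurable m" and v: "v \<in> borel_measurable m" and eq: "AE x in m. u x = v x"
 shows "AE x in m. transition X t u x = transition X t v x"
 using AE_transition[OF t eq] AE_space
proof eventually_elim
 case (elim x)
 hence x: "Some x \<in> topspace (cemetery_topology T)" by (simp add: space_m Some_space)
 have "AE om in law X (Some x). ext0 u (path X t om) = ext0 v (path X t om)"
  using elim(1) by eventually_elim (auto split: option.split)
 thus ?case unfolding transition_def
  by (intro integral_cong_AE)
   (use ext0_path_measurable[OF u t, of \<infinity>] ext0_path_measurable[OF v t, of \<infinity>] in "auto simp: measurable_law[OF x]")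
qed

lemma transition_nonneg: "(!!x. 0 <= u x) ==> transition X t u x >= 0"
 unfolding transition_def by (intro integral_nonneg_AE AE_I2) (auto split: option.split)

lemma ntr_transition:
 assumes t: "t >= 0" and u: "u \<in> L2 m" and u0: "!!x. 0 <= u x"
 shows "AE x in m. ntr t (%x. ennreal (u x)) x = ennreal (transition X t u x)"
 using integrable_path_AE[OF t u]
proof eventually_elim
 case (elim x)
 have e: "ext0 (%x. ennreal (u x)) y = ennreal (ext0 u y)" for y by (cases y) auto
 show ?case unfolding ntr_def transition_def e
  by (rule nn_integral_eq_integral[OF elim]) (use u0 in "auto split: option.split intro!: AE_I2")
qed

text \<open>Symmetry is given for nonnegative functions with extended values; it carries over
  because the real and the extended operator agree almost everywhere. The signed case then splits
  both arguments.\<close>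

lemma transition_sym_nonneg:
 assumes t: "t >= 0" and u: "u \<in> L2 m" "!!x. 0 <= u x" and v: "v \<in> L2 m" "!!x. 0 <= v x"
 shows "l2_inner m (transition X t u) v = l2_inner m u (transition X t v)"
proof -
 have [measurable]: "u \<in> borel_measurable m" "v \<in> borel_measurable m"
  "transition X t u \<in> borel_measurable m" "transition X t v \<in> borel_measurable m"
  using u v t by (auto intro: transition_measurable)
 have "(\<integral>\<^sup>+x. ennreal (transition X t u x * v x) \<partial>m) = (\<integral>\<^sup>+x. ntr t (%x. ennreal (u x)) x * ennreal (v x) \<partial>m)"
  using ntr_transition[OF t u] v(2) by (intro nn_integral_cong_AE) (auto elim!: eventually_mono simp: ennreal_mult'')
 also have "... = (\<integral>\<^sup>+x. ennreal (u x) * ntr t (%x. ennreal (v x)) x \<partial>m)" by (rule ntr_sym[symmetric]) (use t in auto)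
 also have "... = (\<integral>\<^sup>+x. ennreal (u x * transition X t v x) \<partial>m)"
  using ntr_transition[OF t v] u(2) by (intro nn_integral_cong_AE) (auto elim!: eventually_mono simp: ennreal_mult')
 finally show ?thesis unfolding l2_inner_def
  using u(2) v(2) transition_nonneg[of u t] transition_nonneg[of v t]
  by (subst (1 2) integral_eq_nn_integral) auto
qed

lemma transition_parts_AE:
 assumes t: "t >= 0" and u: "u \<in> L2 m"
 shows "AE x in m. transition X t u x = transition X t (%x. max (u x) 0) x - transition X t (%x. max (- u x) 0) x"
proof -
 have "(%x. max (u x) 0) \<in> L2 m" "(%x. max (- u x) 0) \<in> L2 m" using u by auto
 from transition_lin_AE[OF t this, of 1 "-1"] show ?thesis
 proof eventually_elim
  case (elim x)
  have "(%x. 1 * max (u x) 0 + - 1 * max (- u x) 0) = u" by (auto simp: max_def)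
  thus ?case using elim by simp
 qed
qed

lemma transition_sym:
 assumes t: "t >= 0" and u: "u \<in> L2 m" and v: "v \<in> L2 m"
 shows "l2_inner m (transition X t u) v = l2_inner m u (transition X t v)"
proof -
 let ?p = "%u x. max (u x) (0::real)" and ?n = "%u x. max (- u x) (0::real)"
 have dec: "l2_inner m (transition X t u) w = l2_inner m (transition X t (?p u)) w - l2_inner m (transition X t (?n u)) w"
  if u: "u \<in> L2 m" and w: "w \<in> L2 m" for u w
 proof -
  have L: "transition X t u \<in> L2 m" "transition X t (?p u) \<in> L2 m" "transition X t (?n u) \<in> L2 m"
   using transition_L2(1)[OF t] u by auto
  have "l2_inner m (transition X t u) w = l2_inner m (%x. transition X t (?p u) x - transition X t (?n u) x) w"
   using transition_parts_AE[OF t u] L w by (intro l2_inner_AE_cong) (auto intro!: L2_measurable)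
  thus ?thesis using L w by simp
 qed
 have dec2: "l2_inner m w v = l2_inner m w (?p v) - l2_inner m w (?n v)" if v: "v \<in> L2 m" and w: "w \<in> L2 m" for v w
 proof -
  have "l2_inner m w v = l2_inner m w (%x. ?p v x - ?n v x)" by (simp add: l2_inner_def max_def if_distrib cong: if_cong)
   (rule Bochner_Integration.integral_cong, auto)
  thus ?thesis using v w by simp
 qed
 have S: "l2_inner m (transition X t a) b = l2_inner m b (transition X t a)" for a b by (rule l2_inner_commute)
 have pL: "?p u \<in> L2 m" "?n u \<in> L2 m" "?p v \<in> L2 m" "?n v \<in> L2 m" using u v by auto
 note TL = transition_L2(1)[OF t]
 have "l2_inner m (transition X t u) v = l2_inner m (transition X t (?p u)) (?p v) - l2_inner m (transition X t (?p u)) (?n v)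
   - (l2_inner m (transition X t (?n u)) (?p v) - l2_inner m (transition X t (?n u)) (?n v))"
  using dec[OF u v] dec2[OF v TL[OF pL(1)]] dec2[OF v TL[OF pL(2)]] by simp
 also have "... = l2_inner m (transition X t (?p v)) (?p u) - l2_inner m (transition X t (?p v)) (?n u)
   - (l2_inner m (transition X t (?n v)) (?p u) - l2_inner m (transition X t (?n v)) (?n u))"
  using transition_sym_nonneg[OF t pL(1) _ pL(3)] transition_sym_nonneg[OF t pL(1) _ pL(4)]
   transition_sym_nonneg[OF t pL(2) _ pL(3)] transition_sym_nonneg[OF t pL(2) _ pL(4)] by (simp add: S)
 also have "... = l2_inner m (transition X t v) u"
  using dec[OF v u] dec2[OF u TL[OF pL(3)]] dec2[OF u TL[OF pL(4)]] by simp
 finally show ?thesis by (simp add: S)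
qed

text \<open>The law is exact for extended nonnegative functions; passing to real values and then to
  signed functions costs null sets.\<close>

lemma transition_comp_AE:
 assumes s: "s >= 0" and t: "t >= 0" and u: "u \<in> L2 m"
 shows "AE x in m. transition X (s + t) u x = transition X s (transition X t u) x"
proof -
 have pos: "AE x in m. transition X (s + t) u x = transition X s (transition X t u) x"
  if u: "u \<in> L2 m" and u0: "!!x. 0 <= u x" for u
 proof -
  have um: "u \<in> borel_measurable m" using u by auto
  have T0: "transition X t u x >= 0" for x by (rule transition_nonneg[OF u0])
  have st: "s + t >= 0" using s t by simp
  \<comment> \<open>The inner real transition agrees with the extended one only up to a null set,
    and this set is not charged at time s.\<close>
  have cong: "AE x in m. ntr s (ntr t (%x. ennreal (u x))) x = ntr s (%x. ennreal (transition X t u x)) x"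
   using AE_transition[OF s ntr_transition[OF t u u0]]
  proof eventually_elim
   case (elim x)
   show ?case unfolding ntr_def[of s]
    by (rule nn_integral_cong_AE) (use elim in "eventually_elim, auto split: option.split")
  qed
  from cong ntr_transition[OF st u u0] ntr_transition[OF s transition_L2(1)[OF t u] T0] AE_space show ?thesis
  proof eventually_elim
   case (elim x)
   have "ennreal (transition X (s + t) u x) = ntr s (ntr t (%x. ennreal (u x))) x"
    using elim ntr_semigroup[OF s t, of x "%x. ennreal (u x)"] um by (simp add: space_m)
   also have "... = ennreal (transition X s (transition X t u) x)" using elim by simp
   finally show ?case using transition_nonneg[OF u0] transition_nonneg[OF T0] by simp
  qed
 qed
 let ?p = "%x. max (u x) (0::real)" and ?n = "%x. max (- u x) (0::real)"
 have pL: "?p \<in> L2 m" "?n \<in> L2 m" using u by auto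
 have st: "s + t >= 0" using s t by simp
 have TL: "transition X t ?p \<in> L2 m" "transition X t ?n \<in> L2 m" "transition X t u \<in> L2 m"
  using transition_L2(1)[OF t] pL u by auto
 have 1: "AE x in m. transition X s (transition X t u) x = transition X s (%x. 1 * transition X t ?p x + (-1) * transition X t ?n x) x"
  by (rule transition_cong_AE[OF s]) (use TL transition_parts_AE[OF t u] in auto)
 have 2: "AE x in m. transition X (s + t) ?p x = transition X s (transition X t ?p) x" by (rule pos[OF pL(1)]) simp
 have 3: "AE x in m. transition X (s + t) ?n x = transition X s (transition X t ?n) x" by (rule pos[OF pL(2)]) simp
 from 1 2 3 transition_lin_AE[OF s TL(1,2), of 1 "-1"] transition_parts_AE[OF st u]
 show ?thesis by eventually_elim simp
qed

lemma transition_0: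
 assumes "x \<in> topspace T" and f: "f \<in> borel_measurable m" shows "transition X 0 f x = f x"
proof -
 have x: "Some x \<in> topspace (cemetery_topology T)" by (rule Some_space[OF assms(1)])
 interpret prob_space "law X (Some x)" by (rule law_prob[OF x])
 have "(\<integral>om. ext0 f (path X 0 om) \<partial>law X (Some x)) = (\<integral>om. f x \<partial>law X (Some x))"
  by (rule integral_cong_AE)
   (use start_AE[OF x] ext0_path_measurable[OF f, of 0 \<infinity>] in "auto simp: measurable_law[OF x] elim!: eventually_mono")
 thus ?thesis using prob_space by (simp add: transition_def)
qed

lemma transition_upper:
 assumes t: "t >= 0" and u: "u \<in> L2 m" and c: "c >= 0" and le: "AE x in m. u x <= c"
 shows "AE x in m. transition X t u x <= c"
 using AE_transition[OF t le] integrable_path_AE[OF t u] AE_space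
proof eventually_elim
 case (elim x)
 have x: "Some x \<in> topspace (cemetery_topology T)" using elim by (simp add: space_m Some_space)
 interpret prob_space "law X (Some x)" by (rule law_prob[OF x])
 have "transition X t u x <= (\<integral>om. c \<partial>law X (Some x))" unfolding transition_def
  by (rule integral_mono_AE[OF elim(2)]) (use elim(1) c in "auto elim!: eventually_mono split: option.split")
 thus ?case using prob_space by simp
qed

sublocale S: markov_l2_semigroup m "transition X"
proof
 fix t :: real and u assume t: "0 <= t" and u: "u \<in> L2 m"
 show "transition X t u \<in> L2 m" "l2_norm m (transition X t u) <= l2_norm m u" by (rule transition_L2[OF t u])+
 fix c :: real assume "0 <= c" "AE x in m. u x <= c"
 thus "AE x in m. transition X t u x <= c" by (rule transition_upper[OF t u])
next
 fix t :: real and u v w a b assume t: "0 <= t" and u: "u \<in> L2 m" and v: "v \<in> L2 m" and w: "w \<in> L2 m"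
 have L: "transition X t u \<in> L2 m" "transition X t v \<in> L2 m" "transition X t (%x. a * u x + b * v x) \<in> L2 m"
  using transition_L2(1)[OF t] u v by auto
 have "l2_inner m (transition X t (%x. a * u x + b * v x)) w = l2_inner m (%x. a * transition X t u x + b * transition X t v x) w"
  using transition_lin_AE[OF t u v] L w by (intro l2_inner_AE_cong) (auto intro!: L2_measurable)
 thus "l2_inner m (transition X t (%x. a * u x + b * v x)) w = a * l2_inner m (transition X t u) w + b * l2_inner m (transition X t v) w"
  using L w by simp
next
 fix s t :: real and u v assume s: "0 <= s" and t: "0 <= t" and u: "u \<in> L2 m" and v: "v \<in> L2 m"
 have L: "transition X s u \<in> L2 m" "transition X (s + t) u \<in> L2 m" "transition X t (transition X s u) \<in> L2 m"
  using transition_L2(1) s t u by auto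
 have "l2_inner m (transition X (s + t) u) v = l2_inner m (transition X t (transition X s u)) v"
  using transition_comp_AE[OF t s u] L v by (intro l2_inner_AE_cong) (auto simp: add.commute intro!: L2_measurable)
 also have "... = l2_inner m (transition X s u) (transition X t v)" by (rule transition_sym[OF t L(1) v])
 finally show "l2_inner m (transition X (s + t) u) v = l2_inner m (transition X s u) (transition X t v)" .
next
 fix u v assume u: "u \<in> L2 m" and v: "v \<in> L2 m"
 have "AE x in m. transition X 0 u x = u x" by (rule AE_I2) (use u in "auto simp: transition_0 space_m")
 thus "l2_inner m (transition X 0 u) v = l2_inner m u v"
  using transition_L2(1)[of 0 u] u v by (intro l2_inner_AE_cong) auto
qed

end

subsection \<open>Finite-dimensional distributions\<close>

text \<open>Folding the last time into the one before it is what conditioning on the past does, so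
  the recursion fits the Markov property; \<open>nested_shift\<close> gives the opposite reading,
  from the first time on.\<close>

fun nested :: "(real => ('s => real) => 's => real) => (nat => real) => nat => (nat => 's => real) => 's => real" where
 "nested P t 0 f = f 0"
| "nested P t (Suc k) f = nested P t k (f(k := %x. f k x * P (t (Suc k) - t k) (f (Suc k)) x))"

context hunt
begin

lemma transition_bounded:
 assumes r: "r >= 0" and x: "x \<in> topspace T" and f: "f \<in> borel_measurable m"
  and b: "!!z. z \<in> topspace T ==> \<bar>f z\<bar> <= c" and c: "c >= 0"
 shows "\<bar>transition X r f x\<bar> <= c"
proof -
 have y: "Some x \<in> topspace (cemetery_topology T)" by (rule Some_space[OF x])
 interpret prob_space "law X (Some x)" by (rule law_prob[OF y])
 have fm: "(%om. ext0 f (path X r om)) \<in> borel_measurable (law X (Some x))"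
  using ext0_path_measurable[OF f r, of \<infinity>] by (simp add: measurable_law[OF y])
 have bd: "\<bar>ext0 f (path X r om)\<bar> <= c" if "om \<in> sample X" for om
  using path_space[OF that r] b c by (auto simp: topspace_cemetery_topology split: option.split)
 have int: "integrable (law X (Some x)) (%om. ext0 f (path X r om))"
  by (rule integrable_const_bound[where B=c]) (use bd fm in "auto simp: space_law[OF y] intro!: AE_I2")
 have "\<bar>transition X r f x\<bar> <= (\<integral>om. \<bar>ext0 f (path X r om)\<bar> \<partial>law X (Some x))" unfolding transition_def by (rule integral_abs_bound)
 also have "... <= (\<integral>om. c \<partial>law X (Some x))" by (rule integral_mono) (use int bd in "auto simp: space_law[OF y]")
 finally show ?thesis using prob_space by simp
qed

text \<open>Induction with varying functions: the Markov property at \<open>t k\<close> replaces the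
  last factor by a transition operator, whose product with \<open>f k\<close> is measurable and
  bounded again.\<close>

lemma finite_dimensional:
 assumes x: "x \<in> topspace T" and t0: "t 0 = 0" and tm: "!!j. j < k ==> t j <= t (Suc j)"
  and f: "!!j. j <= k ==> f j \<in> borel_measurable m" "!!j. j <= k ==> \<exists>c. \<forall>z\<in>topspace T. \<bar>f j z\<bar> <= c"
 shows "(\<integral>om. (\<Prod>j\<le>k. ext0 (f j) (path X (t j) om)) \<partial>law X (Some x)) = nested (transition X) t k f x"
 using tm f
proof (induction k arbitrary: f)
 case 0
 have "(\<Prod>j\<le>(0::nat). h j) = h 0" for h :: "nat => real" by simp
 thus ?case using transition_0[OF x, of "f 0"] 0 by (simp only: t0 transition_def nested.simps)
next
 case (Suc k)
 have y: "Some x \<in> topspace (cemetery_topology T)" by (rule Some_space[OF x])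
 have tle: "t i <= t j" if "i <= j" "j <= Suc k" for i j
  using that Suc.prems(1) by (induction j) (auto simp: le_Suc_eq intro: order_trans)
 have tpos: "0 <= t j" if "j <= Suc k" for j using tle[of 0 j] that t0 by simp
 define r where "r = t (Suc k) - t k"
 have r: "r >= 0" using tle[of k "Suc k"] by (simp add: r_def)
 define f' where "f' = f(k := %x. f k x * transition X r (f (Suc k)) x)"
 let ?Z = "%om. \<Prod>j\<le>k. ext0 (f j) (path X (t j) om)"
 have "\<exists>c. \<forall>j\<le>Suc k. \<forall>z\<in>topspace T. \<bar>f j z\<bar> <= c j" 
 proof -
  have "\<forall>j. \<exists>c. j <= Suc k --> (\<forall>z\<in>topspace T. \<bar>f j z\<bar> <= c)" using Suc.prems(3) by blast
  from choice[OF this] show ?thesis by blast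
 qed
 then obtain c where c: "!!j z. j <= Suc k ==> z \<in> topspace T ==> \<bar>f j z\<bar> <= c j" by blast
 have c0: "c j >= 0" if "j <= Suc k" for j using c[OF that x] by linarith
 have eb: "\<bar>ext0 (f j) z\<bar> <= c j" if "j <= Suc k" "z \<in> topspace (cemetery_topology T)" for j z
  using that c[OF that(1)] c0[OF that(1)] by (auto simp: topspace_cemetery_topology split: option.split)
 have Zm: "?Z \<in> borel_measurable (filt (ennreal (t k)))"
  using Suc.prems(2) tpos tle by (intro borel_measurable_prod ext0_path_measurable ennreal_leI) auto
 have Zb: "\<bar>?Z om\<bar> <= (\<Prod>j\<le>k. c j)" if "om \<in> sample X" for om
  unfolding abs_prod using eb path_space[OF that] tpos by (intro prod_mono) auto
 have f'm: "f' j \<in> borel_measurable m" if "j <= k" for j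
  using Suc.prems(2)[of j] Suc.prems(2)[of k] transition_measurable[OF Suc.prems(2)[of "Suc k"] r] that by (auto simp: f'_def)
 have f'b: "\<exists>c. \<forall>z\<in>topspace T. \<bar>f' j z\<bar> <= c" if j: "j <= k" for j
 proof (cases "j = k")
  case True
  have "\<bar>f k z * transition X r (f (Suc k)) z\<bar> <= c k * c (Suc k)" if z: "z \<in> topspace T" for z
   unfolding abs_mult using c[of k z] transition_bounded[OF r z Suc.prems(2)[of "Suc k"] c[of "Suc k"] c0] z c0[of k]
   by (intro mult_mono) auto
  thus ?thesis using True by (auto simp: f'_def)
 next
  case False
  thus ?thesis using c[of j] j by (auto simp: f'_def)
 qed
 have "(\<integral>om. (\<Prod>j\<le>Suc k. ext0 (f j) (path X (t j) om)) \<partial>law X (Some x)) =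
   (\<integral>om. ?Z om * ext0 (f (Suc k)) (path X (t k + r) om) \<partial>law X (Some x))"
  by (simp add: r_def mult.commute)
 also have "... = (\<integral>om. ?Z om * (\<integral>om'. ext0 (f (Suc k)) (path X r om') \<partial>law X (path X (t k) om)) \<partial>law X (Some x))"
  using Zm Zb eb measurable_ext0[of "f (Suc k)" T] Suc.prems(2)[of "Suc k"] tpos[of k]
  by (intro markov_real[OF y _ r, where a="\<Prod>j\<le>k. c j" and b="c (Suc k)"]) (auto simp: meas_m)
 also have "... = (\<integral>om. (\<Prod>j\<le>k. ext0 (f' j) (path X (t j) om)) \<partial>law X (Some x))"
 proof (rule Bochner_Integration.integral_cong[OF refl])
  fix om assume "om \<in> space (law X (Some x))"
  hence "path X (t k) om \<in> topspace (cemetery_topology T)" using path_space tpos[of k] by (simp add: space_law[OF y])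
  hence a: "(\<integral>om'. ext0 (f (Suc k)) (path X r om') \<partial>law X (path X (t k) om)) = ext0 (transition X r (f (Suc k))) (path X (t k) om)"
   using law_transition[OF r] Suc.prems(2)[of "Suc k"] by simp
  have b: "ext0 (f k) z * ext0 (transition X r (f (Suc k))) z = ext0 (f' k) z" for z by (cases z) (auto simp: f'_def)
  have "(\<Prod>j<k. ext0 (f j) (path X (t j) om)) = (\<Prod>j<k. ext0 (f' j) (path X (t j) om))"
  proof (rule prod.cong[OF refl])
   fix j assume "j \<in> {..<k}"
   hence "f' j = f j" by (simp add: f'_def)
   thus "ext0 (f j) (path X (t j) om) = ext0 (f' j) (path X (t j) om)" by metis
  qed
  thus "?Z om * (\<integral>om'. ext0 (f (Suc k)) (path X r om') \<partial>law X (path X (t k) om)) = (\<Prod>j\<le>k. ext0 (f' j) (path X (t j) om))"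
   unfolding a lessThan_Suc_atMost[symmetric] by (simp add: b[symmetric] mult.assoc)
 qed
 also have "... = nested (transition X) t k f' x"
  by (rule Suc.IH) (use Suc.prems(1) f'm f'b in auto)
 finally show ?case by (simp add: f'_def r_def)
qed

end

section \<open>Hitting times\<close>

lemma openin_cemetery_Some: "openin T U ==> openin (cemetery_topology T) (Some ` U)"
proof -
 assume U: "openin T U"
 have "Some -` Some ` U = U" by auto
 thus ?thesis unfolding openin_cemetery_topology using U openin_subset[OF U] by auto
qed

lemma continuous_map_ext0:
 assumes f: "f \<in> compactly_supported T" shows "continuous_map (cemetery_topology T) euclideanreal (ext0 f)"
proof -
 have fc: "continuous_map T euclideanreal f" using f by (simp add: compactly_supported_def)
 obtain C where C: "compactin T C" "!!x. x \<in> topspace T - C ==> f x = 0" using f unfolding compactly_supported_def by blast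
 have "openin (cemetery_topology T) {y \<in> topspace (cemetery_topology T). ext0 f y \<in> V}" if V: "openin euclideanreal V" for V
 proof -
  let ?W = "{y \<in> topspace (cemetery_topology T). ext0 f y \<in> V}"
  have e: "Some -` ?W = {x \<in> topspace T. f x \<in> V}" by (auto simp: topspace_cemetery_topology)
  have 1: "openin T (Some -` ?W)" unfolding e by (rule openin_continuous_map_preimage[OF fc V])
  have "compactin T (topspace T - Some -` ?W)" if "None \<in> ?W"
  proof (rule closed_compactin[OF C(1)])
   show "topspace T - Some -` ?W \<subseteq> C" using that C(2) unfolding e by auto
   show "closedin T (topspace T - Some -` ?W)" using 1 by auto
  qed
  thus ?thesis unfolding openin_cemetery_topology using 1 by (auto simp: topspace_cemetery_topology)
 qed
 thus ?thesis unfolding continuous_map_def by auto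
qed

text \<open>At an infinite time \<open>enn2real\<close> returns 0 and the exponential equals 1
  instead of 0; the last assumption on \<open>b\<close> supplies the correct value.\<close>

lemma enn2real_tendsto_top:
 assumes "(s :: nat => ennreal) ---> \<infinity>" "\<alpha> > 0" "!!n. \<bar>b n\<bar> <= (1::real)" "!!n. s n = \<infinity> ==> b n = 0"
 shows "(%n. exp (- \<alpha> * enn2real (s n)) * b n) ---> 0"
proof (rule LIMSEQ_I)
 fix r :: real assume r: "r > 0"
 define c where "c = max 0 (- ln r / \<alpha>) + 1"
 have "\<forall>\<^sub>F n in sequentially. ennreal c < s n" by (rule order_tendstoD(1)[OF assms(1)]) simp
 then obtain N where N: "!!n. n >= N ==> ennreal c < s n" by (auto simp: eventually_sequentially)
 have "norm (exp (- \<alpha> * enn2real (s n)) * b n - 0) < r" if "n >= N" for n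
 proof (cases "s n = \<infinity>")
  case True
  thus ?thesis using assms(4) r by simp
 next
  case False
  then obtain a where a: "s n = ennreal a" "a >= 0" by (cases "s n") auto
  have "c >= 0" by (simp add: c_def)
  hence "c < a" using N[OF that] unfolding a(1) by (simp add: ennreal_less_iff)
  hence "- ln r / \<alpha> < a" by (simp add: c_def)
  hence "- \<alpha> * a < ln r" using assms(2) by (simp add: field_simps)
  hence "exp (- \<alpha> * a) < r" using r by (metis exp_less_mono exp_ln)
  moreover have "exp (- \<alpha> * a) * \<bar>b n\<bar> <= exp (- \<alpha> * a) * 1" using assms(3) by (intro mult_left_mono) auto
  ultimately have "exp (- \<alpha> * a) * \<bar>b n\<bar> < r" by linarith
  thus ?thesis using a by (simp add: abs_mult)
 qed
 thus "\<exists>no. \<forall>n\<ge>no. norm (exp (- \<alpha> * enn2real (s n)) * b n - 0) < r" by blast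
qed

context hunt
begin

section \<open>Hitting times along a path and along a time grid\<close>

definition hitset :: "'s set => 'w => real set" where
 "hitset A om = {t. 0 <= t \<and> path X t om \<in> Some ` A}"

lemma hitting_time_hitset: "hitting_time X A om = Inf (ennreal ` hitset A om)"
 unfolding hitting_time_def hitset_def by (rule arg_cong[where f=Inf]) auto

lemma hitset_bdd: "bdd_below (hitset A om)"
 by (rule bdd_belowI[of _ 0]) (simp add: hitset_def)

lemma hitting_time_eq:
 assumes "hitset A om ~= {}"
 shows "hitting_time X A om = ennreal (Inf (hitset A om))" "Inf (hitset A om) >= 0"
proof -
 show i0: "Inf (hitset A om) >= 0" by (rule cInf_greatest[OF assms]) (simp add: hitset_def)
 show "hitting_time X A om = ennreal (Inf (hitset A om))" unfolding hitting_time_hitset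
 proof (rule antisym)
  obtain t where t: "t \<in> hitset A om" using assms by blast
  have "Inf (ennreal ` hitset A om) <= ennreal t" by (rule Inf_lower) (use t in auto)
  hence "Inf (ennreal ` hitset A om) < \<infinity>" by (rule le_less_trans) simp
  then obtain a where a: "Inf (ennreal ` hitset A om) = ennreal a" "a >= 0" by (cases "Inf (ennreal ` hitset A om)") auto
  have "a <= Inf (hitset A om)"
  proof (rule cInf_greatest[OF assms])
   fix s assume s: "s \<in> hitset A om"
   hence "ennreal a <= ennreal s" unfolding a(1)[symmetric] by (intro Inf_lower) auto
   thus "a <= s" using s by (simp add: hitset_def)
  qed
  thus "Inf (ennreal ` hitset A om) <= ennreal (Inf (hitset A om))" unfolding a by (rule ennreal_leI)
  show "ennreal (Inf (hitset A om)) <= Inf (ennreal ` hitset A om)"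
   by (rule Inf_greatest) (auto intro!: ennreal_leI cInf_lower hitset_bdd)
 qed
qed

lemma hitting_time_empty: "hitset A om = {} ==> hitting_time X A om = \<infinity>"
 by (simp add: hitting_time_hitset)

lemma hitting_time_le: "t \<in> hitset A om ==> hitting_time X A om <= ennreal t"
 unfolding hitting_time_hitset by (intro Inf_lower) auto

lemma hitting_time_mono: "A \<subseteq> B ==> hitting_time X B om <= hitting_time X A om"
 unfolding hitting_time_hitset by (intro Inf_superset_mono image_mono) (auto simp: hitset_def)

lemma ext0_right_cont:
 assumes f: "f \<in> compactly_supported T" and w: "om \<in> sample X" and t: "t >= 0"
 shows "((%s. ext0 f (path X s om)) \<longlongrightarrow> ext0 f (path X t om)) (at_right t)"
 using continuous_map_limit[OF continuous_map_ext0[OF f] right_limit[OF w t]] by (simp add: o_def)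

lemma ext0_right_seq:
 assumes f: "f \<in> compactly_supported T" and w: "om \<in> sample X" and t: "t >= 0"
  and s: "s ---> t" "!!k. s k >= t"
 shows "(%k. ext0 f (path X (s k) om)) ---> ext0 f (path X t om)"
proof -
 have "((%s. ext0 f (path X s om)) \<longlongrightarrow> ext0 f (path X t om)) (at t within {t..})"
  using ext0_right_cont[OF f w t] by (simp add: at_within_Ici_at_right)
 hence "continuous (at t within {t..}) (%s. ext0 f (path X s om))" by (simp add: continuous_within)
 thus ?thesis using s by (auto simp: continuous_within_sequentially o_def)
qed

lemma right_open:
 assumes U: "openin T U" and w: "om \<in> sample X" and t: "t \<in> hitset U om"
 shows "\<exists>d>0. \<forall>s. t <= s \<and> s < t + d --> s \<in> hitset U om"
proof -
 have t0: "t >= 0" "path X t om \<in> Some ` U" using t by (auto simp: hitset_def)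
 have "\<forall>\<^sub>F s in at_right t. path X s om \<in> Some ` U"
  using right_limit[OF w t0(1)] openin_cemetery_Some[OF U] t0(2) unfolding limitin_def by blast
 then obtain b where b: "b > t" "!!s. t < s ==> s < b ==> path X s om \<in> Some ` U"
  unfolding eventually_at_right_field by blast
 have "s \<in> hitset U om" if "t <= s" "s < t + (b - t)" for s
  using b(2)[of s] that t0 by (cases "s = t") (auto simp: hitset_def)
 thus ?thesis using b(1) by (intro exI[of _ "b - t"]) auto
qed

text \<open>An infinite hitting time contributes 0 because \<open>path_at\<close> is then the
  cemetery, where \<open>ext0\<close> vanishes; the exponential alone would contribute 1.\<close>

definition path_hit :: "real => 's set => ('s => real) => 'w => real" where
 "path_hit \<alpha> U f om = exp (- \<alpha> * enn2real (hitting_time X U om)) * ext0 f (path_at X (hitting_time X U om) om)"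

definition grid_hit :: "real => real => 's set => ('s => real) => 'w => real" where
 "grid_hit \<alpha> h U f om = (if \<exists>i::nat. real i * h \<in> hitset U om
   then let i = (LEAST i. real i * h \<in> hitset U om) in exp (- \<alpha> * (real i * h)) * ext0 f (path X (real i * h) om) else 0)"

text \<open>After a visit to the open set U the path stays there for a short interval, so a fine
  enough grid meets it soon after. The first grid visits therefore converge to the hitting time from
  the right, and right continuity does the rest.\<close>

lemma grid_hit_tendsto:
 assumes U: "openin T U" and f: "f \<in> compactly_supported T" and w: "om \<in> sample X"
 shows "(%k. grid_hit \<alpha> ((1/2)^k) U f om) ---> path_hit \<alpha> U f om"
proof (cases "hitset U om = {}")
 case True
 thus ?thesis by (simp add: grid_hit_def path_hit_def hitting_time_empty path_at_def)
next
 case False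
 define s0 where "s0 = Inf (hitset U om)"
 have s0: "hitting_time X U om = ennreal s0" "s0 >= 0" using hitting_time_eq[OF False] by (simp_all add: s0_def)
 define T' where "T' k = real (LEAST i. real i * (1/2)^k \<in> hitset U om) * (1/2)^k" for k :: nat
 have h0: "(%k. (1/2::real)^k) ---> 0" by (intro LIMSEQ_realpow_zero) auto
 have near: "\<forall>\<^sub>F k in sequentially. (\<exists>i::nat. real i * (1/2)^k \<in> hitset U om) \<and> T' k \<in> hitset U om \<and> T' k < s0 + e" if e: "e > 0" for e
 proof -
  obtain t where t: "t \<in> hitset U om" "t < s0 + e" using cInf_lessD[OF False, of "s0 + e"] e by (auto simp: s0_def)
  obtain d where d: "d > 0" "!!s. t <= s ==> s < t + d ==> s \<in> hitset U om" using right_open[OF U w t(1)] by blast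
  have t0: "t >= 0" using t by (simp add: hitset_def)
  define r where "r = min d (s0 + e - t)"
  have "\<forall>\<^sub>F k in sequentially. (1/2::real)^k < r" using d t by (intro order_tendstoD(2)[OF h0]) (auto simp: r_def)
  thus ?thesis
  proof eventually_elim
   case (elim k)
   define h :: real where "h = (1/2)^k"
   have h: "h > 0" "h < r" using elim by (auto simp: h_def)
   define i where "i = nat \<lceil>t / h\<rceil>"
   have "t / h >= 0" using t0 h by simp
   hence "t / h <= real i" "real i < t / h + 1" unfolding i_def by linarith+
   hence i: "t <= real i * h" "real i * h < t + h" using h by (simp_all add: field_simps)
   hence mem: "real i * h \<in> hitset U om" using d(2) h by (auto simp: r_def)
   have L: "T' k \<in> hitset U om" unfolding T'_def h_def[symmetric] by (rule LeastI[of "%i. real i * h \<in> hitset U om", OF mem])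
   have "(LEAST i. real i * h \<in> hitset U om) <= i" by (rule Least_le) (rule mem)
   hence "T' k <= real i * h" unfolding T'_def h_def[symmetric] using h by (intro mult_right_mono) auto
   hence "T' k < s0 + e" using i h by (auto simp: r_def)
   thus ?case using mem L unfolding h_def by blast
  qed
 qed
 have ge: "s0 <= T' k" if "T' k \<in> hitset U om" for k unfolding s0_def by (rule cInf_lower[OF that hitset_bdd])
 obtain N where N: "!!k. k >= N ==> (\<exists>i::nat. real i * (1/2)^k \<in> hitset U om) \<and> T' k \<in> hitset U om"
  using near[of 1] by (auto simp: eventually_sequentially)
 have "T' ---> s0"
 proof (rule LIMSEQ_I)
  fix r :: real assume "r > 0"
  from near[OF this] obtain M where "!!k. k >= M ==> T' k \<in> hitset U om \<and> T' k < s0 + r" by (auto simp: eventually_sequentially)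
  hence "norm (T' k - s0) < r" if "k >= M" for k using ge[of k] that by fastforce
  thus "\<exists>no. \<forall>n\<ge>no. norm (T' n - s0) < r" by blast
 qed
 hence T'N: "(%k. T' (k + N)) ---> s0" by (rule LIMSEQ_ignore_initial_segment)
 have "(%k. exp (- \<alpha> * T' (k + N)) * ext0 f (path X (T' (k + N)) om)) ---> exp (- \<alpha> * s0) * ext0 f (path X s0 om)"
  by (intro tendsto_intros T'N ext0_right_seq[OF f w s0(2)] ge) (use N in auto)
 moreover have "grid_hit \<alpha> ((1/2)^(k + N)) U f om = exp (- \<alpha> * T' (k + N)) * ext0 f (path X (T' (k + N)) om)" for k
  using N[of "k + N"] unfolding grid_hit_def T'_def Let_def by auto
 moreover have "path_hit \<alpha> U f om = exp (- \<alpha> * s0) * ext0 f (path X s0 om)"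
  using s0 by (simp add: path_hit_def path_at_def)
 ultimately have "(%k. grid_hit \<alpha> ((1/2)^(k + N)) U f om) ---> path_hit \<alpha> U f om" by simp
 thus ?thesis by (rule LIMSEQ_offset)
qed

text \<open>The event that the first visit on the grid is at step i is written as a product over
  grid times, so that its expectation is a finite-dimensional one. The indicator of the complement
  of U is 0 at the cemetery, which does no harm: a dead path cannot visit U later.\<close>

definition grid_term :: "real => real => 's set => ('s => real) => nat => 'w => real" where
 "grid_term \<alpha> h U f i om = exp (- \<alpha> * (real i * h)) * ((\<Prod>j<i. ext0 (indicator (topspace T - U)) (path X (real j * h) om))
   * ext0 (%x. indicator U x * f x) (path X (real i * h) om))"

lemma grid_sum:
 assumes h: "h > 0" and w: "om \<in> sample X"
 shows "(\<Sum>i<n. grid_term \<alpha> h U f i om) =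
  (if \<exists>i<n. real i * h \<in> hitset U om then grid_hit \<alpha> h U f om else 0)"
proof -
 have h0: "real i * h >= 0" for i using h by simp
 have zero: "grid_term \<alpha> h U f i om = 0" if "real i * h \<notin> hitset U om" for i
 proof -
  have "path X (real i * h) om \<notin> Some ` U" using that h0[of i] by (simp add: hitset_def)
  hence "ext0 (%x. indicator U x * f x) (path X (real i * h) om) = 0"
   by (cases "path X (real i * h) om") (auto simp: image_iff indicator_def)
  thus ?thesis by (simp add: grid_term_def)
 qed
 show ?thesis
 proof (cases "\<exists>i. real i * h \<in> hitset U om")
  case False
  thus ?thesis using zero by simp
 next
  case True
  define i0 where "i0 = (LEAST i. real i * h \<in> hitset U om)"
  have i0: "real i0 * h \<in> hitset U om" unfolding i0_def using LeastI_ex[OF True] .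
  have least: "\<not> real i * h \<in> hitset U om" if "i < i0" for i using not_less_Least[of i] that unfolding i0_def by blast
  obtain z where z: "path X (real i0 * h) om = Some z" "z \<in> U" using i0 by (auto simp: hitset_def)
  have later: "grid_term \<alpha> h U f i om = 0" if "i0 < i" for i
  proof -
   have "(\<Prod>j<i. ext0 (indicator (topspace T - U)) (path X (real j * h) om)) = (0::real)"
    by (rule prod_zero) (use that z in "auto intro!: bexI[of _ i0]")
   thus ?thesis by (simp add: grid_term_def)
  qed
  have one: "ext0 (indicator (topspace T - U)) (path X (real j * h) om) = (1::real)" if j: "j < i0" for j
  proof -
   have "real j * h <= real i0 * h" using j h by (intro mult_right_mono) auto
   hence "path X (real j * h) om ~= None" using absorbing[OF w h0[of j], of "real i0 * h"] z by auto
   then obtain y where y: "path X (real j * h) om = Some y" by blast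
   have "y \<notin> U" using least[OF j] y h0[of j] by (auto simp: hitset_def)
   moreover have "y \<in> topspace T" using path_space[OF w h0[of j]] y by (auto simp: topspace_cemetery_topology)
   ultimately show ?thesis using y by simp
  qed
  have at: "grid_term \<alpha> h U f i0 om = grid_hit \<alpha> h U f om"
  proof -
   have "(\<Prod>j<i0. ext0 (indicator (topspace T - U)) (path X (real j * h) om)) = (1::real)" by (rule prod.neutral) (use one in auto)
   thus ?thesis using True z by (simp add: grid_term_def grid_hit_def i0_def[symmetric] Let_def)
  qed
  have "(\<Sum>i<n. grid_term \<alpha> h U f i om) = (\<Sum>i<n. if i = i0 then grid_hit \<alpha> h U f om else 0)"
   using zero least later at by (intro sum.cong) (auto, metis linorder_neqE_nat)
  also have "... = (if i0 < n then grid_hit \<alpha> h U f om else 0)" by (simp add: sum.delta')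
  also have "... = (if \<exists>i<n. real i * h \<in> hitset U om then grid_hit \<alpha> h U f om else 0)"
   using i0 least by (metis linorder_not_less order_le_less_trans)
  finally show ?thesis .
 qed
qed

lemma grid_sum_tendsto:
 assumes "h > 0" "om \<in> sample X"
 shows "(%n. \<Sum>i<n. grid_term \<alpha> h U f i om) ---> grid_hit \<alpha> h U f om"
proof (cases "\<exists>i. real i * h \<in> hitset U om")
 case True
 then obtain i where i: "real i * h \<in> hitset U om" by blast
 have "\<forall>\<^sub>F n in sequentially. grid_hit \<alpha> h U f om = (\<Sum>i<n. grid_term \<alpha> h U f i om)"
  using eventually_gt_at_top[of i] by eventually_elim (use i in "auto simp: grid_sum[OF assms]")
 thus ?thesis by (intro Lim_transform_eventually[OF tendsto_const])
next
 case False
 hence "(\<Sum>i<n. grid_term \<alpha> h U f i om) = grid_hit \<alpha> h U f om" for n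
  using grid_sum[OF assms, where n=n and U=U and f=f and \<alpha>=\<alpha>] by (auto simp: grid_hit_def)
 thus ?thesis by simp
qed

lemma ext0_bounds:
 fixes f :: "'s => real"
 shows "(!!x. 0 <= f x) ==> (!!x. f x <= 1) ==> 0 <= ext0 f y \<and> ext0 f y <= 1"
 by (cases y) auto

lemma grid_hit_bounds:
 assumes f: "!!x. 0 <= f x" "!!x. f x <= 1" and a: "\<alpha> > 0" and h: "h > 0"
 shows "0 <= grid_hit \<alpha> h U f om \<and> grid_hit \<alpha> h U f om <= 1"
proof -
 have "exp (- \<alpha> * (real i * h)) <= 1" for i :: nat using a h by simp
 hence "0 <= exp (- \<alpha> * (real i * h)) * ext0 f y \<and> exp (- \<alpha> * (real i * h)) * ext0 f y <= 1" for i :: nat and y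
  using ext0_bounds[of f y, OF f] mult_mono[of "exp (- \<alpha> * (real i * h))" 1 "ext0 f y" 1] by auto
 thus ?thesis unfolding grid_hit_def Let_def by auto
qed

lemma grid_term_measurable:
 assumes h: "h > 0" and f: "f \<in> borel_measurable m" and U: "U \<in> sets m"
 shows "grid_term \<alpha> h U f i \<in> borel_measurable (filt \<infinity>)"
proof -
 have "topspace T - U \<in> sets m" using U unfolding space_m[symmetric] by auto
 hence "(indicator (topspace T - U) :: 's => real) \<in> borel_measurable m" by simp
 thus ?thesis unfolding grid_term_def[abs_def] using f U h
  by (intro borel_measurable_times borel_measurable_const borel_measurable_prod ext0_path_measurable) auto
qed

lemma grid_hit_measurable:
 assumes h: "h > 0" and f: "f \<in> borel_measurable m" and U: "U \<in> sets m"
 shows "grid_hit \<alpha> h U f \<in> borel_measurable (filt \<infinity>)"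
 by (rule borel_measurable_LIMSEQ_real[where u="%n om. \<Sum>i<n. grid_term \<alpha> h U f i om"])
  (use grid_sum_tendsto[OF h] grid_term_measurable[OF assms] in "auto simp: space_filt")

lemma path_hit_measurable:
 assumes U: "openin T U" and f: "f \<in> compactly_supported T" and fm: "f \<in> borel_measurable m"
 shows "path_hit \<alpha> U f \<in> borel_measurable (filt \<infinity>)"
proof (rule borel_measurable_LIMSEQ_real[where u="%k. grid_hit \<alpha> ((1/2)^k) U f"])
 have "U \<in> sets m" using openin_borel_of[OF U] by (simp add: sets_m)
 thus "grid_hit \<alpha> ((1/2)^k) U f \<in> borel_measurable (filt \<infinity>)" for k by (intro grid_hit_measurable fm) auto
qed (use grid_hit_tendsto[OF U f] in "simp add: space_filt")

lemma path_hit_bounds: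
 assumes f: "!!x. 0 <= f x" "!!x. f x <= 1" and a: "\<alpha> > 0"
 shows "0 <= path_hit \<alpha> U f om \<and> path_hit \<alpha> U f om <= 1"
proof -
 have "exp (- \<alpha> * enn2real (hitting_time X U om)) <= 1" using a by simp
 thus ?thesis unfolding path_hit_def
  using ext0_bounds[of f "path_at X (hitting_time X U om) om", OF f]
   mult_mono[of "exp (- \<alpha> * enn2real (hitting_time X U om))" 1 "ext0 f (path_at X (hitting_time X U om) om)" 1] by auto
qed

subsection \<open>Quasi-left continuity along shrinking neighbourhoods\<close>

text \<open>By right continuity an entry into an open set before r is witnessed by a rational time,
  which leaves countably many measurable events.\<close>

lemma hitting_time_less_sets:
 assumes U: "openin T U" and r: "ennreal r <= s" "r > 0"
 shows "{om \<in> sample X. hitting_time X U om < ennreal r} \<in> sets (filt s)"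
proof -
 have "{om \<in> sample X. hitting_time X U om < ennreal r} =
   (\<Union>q\<in>\<rat> \<inter> {0..<r}. path X q -` (Some ` U) \<inter> space (filt s))"
 proof (intro set_eqI iffI)
  fix om assume "om \<in> {om \<in> sample X. hitting_time X U om < ennreal r}"
  hence w: "om \<in> sample X" and lt: "hitting_time X U om < ennreal r" by auto
  have ne: "hitset U om ~= {}" using lt hitting_time_empty[of U om] by auto
  have "Inf (hitset U om) < r" using lt hitting_time_eq[OF ne] by (simp add: ennreal_less_iff)
  then obtain t where t: "t \<in> hitset U om" "t < r" using cInf_lessD[OF ne] by blast
  obtain d where d: "d > 0" "!!s. t <= s ==> s < t + d ==> s \<in> hitset U om" using right_open[OF U w t(1)] by blast
  obtain q where q: "q \<in> \<rat>" "t < q" "q < min (t + d) r" using Rats_dense_in_real[of t "min (t + d) r"] d t by auto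
  hence "q \<in> hitset U om" using d(2)[of q] by auto
  thus "om \<in> (\<Union>q\<in>\<rat> \<inter> {0..<r}. path X q -` (Some ` U) \<inter> space (filt s))"
   using q w by (auto simp: hitset_def space_filt)
 next
  fix om assume "om \<in> (\<Union>q\<in>\<rat> \<inter> {0..<r}. path X q -` (Some ` U) \<inter> space (filt s))"
  then obtain q where q: "0 <= q" "q < r" "path X q om \<in> Some ` U" "om \<in> sample X" by (auto simp: space_filt)
  hence "hitting_time X U om <= ennreal q" by (intro hitting_time_le) (simp add: hitset_def)
  also have "... < ennreal r" using q by (simp add: ennreal_less_iff)
  finally show "om \<in> {om \<in> sample X. hitting_time X U om < ennreal r}" using q by simp
 qed
 also have "... \<in> sets (filt s)"
 proof (rule sets.countable_UN'')
  show "countable (\<rat> \<inter> {0..<r})" using countable_rat by (rule countable_subset[rotated]) auto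
  fix q assume "q \<in> \<rat> \<inter> {0..<r}"
  hence q: "0 <= q" "ennreal q <= s" using r by (auto intro: order_trans[OF ennreal_leI r(1)])
  thus "path X q -` (Some ` U) \<inter> space (filt s) \<in> sets (filt s)"
   using openin_borel_of[OF openin_cemetery_Some[OF U]] by (intro measurable_sets[OF path_measurable[OF q]])
 qed
 finally show ?thesis .
qed

text \<open>The event is decided only an instant after t, hence the strictly larger s; right
  continuity of the augmented filtration closes the gap in \<open>stoppingI\<close>.\<close>

lemma hitting_time_le_sets:
 assumes U: "openin T U" and t: "t >= 0" "ennreal t < s"
 shows "{om \<in> sample X. hitting_time X U om <= ennreal t} \<in> sets (filt s)"
proof -
 obtain r where r: "t < r" "ennreal r <= s"
 proof (cases s)
  case (real s')
  thus thesis using t that[of s'] by (auto simp: ennreal_less_iff)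
 next
  case top
  thus thesis using that[of "t + 1"] by auto
 qed
 define q where "q n = t + (r - t) / real (Suc n)" for n
 have q: "t < q n" "q n <= r" for n
 proof -
  show "t < q n" using r(1) by (simp add: q_def)
  have "(r - t) / real (Suc n) <= (r - t) / 1" using r(1) by (intro divide_left_mono) auto
  thus "q n <= r" by (simp add: q_def)
 qed
 have q0: "q ---> t"
 proof -
  have "(%n. t + (r - t) * (1 / real (Suc n))) ---> t + (r - t) * 0"
   by (intro tendsto_intros LIMSEQ_Suc[OF lim_1_over_n])
  thus ?thesis by (simp add: q_def[abs_def])
 qed
 have "{om \<in> sample X. hitting_time X U om <= ennreal t} = (\<Inter>n. {om \<in> sample X. hitting_time X U om < ennreal (q n)})"
 proof (intro set_eqI iffI)
  fix om assume "om \<in> {om \<in> sample X. hitting_time X U om <= ennreal t}"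
  moreover have "ennreal t < ennreal (q n)" for n using q(1) t by (simp add: ennreal_less_iff)
  ultimately show "om \<in> (\<Inter>n. {om \<in> sample X. hitting_time X U om < ennreal (q n)})" by (auto intro: le_less_trans)
 next
  fix om assume w: "om \<in> (\<Inter>n. {om \<in> sample X. hitting_time X U om < ennreal (q n)})"
  have "(%n. ennreal (q n)) ---> ennreal t" by (intro tendsto_intros q0)
  hence "hitting_time X U om <= ennreal t" by (rule LIMSEQ_le_const) (use w in "auto intro: less_imp_le")
  thus "om \<in> {om \<in> sample X. hitting_time X U om <= ennreal t}" using w by auto
 qed
 also have "... \<in> sets (filt s)"
 proof (rule sets.countable_INT)
  have "{om \<in> sample X. hitting_time X U om < ennreal (q n)} \<in> sets (filt s)" for n
   using q[of n] r t by (intro hitting_time_less_sets[OF U]) (auto intro: order_trans[OF ennreal_leI r(2)])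
  thus "range (%n. {om \<in> sample X. hitting_time X U om < ennreal (q n)}) \<subseteq> sets (filt s)" by auto
 qed simp
 finally show ?thesis .
qed

lemma stoppingI:
 assumes "!!t s. t >= 0 ==> ennreal t < s ==> {om \<in> sample X. \<sigma> om <= ennreal t} \<in> sets (filt s)"
 shows "stopping T X \<sigma>"
 unfolding stopping_def
proof
 fix t :: ennreal
 show "{om \<in> sample X. \<sigma> om <= t} \<in> augmented T X t"
 proof (cases t)
  case (real t')
  hence "{om \<in> sample X. \<sigma> om <= t} \<in> (\<Inter>s\<in>{t<..}. augmented T X s)"
   using assms[of t'] filt_augmented by auto
  moreover have "(\<Inter>s\<in>{t<..}. augmented T X s) = augmented T X t"
   using hunt real unfolding hunt_process_def strong_markov_def by (auto simp: less_top[symmetric])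
  ultimately show ?thesis by simp
 next
  case top
  hence "{om \<in> sample X. \<sigma> om <= t} = space (filt t)" by (auto simp: space_filt)
  thus ?thesis using filt_augmented[OF sets.top] by simp
 qed
qed

lemma quasi_left_hitting:
 assumes x: "x \<in> topspace T" and U: "!!n. openin T (U n)" "!!n. U (Suc n) \<subseteq> U n"
 shows "AE om in law X (Some x). (SUP n. hitting_time X (U n) om) < \<infinity> -->
  limitin (cemetery_topology T) (%n. path_at X (hitting_time X (U n) om) om)
   (path_at X (SUP n. hitting_time X (U n) om) om) sequentially"
proof -
 let ?\<sigma> = "%om. SUP n. hitting_time X (U n) om"
 have y: "Some x \<in> topspace (cemetery_topology T)" by (rule Some_space[OF x])
 have st: "stopping T X (hitting_time X (U n))" for n by (rule stoppingI) (rule hitting_time_le_sets[OF U(1)])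
 have st': "stopping T X ?\<sigma>"
 proof (rule stoppingI)
  fix t :: real and s assume t: "t >= 0" "ennreal t < s"
  have "{om \<in> sample X. ?\<sigma> om <= ennreal t} = (\<Inter>n. {om \<in> sample X. hitting_time X (U n) om <= ennreal t})"
   by (auto simp: SUP_le_iff)
  also have "... \<in> sets (filt s)" using hitting_time_le_sets[OF U(1) t] by (intro sets.countable_INT) auto
  finally show "{om \<in> sample X. ?\<sigma> om <= ennreal t} \<in> sets (filt s)" .
 qed
 have inc: "incseq (%n. hitting_time X (U n) om)" for om by (rule incseq_SucI) (rule hitting_time_mono[OF U(2)])
 have lim: "(%n. hitting_time X (U n) om) ---> ?\<sigma> om" for om by (rule LIMSEQ_SUP[OF inc])
 have "quasi_left_continuous T X" using hunt by (simp add: hunt_process_def)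
 hence "AE om in law_from X (return cem (Some x)). ?\<sigma> om < \<infinity> -->
  limitin (cemetery_topology T) (%n. path_at X (hitting_time X (U n) om) om) (path_at X (?\<sigma> om) om) sequentially"
  unfolding quasi_left_continuous_def
  using return_initial[OF y] st st' inc lim
  by (elim ballE[of _ _ "return cem (Some x)"] allE[of _ ?\<sigma>] allE[of _ "%n. hitting_time X (U n)"] impE) auto
 thus ?thesis unfolding law_from_return[OF y] .
qed

text \<open>The hitting times of the shrinking neighbourhoods increase to some L. If L is finite,
  quasi-left continuity makes the path converge along them, the limit lies where \<psi> is 1, and so
  F is hit at L itself. If L is infinite, both the limit and the hitting variable of F are
  0.\<close>

lemma path_hit_shrinking:
 assumes x: "x \<in> topspace T" and \<psi>: "\<psi> \<in> compactly_supported T" "!!x. x \<in> topspace T ==> \<psi> x <= 1"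
  and f: "f \<in> compactly_supported T" "!!x. 0 <= f x" "!!x. f x <= 1" and a: "\<alpha> > 0"
  and F: "F = {x \<in> topspace T. \<psi> x = 1}"
 shows "AE om in law X (Some x). (%n. path_hit \<alpha> {x \<in> topspace T. \<psi> x > 1 - 1 / real (n + 2)} f om) ---> path_hit \<alpha> F f om"
proof -
 define U where "U n = {x \<in> topspace T. \<psi> x > 1 - 1 / real (n + 2)}" for n
 have \<psi>c: "continuous_map T euclideanreal \<psi>" using \<psi> by (simp add: compactly_supported_def)
 have Uo: "openin T (U n)" for n
  using openin_continuous_map_preimage[OF \<psi>c, of "{1 - 1 / real (n + 2)<..}"] by (simp add: U_def)
 have Ud: "U (Suc n) \<subseteq> U n" for n
 proof -
  have "1 / real (Suc n + 2) <= 1 / real (n + 2)" by (simp add: frac_le)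
  thus ?thesis unfolding U_def by auto
 qed
 have FU: "F \<subseteq> U n" for n unfolding F U_def by auto
 have y: "Some x \<in> topspace (cemetery_topology T)" by (rule Some_space[OF x])
 have ev: "ext0 \<psi> y <= 1" if "y \<in> topspace (cemetery_topology T)" for y
  using that \<psi>(2) by (auto simp: topspace_cemetery_topology split: option.split)
 show ?thesis using quasi_left_hitting[of x U, OF x Uo Ud] AE_sample[OF y]
  unfolding U_def[symmetric]
 proof eventually_elim
  case (elim om)
  note w = elim(2)
  define s where "s n = hitting_time X (U n) om" for n
  define L where "L = (SUP n. s n)"
  have inc: "incseq s" unfolding s_def by (rule incseq_SucI) (rule hitting_time_mono[OF Ud])
  have sL: "s ---> L" unfolding L_def by (rule LIMSEQ_SUP[OF inc])
  have LF: "L <= hitting_time X F om" unfolding L_def s_def by (rule SUP_least) (rule hitting_time_mono[OF FU])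
  show ?case
  proof (cases "L = \<infinity>")
   case True
   hence "hitting_time X F om = \<infinity>" using LF by (simp add: top_unique)
   hence "path_hit \<alpha> F f om = 0" by (simp add: path_hit_def path_at_def)
   moreover have "(%n. exp (- \<alpha> * enn2real (s n)) * ext0 f (path_at X (s n) om)) ---> 0"
   proof (rule enn2real_tendsto_top[OF _ a])
    show "s ---> \<infinity>" using sL True by simp
    show "\<bar>ext0 f (path_at X (s n) om)\<bar> <= 1" for n using ext0_bounds[of f "path_at X (s n) om", OF f(2,3)] by auto
    show "ext0 f (path_at X (s n) om) = 0" if "s n = \<infinity>" for n using that by (simp add: path_at_def)
   qed
   ultimately show ?thesis by (simp add: path_hit_def s_def)
  next
   case False
   then obtain l where l: "L = ennreal l" "l >= 0" by (cases L) auto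
   have fin: "L < \<infinity>" using l by simp
   have lim: "limitin (cemetery_topology T) (%n. path_at X (s n) om) (path_at X L om) sequentially"
    using elim(1) fin unfolding L_def s_def by blast
   have limg: "(%n. ext0 g (path_at X (s n) om)) ---> ext0 g (path_at X L om)" if "g \<in> compactly_supported T" for g :: "'s => real"
    using continuous_map_limit[OF continuous_map_ext0[OF that] lim] by (simp add: o_def)
   have sfin: "s n < \<infinity>" for n using fin SUP_upper[of n UNIV s] unfolding L_def by (auto intro: le_less_trans)
   \<comment> \<open>At the infimum of the visiting times the path need not lie in the open set, but
     by right continuity \<psi> is there at least the threshold.\<close>
   have ge: "ext0 \<psi> (path_at X (s n) om) >= 1 - 1 / real (n + 2)" for n
   proof -
    have ne: "hitset (U n) om ~= {}" using sfin[of n] hitting_time_empty[of "U n" om] by (auto simp: s_def)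
    define s0 where "s0 = Inf (hitset (U n) om)"
    have s0: "s n = ennreal s0" "s0 >= 0" using hitting_time_eq[OF ne] by (simp_all add: s0_def s_def)
    have "\<exists>r. \<forall>i. r i \<in> hitset (U n) om \<and> r i < s0 + 1 / real (Suc i)"
    proof (rule choice, rule allI)
     fix i
     have "s0 < s0 + 1 / real (Suc i)" by simp
     from cInf_lessD[OF ne this[unfolded s0_def]] show "\<exists>r. r \<in> hitset (U n) om \<and> r < s0 + 1 / real (Suc i)"
      unfolding s0_def by blast
    qed
    then obtain r where r: "!!i. r i \<in> hitset (U n) om" "!!i. r i < s0 + 1 / real (Suc i)" by blast
    have rge: "s0 <= r i" for i unfolding s0_def by (rule cInf_lower[OF r(1) hitset_bdd])
    have "(%i. s0 + 1 / real (Suc i)) ---> s0 + 0" by (intro tendsto_intros LIMSEQ_Suc[OF lim_1_over_n])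
    hence "r ---> s0"
     by (intro tendsto_sandwich[OF _ _ tendsto_const, of s0 r _ "%i. s0 + 1 / real (Suc i)"])
      (use rge less_imp_le[OF r(2)] in "simp_all del: of_nat_Suc")
    hence "(%i. ext0 \<psi> (path X (r i) om)) ---> ext0 \<psi> (path X s0 om)"
     by (rule ext0_right_seq[OF \<psi>(1) w s0(2) _ rge])
    moreover have "1 - 1 / real (n + 2) <= ext0 \<psi> (path X (r i) om)" for i
     using r(1)[of i] by (auto simp: hitset_def U_def)
    ultimately have "1 - 1 / real (n + 2) <= ext0 \<psi> (path X s0 om)" by (intro LIMSEQ_le_const) auto
    thus ?thesis using s0 by (simp add: path_at_def)
   qed
   \<comment> \<open>Since \<open>ext0\<close> vanishes at the cemetery, this also excludes that the
     path is dead at time L.\<close>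
   have "1 - 0 <= ext0 \<psi> (path_at X L om)"
   proof (rule LIMSEQ_le[OF _ limg[OF \<psi>(1)]])
    have "(%n. 1 / real (n + 2)) ---> 0" using LIMSEQ_ignore_initial_segment[OF lim_1_over_n, of 2] by simp
    thus "(%n. 1 - 1 / real (n + 2)) ---> 1 - (0::real)" by (intro tendsto_intros)
   qed (use ge in blast)
   moreover have PL: "path_at X L om = path X l om" using l by (simp add: path_at_def)
   moreover have Pt: "path X l om \<in> topspace (cemetery_topology T)" by (rule path_space[OF w l(2)])
   ultimately have one: "ext0 \<psi> (path X l om) = 1" using ev[OF Pt] by simp
   then obtain z where z: "path X l om = Some z" "\<psi> z = 1" by (cases "path X l om") auto
   hence "z \<in> F" using Pt by (auto simp: F topspace_cemetery_topology)
   hence "l \<in> hitset F om" using z l by (simp add: hitset_def)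
   from hitting_time_le[OF this] LF l have LF': "hitting_time X F om = L" by simp
   have "(%n. enn2real (s n)) ---> l" using sL l by (intro tendsto_enn2real) auto
   moreover have "enn2real L = l" using l by simp
   ultimately have eL: "(%n. enn2real (s n)) ---> enn2real L" by simp
   have "(%n. exp (- \<alpha> * enn2real (s n)) * ext0 f (path_at X (s n) om)) ---> exp (- \<alpha> * enn2real L) * ext0 f (path_at X L om)"
    by (intro tendsto_mult tendsto_exp tendsto_const eL limg f(1))
   thus ?thesis by (simp add: path_hit_def s_def LF')
  qed
 qed
qed

end

context hunt
begin

lemma associated_form:
 assumes assoc: "associated_hunt_process D X" and D: "refm D = m"
 shows "fdom D = S.form_dom"
  "u \<in> S.form_dom ==> v \<in> S.form_dom ==> energy D u v = S.form u v"
proof -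
 have eq: "((%t. l2_inner m (%x. u x - transition X t u x) v / t) \<longlongrightarrow> l) (at_right 0) \<longleftrightarrow>
   ((%t. S.aform t u v) \<longlongrightarrow> l) (at_right 0)" if "u \<in> L2 m" "v \<in> L2 m" for u v l
 proof (rule tendsto_cong)
  show "\<forall>\<^sub>F t in at_right 0. l2_inner m (%x. u x - transition X t u x) v / t = S.aform t u v"
   using eventually_at_right_less[of "0::real"]
   by eventually_elim (use that transition_L2(1) in "simp add: S.aform_def")
 qed
 show dom: "fdom D = S.form_dom"
  using assoc eq unfolding associated_hunt_process_def S.form_dom_def D by auto
 show "energy D u v = S.form u v" if "u \<in> S.form_dom" "v \<in> S.form_dom"
 proof -
  have "((%t. l2_inner m (%x. u x - transition X t u x) v / t) \<longlongrightarrow> energy D u v) (at_right 0)"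
   using assoc that unfolding associated_hunt_process_def D dom by blast
  thus ?thesis using eq[of u v] that S.form_eqI by auto
 qed
qed

subsection \<open>Discrete hitting distributions as minimisers\<close>

text \<open>\<open>hit_iter h U f i x\<close> is the undiscounted expectation of f at step i on the
  event that step i is the first grid visit to U.\<close>

fun hit_iter :: "real => 's set => ('s => real) => nat => 's => real" where
 "hit_iter h U f 0 = (%x. indicator U x * f x)"
| "hit_iter h U f (Suc i) = (%x. indicator (topspace T - U) x * transition X h (hit_iter h U f i) x)"

lemma nested_hit_iter:
 "g k = hit_iter h U f i ==> (!!j. j < k ==> g j = indicator (topspace T - U)) ==>
  nested (transition X) (%j. real j * h) k g = hit_iter h U f (i + k)"
proof (induction k arbitrary: g i)
 case (Suc k)
 have h: "real (Suc k) * h - real k * h = h" by (simp add: algebra_simps)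
 have "nested (transition X) (%j. real j * h) k (g(k := %x. g k x * transition X h (g (Suc k)) x)) = hit_iter h U f (Suc i + k)"
  by (rule Suc.IH) (use Suc.prems in auto)
 thus ?case by (simp only: nested.simps h) simp
qed simp

definition grid_fun :: "real => real => 's set => ('s => real) => 's => real" where
 "grid_fun \<alpha> h U f x = (\<integral>om. grid_hit \<alpha> h U f om \<partial>law X (Some x))"

definition hit_fun :: "real => 's set => ('s => real) => 's => real" where
 "hit_fun \<alpha> U f x = (\<integral>om. path_hit \<alpha> U f om \<partial>law X (Some x))"

context
 fixes h \<alpha> :: real and U :: "'s set" and f :: "'s => real"
 assumes h: "h > 0" and \<alpha>: "\<alpha> > 0" and U: "U \<in> sets m" and f: "f \<in> L2 m" and f0: "!!x. 0 <= f x" and f1: "!!x. f x <= 1"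
begin

lemma U_compl: "topspace T - U \<in> sets m"
 using U unfolding space_m[symmetric] by auto

lemma hit_iter_L2: "hit_iter h U f i \<in> L2 m \<and> l2_norm m (hit_iter h U f i) <= l2_norm m f"
proof (induction i)
 case 0
 have L: "hit_iter h U f 0 \<in> L2 m" unfolding hit_iter.simps by (rule L2_indicator_times[OF f U])
 have "l2_norm m (hit_iter h U f 0) <= l2_norm m f"
  by (rule l2_norm_mono[OF L f]) (auto split: split_indicator)
 with L show ?case by simp
next
 case (Suc i)
 have P: "transition X h (hit_iter h U f i) \<in> L2 m" using transition_L2(1)[of h] Suc h by auto
 have L: "hit_iter h U f (Suc i) \<in> L2 m" unfolding hit_iter.simps by (rule L2_indicator_times[OF P U_compl])
 have "l2_norm m (hit_iter h U f (Suc i)) <= l2_norm m (transition X h (hit_iter h U f i))"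
  by (rule l2_norm_mono[OF L P]) (auto split: split_indicator)
 also have "... <= l2_norm m (hit_iter h U f i)" using transition_L2(2)[of h] Suc h by auto
 finally show ?case using L Suc by auto
qed

lemma grid_term_integral:
 assumes x: "x \<in> topspace T"
 shows "(\<integral>om. grid_term \<alpha> h U f i om \<partial>law X (Some x)) = exp (- \<alpha> * (real i * h)) * hit_iter h U f i x"
proof -
 let ?g = "%j. if j < i then indicator (topspace T - U) else hit_iter h U f 0"
 have g: "?g j \<in> borel_measurable m" for j using hit_iter_L2[of 0] U_compl by (auto simp del: hit_iter.simps)
 have b: "\<exists>c. \<forall>z\<in>topspace T. \<bar>?g j z\<bar> <= c" for j
  using f0 f1 by (intro exI[of _ 1]) (auto split: split_indicator)
 have "(\<integral>om. (\<Prod>j\<le>i. ext0 (?g j) (path X (real j * h) om)) \<partial>law X (Some x)) = nested (transition X) (%j. real j * h) i ?g x"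
  by (rule finite_dimensional[OF x]) (use g b h in "auto intro!: mult_right_mono")
 also have "... = hit_iter h U f (0 + i) x" by (rule fun_cong[OF nested_hit_iter]) auto
 finally have 1: "(\<integral>om. (\<Prod>j\<le>i. ext0 (?g j) (path X (real j * h) om)) \<partial>law X (Some x)) = hit_iter h U f i x" by simp
 have "grid_term \<alpha> h U f i om = exp (- \<alpha> * (real i * h)) * (\<Prod>j\<le>i. ext0 (?g j) (path X (real j * h) om))" for om
 proof -
  have "(\<Prod>j<i. ext0 (?g j) (path X (real j * h) om)) = (\<Prod>j<i. ext0 (indicator (topspace T - U)) (path X (real j * h) om))"
   by (intro prod.cong) auto
  moreover have "(\<Prod>j\<le>i. ext0 (?g j) (path X (real j * h) om)) =
    (\<Prod>j<i. ext0 (?g j) (path X (real j * h) om)) * ext0 (hit_iter h U f 0) (path X (real i * h) om)"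
   unfolding lessThan_Suc_atMost[symmetric] prod.lessThan_Suc by (simp only: less_irrefl if_False)
  ultimately show ?thesis by (simp only: grid_term_def hit_iter.simps mult.assoc)
 qed
 thus ?thesis using 1 by simp
qed

lemma grid_sum_bounds:
 assumes w: "om \<in> sample X" shows "\<bar>\<Sum>i<n. grid_term \<alpha> h U f i om\<bar> <= 1"
 unfolding grid_sum[OF h w] using grid_hit_bounds[of f \<alpha> h U om, OF f0 f1 \<alpha> h] by auto

lemma grid_partial_sums:
 assumes x: "x \<in> topspace T"
 shows "(%n. \<Sum>i<n. exp (- \<alpha> * (real i * h)) * hit_iter h U f i x) ---> grid_fun \<alpha> h U f x"
proof -
 have y: "Some x \<in> topspace (cemetery_topology T)" by (rule Some_space[OF x])
 interpret prob_space "law X (Some x)" by (rule law_prob[OF y])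
 have fm: "f \<in> borel_measurable m" using f by auto
 have tm: "grid_term \<alpha> h U f i \<in> borel_measurable (law X (Some x))" for i
  using grid_term_measurable[OF h fm U] by (simp add: measurable_law[OF y])
 have gm: "grid_hit \<alpha> h U f \<in> borel_measurable (law X (Some x))"
  using grid_hit_measurable[OF h fm U] by (simp add: measurable_law[OF y])
 have tb: "\<bar>grid_term \<alpha> h U f i om\<bar> <= 2" if "om \<in> sample X" for i om
  using grid_sum_bounds[OF that, of i] grid_sum_bounds[OF that, of "Suc i"] by simp
 have int: "integrable (law X (Some x)) (grid_term \<alpha> h U f i)" for i
  by (rule integrable_const_bound[where B=2]) (use tb tm in "auto simp: space_law[OF y] intro!: AE_I2")
 have "(%n. \<integral>om. (\<Sum>i<n. grid_term \<alpha> h U f i om) \<partial>law X (Some x)) ---> grid_fun \<alpha> h U f x"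
  unfolding grid_fun_def
 proof (rule integral_dominated_convergence[where w="%_. 1"])
  show "AE om in law X (Some x). (%n. \<Sum>i<n. grid_term \<alpha> h U f i om) ---> grid_hit \<alpha> h U f om"
   by (rule AE_I2) (use grid_sum_tendsto[OF h] in "auto simp: space_law[OF y]")
  show "AE om in law X (Some x). norm (\<Sum>i<n. grid_term \<alpha> h U f i om) <= 1" for n
   by (rule AE_I2) (use grid_sum_bounds in "auto simp: space_law[OF y]")
 qed (use tm gm in auto)
 moreover have "(\<integral>om. (\<Sum>i<n. grid_term \<alpha> h U f i om) \<partial>law X (Some x)) = (\<Sum>i<n. exp (- \<alpha> * (real i * h)) * hit_iter h U f i x)" for n
  using int by (simp add: grid_term_integral[OF x])
 ultimately show ?thesis by simp
qed

text \<open>From a starting point in U the first grid visit is at time 0, so only the summand with i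
  = 0 survives.\<close>

lemma grid_fun_eq:
 assumes x: "x \<in> U" shows "grid_fun \<alpha> h U f x = f x"
proof -
 have xT: "x \<in> topspace T" using sets.sets_into_space[OF U] x by (auto simp: space_m)
 have "(\<Sum>i<Suc n. exp (- \<alpha> * (real i * h)) * hit_iter h U f i x) = f x" for n
  by (subst sum.lessThan_Suc_shift) (use x in simp)
 hence "(%n. \<Sum>i<Suc n. exp (- \<alpha> * (real i * h)) * hit_iter h U f i x) ---> f x" by simp
 moreover have "(%n. \<Sum>i<Suc n. exp (- \<alpha> * (real i * h)) * hit_iter h U f i x) ---> grid_fun \<alpha> h U f x"
  by (rule LIMSEQ_Suc[OF grid_partial_sums[OF xT]])
 ultimately show ?thesis using LIMSEQ_unique by blast
qed

text \<open>The iterates do not grow in norm and the discount is geometric, so the partial sums are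
  Cauchy; their mean-square limit is then the pointwise limit already found.\<close>

lemma grid_fun_L2_limit: "l2_tendsto m (%n x. \<Sum>i<n. exp (- \<alpha> * (real i * h)) * hit_iter h U f i x) (grid_fun \<alpha> h U f)"
proof (rule l2_Cauchy_pointwise_limit)
 define \<rho> where "\<rho> = exp (- \<alpha> * h)"
 have \<rho>: "0 < \<rho>" "\<rho> < 1" unfolding \<rho>_def using \<alpha> h by auto
 have pw: "exp (- \<alpha> * (real i * h)) = \<rho>^i" for i unfolding \<rho>_def by (simp add: exp_of_nat_mult[symmetric] algebra_simps)
 have fm: "f \<in> borel_measurable m" using f by auto
 show "grid_fun \<alpha> h U f \<in> borel_measurable m"
  unfolding grid_fun_def[abs_def] by (rule law_Some_measurable[OF grid_hit_measurable[OF h fm U]])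
 show "AE x in m. (%n. \<Sum>i<n. exp (- \<alpha> * (real i * h)) * hit_iter h U f i x) ---> grid_fun \<alpha> h U f x"
  by (rule AE_I2) (rule grid_partial_sums, simp add: space_m)
 let ?s = "%n x. \<Sum>i<n. \<rho>^i * hit_iter h U f i x"
 have sL: "?s n \<in> L2 m" for n using hit_iter_L2 by auto
 have close: "l2_norm m (%x. ?s q x - ?s p x) <= \<rho>^p * (l2_norm m f / (1 - \<rho>))" if "p <= q" for p q
 proof -
  have "?s q x - ?s p x = (\<Sum>i\<in>{p..<q}. \<rho>^i * hit_iter h U f i x)" for x
   using sum.atLeastLessThan_concat[of 0 p q "%i. \<rho>^i * hit_iter h U f i x"] that by (simp add: atLeast0LessThan)
  hence "l2_norm m (%x. ?s q x - ?s p x) = l2_norm m (%x. \<Sum>i\<in>{p..<q}. \<rho>^i * hit_iter h U f i x)" by simp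
  also have "... <= (\<Sum>i\<in>{p..<q}. l2_norm m (%x. \<rho>^i * hit_iter h U f i x))"
   by (rule l2_norm_sum) (use hit_iter_L2 in auto)
  also have "... <= (\<Sum>i\<in>{p..<q}. \<rho>^i * l2_norm m f)"
   using hit_iter_L2 \<rho> by (intro sum_mono) (simp add: l2_norm_cmult mult_left_mono)
  also have "... = \<rho>^p * ((\<Sum>i<q - p. \<rho>^i) * l2_norm m f)"
  proof -
   have "(\<Sum>i\<in>{p..<q}. \<rho>^i) = (\<Sum>i<q - p. \<rho>^(p + i))"
    by (rule sum.reindex_bij_witness[of _ "%i. p + i" "%i. i - p"]) auto
   thus ?thesis by (simp add: sum_distrib_right[symmetric] power_add sum_distrib_left[symmetric])
  qed
  also have "... <= \<rho>^p * (1 / (1 - \<rho>) * l2_norm m f)"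
   using \<rho> by (intro mult_left_mono mult_right_mono) (auto simp: sum_gp_strict divide_right_mono)
  finally show ?thesis by simp
 qed
 have "l2_Cauchy m ?s" unfolding l2_Cauchy_def
 proof (intro conjI allI impI sL)
  fix e :: real assume e: "e > 0"
  have "(%p. \<rho>^p * (l2_norm m f / (1 - \<rho>))) ---> 0" using \<rho> by (intro tendsto_mult_left_zero LIMSEQ_realpow_zero) auto
  hence "\<forall>\<^sub>F p in sequentially. \<rho>^p * (l2_norm m f / (1 - \<rho>)) < e" using e by (rule order_tendstoD)
  then obtain N where N: "!!p. p >= N ==> \<rho>^p * (l2_norm m f / (1 - \<rho>)) < e" by (auto simp: eventually_sequentially)
  have "l2_norm m (%x. ?s p x - ?s q x) < e" if "p >= N" "q >= N" for p q
  proof (cases "p <= q")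
   case True
   thus ?thesis using close[OF True] N[OF that(1)] l2_norm_minus_commute[of m "?s p" "?s q"] by linarith
  next
   case False
   thus ?thesis using close[of q p] N[OF that(2)] by simp
  qed
  thus "\<exists>N. \<forall>p\<ge>N. \<forall>q\<ge>N. l2_norm m (%x. ?s p x - ?s q x) < e" by blast
 qed
 thus "l2_Cauchy m (%n x. \<Sum>i<n. exp (- \<alpha> * (real i * h)) * hit_iter h U f i x)" by (simp only: pw)
qed

text \<open>Away from U the function equals its own discounted one-step transition. Tested against
  functions vanishing on U, this is the Euler--Lagrange equation of the approximating form at mesh
  h; it results from an index shift in the partial sums.\<close>

lemma grid_fun_orthogonal:
 assumes z: "z \<in> L2 m" "!!x. x \<in> U ==> z x = 0"
 shows "l2_inner m (grid_fun \<alpha> h U f) z = exp (- \<alpha> * h) * l2_inner m (transition X h (grid_fun \<alpha> h U f)) z"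
proof -
 let ?c = "%i. exp (- \<alpha> * (real i * h))"
 let ?s = "%n x. \<Sum>i<n. ?c i * hit_iter h U f i x"
 have hL: "hit_iter h U f i \<in> L2 m" for i using hit_iter_L2 by simp
 have PL: "transition X h (hit_iter h U f i) \<in> L2 m" for i using transition_L2(1)[of h] h hL by auto
 have step: "l2_inner m (?s (Suc n)) z = exp (- \<alpha> * h) * l2_inner m (transition X h (?s n)) z" for n
 proof -
  have h0: "l2_inner m (hit_iter h U f 0) z = 0"
  proof -
   have "(%x. indicator U x * f x * z x) = (%_. 0)" using z(2) by (intro ext) (auto split: split_indicator)
   thus ?thesis unfolding l2_inner_def hit_iter.simps by simp
  qed
  have hS: "l2_inner m (hit_iter h U f (Suc i)) z = l2_inner m (transition X h (hit_iter h U f i)) z" for i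
   unfolding l2_inner_def
   by (rule Bochner_Integration.integral_cong) (use z(2) in "auto simp: space_m split: split_indicator")
  have cS: "?c (Suc i) = exp (- \<alpha> * h) * ?c i" for i by (simp add: exp_add[symmetric] algebra_simps)
  have "l2_inner m (?s (Suc n)) z = (\<Sum>i<Suc n. ?c i * l2_inner m (hit_iter h U f i) z)"
   using hL z(1) by (subst l2_inner_sum) auto
  also have "... = (\<Sum>i<n. ?c (Suc i) * l2_inner m (hit_iter h U f (Suc i)) z)"
   unfolding sum.lessThan_Suc_shift by (simp only: h0)
  also have "... = exp (- \<alpha> * h) * (\<Sum>i<n. ?c i * l2_inner m (transition X h (hit_iter h U f i)) z)"
   unfolding cS hS by (simp add: sum_distrib_left mult.assoc)
  also have "(\<Sum>i<n. ?c i * l2_inner m (transition X h (hit_iter h U f i)) z) = l2_inner m (transition X h (?s n)) z"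
   using hL z(1) h by (subst S.P_sum) (auto simp: S.P_cmult)
  finally show ?thesis .
 qed
 note lim = grid_fun_L2_limit
 have "(%n. l2_inner m (?s (Suc n)) z) ---> l2_inner m (grid_fun \<alpha> h U f) z"
  by (rule LIMSEQ_Suc) (intro l2_tendsto_inner lim l2_tendsto_const z)
 moreover have "(%n. exp (- \<alpha> * h) * l2_inner m (transition X h (?s n)) z) --->
   exp (- \<alpha> * h) * l2_inner m (transition X h (grid_fun \<alpha> h U f)) z"
  using h by (intro tendsto_mult_left l2_tendsto_inner S.P_tendsto lim l2_tendsto_const z) auto
 ultimately show ?thesis unfolding step by (rule LIMSEQ_unique)
qed

end

end

section \<open>Hitting distributions in the form domain\<close>

text \<open>Serves the hitting variable of a compact set, which is known only as an almost sure
  limit of measurable variables.\<close>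

lemma completion_measurable_AE:
 fixes f g :: "'s => real"
 assumes g: "g \<in> borel_measurable M" and ae: "AE x in M. g x = f x"
 shows "f \<in> borel_measurable (completion M)"
proof (rule borel_measurableI)
 fix S :: "real set" assume "open S"
 show "f -` S \<inter> space (completion M) \<in> sets (completion M)"
 proof (rule completion.in_sets_AE[where A="g -` S \<inter> space (completion M)"])
  show "AE x in completion M. (x \<in> g -` S \<inter> space (completion M)) = (x \<in> f -` S \<inter> space (completion M))"
   using AE_completion[OF ae] by eventually_elim auto
  show "g -` S \<inter> space (completion M) \<in> sets (completion M)"
   using measurable_sets[OF g, of S] \<open>open S\<close> by (simp add: space_completion)
 qed auto
qed

text \<open>A Cauchy criterion through a convergent sequence of energies; the absolute value covers
  increasing and decreasing energies, and both cases occur.\<close>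

lemma l2_CauchyI:
 assumes u: "!!n. u n \<in> L2 m" and c: "c > 0" and F: "convergent F"
  and le: "!!n p. n <= p ==> c * (l2_norm m (%x. u p x - u n x))^2 <= 2 * \<bar>F p - F n\<bar>"
 shows "l2_Cauchy m u"
 unfolding l2_Cauchy_def
proof (intro conjI allI impI u)
 fix e :: real assume e: "e > 0"
 hence "c * e^2 / 2 > 0" using c by simp
 from metric_CauchyD[OF convergent_Cauchy[OF F] this]
 obtain M where M: "!!p q. p >= M ==> q >= M ==> \<bar>F p - F q\<bar> < c * e^2 / 2" by (auto simp: dist_real_def)
 have le: "l2_norm m (%x. u q x - u p x) < e" if "M <= p" "p <= q" for p q
 proof (rule power_less_imp_less_base)
  have "c * (l2_norm m (%x. u q x - u p x))^2 < c * e^2" using assms(4)[OF that(2)] M[of q p] that by simp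
  thus "(l2_norm m (%x. u q x - u p x))^2 < e^2" using c by simp
 qed (use e in simp)
 hence "l2_norm m (%x. u p x - u q x) < e" if "M <= p" "M <= q" for p q
  using that l2_norm_minus_commute[of m "u p" "u q"] le[of p q] le[of q p] by (cases "p <= q") auto
 thus "\<exists>M. \<forall>p\<ge>M. \<forall>q\<ge>M. l2_norm m (%x. u p x - u q x) < e" by blast
qed

text \<open>The energies decrease to some L, so \<open>u p - u n\<close> is bounded by
  \<open>2 * (F n - L)\<close> for all late p, and lower semicontinuity carries this bound to
  \<open>w - u n\<close>.\<close>

lemma (in l2_semigroup) form_Cauchy_limit:
 assumes u: "!!n. u n \<in> form_dom" and lim: "l2_tendsto m u w" and F0: "!!n. F n >= 0"
  and F: "!!n p. n <= p ==> form (%x. u p x - u n x) (%x. u p x - u n x) <= 2 * (F n - F p)"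
 shows "w \<in> form_dom" "(%n. form (%x. w x - u n x) (%x. w x - u n x)) ---> 0"
proof -
 have uu: "(%x. u p x - u n x) \<in> form_dom" for n p by (rule form_dom_diff[OF u u])
 have "decseq F" unfolding decseq_def using F form_nonneg[OF uu] by (meson diff_ge_0_iff_ge mult_nonneg_nonneg order_trans zero_le_mult_iff not_numeral_le_zero zero_le_numeral)
 then obtain L where L: "F ---> L" "!!n. L <= F n" using decseq_convergent[of F 0] F0 by blast
 have *: "(%x. w x - u n x) \<in> form_dom \<and> form (%x. w x - u n x) (%x. w x - u n x) <= 2 * (F n - L)" for n
 proof (rule form_lsc)
  have "l2_tendsto m (%p. u (p + n)) w" by (rule l2_tendsto_subseq[OF lim]) (simp add: strict_mono_def)
  thus "l2_tendsto m (%p x. u (p + n) x - u n x) (%x. w x - u n x)" by (intro l2_tendsto_diff l2_tendsto_const form_dom_L2 u)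
  show "form (%x. u (p + n) x - u n x) (%x. u (p + n) x - u n x) <= 2 * (F n - L)" for p
   using F[of n "p + n"] L(2)[of "p + n"] by simp
 qed (rule uu)
 hence "(%x. (w x - u 0 x) + u 0 x) \<in> form_dom" by (intro form_dom_add u) blast
 thus "w \<in> form_dom" by simp
 have lim0: "(%n. 2 * (F n - L)) ---> 2 * (L - L)" by (intro tendsto_intros L)
 show "(%n. form (%x. w x - u n x) (%x. w x - u n x)) ---> 0"
  by (rule tendsto_sandwich[OF _ _ tendsto_const lim0[simplified]]) (use * form_nonneg in auto)
qed

context hunt
begin

text \<open>The hitting distribution along the dyadic grid solves the Euler--Lagrange equation of the
 approximating form on the functions prescribed on \<open>U\<close>; its energies increase with the refinement of
 the grid, and coercivity turns this into convergence in mean square.\<close>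

lemma hit_fun_minimal:
 assumes a: "\<alpha> > 0" and U: "openin T U"
  and f: "f \<in> S.form_dom" "f \<in> compactly_supported T" and f0: "!!x. 0 <= f x" and f1: "!!x. f x <= 1"
 shows "hit_fun \<alpha> U f \<in> S.form_dom" "!!x. x \<in> U ==> hit_fun \<alpha> U f x = f x"
  "!!v. v \<in> S.form_dom ==> (!!x. x \<in> U ==> v x = f x) ==>
   S.form (hit_fun \<alpha> U f) (hit_fun \<alpha> U f) + \<alpha> * l2_inner m (hit_fun \<alpha> U f) (hit_fun \<alpha> U f) \<le>
   S.form v v + \<alpha> * l2_inner m v v"
proof -
 define Q where "Q = (%t u x. exp (- \<alpha> * t) * transition X t u x)"
 have a0: "\<alpha> >= 0" using a by simp
 interpret Q: l2_semigroup m Q unfolding Q_def by (rule S.scaled_semigroup[OF a0])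
 note dom = S.scaled_form(1)[OF a0 Q_def] and frm = S.scaled_form(2)[OF a0 Q_def]
 define h where "h k = (1/2::real)^k" for k :: nat
 have h: "h k > 0" "h k <= 1" for k by (simp_all add: h_def power_le_one)
 define w where "w k = grid_fun \<alpha> (h k) U f" for k
 have fL: "f \<in> L2 m" by (rule S.form_dom_L2[OF f(1)])
 hence fm: "f \<in> borel_measurable m" by auto
 have Us: "U \<in> sets m" using openin_borel_of[OF U] by (simp add: sets_m)
 have UT: "U \<subseteq> topspace T" by (rule openin_subset[OF U])
 have wL: "w k \<in> L2 m" for k
  unfolding w_def by (rule l2_tendstoD(2)[OF grid_fun_L2_limit[OF h(1) a Us fL f0 f1]])
 have wU: "w k x = f x" if "x \<in> U" for k x
  unfolding w_def by (rule grid_fun_eq[OF h(1) a Us fL f0 f1 that])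
 have orth: "Q.aform (h k) (w k) z = 0" if "z \<in> L2 m" "!!x. x \<in> U ==> z x = 0" for k z
  using grid_fun_orthogonal[OF h(1) a Us fL f0 f1 that, of k]
  unfolding Q.aform_def by (simp add: Q_def w_def[symmetric])
 \<comment> \<open>Pythagoras: a competitor differs from \<open>w k\<close> by a function vanishing
   on U, and such functions are orthogonal to \<open>w k\<close>.\<close>
 have pyth: "Q.aform (h k) v v = Q.aform (h k) (w k) (w k) + Q.aform (h k) (%x. v x - w k x) (%x. v x - w k x)"
  if v: "v \<in> L2 m" "!!x. x \<in> U ==> v x = f x" for k v
 proof -
  have z: "(%x. v x - w k x) \<in> L2 m" using v wL by auto
  have "Q.aform (h k) (w k) (%x. v x - w k x) = 0" by (rule orth[OF z]) (use v wU in auto)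
  thus ?thesis using Q.aform_quadratic[of "h k" "w k" "%x. v x - w k x" 1 1] h(1)[of k] wL z by simp
 qed
 define G where "G k = Q.aform (h k) (w k) (w k)" for k
 have Gle: "G k <= Q.aform (h k) v v" if "v \<in> L2 m" "!!x. x \<in> U ==> v x = f x" for k v
  using pyth[OF that, of k] Q.aform_nonneg[of "h k" "%x. v x - w k x"] h(1)[of k] that(1) wL[of k] by (simp add: G_def)
 have Gform: "G k <= Q.form v v" if "v \<in> Q.form_dom" "!!x. x \<in> U ==> v x = f x" for k v
  using Gle[OF Q.form_dom_L2[OF that(1)] that(2), of k] Q.aform_le_form[OF that(1) h(1)[of k]] by simp
 \<comment> \<open>Use \<open>w p\<close> as a competitor at mesh \<open>h n\<close>, where its
   energy is at most the one at the finer mesh.\<close>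
 have step: "Q.aform (h n) (%x. w p x - w n x) (%x. w p x - w n x) <= G p - G n" if "n <= p" for n p
  using pyth[OF wL wU, of n p] Q.aform_dyadic_mono[OF wL that, of p] by (simp add: G_def h_def)
 \<comment> \<open>Time 1 gives a coercivity constant that is valid for every dyadic mesh.\<close>
 define c where "c = 1 - exp (- \<alpha>)"
 have c: "c > 0" unfolding c_def using a by simp
 have coercive: "c * (l2_norm m u)^2 <= Q.aform (h n) u u" if u: "u \<in> L2 m" for u n
 proof -
  have "Q.corr u 1 <= exp (- \<alpha>) * l2_inner m u u"
   using S.corr_le[of 1 u] u unfolding Q.corr_def S.corr_def by (simp add: Q_def)
  hence "c * (l2_norm m u)^2 <= Q.aform ((1/2)^0) u u"
   by (simp add: Q.aform_self l2_norm_square c_def left_diff_distrib)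
  also have "... <= Q.aform (h n) u u" unfolding h_def by (rule Q.aform_dyadic_mono[OF u]) simp
  finally show ?thesis .
 qed
 have Ginc: "incseq G" unfolding incseq_def
 proof (intro allI impI)
  fix n p :: nat assume "n <= p"
  thus "G n <= G p" using step[of n p] Q.aform_nonneg[of "h n" "%x. w p x - w n x"] h(1)[of n] wL by auto
 qed
 have fd: "f \<in> Q.form_dom" using f dom by simp
 obtain L where L: "G ---> L" "!!k. G k <= L" using incseq_convergent[OF Ginc, of "Q.form f f"] Gform[OF fd] by blast
 have "l2_Cauchy m w"
 proof (rule l2_CauchyI[where F=G, OF wL c])
  show "convergent G" using L by (auto simp: convergent_def)
  show "c * (l2_norm m (%x. w p x - w n x))^2 <= 2 * \<bar>G p - G n\<bar>" if "n <= p" for n p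
   by (rule order_trans[OF coercive[OF L2_diff[OF wL wL]] order_trans[OF step[OF that]]]) (simp add: abs_if)
 qed
 moreover have lim: "(%k. w k x) ---> hit_fun \<alpha> U f x" if x: "x \<in> topspace T" for x
  unfolding w_def h_def grid_fun_def hit_fun_def
 proof (rule integral_dominated_convergence[where w="%_. 1"])
  have y: "Some x \<in> topspace (cemetery_topology T)" by (rule Some_space[OF x])
  interpret prob_space "law X (Some x)" by (rule law_prob[OF y])
  show "path_hit \<alpha> U f \<in> borel_measurable (law X (Some x))"
   using path_hit_measurable[OF U f(2) fm] by (simp add: measurable_law[OF y])
  show "grid_hit \<alpha> ((1/2)^k) U f \<in> borel_measurable (law X (Some x))" for k
   using grid_hit_measurable[of "(1/2)^k", OF _ fm Us] by (simp add: measurable_law[OF y])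
  show "AE om in law X (Some x). (%k. grid_hit \<alpha> ((1/2)^k) U f om) ---> path_hit \<alpha> U f om"
   by (rule AE_I2) (use grid_hit_tendsto[OF U f(2)] in "auto simp: space_law[OF y]")
  show "AE om in law X (Some x). norm (grid_hit \<alpha> ((1/2)^k) U f om) <= 1" for k
   by (rule AE_I2) (use grid_hit_bounds[of f \<alpha> "(1/2)^k" U, OF f0 f1 a] in auto)
  show "integrable (law X (Some x)) (%_. 1::real)" by simp
 qed
 moreover have "hit_fun \<alpha> U f \<in> borel_measurable m"
  unfolding hit_fun_def[abs_def] by (rule law_Some_measurable[OF path_hit_measurable[OF U f(2) fm]])
 ultimately have wt: "l2_tendsto m w (hit_fun \<alpha> U f)"
  by (intro l2_Cauchy_pointwise_limit AE_I2) (auto simp: space_m)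
 note hL = l2_tendstoD(2)[OF wt]
 \<comment> \<open>At a fixed mesh n the energies of all later \<open>w k\<close> are below L; the
   bound survives the mean-square limit, and only then does the mesh go to 0.\<close>
 have bd: "Q.aform (h n) (hit_fun \<alpha> U f) (hit_fun \<alpha> U f) <= L" for n
 proof (rule LIMSEQ_le_const2)
  show "(%k. Q.aform (h n) (w k) (w k)) ---> Q.aform (h n) (hit_fun \<alpha> U f) (hit_fun \<alpha> U f)"
   using h(1)[of n] by (intro Q.aform_tendsto wt) auto
  have "Q.aform (h n) (w k) (w k) <= L" if "n <= k" for k
   using Q.aform_dyadic_mono[OF wL that, of k] L(2)[of k] by (simp add: G_def h_def)
  thus "\<exists>N. \<forall>k\<ge>N. Q.aform (h n) (w k) (w k) <= L" by blast
 qed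
 have h0: "h ---> 0" unfolding h_def[abs_def] by (rule LIMSEQ_realpow_zero) auto
 note hd = Q.form_domI[OF hL h0 h(1) bd]
 show 1: "hit_fun \<alpha> U f \<in> S.form_dom" using hd(1) dom by simp
 show "hit_fun \<alpha> U f x = f x" if "x \<in> U" for x
  using lim[of x] wU[OF that] UT that LIMSEQ_unique[of "%k. w k x"] by (auto simp: LIMSEQ_const_iff)
 fix v assume v: "v \<in> S.form_dom" "!!x. x \<in> U ==> v x = f x"
 have "L <= Q.form v v" by (rule LIMSEQ_le_const2[OF L(1)]) (use Gform v dom in auto)
 thus "S.form (hit_fun \<alpha> U f) (hit_fun \<alpha> U f) + \<alpha> * l2_inner m (hit_fun \<alpha> U f) (hit_fun \<alpha> U f) \<le>
   S.form v v + \<alpha> * l2_inner m v v"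
  using hd(2) frm[OF 1] frm[OF v(1)] by simp
qed

text \<open>Integrated against the completed law, because for a set F that is not open the integrand
  is shown to be measurable only up to null sets.\<close>

definition hit_limit :: "real => 's set => ('s => real) => 's => real" where
 "hit_limit \<alpha> F f x = (\<integral>om. path_hit \<alpha> F f om \<partial>completion (law X (Some x)))"

text \<open>As the neighbourhoods shrink the constraint weakens, so the minimal energies decrease.
  The mean of \<open>w n\<close> and \<open>w p\<close> is admissible for the smaller neighbourhood,
  and the parallelogram law turns convergence of energies into convergence of the functions.\<close>

lemma hit_limit_form:
 assumes a: "\<alpha> > 0" and \<psi>: "\<psi> \<in> compactly_supported T" "!!x. x \<in> topspace T ==> \<psi> x <= 1"
  and f: "f \<in> S.form_dom" "f \<in> compactly_supported T" and f0: "!!x. 0 <= f x" and f1: "!!x. f x <= 1"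
  and F: "F = {x \<in> topspace T. \<psi> x = 1}"
 defines "w \<equiv> %n. hit_fun \<alpha> {x \<in> topspace T. \<psi> x > 1 - 1 / real (n + 2)} f"
 shows "hit_limit \<alpha> F f \<in> S.form_dom"
  "(%n. S.e1 (%x. hit_limit \<alpha> F f x - w n x) (%x. hit_limit \<alpha> F f x - w n x)) ---> 0"
proof -
 define U where "U n = {x \<in> topspace T. \<psi> x > 1 - 1 / real (n + 2)}" for n
 have w: "w n = hit_fun \<alpha> (U n) f" for n by (simp add: w_def U_def)
 have \<psi>c: "continuous_map T euclideanreal \<psi>" using \<psi> by (simp add: compactly_supported_def)
 have U: "openin T (U n)" for n
  using openin_continuous_map_preimage[OF \<psi>c, of "{1 - 1 / real (n + 2)<..}"] by (simp add: U_def)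
 have Ud: "U p \<subseteq> U n" if "n <= p" for n p
 proof -
  have "1 / real (p + 2) <= 1 / real (n + 2)" using that by (simp add: frac_le)
  thus ?thesis unfolding U_def by auto
 qed
 have fL: "f \<in> L2 m" by (rule S.form_dom_L2[OF f(1)])
 hence fm: "f \<in> borel_measurable m" by auto
 have lim: "(%n. w n x) ---> hit_limit \<alpha> F f x" if x: "x \<in> topspace T" for x
 proof -
  let ?M = "law X (Some x)"
  have y: "Some x \<in> topspace (cemetery_topology T)" by (rule Some_space[OF x])
  interpret prob_space ?M by (rule law_prob[OF y])
  have pm: "path_hit \<alpha> (U n) f \<in> borel_measurable ?M" for n
   using path_hit_measurable[OF U f(2) fm] by (simp add: measurable_law[OF y])
  have ae: "AE om in ?M. (%n. path_hit \<alpha> (U n) f om) ---> path_hit \<alpha> F f om"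
   unfolding U_def by (rule path_hit_shrinking[OF x \<psi> f(2) f0 f1 a F])
  have "(%om. lim (%n. path_hit \<alpha> (U n) f om)) \<in> borel_measurable ?M" by (intro borel_measurable_lim_metric pm)
  moreover have "AE om in ?M. lim (%n. path_hit \<alpha> (U n) f om) = path_hit \<alpha> F f om"
   using ae by eventually_elim (rule limI)
  ultimately have Fm: "path_hit \<alpha> F f \<in> borel_measurable (completion ?M)" by (rule completion_measurable_AE)
  have "(%n. \<integral>om. path_hit \<alpha> (U n) f om \<partial>completion ?M) ---> hit_limit \<alpha> F f x"
   unfolding hit_limit_def
  proof (rule integral_dominated_convergence[where w="%_. 1"])
   show "integrable (completion ?M) (%_. 1::real)" by (subst integrable_completion) auto
   show "AE om in completion ?M. norm (path_hit \<alpha> (U n) f om) <= 1" for n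
    by (rule AE_I2) (use path_hit_bounds[OF f0 f1 a, of "U n"] in auto)
   show "AE om in completion ?M. (%n. path_hit \<alpha> (U n) f om) ---> path_hit \<alpha> F f om"
    by (rule AE_completion[OF ae])
  qed (use Fm measurable_completion[OF pm] in auto)
  thus ?thesis by (simp add: w hit_fun_def integral_completion[OF pm])
 qed
 define Q where "Q = (%t u x. exp (- \<alpha> * t) * transition X t u x)"
 have a0: "\<alpha> >= 0" using a by simp
 interpret Q: l2_semigroup m Q unfolding Q_def by (rule S.scaled_semigroup[OF a0])
 note dom = S.scaled_form(1)[OF a0 Q_def] and frm = S.scaled_form(2)[OF a0 Q_def]
 note hm = hit_fun_minimal[OF a U f f0 f1]
 have wd: "w n \<in> Q.form_dom" for n unfolding w dom by (rule hm(1))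
 note wL = Q.form_dom_L2[OF wd]
 have wU: "w n x = f x" if "x \<in> U n" for n x unfolding w by (rule hm(2)[OF that])
 define G where "G n = Q.form (w n) (w n)" for n
 have G0: "G n >= 0" for n unfolding G_def by (rule Q.form_nonneg[OF wd])
 have min: "G n <= Q.form v v" if v: "v \<in> Q.form_dom" "!!x. x \<in> U n ==> v x = f x" for n v
 proof -
  have v': "v \<in> S.form_dom" using v dom by simp
  show ?thesis using hm(3)[OF v' v(2)] frm[OF v'] frm[OF hm(1)[of n]] by (simp add: G_def w)
 qed
 have le: "Q.form (%x. w p x - w n x) (%x. w p x - w n x) <= 2 * (G n - G p)" if "n <= p" for n p
 proof -
  have "G p <= Q.form (%x. 1/2 * w p x + 1/2 * w n x) (%x. 1/2 * w p x + 1/2 * w n x)"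
  proof (rule min)
   show "(%x. 1/2 * w p x + 1/2 * w n x) \<in> Q.form_dom" by (rule Q.form_dom_lin[OF wd wd])
   show "1/2 * w p x + 1/2 * w n x = f x" if "x \<in> U p" for x
    using wU[of x p] wU[of x n] Ud[OF \<open>n <= p\<close>] that by auto
  qed
  thus ?thesis using Q.form_quadratic[OF wd wd, of "1/2" p "1/2" n] Q.form_quadratic[OF wd wd, of 1 p "-1" n]
   by (simp add: G_def power2_eq_square)
 qed
 have coercive: "\<alpha> * (l2_norm m u)^2 <= Q.form u u" if "u \<in> Q.form_dom" for u
  using that frm[of u] S.form_nonneg[of u] dom by (simp add: l2_norm_square)
 have wdd: "(%x. w p x - w n x) \<in> Q.form_dom" for n p using Q.form_dom_lin[OF wd wd, of 1 p "-1" n] by simp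
 have dec: "decseq G" unfolding decseq_def
 proof (intro allI impI)
  fix n p :: nat assume "n <= p"
  thus "G p <= G n" using le[of n p] Q.form_nonneg[OF wdd[of p n]] by simp
 qed
 have "l2_Cauchy m w"
 proof (rule l2_CauchyI[where F=G, OF wL a])
  obtain L where "G ---> L" using decseq_convergent[OF dec, of 0] G0 by blast
  thus "convergent G" by (auto simp: convergent_def)
  show "\<alpha> * (l2_norm m (%x. w p x - w n x))^2 <= 2 * \<bar>G p - G n\<bar>" if "n <= p" for n p
   by (rule order_trans[OF coercive[OF wdd] order_trans[OF le[OF that]]]) (simp add: abs_if)
 qed
 moreover have "hit_limit \<alpha> F f \<in> borel_measurable m"
  by (rule borel_measurable_LIMSEQ_real[where u=w]) (use lim wL in "auto simp: space_m")
 ultimately have wt: "l2_tendsto m w (hit_limit \<alpha> F f)"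
  using lim by (intro l2_Cauchy_pointwise_limit AE_I2) (auto simp: space_m)
 note fc = Q.form_Cauchy_limit[OF wd wt G0 le]
 show wdom: "hit_limit \<alpha> F f \<in> S.form_dom" using fc(1) dom by simp
 let ?d = "%n x. hit_limit \<alpha> F f x - w n x"
 have dd: "?d n \<in> S.form_dom" for n using Q.form_dom_lin[OF fc(1) wd, of 1 "-1" n] dom by simp
 have "l2_tendsto m ?d (%x. hit_limit \<alpha> F f x - hit_limit \<alpha> F f x)" by (intro l2_tendsto_diff wt l2_tendsto_const) (rule l2_tendstoD(2)[OF wt])
 from l2_tendsto_inner[OF this this] have in0: "(%n. l2_inner m (?d n) (?d n)) ---> 0" by (simp add: l2_inner_def)
 \<comment> \<open>The damped form has weight \<alpha> on the inner product; the correction 1 -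
   \<alpha>, of either sign, converts it to weight 1.\<close>
 have "(%n. Q.form (?d n) (?d n) + (1 - \<alpha>) * l2_inner m (?d n) (?d n)) ---> 0 + (1 - \<alpha>) * 0"
  by (intro tendsto_intros fc(2) in0)
 thus "(%n. S.e1 (?d n) (?d n)) ---> 0"
  using frm[OF dd] by (simp add: S.e1_def algebra_simps)
qed

end

section \<open>Cut-off functions on locally compact metric spaces\<close>

lemma compactly_supported_mult:
 assumes f: "f \<in> compactly_supported T" and g: "continuous_map T euclideanreal g"
 shows "(%x. f x * g x) \<in> compactly_supported T"
 using assms unfolding compactly_supported_def by (auto intro: continuous_map_real_mult)

lemma compactly_supported_comp:
 assumes f: "f \<in> compactly_supported T" and g: "continuous_map T euclideanreal (%x. g (f x))" "g 0 = 0"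
 shows "(%x. g (f x)) \<in> compactly_supported T"
 using assms unfolding compactly_supported_def by fastforce

lemma Urysohn_compactly_supported:
 assumes lc: "locally_compact_space T" and m: "metrizable_space T" and F: "compactin T F" and C: "closedin T C" "F \<inter> C = {}"
 shows "\<exists>g\<in>compactly_supported T. (\<forall>x\<in>topspace T. 0 <= g x \<and> g x <= 1) \<and> (\<forall>x\<in>F. g x = 1) \<and> (\<forall>x\<in>C. g x = 0)"
proof -
 have "Hausdorff_space T \<or> regular_space T" using metrizable_imp_Hausdorff_space[OF m] by simp
 from locally_compact_space_compact_closed_compact[OF this] lc F
 obtain U L where U: "openin T U" "compactin T L" "F \<subseteq> U" "U \<subseteq> L" by blast
 have cl: "closedin T ((topspace T - U) \<union> C)" using U C by auto
 have dj: "disjnt F ((topspace T - U) \<union> C)" using U C by (auto simp: disjnt_def)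
 obtain g where g: "continuous_map T (subtopology euclidean {0..1::real}) g" "g ` ((topspace T - U) \<union> C) \<subseteq> {0}" "g ` F \<subseteq> {1}"
  by (rule Urysohn_completely_regular_compact_closed[OF _ metrizable_imp_completely_regular_space[OF m] F cl dj, of 0 1]) simp_all
 have gc: "continuous_map T euclideanreal g" "g \<in> topspace T \<rightarrow> {0..1}" using g(1) by (auto simp: continuous_map_in_subtopology)
 moreover have "g \<in> compactly_supported T"
  unfolding compactly_supported_def using gc(1) U g(2) by (intro CollectI conjI exI[of _ L]) auto
 ultimately show ?thesis using g(2,3) by (intro bexI[of _ g]) auto
qed

text \<open>The superlevel sets of a function with peak set exactly F are neighbourhoods shrinking
  to F. It is an ordinary cut-off, equal to 1 on F, times 1 minus the distance to F, cut at
  0.\<close>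

lemma compact_peak_function:
 fixes E :: "'a metric"
 assumes lc: "locally_compact_space (mtopology_of E)" and F: "compactin (mtopology_of E) F"
 shows "\<exists>\<psi>\<in>compactly_supported (mtopology_of E). (\<forall>x\<in>mspace E. \<psi> x <= 1) \<and> F = {x \<in> mspace E. \<psi> x = 1}"
proof (cases "F = {}")
 case True
 thus ?thesis by (intro bexI[of _ "%_. 0"]) (auto simp: compactly_supported_def intro: exI[of _ "{}"])
next
 case False
 let ?T = "mtopology_of E"
 have FE: "F \<subseteq> mspace E" using compactin_subset_topspace[OF F] by simp
 have met: "metrizable_space ?T" unfolding mtopology_of_def by (rule Metric_space.metrizable_space_mtopology[OF Metric_space_mspace_mdist])
 have Fc: "closedin ?T F" by (rule compactin_imp_closedin[OF metrizable_imp_Hausdorff_space[OF met] F])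
 obtain g where g: "g \<in> compactly_supported ?T" "!!x. x \<in> mspace E ==> 0 <= g x \<and> g x <= 1" "!!x. x \<in> F ==> g x = 1"
  using Urysohn_compactly_supported[OF lc met F closedin_empty] by auto
 define d where "d x = (INF z\<in>F. mdist E x z)" for x
 have bdd: "bdd_below ((%z. mdist E x z) ` F)" for x by (rule bdd_belowI2[of _ 0]) simp
 have d0: "d x >= 0" for x unfolding d_def using False by (intro cINF_greatest) auto
 have lip: "d x <= d y + mdist E x y" if "x \<in> mspace E" "y \<in> mspace E" for x y
 proof -
  have "d x - mdist E x y <= d y" unfolding d_def[of y]
  proof (rule cINF_greatest[OF False])
   fix z assume z: "z \<in> F"
   have "d x <= mdist E x z" unfolding d_def by (rule cINF_lower[OF bdd z])
   also have "... <= mdist E x y + mdist E y z" using that z FE by (intro mdist_triangle) auto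
   finally show "d x - mdist E x y <= mdist E y z" by simp
  qed
  thus ?thesis by simp
 qed
 have "\<bar>d x - d y\<bar> <= 1 * mdist E x y" if "x \<in> mspace E" "y \<in> mspace E" for x y
  using lip[OF that] lip[OF that(2,1)] mdist_commute[of E x y] by (simp add: abs_le_iff)
 hence "Lipschitz_continuous_map E euclidean_metric d"
  unfolding Lipschitz_continuous_map_def by (auto simp: dist_real_def intro!: exI[of _ 1])
 hence dc: "continuous_map ?T euclideanreal d" using Lipschitz_continuous_imp_continuous_map by force
 have dF: "x \<in> F" if x: "x \<in> mspace E" "d x = 0" for x
 proof (rule ccontr)
  assume "x \<notin> F"
  have "openin ?T (mspace E - F)" using Fc by (simp add: closedin_def)
  moreover have "x \<in> mspace E - F" using x \<open>x \<notin> F\<close> by simp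
  ultimately obtain r where r: "r > 0" "mball_of E x r \<subseteq> mspace E - F"
   by (metis Metric_space.openin_mtopology Metric_space_mspace_mdist mball_of_def mtopology_of_def)
  have "r <= d x" unfolding d_def
  proof (rule cINF_greatest[OF False])
   fix z assume "z \<in> F"
   hence "z \<notin> mball_of E x r" "z \<in> mspace E" using r FE by auto
   thus "r <= mdist E x z" using x(1) by (simp add: in_mball_of)
  qed
  thus False using r x by simp
 qed
 have dz: "d x = 0" if "x \<in> F" for x
 proof -
  have "d x <= mdist E x x" unfolding d_def by (rule cINF_lower[OF bdd that])
  moreover have "mdist E x x = 0" using that FE by auto
  ultimately show ?thesis using d0[of x] by simp
 qed
 let ?\<psi> = "%x. g x * max 0 (1 - d x)"
 have inF: "x \<in> F" if x: "x \<in> mspace E" "?\<psi> x = 1" for x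
 proof -
  have "g x * max 0 (1 - d x) <= 1 * max 0 (1 - d x)" using g(2)[OF x(1)] by (intro mult_right_mono) auto
  hence "d x = 0" using x(2) d0[of x] by (simp add: max_def split: if_splits)
  thus ?thesis by (rule dF[OF x(1)])
 qed
 have "?\<psi> \<in> compactly_supported ?T"
  by (rule compactly_supported_mult[OF g(1)]) (intro continuous_intros dc)
 moreover have "\<forall>x\<in>mspace E. ?\<psi> x <= 1"
 proof
  fix x assume "x \<in> mspace E"
  thus "?\<psi> x <= 1"
  using mult_mono[of "g x" 1 "max 0 (1 - d x)" 1] g(2)[of x] d0[of x] by simp
 qed
 moreover have "F = {x \<in> mspace E. ?\<psi> x = 1}"
 proof (intro set_eqI iffI CollectI conjI)
  show "?\<psi> x = 1" if "x \<in> F" for x using g(3)[OF that] dz[OF that] by simp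
 qed (use FE inF in auto)
 ultimately show ?thesis by (intro bexI[of _ ?\<psi>] conjI)
qed

section \<open>Hitting functions and the domain with darning\<close>

locale dirichlet_hunt = hunt "base D" "refm D" X for D :: "'s form_data" and X :: "('s, 'w) process" +
 assumes second_countable: "second_countable (base D)"
  and sigma_finite_refm: "sigma_finite_measure (refm D)"
  and regular_form: "regular_dirichlet_form D"
  and assoc: "associated_hunt_process D X"

sublocale dirichlet_hunt \<subseteq> dirichlet_space D "transition X"
proof unfold_locales
 show "fdom D = S.form_dom" by (rule associated_form(1)[OF assoc refl])
 show "energy D u v = S.form u v" if "u \<in> S.form_dom" "v \<in> S.form_dom" for u v
  by (rule associated_form(2)[OF assoc refl that])
qed (rule sets_m second_countable sigma_finite_measure.sigma_finite_countable[OF sigma_finite_refm] regular_form)+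

context dirichlet_hunt
begin

text \<open>Regularity of the form approximates a cut-off uniformly within 1/4. The map \<theta>
  sends values above 3/4 to 1 and values below 1/4 to 0, and as a multiple of a difference of
  truncations it keeps the function in the domain.\<close>

lemma separating_function:
 assumes lc: "locally_compact_space (base D)" and met: "metrizable_space (base D)"
  and F: "compactin (base D) F" and C: "closedin (base D) C" "F \<inter> C = {}"
 shows "\<exists>f\<in>fdom D \<inter> compactly_supported (base D). (\<forall>x. 0 <= f x \<and> f x <= 1) \<and> (\<forall>x\<in>F. f x = 1) \<and> (\<forall>x\<in>C. f x = 0)"
proof -
 obtain u where u: "u \<in> compactly_supported (base D)" "!!x. x \<in> F ==> u x = 1" "!!x. x \<in> C ==> u x = 0"
  using Urysohn_compactly_supported[OF lc met F C] by auto
 have "\<exists>g\<in>fdom D \<inter> compactly_supported (base D). \<forall>x\<in>topspace (base D). \<bar>u x - g x\<bar> < 1/4"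
 proof -
  have "(0::real) < 1/4" by simp
  thus ?thesis using regular_form u(1) unfolding regular_dirichlet_form_def by blast
 qed
 then obtain g where g: "g \<in> fdom D" "g \<in> compactly_supported (base D)" "!!x. x \<in> topspace (base D) ==> \<bar>u x - g x\<bar> < 1/4" by auto
 define \<theta> :: "real => real" where "\<theta> s = 2 * (min (max s 0) (3/4) - min (max s 0) (1/4))" for s
 have gd: "g \<in> S.form_dom" using g dom by simp
 have "(%x. min (max (g x) 0) c) \<in> S.form_dom" if "c >= 0" for c
  using S.form_truncation(3)[OF S.form_pos_part(1)[OF gd] that] .
 hence 1: "(%x. \<theta> (g x)) \<in> S.form_dom"
  unfolding \<theta>_def by (intro S.form_dom_cmult S.form_dom_diff) auto
 have gc: "continuous_map (base D) euclideanreal g" using g(2) by (simp add: compactly_supported_def)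
 have 2: "(%x. \<theta> (g x)) \<in> compactly_supported (base D)"
  by (rule compactly_supported_comp[OF g(2)])
   (auto simp: \<theta>_def intro!: continuous_intros gc)
 have \<theta>: "s >= 3/4 ==> \<theta> s = 1" "s <= 1/4 ==> \<theta> s = 0" "0 <= \<theta> s \<and> \<theta> s <= 1" for s
  by (auto simp: \<theta>_def)
 have sub: "F \<subseteq> topspace (base D)" "C \<subseteq> topspace (base D)" using compactin_subset_topspace[OF F] closedin_subset[OF C(1)] by auto
 have "\<theta> (g x) = 1" if "x \<in> F" for x
 proof (rule \<theta>(1))
  have "\<bar>u x - g x\<bar> < 1/4" using g(3) sub that by blast
  thus "g x >= 3/4" using u(2)[OF that] by linarith
 qed
 moreover have "\<theta> (g x) = 0" if "x \<in> C" for x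
 proof (rule \<theta>(2))
  have "\<bar>u x - g x\<bar> < 1/4" using g(3) sub that by blast
  thus "g x <= 1/4" using u(3)[OF that] by linarith
 qed
 ultimately show ?thesis using 1 2 dom \<theta>(3) by (intro bexI[of _ "%x. \<theta> (g x)"]) auto
qed

text \<open>The differences \<open>f - w n\<close> vanish on neighbourhoods of F and converge in
  energy to f minus the hitting function, whose version therefore vanishes quasi-everywhere on F,
  even when F is a null set.\<close>

lemma hit_limit_qc:
 assumes a: "\<alpha> > 0" and \<psi>: "\<psi> \<in> compactly_supported (base D)" "!!x. x \<in> topspace (base D) ==> \<psi> x <= 1"
  and f: "f \<in> fdom D" "f \<in> compactly_supported (base D)" and f0: "!!x. 0 <= f x" and f1: "!!x. f x <= 1"
  and F: "F = {x \<in> topspace (base D). \<psi> x = 1}"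
 shows "\<exists>g. qc_version D (hit_limit \<alpha> F f) g \<and> qe_on D F (%x. g x = f x)"
proof -
 define U where "U n = {x \<in> topspace (base D). \<psi> x > 1 - 1 / real (n + 2)}" for n
 have \<psi>c: "continuous_map (base D) euclideanreal \<psi>" using \<psi> by (simp add: compactly_supported_def)
 have U: "openin (base D) (U n)" for n
  using openin_continuous_map_preimage[OF \<psi>c, of "{1 - 1 / real (n + 2)<..}"] by (simp add: U_def)
 have Ud: "U (Suc n) \<subseteq> U n" for n
 proof -
  have "1 / real (Suc n + 2) <= 1 / real (n + 2)" by (simp add: frac_le)
  thus ?thesis unfolding U_def by auto
 qed
 have fd: "f \<in> S.form_dom" using f dom by simp
 define w where "w n = hit_fun \<alpha> (U n) f" for n
 let ?w = "hit_limit \<alpha> F f"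
 note hl = hit_limit_form[OF a \<psi> fd f(2) f0 f1 F, folded U_def, folded w_def]
 note hm = hit_fun_minimal[OF a U fd f(2) f0 f1, folded w_def]
 let ?v = "%x. f x - ?w x" and ?vn = "%n x. f x - w n x"
 have v: "?v \<in> S.form_dom" by (rule S.form_dom_diff[OF fd hl(1)])
 have vn: "?vn n \<in> S.form_dom" for n by (rule S.form_dom_diff[OF fd hm(1)])
 obtain h where h: "qc_version D ?v h" using qc_version_exists[OF v] by blast
 have "qe_on D (\<Inter>n. U n) (%x. h x = 0)"
 proof (rule quasi_continuous_zero_limit[where U=U and vn="?vn", OF v h vn U Ud])
  show "AE x in refm D. x \<in> U n --> ?vn n x = 0" for n using hm(2)[of _ n] by (intro AE_I2) auto
  have "(%x. ?vn n x - ?v x) = (%x. ?w x - w n x)" for n by auto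
  thus "(%n. S.e1 (%x. ?vn n x - ?v x) (%x. ?vn n x - ?v x)) ---> 0" using hl(2) by simp
 qed
 hence "qe_on D F (%x. 1 * f x + (-1) * h x = f x)" by (rule qe_on_mono) (auto simp: F U_def)
 moreover have "qc_version D ?w (%x. 1 * f x + (-1) * h x)"
  unfolding qc_version_def
 proof
  show "quasi_continuous D (%x. 1 * f x + (-1) * h x)"
   by (rule quasi_continuous_lin) (use h f(2) in "auto simp: qc_version_def compactly_supported_def intro: quasi_continuous_continuous")
  show "AE x in refm D. 1 * f x + (-1) * h x = ?w x"
   using h unfolding qc_version_def by (elim conjE) (erule eventually_mono, simp)
 qed
 ultimately show ?thesis by blast
qed

text \<open>The hitting time is a limit from the right of visits to the level set where \<psi> is 1;
  as that value is not 0, the path is not at the cemetery.\<close>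

lemma path_at_hitting_closed:
 assumes \<psi>: "\<psi> \<in> compactly_supported (base D)" and F: "F = {x \<in> topspace (base D). \<psi> x = 1}"
  and w: "om \<in> sample X" and fin: "hitting_time X F om < \<infinity>"
 shows "path_at X (hitting_time X F om) om \<in> Some ` F"
proof -
 have ne: "hitset F om ~= {}" using fin hitting_time_empty by force
 define l where "l = Inf (hitset F om)"
 have l: "hitting_time X F om = ennreal l" "l >= 0" unfolding l_def by (rule hitting_time_eq[OF ne])+
 have "\<exists>s. \<forall>k. s k \<in> hitset F om \<and> s k < l + 1 / real (Suc k)"
 proof (intro choice allI)
  fix k
  have "Inf (hitset F om) < l + 1 / real (Suc k)" unfolding l_def by simp
  thus "\<exists>s. s \<in> hitset F om \<and> s < l + 1 / real (Suc k)" using cInf_lessD[OF ne] by blast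
 qed
 then obtain s where s: "!!k. s k \<in> hitset F om" "!!k. s k < l + 1 / real (Suc k)" by blast
 have sl: "s k >= l" for k unfolding l_def by (rule cInf_lower[OF s(1) hitset_bdd])
 have lk: "(%k. l + 1 / real (Suc k)) ---> l" using LIMSEQ_inverse_real_of_nat_add[of l] by (simp add: inverse_eq_divide)
 have "s ---> l"
 proof (rule real_tendsto_sandwich[where f="%_. l" and h="%k. l + 1 / real (Suc k)", OF _ _ tendsto_const lk])
  show "\<forall>\<^sub>F k in sequentially. l <= s k" using sl by (rule always_eventually[OF allI])
  show "\<forall>\<^sub>F k in sequentially. s k <= l + 1 / real (Suc k)" using s(2) by (intro always_eventually allI less_imp_le)
 qed
 note ext0_right_seq[OF \<psi> w l(2) this sl]
 hence "(%k. ext0 \<psi> (path X (s k) om)) ---> ext0 \<psi> (path X l om)" .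
 moreover have "ext0 \<psi> (path X (s k) om) = 1" for k using s(1)[of k] by (auto simp: hitset_def F)
 ultimately have one: "ext0 \<psi> (path X l om) = 1" by (simp add: LIMSEQ_const_iff)
 then obtain z where z: "path X l om = Some z" "\<psi> z = 1" by (cases "path X l om") auto
 moreover have "path X l om \<in> topspace (cemetery_topology (base D))" by (rule path_space[OF w l(2)])
 ultimately have "z \<in> F" by (auto simp: F topspace_cemetery_topology)
 thus ?thesis using l z by (simp add: path_at_def)
qed

text \<open>The first hit lies in the hole, where f coincides with the indicator of
  \<open>K j\<close>; so the indicator can be replaced by a continuous function of the
  domain.\<close>

lemma hitting_function_eq:
 assumes \<psi>: "\<psi> \<in> compactly_supported (base D)" and F: "hole K N = {x \<in> topspace (base D). \<psi> x = 1}"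
  and f: "!!x. x \<in> hole K N ==> f x = indicator (K j) x" and x: "x \<in> topspace (base D)"
 shows "hitting_function X K N \<alpha> j x = hit_limit \<alpha> (hole K N) f x"
 unfolding hitting_function_def hit_limit_def
proof (rule Bochner_Integration.integral_cong[OF refl])
 fix om assume "om \<in> space (completion (law X (Some x)))"
 hence w: "om \<in> sample X" using space_law[OF Some_space[OF x]] by (simp add: space_completion)
 let ?\<sigma> = "hitting_time X (hole K N) om"
 have "indicator {om. path_at X (hitting_time X (hole K N) om) om \<in> Some ` K j} om = ext0 f (path_at X ?\<sigma> om)"
 proof (cases "?\<sigma> < \<infinity>")
  case True
  then obtain z where "path_at X ?\<sigma> om = Some z" "z \<in> hole K N"
   using path_at_hitting_closed[OF \<psi> F w] by blast
  thus ?thesis using f by (auto split: split_indicator)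
 next
  case False
  thus ?thesis by (auto simp: path_at_def less_top split: split_indicator)
 qed
 thus "exp (- \<alpha> * enn2real ?\<sigma>) * indicator {om. path_at X (hitting_time X (hole K N) om) om \<in> Some ` K j} om =
   path_hit \<alpha> (hole K N) f om"
  by (simp add: path_hit_def)
qed

lemma qe_on_finite_Ball: "finite I ==> (!!i. i \<in> I ==> qe_on D A (Q i)) ==> qe_on D A (%x. \<forall>i\<in>I. Q i x)"
proof (induction I rule: finite_induct)
 case empty
 thus ?case by (simp add: qe_on_polar polar_empty)
next
 case (insert i I)
 hence "qe_on D A (%x. Q i x \<and> (\<forall>i\<in>I. Q i x))" by (intro qe_on_conj) auto
 thus ?case by simp
qed

lemma qe_on_finite_UN: "finite I ==> (!!i. i \<in> I ==> qe_on D (A i) Q) ==> qe_on D (\<Union>i\<in>I. A i) Q"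
 by (induction I rule: finite_induct) (simp_all add: qe_on_Un, simp add: qe_on_polar polar_empty)

lemma qc_version_lin:
 "qc_version D u g ==> qc_version D v h ==> qc_version D (%x. a * u x + b * v x) (%x. a * g x + b * h x)"
 unfolding qc_version_def by (auto intro: quasi_continuous_lin)

lemma qc_version_AE_cong: "qc_version D u g ==> AE x in refm D. u x = v x ==> qc_version D v g"
 unfolding qc_version_def by auto

lemma qc_version_sum:
 "finite I ==> (!!i. i \<in> I ==> qc_version D (u i) (g i)) ==>
  qc_version D (%x. \<Sum>i\<in>I. c i * u i x) (%x. \<Sum>i\<in>I. c i * g i x)"
proof (induction I rule: finite_induct)
 case empty
 thus ?case by (simp add: qc_version_def quasi_continuous_continuous)
next
 case (insert i I)
 hence "qc_version D (%x. c i * u i x + 1 * (\<Sum>i\<in>I. c i * u i x)) (%x. c i * g i x + 1 * (\<Sum>i\<in>I. c i * g i x))"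
  by (intro qc_version_lin) auto
 thus ?case using insert by simp
qed

text \<open>Quasi-everywhere, each hitting function has boundary value 1 on its own
  \<open>K j\<close> and 0 on the others. So subtracting a combination with the right coefficients
  brings given constants on the \<open>K j\<close> down to 0, and a function of the part domain plus
  a combination has the coefficients as constants.\<close>

lemma darning_domain_eq:
 fixes E :: "'s metric"
 assumes base: "base D = mtopology_of E" and lc: "locally_compact_space (base D)"
  and K: "!!j. j \<in> {1..N} ==> compactin (base D) (K j)"
  and disj: "!!i j. i \<in> {1..N} ==> j \<in> {1..N} ==> i ~= j ==> K i \<inter> K j = {}" and a: "\<alpha> > 0"
 shows "darning_domain D X K N \<alpha> = constant_domain D K N"
proof -
 let ?H = "hole K N"
 have met: "metrizable_space (base D)" unfolding base mtopology_of_def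
  by (rule Metric_space.metrizable_space_mtopology[OF Metric_space_mspace_mdist])
 have Kc: "closedin (base D) (K j)" if "j \<in> {1..N}" for j
  by (rule compactin_imp_closedin[OF metrizable_imp_Hausdorff_space[OF met] K[OF that]])
 have Hc: "compactin (base D) ?H" unfolding hole_def by (intro compactin_Union) (use K in auto)
 hence HT: "?H \<subseteq> topspace (base D)" by (rule compactin_subset_topspace)
 obtain \<psi> where \<psi>: "\<psi> \<in> compactly_supported (base D)" "!!x. x \<in> topspace (base D) ==> \<psi> x <= 1"
  "?H = {x \<in> topspace (base D). \<psi> x = 1}"
  using compact_peak_function[of E ?H] lc Hc unfolding base by auto
 have "\<exists>f. \<forall>j\<in>{1..N}. f j \<in> fdom D \<inter> compactly_supported (base D) \<and> (\<forall>x. 0 <= f j x \<and> f j x <= 1) \<and>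
   (\<forall>x\<in>K j. f j x = 1) \<and> (\<forall>x\<in>(\<Union>i\<in>{1..N} - {j}. K i). f j x = 0)"
 proof (intro bchoice ballI)
  fix j assume j: "j \<in> {1..N}"
  have cl: "closedin (base D) (\<Union>i\<in>{1..N} - {j}. K i)" by (intro closedin_Union) (use Kc in auto)
  have dj: "K j \<inter> (\<Union>i\<in>{1..N} - {j}. K i) = {}" using disj[OF j] by blast
  show "\<exists>f. f \<in> fdom D \<inter> compactly_supported (base D) \<and> (\<forall>x. 0 <= f x \<and> f x <= 1) \<and>
   (\<forall>x\<in>K j. f x = 1) \<and> (\<forall>x\<in>(\<Union>i\<in>{1..N} - {j}. K i). f x = 0)"
   using separating_function[OF lc met K[OF j] cl dj] unfolding Bex_def .
 qed
 then obtain f where fp: "\<forall>j\<in>{1..N}. f j \<in> fdom D \<inter> compactly_supported (base D) \<and> (\<forall>x. 0 <= f j x \<and> f j x <= 1) \<and>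
   (\<forall>x\<in>K j. f j x = 1) \<and> (\<forall>x\<in>(\<Union>i\<in>{1..N} - {j}. K i). f j x = 0)" by (rule exE)
 have f: "f j \<in> fdom D" "f j \<in> compactly_supported (base D)" "!!x. 0 <= f j x" "!!x. f j x <= 1"
   "!!x. x \<in> K j ==> f j x = 1" if "j \<in> {1..N}" for j
  using bspec[OF fp that] by simp_all
 have f6: "f j x = 0" if "j \<in> {1..N}" "i \<in> {1..N}" "i ~= j" "x \<in> K i" for i j x
 proof -
  have "x \<in> (\<Union>i\<in>{1..N} - {j}. K i)" using that by blast
  thus ?thesis using bspec[OF fp that(1)] by fast
 qed
 define w where "w j = hit_limit \<alpha> ?H (f j)" for j
 have f_ind: "f j x = indicator (K j) x" if j: "j \<in> {1..N}" and x: "x \<in> ?H" for j x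
 proof -
  obtain i where i: "i \<in> {1..N}" "x \<in> K i" using x unfolding hole_def by blast
  show ?thesis
   using f(5)[OF j] f6[OF j i(1) _ i(2)] i(2) by (cases "x \<in> K j"; cases "i = j") auto
 qed
 have wh: "hitting_function X K N \<alpha> j x = w j x" if "j \<in> {1..N}" "x \<in> topspace (base D)" for j x
  unfolding w_def by (rule hitting_function_eq[OF \<psi>(1,3) f_ind[OF that(1)] that(2)])
 have "\<exists>g. \<forall>j\<in>{1..N}. qc_version D (w j) (g j) \<and> qe_on D ?H (%x. g j x = f j x)"
  unfolding w_def
 proof (intro bchoice ballI)
  fix j assume j: "j \<in> {1..N}"
  show "\<exists>g. qc_version D (hit_limit \<alpha> ?H (f j)) g \<and> qe_on D ?H (%x. g x = f j x)"
   by (rule hit_limit_qc[OF a \<psi>(1,2) f(1-4)[OF j] \<psi>(3)])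
 qed
 then obtain g where g: "!!j. j \<in> {1..N} ==> qc_version D (w j) (g j)"
  "!!j. j \<in> {1..N} ==> qe_on D ?H (%x. g j x = f j x)" by blast
 have wd: "w j \<in> S.form_dom" if j: "j \<in> {1..N}" for j
  unfolding w_def by (rule hit_limit_form(1)[OF a \<psi>(1,2) f(1)[OF j, unfolded dom] f(2-4)[OF j] \<psi>(3)])
 define S where "S c x = (\<Sum>j\<in>{1..N}. c j * w j x)" for c x
 define G where "G c x = (\<Sum>j\<in>{1..N}. c j * g j x)" for c x
 have Sd: "S c \<in> S.form_dom" for c
  unfolding S_def[abs_def] by (intro S.form_dom_sum S.form_dom_cmult wd)
 have SG: "qc_version D (S c) (G c)" for c
  unfolding S_def[abs_def] G_def[abs_def] by (intro qc_version_sum g) auto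
 have Gc: "qe_on D (K i) (%x. G c x = c i)" if i: "i \<in> {1..N}" for c i
 proof (rule qe_on_mono)
  show "qe_on D ?H (%x. \<forall>j\<in>{1..N}. g j x = f j x)" by (intro qe_on_finite_Ball g) auto
  show "K i \<subseteq> ?H" using i by (auto simp: hole_def)
  fix x assume x: "x \<in> K i" "\<forall>j\<in>{1..N}. g j x = f j x"
  have "G c x = (\<Sum>j\<in>{1..N}. if j = i then c i else 0)"
   unfolding G_def using f(5)[OF i x(1)] f6[OF _ i _ x(1)] x(2) by (intro sum.cong refl) (metis mult.right_neutral mult_zero_right)
  thus "G c x = c i" using i by simp
 qed
 have SH: "AE x in refm D. (\<Sum>j\<in>{1..N}. c j * hitting_function X K N \<alpha> j x) = S c x" for c
  unfolding S_def using wh by (intro AE_I2) (auto simp: space_refm intro!: sum.cong)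
 show ?thesis
 proof (intro set_eqI iffI)
  fix u assume "u \<in> darning_domain D X K N \<alpha>"
  then obtain h c where u: "u \<in> L2 (refm D)" and h: "h \<in> part_domain D (topspace (base D) - ?H)"
   and eq: "AE x in refm D. u x = h x + (\<Sum>j\<in>{1..N}. c j * hitting_function X K N \<alpha> j x)"
   unfolding darning_domain_def by blast
  obtain gh where gh: "qc_version D h gh" "qe_on D (topspace (base D) - (topspace (base D) - ?H)) (%x. gh x = 0)"
   and hd: "h \<in> S.form_dom" using h unfolding part_domain_def dom by blast
  have eq': "AE x in refm D. u x = h x + S c x" using eq SH[of c] by eventually_elim simp
  have ud: "u \<in> S.form_dom"
   by (rule S.form_AE_cong(1)[OF S.form_dom_add[OF hd Sd] L2_measurable[OF u] eq'])
  have "qc_version D (%x. 1 * h x + 1 * S c x) (%x. 1 * gh x + 1 * G c x)" by (rule qc_version_lin[OF gh(1) SG])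
  hence 1: "qc_version D u (%x. 1 * gh x + 1 * G c x)" by (rule qc_version_AE_cong) (use eq' in auto)
  have 2: "qe_on D (K i) (%x. 1 * gh x + 1 * G c x = c i)" if i: "i \<in> {1..N}" for i
  proof -
   have "K i \<subseteq> topspace (base D) - (topspace (base D) - ?H)"
    using compactin_subset_topspace[OF K[OF i]] i by (auto simp: hole_def)
   hence "qe_on D (K i) (%x. gh x = 0)" by (rule qe_on_mono[OF gh(2)])
   from qe_on_conj[OF this Gc[OF i, of c]] show ?thesis by (rule qe_on_mono) auto
  qed
  show "u \<in> constant_domain D K N" unfolding constant_domain_def dom using ud 1 2 by blast
 next
  fix u assume "u \<in> constant_domain D K N"
  then obtain gu where ud: "u \<in> S.form_dom" and gu: "qc_version D u gu"
   and "\<forall>j\<in>{1..N}. \<exists>c. qe_on D (K j) (%x. gu x = c)" unfolding constant_domain_def dom by blast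
  then obtain c where c: "!!j. j \<in> {1..N} ==> qe_on D (K j) (%x. gu x = c j)" by metis
  let ?h = "%x. 1 * u x + (-1) * S c x"
  have hd: "?h \<in> S.form_dom" by (rule S.form_dom_lin[OF ud Sd])
  have hq: "qc_version D ?h (%x. 1 * gu x + (-1) * G c x)" by (rule qc_version_lin[OF gu SG])
  have "qe_on D (\<Union>j\<in>{1..N}. K j) (%x. 1 * gu x + (-1) * G c x = 0)"
  proof (rule qe_on_finite_UN)
   fix i assume i: "i \<in> {1..N}"
   from qe_on_conj[OF c[OF i] Gc[OF i, of c]] show "qe_on D (K i) (%x. 1 * gu x + (-1) * G c x = 0)"
    by (rule qe_on_mono) auto
  qed simp
  hence "qe_on D (topspace (base D) - (topspace (base D) - ?H)) (%x. 1 * gu x + (-1) * G c x = 0)"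
   by (rule qe_on_mono) (auto simp: hole_def)
  hence hp: "?h \<in> part_domain D (topspace (base D) - ?H)" unfolding part_domain_def dom using hd hq by blast
  have "AE x in refm D. u x = ?h x + (\<Sum>j\<in>{1..N}. c j * hitting_function X K N \<alpha> j x)"
   using SH[of c] by eventually_elim simp
  thus "u \<in> darning_domain D X K N \<alpha>"
   unfolding darning_domain_def using S.form_dom_L2[OF ud] hp
   by (intro CollectI conjI bexI[of _ ?h] exI[of _ c])
 qed
qed

end

section \<open>The approximating forms\<close>

text \<open>Fubini: for almost every x, g equals g x almost everywhere, and one such x supplies the
  constant. The zero measure is set apart because there no x need qualify.\<close>

lemma AE_pair_const:
 fixes g :: "'s => real"
 assumes M: "sigma_finite_measure M" and ae: "AE z in M \<Otimes>\<^sub>M M. g (fst z) = g (snd z)"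
 shows "\<exists>c. AE x in M. g x = c"
proof -
 interpret pair_sigma_finite M M using M by (simp add: pair_sigma_finite_def)
 have 1: "AE x in M. AE y in M. g x = g y" using AE_pair[OF ae] by simp
 show ?thesis
 proof (cases "AE x in M. False")
  case True
  hence "AE x in M. g x = 0" by (rule eventually_mono) simp
  thus ?thesis by blast
 next
  case False
  have "\<exists>x. AE y in M. g x = g y"
  proof (rule ccontr)
   assume "\<not> ?thesis"
   with 1 have "AE x in M. False" by (auto elim: eventually_mono)
   with False show False by blast
  qed
  then obtain x where "AE y in M. g x = g y" by blast
  hence "AE y in M. g y = g x" by (rule eventually_mono) simp
  thus ?thesis by blast
 qed
qed

lemma AE_pair_both:
 assumes M: "sigma_finite_measure M" and P: "{x \<in> space M. P x} \<in> sets M" and ae: "AE x in M. P x"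
 shows "AE z in M \<Otimes>\<^sub>M M. P (fst z) \<and> P (snd z)"
proof -
 interpret pair_sigma_finite M M using M by (simp add: pair_sigma_finite_def)
 have "{z \<in> space (M \<Otimes>\<^sub>M M). P (fst z) \<and> P (snd z)} = {x \<in> space M. P x} \<times> {x \<in> space M. P x}"
  by (auto simp: space_pair_measure)
 hence "{z \<in> space (M \<Otimes>\<^sub>M M). P (fst z) \<and> P (snd z)} \<in> sets (M \<Otimes>\<^sub>M M)" using P by simp
 moreover have "AE x in M. AE y in M. P (fst (x, y)) \<and> P (snd (x, y))"
  using ae by eventually_elim (use ae in "auto elim: eventually_mono")
 ultimately show ?thesis by (rule AE_pair_measure)
qed

text \<open>The sequences are indexed from 0 here; the theorem, whose hypotheses start at 1, uses
  them shifted by one.\<close>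

locale approximation = dirichlet_hunt D X for D :: "'s form_data" and X :: "('s, 'w) process" +
 fixes K :: "nat => 's set" and N :: nat and \<nu> :: "nat => 's measure" and lam :: "nat => real"
  and Xn :: "nat => ('s, 'w1) process"
 assumes K_closed: "!!j. j \<in> {1..N} ==> closedin (base D) (K j)"
  and finite_\<nu>: "!!j. j \<in> {1..N} ==> finite_measure (\<nu> j)"
  and smooth_\<nu>: "!!j. j \<in> {1..N} ==> smooth_measure D (\<nu> j)"
  and support_\<nu>: "!!j. j \<in> {1..N} ==> quasi_support D (\<nu> j) (K j)"
  and lam_pos: "!!n. lam n > 0" and lam_mono: "!!n. lam n <= lam (Suc n)" and lam_top: "filterlim lam at_top sequentially"
  and assoc_n: "!!n. associated_hunt_process (approx_form D K N \<nu> (lam n)) (Xn n)"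

sublocale approximation \<subseteq> Xn: hunt "base D" "refm D" "Xn n" for n
proof
 show "hunt_process (base D) (Xn n)" "symmetric_process (refm D) (Xn n)"
  using assoc_n[of n] unfolding associated_hunt_process_def approx_form_def by simp_all
 show "sets (refm D) = sets (borel_of (base D))" by (rule borel_sets)
qed

context approximation
begin

definition jump :: "nat => ('s => real) => real" where
 "jump j u = (LINT (x, y):K j \<times> K j|\<nu> j \<Otimes>\<^sub>M \<nu> j.
   (the_qc_version D u x - the_qc_version D u y) * (the_qc_version D u x - the_qc_version D u y))"

lemma approx_dom: "Xn.S.form_dom n = S.form_dom"
 using Xn.associated_form(1)[OF assoc_n, of n] dom by (simp add: approx_form_def)

lemma approx_energy:
 assumes "u \<in> S.form_dom"
 shows "Xn.S.form n u u = S.form u u + lam n * (\<Sum>j\<in>{1..N}. jump j u)"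
 using Xn.associated_form(2)[OF assoc_n, of n u u] assms
 by (simp add: approx_form_def approx_dom energy_form jump_def)

lemma jump_nonneg: "jump j u >= 0"
 unfolding jump_def set_lebesgue_integral_def by (rule integral_nonneg_AE) (auto split: split_indicator)

context
 fixes j assumes j: "j \<in> {1..N}"
begin

lemma sets_\<nu>: "sets (\<nu> j) = sets (refm D)"
 using smooth_\<nu>[OF j] by (simp add: smooth_measure_def borel_sets)

lemma space_\<nu>: "space (\<nu> j) = topspace (base D)"
 using sets_eq_imp_space_eq[OF sets_\<nu>] by (simp add: space_refm)

lemma \<nu>_sigma_finite: "sigma_finite_measure (\<nu> j)"
 using finite_\<nu>[OF j] by (simp add: finite_measure.axioms)

lemma AE_\<nu>_K: "AE x in \<nu> j. x \<in> K j"
 using support_\<nu>[OF j] by (simp add: quasi_support_def)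

lemma AE_pair_K: "AE z in \<nu> j \<Otimes>\<^sub>M \<nu> j. fst z \<in> K j \<and> snd z \<in> K j"
proof (rule AE_pair_both[OF \<nu>_sigma_finite _ AE_\<nu>_K])
 show "{x \<in> space (\<nu> j). x \<in> K j} \<in> sets (\<nu> j)"
  using closedin_sets[OF K_closed[OF j]] sets.sets_into_space[of "K j" "\<nu> j"] sets_\<nu> by (simp add: Int_def[symmetric] Int_absorb1 Collect_conj_eq)
qed

lemma \<nu>_measurable: "u \<in> S.form_dom ==> the_qc_version D u \<in> borel_measurable (\<nu> j)"
 using the_qc_version(1)[of u] measurable_cong_sets[OF sets_\<nu> refl, of borel] by auto

lemma qe_AE_\<nu>: "qe_on D (topspace (base D)) Q ==> AE x in \<nu> j. Q x"
 using smooth_qe_AE[OF smooth_\<nu>[OF j], of "topspace (base D)" Q] by (auto simp: space_\<nu>[symmetric] AE_space)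

text \<open>Boundedness makes the integrand integrable for the finite product measure. Otherwise a
  zero integral could be the default value for a non-integrable function and would say
  nothing.\<close>

lemma jump_AE_zero:
 assumes u: "u \<in> S.form_dom" and bd: "AE x in \<nu> j. \<bar>the_qc_version D u x\<bar> <= c" and z: "jump j u = 0"
 shows "AE z in \<nu> j \<Otimes>\<^sub>M \<nu> j. the_qc_version D u (fst z) = the_qc_version D u (snd z)"
proof -
 let ?g = "the_qc_version D u" and ?M = "\<nu> j \<Otimes>\<^sub>M \<nu> j"
 let ?F = "%z. indicator (K j \<times> K j) z * ((?g (fst z) - ?g (snd z)) * (?g (fst z) - ?g (snd z)))"
 have [measurable]: "?g \<in> borel_measurable (\<nu> j)" by (rule \<nu>_measurable[OF u])
 have [measurable]: "K j \<in> sets (\<nu> j)" using closedin_sets[OF K_closed[OF j]] by (simp add: sets_\<nu>)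
 interpret finite_measure "\<nu> j" by (rule finite_\<nu>[OF j])
 interpret M: finite_measure ?M by (rule finite_measure_pair_measure) unfold_locales
 have b: "AE z in ?M. \<bar>?g (fst z)\<bar> <= c \<and> \<bar>?g (snd z)\<bar> <= c"
  by (rule AE_pair_both[OF \<nu>_sigma_finite _ bd]) measurable
 have "integrable ?M ?F"
 proof (rule M.integrable_const_bound[where B="(2 * c)^2"])
  show "AE z in ?M. norm (?F z) <= (2 * c)^2"
   using b
  proof eventually_elim
   case (elim z)
   hence "\<bar>?g (fst z) - ?g (snd z)\<bar>^2 <= (2 * c)^2" by (intro power_mono) auto
   thus ?case by (auto simp: power2_eq_square split: split_indicator)
  qed
 qed measurable
 moreover have "(\<integral>z. ?F z \<partial>?M) = 0"
  using z by (simp add: jump_def set_lebesgue_integral_def case_prod_beta)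
 ultimately have "AE z in ?M. ?F z = 0"
  by (subst (asm) integral_nonneg_eq_0_iff_AE) (auto split: split_indicator)
 thus ?thesis using AE_pair_K by eventually_elim (auto simp: indicator_def split: if_splits)
qed

text \<open>The points of \<open>K j\<close> where the version equals c form a quasi-closed set
  carrying \<open>\<nu> j\<close>; minimality of the quasi-support forces it to exhaust
  \<open>K j\<close> up to a polar set.\<close>

lemma qe_const_of_AE:
 assumes u: "u \<in> S.form_dom" and c: "AE x in \<nu> j. the_qc_version D u x = c"
 shows "qe_on D (K j) (%x. the_qc_version D u x = c)"
proof -
 let ?g = "the_qc_version D u"
 define S where "S = {x \<in> K j. ?g x = c}"
 obtain C where C: "nest D C" "!!k. continuous_map (subtopology (base D) (C k)) euclideanreal ?g"
  using the_qc_version(2)[OF u] unfolding quasi_continuous_def by blast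
 have KT: "K j \<subseteq> topspace (base D)" by (rule closedin_subset[OF K_closed[OF j]])
 have "closedin (subtopology (base D) (C k)) (S \<inter> C k)" for k
 proof -
  have "closedin (subtopology (base D) (C k)) {x \<in> topspace (subtopology (base D) (C k)). ?g x \<in> {c}}"
   by (rule closedin_continuous_map_preimage[OF C(2)]) simp
  moreover have "closedin (subtopology (base D) (C k)) (K j \<inter> C k)"
   using K_closed[OF j] by (metis closedin_subtopology_Int_closed inf_commute)
  ultimately have "closedin (subtopology (base D) (C k))
    ({x \<in> topspace (subtopology (base D) (C k)). ?g x \<in> {c}} \<inter> (K j \<inter> C k))" by (rule closedin_Int)
  moreover have "{x \<in> topspace (subtopology (base D) (C k)). ?g x \<in> {c}} \<inter> (K j \<inter> C k) = S \<inter> C k"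
   using KT unfolding S_def by auto
  ultimately show ?thesis by simp
 qed
 hence "quasi_closed D S" unfolding quasi_closed_def using C(1) KT by (auto simp: S_def)
 moreover have "AE x in \<nu> j. x \<in> S" using AE_\<nu>_K c by eventually_elim (simp add: S_def)
 ultimately have "qe_on D (K j) (%x. x \<in> S)" using support_\<nu>[OF j] unfolding quasi_support_def by blast
 thus ?thesis by (rule qe_on_mono) (auto simp: S_def)
qed

lemma jump_const:
 assumes u: "u \<in> S.form_dom" and c: "qe_on D (K j) (%x. the_qc_version D u x = c)"
 shows "jump j u = 0"
proof -
 let ?g = "the_qc_version D u"
 have [measurable]: "?g \<in> borel_measurable (\<nu> j)" by (rule \<nu>_measurable[OF u])
 have "AE x in \<nu> j. ?g x = c" using smooth_qe_AE[OF smooth_\<nu>[OF j] c] AE_\<nu>_K by eventually_elim simp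
 hence "AE z in \<nu> j \<Otimes>\<^sub>M \<nu> j. ?g (fst z) = c \<and> ?g (snd z) = c"
  by (intro AE_pair_both[OF \<nu>_sigma_finite]) measurable
 hence "AE z in \<nu> j \<Otimes>\<^sub>M \<nu> j. indicator (K j \<times> K j) z *\<^sub>R (case z of (x, y) => (?g x - ?g y) * (?g x - ?g y)) = 0"
  by eventually_elim (simp add: case_prod_beta)
 thus ?thesis unfolding jump_def set_lebesgue_integral_def by (rule integral_eq_zero_AE)
qed

end

lemma constant_domain_jump: "u \<in> constant_domain D K N ==> j \<in> {1..N} ==> jump j u = 0"
proof -
 assume u: "u \<in> constant_domain D K N" and j: "j \<in> {1..N}"
 then obtain g c where ud: "u \<in> S.form_dom" and g: "qc_version D u g" and c: "qe_on D (K j) (%x. g x = c)"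
  unfolding constant_domain_def dom by blast
 have "qc_version D u (the_qc_version D u)" using the_qc_version[OF ud] by (simp add: qc_version_def)
 from qc_version_unique[OF this g]
 have "qe_on D (K j) (%x. the_qc_version D u x = g x)"
  by (rule qe_on_mono) (use closedin_subset[OF K_closed[OF j]] in auto)
 from qe_on_conj[OF this c] have "qe_on D (K j) (%x. the_qc_version D u x = c)" by (rule qe_on_mono) auto
 thus ?thesis by (rule jump_const[OF j ud])
qed

text \<open>Clipping does not raise the energies, so at each level the jump terms of the clipped
  function, multiplied by \<open>lam n\<close>, stay bounded in n and must vanish. Clipping comes
  first because it guarantees that the jump integrals exist; letting the level grow recovers
  u.\<close>

lemma constant_domain_of_bounded_energy:
 assumes u: "u \<in> S.form_dom" and C: "!!n. Xn.S.form n u u <= C"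
 shows "u \<in> constant_domain D K N"
proof -
 let ?g = "the_qc_version D u"
 let ?u = "%c::nat. %x. max (- real c) (min (u x) (real c))"
 let ?gc = "%c::nat. %x. max (- real c) (min (?g x) (real c))"
 have ud: "?u c \<in> S.form_dom" for c by (rule S.form_clip(1)[OF u]) simp
 have jz: "jump j (?u c) = 0" if j: "j \<in> {1..N}" for j c
 proof -
  let ?S = "\<Sum>j\<in>{1..N}. jump j (?u c)"
  have S0: "?S >= 0" by (intro sum_nonneg jump_nonneg)
  have "lam n * ?S <= C" for n
  proof -
   have "Xn.S.form n (?u c) (?u c) <= Xn.S.form n u u"
    by (rule Xn.S.form_clip(2)) (use u approx_dom in auto)
   thus ?thesis using approx_energy[OF ud, of n c] S.form_nonneg[OF ud[of c]] C[of n] by linarith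
  qed
  moreover have "filterlim (%n. lam n * ?S) at_top sequentially" if "?S > 0"
   by (rule filterlim_at_top_mult_tendsto_pos[OF tendsto_const that lam_top])
  ultimately have "\<not> ?S > 0"
   by (metis (no_types, lifting) eventually_sequentially filterlim_at_top_dense not_less order_refl)
  hence "?S = 0" using S0 by simp
  thus ?thesis using j by (subst (asm) sum_nonneg_eq_0_iff) (auto intro: jump_nonneg)
 qed
 have const: "\<exists>c. qe_on D (K j) (%x. ?g x = c)" if j: "j \<in> {1..N}" for j
 proof -
  have eq: "AE x in \<nu> j. the_qc_version D (?u c) x = ?gc c x" for c
  proof (rule qe_AE_\<nu>[OF j], rule qc_version_unique)
   show "qc_version D (?u c) (the_qc_version D (?u c))" using the_qc_version[OF ud] by (simp add: qc_version_def)
   show "qc_version D (?u c) (?gc c)"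
    unfolding qc_version_def using the_qc_version(2,3)[OF u] by (auto intro: quasi_continuous_clip)
  qed
  have "AE x in \<nu> j. \<bar>the_qc_version D (?u c) x\<bar> <= real c" for c using eq[of c] by eventually_elim auto
  from jump_AE_zero[OF j ud this jz[OF j]]
  have z: "AE z in \<nu> j \<Otimes>\<^sub>M \<nu> j. the_qc_version D (?u c) (fst z) = the_qc_version D (?u c) (snd z)" for c .
  have eq2: "AE z in \<nu> j \<Otimes>\<^sub>M \<nu> j. the_qc_version D (?u c) (fst z) = ?gc c (fst z) \<and> the_qc_version D (?u c) (snd z) = ?gc c (snd z)" for c
  proof -
   have [measurable]: "?g \<in> borel_measurable (\<nu> j)" "the_qc_version D (?u c) \<in> borel_measurable (\<nu> j)"
    by (rule \<nu>_measurable[OF j u], rule \<nu>_measurable[OF j ud])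
   show ?thesis by (rule AE_pair_both[OF \<nu>_sigma_finite[OF j] _ eq]) measurable
  qed
  have "AE z in \<nu> j \<Otimes>\<^sub>M \<nu> j. ?gc c (fst z) = ?gc c (snd z)" for c using eq2[of c] z[of c] by eventually_elim simp
  \<comment> \<open>Countably many levels share one null set, and at a given pair of points a large
    level clips nothing.\<close>
  hence "AE z in \<nu> j \<Otimes>\<^sub>M \<nu> j. \<forall>c. ?gc c (fst z) = ?gc c (snd z)" by (simp add: AE_all_countable)
  hence "AE z in \<nu> j \<Otimes>\<^sub>M \<nu> j. ?g (fst z) = ?g (snd z)"
  proof eventually_elim
   case (elim z)
   obtain c :: nat where "real c >= \<bar>?g (fst z)\<bar> + \<bar>?g (snd z)\<bar>" using real_arch_simple by blast
   hence "?gc c (fst z) = ?g (fst z)" "?gc c (snd z) = ?g (snd z)" by auto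
   with elim show ?case by metis
  qed
  from AE_pair_const[OF \<nu>_sigma_finite[OF j] this] qe_const_of_AE[OF j u] show ?thesis by blast
 qed
 have "qc_version D u ?g" using the_qc_version[OF u] by (simp add: qc_version_def)
 thus ?thesis unfolding constant_domain_def dom using u const by blast
qed

lemma approx_energy_constant: "u \<in> constant_domain D K N ==> Xn.S.form n u u = S.form u u"
 using approx_energy[of u n] constant_domain_jump[of u] by (simp add: constant_domain_def dom)

text \<open>Strong convexity comes from the inner product with weight b alone, with constant b / 4
  from the midpoint identity, the forms being merely nonnegative. The limiting maximiser has
  energies bounded in n, so it is quasi-everywhere constant on each \<open>K j\<close>, which gives
  \<open>S <= S0\<close>; the converse tests with a maximiser of the limit problem.\<close>

lemma laplace_limit:
 assumes f: "f \<in> L2 (refm D)" and b: "b > 0"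
  and up: "!!v. v \<in> constant_domain D K N ==> 2 * l2_inner (refm D) f v - b * l2_inner (refm D) v v - S.form v v <= S0"
  and at: "\<exists>w\<in>constant_domain D K N. 2 * l2_inner (refm D) f w - b * l2_inner (refm D) w w - S.form w w >= S0"
 shows "(%n. Xn.S.laplace n f b) ---> S0"
proof -
 let ?m = "refm D" and ?V = "S.form_dom"
 let ?a = "%n u. Xn.S.form n u u + b * l2_inner ?m u u"
 have V: "?V \<subseteq> L2 ?m" by auto
 note lap = Xn.S.laplace_eq_sup[OF b f, unfolded approx_dom]
 have b4: "b / 4 > 0" using b by simp
 have "\<exists>S. (%n. Xn.S.laplace n f b) ---> S \<and> (\<exists>w\<in>?V. \<forall>n. 2 * l2_inner ?m f w - ?a n w >= S)"
 proof (rule increasing_forms_sup[OF f V b4])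
  fix u v assume uv: "u \<in> ?V" "v \<in> ?V"
  from S.form_dom_lin[OF uv, of "1/2" "1/2"] show mid: "(%x. (u x + v x) / 2) \<in> ?V" by (simp add: add_divide_distrib)
  fix n
  have uv': "u \<in> Xn.S.form_dom n" "v \<in> Xn.S.form_dom n" using uv approx_dom by auto
  have uL: "u \<in> L2 ?m" "v \<in> L2 ?m" using uv by auto
  have e: "(%x. (u x + v x) / 2) = (%x. (1/2) * u x + (1/2) * v x)" by (simp add: add_divide_distrib)
  have "0 <= Xn.S.form n (%x. 1 * u x + (-1) * v x) (%x. 1 * u x + (-1) * v x)"
   by (rule Xn.S.form_nonneg[OF Xn.S.form_dom_lin[OF uv']])
  hence 1: "Xn.S.form n (%x. (u x + v x) / 2) (%x. (u x + v x) / 2) \<le>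
    (Xn.S.form n u u + Xn.S.form n v v) / 2"
   unfolding e Xn.S.form_quadratic[OF uv'] by (simp add: power2_eq_square)
  have 2: "l2_inner ?m (%x. (u x + v x) / 2) (%x. (u x + v x) / 2) =
    (l2_inner ?m u u + l2_inner ?m v v) / 2 - (1/4) * (l2_norm ?m (%x. u x - v x))^2"
  proof -
   have "l2_inner ?m (%x. a * u x + a * v x) (%x. a * u x + a * v x) =
     a * a * (l2_inner ?m u u + 2 * l2_inner ?m u v + l2_inner ?m v v)" for a
    using uL by (simp add: l2_inner_commute[of ?m v u] algebra_simps)
   note this[of "1/2"]
   moreover have "l2_inner ?m (%x. u x - v x) (%x. u x - v x) = l2_inner ?m u u - 2 * l2_inner ?m u v + l2_inner ?m v v"
    using uL by (simp add: l2_inner_commute[of ?m v u])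
   ultimately show ?thesis unfolding e l2_norm_square by (simp add: field_simps)
  qed
  show "?a n (%x. (u x + v x) / 2) <= (?a n u + ?a n v) / 2 - b / 4 * (l2_norm ?m (%x. u x - v x))^2"
   using 1 unfolding 2 by (simp add: field_simps)
 next
  fix n w assume w: "w \<in> ?V"
  have "lam n * (\<Sum>j\<in>{1..N}. jump j w) <= lam (Suc n) * (\<Sum>j\<in>{1..N}. jump j w)"
   by (intro mult_right_mono lam_mono sum_nonneg jump_nonneg)
  thus "?a n w <= ?a (Suc n) w" using approx_energy[OF w] by simp
 next
  fix n u w C assume lim: "l2_tendsto ?m u w" and u: "!!i. u i \<in> ?V" and C: "!!i. ?a n (u i) <= C"
  have in_lim: "(%i. b * l2_inner ?m (u i) (u i)) ---> b * l2_inner ?m w w"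
   by (intro tendsto_mult_left l2_tendsto_inner lim)
  have ev: "w \<in> ?V \<and> Xn.S.form n w w <= C - b * l2_inner ?m w w + e" if e: "e > 0" for e
  proof -
   have "\<forall>\<^sub>F i in sequentially. b * l2_inner ?m w w - e < b * l2_inner ?m (u i) (u i)"
    using e by (intro order_tendstoD(1)[OF in_lim]) simp
   then obtain M where M: "!!i. i >= M ==> b * l2_inner ?m w w - e < b * l2_inner ?m (u i) (u i)"
    by (auto simp: eventually_sequentially)
   have "w \<in> Xn.S.form_dom n \<and> Xn.S.form n w w <= C - b * l2_inner ?m w w + e"
   proof (rule Xn.S.form_lsc)
    show "l2_tendsto ?m (%i. u (i + M)) w" by (rule l2_tendsto_subseq[OF lim]) (simp add: strict_mono_def)
    show "u (i + M) \<in> Xn.S.form_dom n" for i using u approx_dom by simp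
    show "Xn.S.form n (u (i + M)) (u (i + M)) <= C - b * l2_inner ?m w w + e" for i
     using C[of "i + M"] M[of "i + M"] by simp
   qed
   thus ?thesis by (simp add: approx_dom)
  qed
  have "Xn.S.form n w w <= C - b * l2_inner ?m w w" by (rule field_le_epsilon) (use ev in blast)
  thus "w \<in> ?V \<and> ?a n w <= C" using ev[of 1] by simp
 next
  fix n w assume "w \<in> ?V"
  from lap(1)[OF this, of n] show "2 * l2_inner ?m f w - ?a n w <= Xn.S.laplace n f b" by simp
 next
  fix n and e :: real assume "e > 0"
  with lap(2)[of n] show "\<exists>w\<in>?V. 2 * l2_inner ?m f w - ?a n w > Xn.S.laplace n f b - e" by force
 next
  fix n
  have "Xn.S.form n (%x. 0) (%x. 0) = 0" using Xn.S.form_cmult[where a=0, OF Xn.S.form_dom_zero[of n]] by simp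
  thus "0 <= Xn.S.laplace n f b" using lap(1)[OF S.form_dom_zero, of n] by (simp add: l2_inner_def)
 qed
 then obtain S w where S: "(%n. Xn.S.laplace n f b) ---> S" and w: "w \<in> ?V" and wS: "!!n. 2 * l2_inner ?m f w - ?a n w >= S"
  by blast
 have wc: "w \<in> constant_domain D K N"
  by (rule constant_domain_of_bounded_energy[OF w, where C="2 * l2_inner ?m f w - b * l2_inner ?m w w - S"])
   (use wS in "simp add: algebra_simps")
 have "S <= S0" using up[OF wc] wS[of 0] approx_energy_constant[OF wc, of 0] by simp
 moreover have "S0 <= S"
 proof -
  obtain v where v: "v \<in> constant_domain D K N" "2 * l2_inner ?m f v - b * l2_inner ?m v v - S.form v v >= S0"
   using at by blast
  have "v \<in> ?V" using v(1) by (simp add: constant_domain_def dom)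
  from lap(1)[OF this] have "S0 <= Xn.S.laplace n f b" for n
   using v approx_energy_constant[OF v(1), of n] order_trans by (simp add: algebra_simps) (smt (verit))
  thus ?thesis by (intro LIMSEQ_le_const[OF S]) auto
 qed
 ultimately show ?thesis using S by simp
qed

end

section \<open>Functions on the collapsed space\<close>

locale collapsing =
 fixes T :: "'s topology" and m :: "'s measure" and K :: "nat => 's set" and N :: nat
 assumes sets_m: "sets m = sets (borel_of T)"
  and K_closed: "!!j. j \<in> {1..N} ==> closedin T (K j)"
  and K_nonempty: "!!j. j \<in> {1..N} ==> K j ~= {}"
  and K_disjoint: "!!i j. i \<in> {1..N} ==> j \<in> {1..N} ==> i ~= j ==> K i \<inter> K j = {}"
  and K_finite: "!!j. j \<in> {1..N} ==> emeasure m (K j) < \<infinity>"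
begin

abbreviation "H \<equiv> hole K N"
abbreviation "Tc \<equiv> collapsed_topology T K N"
abbreviation "c \<equiv> collapse K N"
abbreviation "\<mu> \<equiv> sticky_measure T m K N"

lemma space_m: "space m = topspace T"
 using sets_eq_imp_space_eq[OF sets_m] by simp

lemma K_sub: "j \<in> {1..N} ==> K j \<subseteq> topspace T"
 by (rule closedin_subset[OF K_closed])

lemma K_sets: "j \<in> {1..N} ==> K j \<in> sets m"
 by (simp add: sets_m closedin_borel_of K_closed del: atLeastAtMost_iff)

lemma open_compl: "openin T (topspace T - H)"
proof -
 have "closedin T H" unfolding hole_def by (intro closedin_Union) (use K_closed in auto)
 thus ?thesis by (rule openin_diff[OF openin_topspace])
qed

lemma topspace_Tc: "topspace Tc = Inl ` (topspace T - H) \<union> Inr ` {1..N}"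
 by (rule topspace_collapsed_topology) (rule K_sub)

lemma collapse_Inl: "x \<notin> H ==> c x = Inl x"
 by (simp add: collapse_def)

lemma collapse_Inr: "j \<in> {1..N} ==> x \<in> K j ==> c x = Inr j"
proof -
 assume j: "j \<in> {1..N}" "x \<in> K j"
 hence "(THE j. j \<in> {1..N} \<and> x \<in> K j) = j" using K_disjoint by (intro the_equality) blast+
 thus ?thesis using j by (auto simp: collapse_def hole_def)
qed

lemma openin_Tc_Inl: "openin Tc W ==> openin T (Inl -` W)"
 using open_compl openin_open_subtopology unfolding openin_collapsed_topology by blast

lemma open_point_compl: "j \<in> {1..N} ==> openin Tc (topspace Tc - {Inr j})"
proof -
 assume "j \<in> {1..N}"
 have v: "Inl -` (topspace Tc - {Inr j}) = topspace T - H" unfolding topspace_Tc by auto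
 have op: "openin (subtopology T (topspace T - H)) (topspace T - H)"
  by (metis Diff_subset inf.absorb_iff2 openin_topspace topspace_subtopology)
 have nb: "\<exists>U. openin T U \<and> K i \<subseteq> U \<and> U - H \<subseteq> topspace T - H" if "Inr i \<in> topspace Tc - {Inr j}" for i
 proof -
  have "i \<in> {1..N}" using that unfolding topspace_Tc by blast
  thus ?thesis using K_sub by (intro exI[of _ "topspace T"] conjI) auto
 qed
 show ?thesis unfolding openin_collapsed_topology v
 proof (intro conjI allI impI op nb)
  show "topspace Tc - {Inr j} \<subseteq> Inl ` (topspace T - H) \<union> Inr ` {1..N}" unfolding topspace_Tc by (rule Diff_subset)
 qed
qed

lemma point_sets: "j \<in> {1..N} ==> {Inr j} \<in> sets (borel_of Tc)"
proof -
 assume j: "j \<in> {1..N}"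
 have "topspace Tc - (topspace Tc - {Inr j}) \<in> sets (borel_of Tc)"
  using sets.compl_sets[OF openin_borel_of[OF open_point_compl[OF j]]] by simp
 moreover have "topspace Tc - (topspace Tc - {Inr j}) = {Inr j}" using j unfolding topspace_Tc by blast
 ultimately show ?thesis by simp
qed

lemma points_sets: "J \<subseteq> {1..N} ==> Inr ` J \<in> sets (borel_of Tc)"
proof -
 assume J: "J \<subseteq> {1..N}"
 hence "(\<Union>j\<in>J. {Inr j}) \<in> sets (borel_of Tc)"
  by (intro sets.finite_UN point_sets finite_subset[OF J]) auto
 thus ?thesis by (simp add: UNION_singleton_eq_range)
qed

lemma Inl_open: "openin T U ==> openin Tc (Inl ` (U - H))"
proof -
 assume U: "openin T U"
 have v: "(Inl :: 's => 's + nat) -` (Inl ` (U - H)) = U - H" by auto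
 have "openin (subtopology T (topspace T - H)) (U - H)"
  using U openin_subset[OF U] open_compl by (auto simp: openin_open_subtopology Diff_eq openin_Int intro: rev_iffD1[OF openin_Int[OF U open_compl] arg_cong[where f="openin T"]])
 thus ?thesis unfolding openin_collapsed_topology v using openin_subset[OF U] by auto
qed

lemma collapse_measurable: "c \<in> measurable m (borel_of Tc)"
proof (rule measurable_borel_ofI)
 show "c \<in> space m \<rightarrow> topspace Tc"
 proof
  fix x assume "x \<in> space m"
  thus "c x \<in> topspace Tc"
   using collapse_Inl[of x] collapse_Inr[of _ x] unfolding space_m topspace_Tc
   by (cases "x \<in> H") (auto simp: hole_def)
 qed
 fix W assume W: "openin Tc W"
 have "c -` W \<inter> space m = (Inl -` W - H) \<union> (\<Union>j\<in>{j\<in>{1..N}. Inr j \<in> W}. K j)"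
 proof (intro set_eqI iffI)
  fix x assume x: "x \<in> c -` W \<inter> space m"
  show "x \<in> (Inl -` W - H) \<union> (\<Union>j\<in>{j\<in>{1..N}. Inr j \<in> W}. K j)"
  proof (cases "x \<in> H")
   case True
   then obtain j where "j \<in> {1..N}" "x \<in> K j" unfolding hole_def by blast
   thus ?thesis using x collapse_Inr[of j x] by auto
  qed (use x collapse_Inl[of x] in auto)
 next
  fix x assume x: "x \<in> (Inl -` W - H) \<union> (\<Union>j\<in>{j\<in>{1..N}. Inr j \<in> W}. K j)"
  thus "x \<in> c -` W \<inter> space m"
  proof
   assume "x \<in> Inl -` W - H"
   thus ?thesis using collapse_Inl[of x] openin_subset[OF openin_Tc_Inl[OF W]] by (auto simp: space_m)
  next
   assume "x \<in> (\<Union>j\<in>{j\<in>{1..N}. Inr j \<in> W}. K j)"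
   then obtain j where j: "j \<in> {1..N}" "Inr j \<in> W" "x \<in> K j" by blast
   thus ?thesis using collapse_Inr[OF j(1,3)] K_sub[OF j(1)] by (auto simp: space_m)
  qed
 qed
 moreover have "(Inl -` W - H) \<in> sets m"
 proof -
  have "Inl -` W - H = Inl -` W \<inter> (topspace T - H)" using openin_subset[OF openin_Tc_Inl[OF W]] by auto
  thus ?thesis using openin_Int[OF openin_Tc_Inl[OF W] open_compl] by (simp add: sets_m openin_borel_of)
 qed
 moreover have "(\<Union>j\<in>{j\<in>{1..N}. Inr j \<in> W}. K j) \<in> sets m"
  by (intro sets.finite_UN) (use K_sets in auto)
 ultimately show "c -` W \<inter> space m \<in> sets m" by (simp only: sets.Un)
qed

lemma sets_\<mu>: "sets \<mu> = sets (borel_of Tc)"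
 unfolding sticky_measure_def space_borel_of[symmetric] by (rule sets.sets_measure_of_eq)

lemma space_\<mu>: "space \<mu> = topspace Tc"
 using sets_eq_imp_space_eq[OF sets_\<mu>] by simp

text \<open>Both measures of A consist of the part in D and the masses of those \<open>K j\<close>
  whose point lies in A. Seeing \<mu> as an image measure makes composition with the collapsing map
  an isometry.\<close>

lemma sticky_measure_eq_distr: "\<mu> = distr m (borel_of Tc) c"
proof (rule measure_eqI)
 show "sets \<mu> = sets (distr m (borel_of Tc) c)" by (simp add: sets_\<mu>)
 fix A assume "A \<in> sets \<mu>"
 hence A: "A \<in> sets (borel_of Tc)" by (simp add: sets_\<mu>)
 let ?A0 = "{x \<in> topspace T - H. Inl x \<in> A}" and ?J = "{j\<in>{1..N}. Inr j \<in> A}"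
 have eq: "c -` A \<inter> space m = ?A0 \<union> (\<Union>j\<in>?J. K j)"
 proof (intro set_eqI iffI)
  fix x assume x: "x \<in> c -` A \<inter> space m"
  show "x \<in> ?A0 \<union> (\<Union>j\<in>?J. K j)"
  proof (cases "x \<in> H")
   case True
   then obtain j where "j \<in> {1..N}" "x \<in> K j" unfolding hole_def by blast
   thus ?thesis using x collapse_Inr[of j x] by auto
  qed (use x collapse_Inl[of x] in "auto simp: space_m")
 next
  fix x assume "x \<in> ?A0 \<union> (\<Union>j\<in>?J. K j)"
  thus "x \<in> c -` A \<inter> space m"
  proof
   assume "x \<in> (\<Union>j\<in>?J. K j)"
   then obtain j where j: "j \<in> {1..N}" "Inr j \<in> A" "x \<in> K j" by blast
   thus ?thesis using collapse_Inr[OF j(1,3)] K_sub[OF j(1)] by (auto simp: space_m)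
  qed (use collapse_Inl[of x] in "auto simp: space_m")
 qed
 have cA: "c -` A \<inter> space m \<in> sets m" by (rule measurable_sets[OF collapse_measurable A])
 have JK: "(\<Union>j\<in>?J. K j) \<in> sets m" by (intro sets.finite_UN) (use K_sets in auto)
 have A0_eq: "?A0 = (c -` A \<inter> space m) \<inter> (topspace T - H)" using collapse_Inl by (auto simp: space_m)
 have A0: "?A0 \<in> sets m" unfolding A0_eq by (intro sets.Int cA) (simp add: sets_m openin_borel_of open_compl)
 have "emeasure m (\<Union>j\<in>?J. K j) = (\<Sum>j\<in>?J. emeasure m (K j))"
 proof (rule sum_emeasure[symmetric])
  show "K ` ?J \<subseteq> sets m" using K_sets by blast
  show "disjoint_family_on K ?J" using K_disjoint unfolding disjoint_family_on_def by blast
 qed simp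
 also have "... = (\<Sum>j\<in>{1..N}. emeasure m (K j) * indicator A (Inr j))"
  by (rule sum.mono_neutral_cong_left) (auto split: split_indicator)
 finally have 1: "emeasure m (\<Union>j\<in>?J. K j) = (\<Sum>j\<in>{1..N}. emeasure m (K j) * indicator A (Inr j))" .
 have "emeasure (distr m (borel_of Tc) c) A = emeasure m (?A0 \<union> (\<Union>j\<in>?J. K j))"
  using emeasure_distr[OF collapse_measurable A] eq by simp
 also have "... = emeasure m ?A0 + emeasure m (\<Union>j\<in>?J. K j)"
  by (rule plus_emeasure[OF A0 JK, symmetric]) (auto simp: hole_def)
 also have "... = emeasure \<mu> A"
  using emeasure_sticky_measure[OF A, of m] emeasure_darning_measure[OF sets_m open_compl A] 1 by simp
 finally show "emeasure \<mu> A = emeasure (distr m (borel_of Tc) c) A" by simp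
qed

lemma \<mu>_measurable: "borel_measurable \<mu> = borel_measurable (borel_of Tc)"
 by (rule measurable_cong_sets[OF sets_\<mu> refl])

lemma \<mu>_measurable_comp: "g \<in> borel_measurable \<mu> ==> g \<circ> c \<in> borel_measurable m"
 unfolding \<mu>_measurable by (rule measurable_comp[OF collapse_measurable])

lemma integral_\<mu>: "g \<in> borel_measurable \<mu> ==> (\<integral>y. g y \<partial>\<mu>) = (\<integral>x. g (c x) \<partial>m :: real)"
 unfolding sticky_measure_eq_distr by (rule integral_distr[OF collapse_measurable]) simp

lemma integrable_\<mu>: "g \<in> borel_measurable \<mu> ==> integrable \<mu> g \<longleftrightarrow> integrable m (%x. g (c x) :: real)"
 unfolding sticky_measure_eq_distr by (rule integrable_distr_eq[OF collapse_measurable]) simp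

lemma L2_\<mu>: "g \<in> borel_measurable \<mu> ==> g \<in> L2 \<mu> \<longleftrightarrow> g \<circ> c \<in> L2 m"
 using integrable_\<mu>[of "%y. (g y)^2"] \<mu>_measurable_comp[of g] by (simp add: L2_def)

lemma L2_\<mu>_comp: "g \<in> L2 \<mu> ==> g \<circ> c \<in> L2 m"
 using L2_\<mu>[of g] L2_measurable[of g \<mu>] by blast

lemma inner_\<mu>: "g \<in> borel_measurable \<mu> ==> h \<in> borel_measurable \<mu> ==> l2_inner \<mu> g h = l2_inner m (g \<circ> c) (h \<circ> c)"
 by (simp add: l2_inner_def integral_\<mu>)

lemma AE_\<mu>: "{y \<in> topspace Tc. P y} \<in> sets \<mu> ==> (AE y in \<mu>. P y) \<longleftrightarrow> (AE x in m. P (c x))"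
 unfolding sets_\<mu> unfolding sticky_measure_eq_distr by (rule AE_distr_iff[OF collapse_measurable]) simp

text \<open>The starred function is f composed with a Borel selection \<rho>, which picks a point in
  each \<open>K j\<close>, corrected at finitely many points.\<close>

lemma star_fun_measurable:
 assumes f: "f \<in> borel_measurable m" shows "star_fun m K f \<in> borel_measurable \<mu>"
proof -
 define p where "p j = (SOME x. x \<in> K j)" for j
 have p: "p j \<in> K j" if "j \<in> {1..N}" for j unfolding p_def some_in_eq by (rule K_nonempty[OF that])
 define \<rho> where "\<rho> y = (case y of Inl x => x | Inr j => p j)" for y
 have "\<rho> \<in> measurable (borel_of Tc) (borel_of T)"
 proof (rule measurable_borel_ofI)
  show "\<rho> \<in> space (borel_of Tc) \<rightarrow> topspace T" using p K_sub unfolding space_borel_of topspace_Tc \<rho>_def by fastforce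
  fix U assume U: "openin T U"
  have eq: "\<rho> -` U \<inter> space (borel_of Tc) = Inl ` (U - H) \<union> Inr ` {j\<in>{1..N}. p j \<in> U}"
   using openin_subset[OF U] unfolding space_borel_of topspace_Tc \<rho>_def by auto
  show "\<rho> -` U \<inter> space (borel_of Tc) \<in> sets (borel_of Tc)"
   unfolding eq by (intro sets.Un openin_borel_of Inl_open U points_sets) blast
 qed
 moreover have "f \<in> borel_measurable (borel_of T)" using f by (simp add: measurable_cong_sets[OF sets_m refl])
 ultimately have [measurable]: "(%y. f (\<rho> y)) \<in> borel_measurable (borel_of Tc)" by (rule measurable_compose)
 have [measurable]: "Inl ` (topspace T - H) \<in> sets (borel_of Tc)" by (rule openin_borel_of[OF Inl_open[OF openin_topspace]])
 have [measurable]: "{Inr j} \<in> sets (borel_of Tc)" if "j \<in> {1..N}" for j by (rule point_sets[OF that])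
 define a where "a j = star_fun m K f (Inr j)" for j
 have m1: "(%y. \<Sum>j\<in>{1..N}. a j * indicator {Inr j} y) \<in> borel_measurable (borel_of Tc)"
  by (intro borel_measurable_sum borel_measurable_times borel_measurable_const borel_measurable_indicator point_sets)
 have m2: "(%y. indicator (Inl ` (topspace T - H)) y * f (\<rho> y)) \<in> borel_measurable (borel_of Tc)" by measurable
 have "star_fun m K f y = indicator (Inl ` (topspace T - H)) y * f (\<rho> y) + (\<Sum>j\<in>{1..N}. a j * indicator {Inr j} y)"
  if "y \<in> topspace Tc" for y
 proof (cases y)
  case (Inl x)
  hence "x \<in> topspace T - H" using that unfolding topspace_Tc by auto
  thus ?thesis using Inl by (simp add: star_fun_def \<rho>_def)
 next
  case (Inr i)
  hence i: "i \<in> {1..N}" using that unfolding topspace_Tc by auto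
  have "(\<Sum>j\<in>{1..N}. a j * indicator {Inr j} y) = (\<Sum>j\<in>{1..N}. if j = i then a i else 0)"
   using Inr by (intro sum.cong) auto
  thus ?thesis using Inr i by (simp add: a_def image_iff)
 qed
 hence "star_fun m K f \<in> borel_measurable (borel_of Tc)"
  using borel_measurable_add[OF m2 m1] by (subst measurable_cong) auto
 thus ?thesis by (simp add: \<mu>_measurable)
qed

text \<open>The mean over \<open>K j\<close> of a function constant there returns the constant. If
  \<open>K j\<close> is null, the default value 0 of \<open>star_fun\<close> may differ from f, but
  only on a null set.\<close>

lemma star_fun_collapse:
 assumes f: "f \<in> borel_measurable m" and const: "!!j. j \<in> {1..N} ==> \<exists>a. AE x in m. x \<in> K j --> f x = a"
 shows "AE x in m. (star_fun m K f \<circ> c) x = f x"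
proof -
 have "AE x in m. x \<in> K j --> star_fun m K f (Inr j) = f x" if j: "j \<in> {1..N}" for j
 proof -
  obtain a where a: "AE x in m. x \<in> K j --> f x = a" using const[OF j] by blast
  show ?thesis
  proof (cases "measure m (K j) > 0")
   case True
   have "(LINT x:K j|m. f x) = (LINT x:K j|m. a)"
    unfolding set_lebesgue_integral_def
    by (rule integral_cong_AE) (use f K_sets[OF j] a in "auto split: split_indicator")
   also have "... = measure m (K j) * a"
   proof -
    have "integrable m (indicator (K j) :: 's => real)" using K_sets[OF j] K_finite[OF j] by (simp add: integrable_real_indicator)
    thus ?thesis using K_sets[OF j] sets.sets_into_space[OF K_sets[OF j]]
     by (simp add: set_lebesgue_integral_def Int_absorb1 Int_absorb2)
   qed
   finally have "star_fun m K f (Inr j) = a" using True by (simp add: star_fun_def)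
   thus ?thesis using a by auto
  next
   case False
   hence "emeasure m (K j) = 0" using K_finite[OF j] by (simp add: measure_def enn2real_eq_0_iff zero_less_iff_neq_zero less_top enn2real_positive_iff)
   hence "K j \<in> null_sets m" using K_sets[OF j] by auto
   from AE_not_in[OF this] show ?thesis by eventually_elim auto
  qed
 qed
 hence "AE x in m. \<forall>j\<in>{1..N}. x \<in> K j --> star_fun m K f (Inr j) = f x" by (intro AE_finite_allI) auto
 thus ?thesis
 proof (eventually_elim)
  case (elim x)
  show ?case
  proof (cases "x \<in> H")
   case True
   then obtain j where "j \<in> {1..N}" "x \<in> K j" unfolding hole_def by blast
   thus ?thesis using elim collapse_Inr[of j x] by auto
  qed (simp add: collapse_Inl star_fun_def)
 qed
qed

end

text \<open>Along an almost everywhere convergent subsequence the constants themselves converge as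
  soon as A has a good point; the limit operator names the new constant without a case distinction
  on whether A is null.\<close>

lemma AE_const_on_limit:
 assumes lim: "l2_tendsto m g f" and const: "!!n. \<exists>a. AE x in m. x \<in> A --> g n x = a"
 shows "\<exists>a. AE x in m. x \<in> A --> f x = a"
proof -
 obtain a where "!!n. AE x in m. x \<in> A --> g n x = a n" using const by metis
 hence 1: "AE x in m. \<forall>n. x \<in> A --> g n x = a n" unfolding AE_all_countable by blast
 obtain r where r: "AE x in m. (%n. g (r n) x) ---> f x" using l2_tendsto_AE_subseq[OF lim] by blast
 have "AE x in m. x \<in> A --> f x = lim (%n. a (r n))" using 1 r
  by eventually_elim (auto dest: limI)
 thus ?thesis by blast
qed

section \<open>Convergence of the finite-dimensional distributions\<close>

text \<open>Reading from the first time exhibits the outermost transition operator, the shape in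
  which mean-square convergence propagates by induction.\<close>

lemma nested_shift:
 "nested P t (Suc k) f = (%x. f 0 x * P (t (Suc 0) - t 0) (nested P (%j. t (Suc j)) k (%j. f (Suc j))) x)"
proof (induction k arbitrary: f)
 case (Suc k)
 have "nested P t (Suc (Suc k)) f = nested P t (Suc k) (f(Suc k := %x. f (Suc k) x * P (t (Suc (Suc k)) - t (Suc k)) (f (Suc (Suc k))) x))"
  by (rule nested.simps(2))
 also have "... = (%x. f 0 x * P (t (Suc 0) - t 0) (nested P (%j. t (Suc j)) (Suc k) (%j. f (Suc j))) x)"
 proof -
  have 1: "(%j. (f(Suc k := g)) (Suc j)) = (%j. f (Suc j))(k := g)" for g by auto
  have 2: "(f(Suc k := g)) 0 = f 0" for g by simp
  show ?thesis unfolding Suc.IH nested.simps(2)[of P "%j. t (Suc j)" k] by (simp only: 1 2)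
 qed
 finally show ?case .
qed simp

text \<open>The representatives \<open>g\<close> replace the \<open>f\<close> because null sets are
  not charged at any of the times; the pointwise formula for the distributions asks for functions
  bounded everywhere.\<close>

lemma (in hunt) path_integral_eq_nested:
 assumes t0: "t 0 = 0" and tm: "!!j. j < k ==> t j <= t (Suc j)"
  and f: "!!j. j <= k ==> f j \<in> borel_measurable m" and g: "!!j. j <= k ==> g j \<in> borel_measurable m"
  and eq: "!!j. j <= k ==> AE x in m. g j x = f j x" and B: "!!j x. j <= k ==> \<bar>g j x\<bar> <= B j"
 shows "(\<integral>x. (\<integral>om. (\<Prod>j\<le>k. ext0 (f j) (path X (t j) om)) \<partial>law X (Some x)) \<partial>m) = (\<integral>x. nested (transition X) t k g x \<partial>m)"
proof -
 have tn: "t j >= 0" if "j <= k" for j using that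
 proof (induction j)
  case (Suc j)
  thus ?case using tm[of j] by simp
 qed (simp add: t0)
 have pm: "(%om. \<Prod>j\<le>k. ext0 (h j) (path X (t j) om)) \<in> borel_measurable (filt \<infinity>)"
  if "!!j. j <= k ==> h j \<in> borel_measurable m" for h :: "nat => 's => real"
  by (rule borel_measurable_prod, rule ext0_path_measurable) (use that tn in auto)
 have "AE x in m. \<forall>j\<in>{..k}. AE om in law X (Some x). \<forall>z. path X (t j) om = Some z --> g j z = f j z"
 proof (rule AE_finite_allI)
  show "AE x in m. AE om in law X (Some x). \<forall>z. path X (t j) om = Some z --> g j z = f j z" if "j \<in> {..k}" for j
   by (rule AE_transition) (use that tn eq in auto)
 qed simp
 hence ae: "AE x in m. (\<integral>om. (\<Prod>j\<le>k. ext0 (f j) (path X (t j) om)) \<partial>law X (Some x)) =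
   (\<integral>om. (\<Prod>j\<le>k. ext0 (g j) (path X (t j) om)) \<partial>law X (Some x))"
  using AE_space
 proof eventually_elim
  case (elim x)
  have y: "Some x \<in> topspace (cemetery_topology T)" using elim(2) by (intro Some_space) (simp add: space_m)
  show ?case
  proof (rule integral_cong_AE)
   show "(%om. \<Prod>j\<le>k. ext0 (f j) (path X (t j) om)) \<in> borel_measurable (law X (Some x))"
    using pm[OF f] by (simp only: measurable_law[OF y])
   show "(%om. \<Prod>j\<le>k. ext0 (g j) (path X (t j) om)) \<in> borel_measurable (law X (Some x))"
    using pm[OF g] by (simp only: measurable_law[OF y])
   have "AE om in law X (Some x). \<forall>j\<in>{..k}. \<forall>z. path X (t j) om = Some z --> g j z = f j z"
    by (rule AE_finite_allI) (use elim(1) in auto)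
   thus "AE om in law X (Some x). (\<Prod>j\<le>k. ext0 (f j) (path X (t j) om)) = (\<Prod>j\<le>k. ext0 (g j) (path X (t j) om))"
   proof eventually_elim
    case (elim om)
    have "ext0 (f j) (path X (t j) om) = ext0 (g j) (path X (t j) om)" if "j \<in> {..k}" for j
     using bspec[OF elim that] by (cases "path X (t j) om") auto
    thus ?case by (rule prod.cong[OF refl])
   qed
  qed
 qed
 have "(\<integral>x. (\<integral>om. (\<Prod>j\<le>k. ext0 (f j) (path X (t j) om)) \<partial>law X (Some x)) \<partial>m) =
   (\<integral>x. (\<integral>om. (\<Prod>j\<le>k. ext0 (g j) (path X (t j) om)) \<partial>law X (Some x)) \<partial>m)"
  by (rule integral_cong_AE[OF law_Some_measurable[OF pm[OF f]] law_Some_measurable[OF pm[OF g]] ae])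
 also have "... = (\<integral>x. nested (transition X) t k g x \<partial>m)"
  by (rule Bochner_Integration.integral_cong[OF refl], rule finite_dimensional[where f=g])
   (use g B t0 tm in "auto simp: space_m")
 finally show ?thesis .
qed

text \<open>The identification of the domain is an assumption here, discharged in the theorem;
  nothing else about hitting times enters from here on.\<close>

locale darning_limit = approximation D X K N \<nu> lam Xn + C: collapsing "base D" "refm D" K N
 for D :: "'s form_data" and X :: "('s, 'w) process" and K N \<nu> lam and Xn :: "nat => ('s, 'w1) process" +
 fixes Y :: "('s + nat, 'w2) process" and \<alpha> :: real
 assumes darning: "darning_domain D X K N \<alpha> = constant_domain D K N"
  and assoc_Y: "associated_hunt_process (sticky_form D X K N \<alpha>) Y"

sublocale darning_limit \<subseteq> Y: hunt "C.Tc" "C.\<mu>" Y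
proof
 show "hunt_process C.Tc Y" "symmetric_process C.\<mu> Y"
  using assoc_Y unfolding associated_hunt_process_def sticky_form_def by simp_all
qed (rule C.sets_\<mu>)

context darning_limit
begin

section \<open>The form of \<open>Y\<close> read on the original space\<close>

lemma Y_form:
 "Y.S.form_dom = {g \<in> L2 C.\<mu>. g \<circ> C.c \<in> constant_domain D K N}"
 "g \<in> Y.S.form_dom ==> Y.S.form g g = S.form (g \<circ> C.c) (g \<circ> C.c)"
proof -
 have 0: "refm (sticky_form D X K N \<alpha>) = C.\<mu>" by (simp add: sticky_form_def)
 note Y = Y.associated_form[OF assoc_Y 0]
 show 1: "Y.S.form_dom = {g \<in> L2 C.\<mu>. g \<circ> C.c \<in> constant_domain D K N}"
  unfolding Y(1)[symmetric] by (simp add: sticky_form_def darning)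
 show "Y.S.form g g = S.form (g \<circ> C.c) (g \<circ> C.c)" if g: "g \<in> Y.S.form_dom"
 proof -
  have "g \<circ> C.c \<in> S.form_dom" using g unfolding 1 by (simp add: constant_domain_def dom)
  thus ?thesis using Y(2)[OF g g] energy_form by (simp add: sticky_form_def)
 qed
qed

lemma constant_AE_cong:
 assumes u: "u \<in> constant_domain D K N" and v: "v \<in> borel_measurable (refm D)" and eq: "AE x in refm D. v x = u x"
 shows "v \<in> constant_domain D K N" "S.form v v = S.form u u"
proof -
 have ud: "u \<in> S.form_dom" using u by (simp add: constant_domain_def dom)
 note vd = S.form_AE_cong(1)[OF ud v eq]
 obtain g where g: "qc_version D u g" "\<forall>j\<in>{1..N}. \<exists>c. qe_on D (K j) (%x. g x = c)"
  using u unfolding constant_domain_def by blast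
 have "qc_version D v g" by (rule qc_version_AE_cong[OF g(1)]) (use eq in auto)
 thus "v \<in> constant_domain D K N" unfolding constant_domain_def dom using vd g(2) by blast
 have "S.form v v = S.form u v" by (rule S.form_AE_cong(2)[OF ud v eq vd])
 also have "... = S.form v u" by (rule S.form_sym[OF ud vd])
 also have "... = S.form u u" by (rule S.form_AE_cong(2)[OF ud v eq ud])
 finally show "S.form v v = S.form u u" .
qed

lemma constant_domain_AE_const:
 assumes u: "u \<in> constant_domain D K N" and j: "j \<in> {1..N}"
 shows "\<exists>a. AE x in refm D. x \<in> K j --> u x = a"
proof -
 obtain g a where g: "qc_version D u g" "qe_on D (K j) (%x. g x = a)"
  using u j unfolding constant_domain_def by blast
 have "AE x in refm D. g x = u x" using g(1) by (simp add: qc_version_def)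
 hence "AE x in refm D. x \<in> K j --> u x = a" using qe_on_AE[OF g(2)] by eventually_elim auto
 thus ?thesis by blast
qed

text \<open>The starred function of v collapses back to v almost everywhere, so up to null sets the
  domain of \<open>Y\<close> is the whole constant domain and the two variational problems range
  over the same functions.\<close>

lemma lift_constant:
 assumes v: "v \<in> constant_domain D K N"
 shows "\<exists>w\<in>Y.S.form_dom. AE x in refm D. (w \<circ> C.c) x = v x"
proof -
 have vm: "v \<in> borel_measurable (refm D)" 
  by (rule L2_measurable, rule S.form_dom_L2) (use v in "simp add: constant_domain_def dom")
 let ?w = "star_fun (refm D) K v"
 have wm: "?w \<in> borel_measurable C.\<mu>" by (rule C.star_fun_measurable[OF vm])
 have eq: "AE x in refm D. (?w \<circ> C.c) x = v x"
  by (rule C.star_fun_collapse[OF vm constant_domain_AE_const[OF v]])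
 have wc: "?w \<circ> C.c \<in> constant_domain D K N" by (rule constant_AE_cong(1)[OF v C.\<mu>_measurable_comp[OF wm] eq])
 hence "?w \<circ> C.c \<in> L2 (refm D)" using S.form_dom_L2 by (simp add: constant_domain_def dom)
 hence "?w \<in> Y.S.form_dom" unfolding Y_form(1) using C.L2_\<mu>[OF wm] wc by blast
 thus ?thesis using eq by blast
qed

section \<open>Convergence of Laplace transforms, autocorrelations and semigroups\<close>

lemma laplace_tendsto:
 assumes g: "g \<in> L2 C.\<mu>" and b: "b > 0"
 shows "(%n. Xn.S.laplace n (g \<circ> C.c) b) ---> Y.S.laplace g b"
proof (rule laplace_limit[OF C.L2_\<mu>_comp[OF g] b])
 note gL = C.L2_\<mu>_comp[OF g]
 have inn: "l2_inner C.\<mu> u w = l2_inner (refm D) (u \<circ> C.c) (w \<circ> C.c)" if "u \<in> L2 C.\<mu>" "w \<in> L2 C.\<mu>" for u w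
  by (rule C.inner_\<mu>) (use that L2_measurable in auto)
 fix v assume v: "v \<in> constant_domain D K N"
 obtain w where w: "w \<in> Y.S.form_dom" "AE x in refm D. (w \<circ> C.c) x = v x" using lift_constant[OF v] by blast
 have wL: "w \<in> L2 C.\<mu>" by (rule Y.S.form_dom_L2[OF w(1)])
 have vm: "v \<in> borel_measurable (refm D)" 
  by (rule L2_measurable, rule S.form_dom_L2) (use v in "simp add: constant_domain_def dom")
 have cm: "w \<circ> C.c \<in> borel_measurable (refm D)" "g \<circ> C.c \<in> borel_measurable (refm D)"
  using L2_measurable[OF C.L2_\<mu>_comp[OF wL]] L2_measurable[OF gL] by auto
 have "l2_inner (refm D) (g \<circ> C.c) v = l2_inner C.\<mu> g w"
  unfolding inn[OF g wL] by (rule l2_inner_AE_cong) (use w(2) cm vm in auto)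
 moreover have "l2_inner (refm D) v v = l2_inner C.\<mu> w w"
  unfolding inn[OF wL wL] by (rule l2_inner_AE_cong) (use w(2) cm vm in auto)
 moreover have "S.form v v = Y.S.form w w"
  unfolding Y_form(2)[OF w(1)] by (rule constant_AE_cong(2)[OF v cm(1) w(2), symmetric])
 ultimately show "2 * l2_inner (refm D) (g \<circ> C.c) v - b * l2_inner (refm D) v v - S.form v v <= Y.S.laplace g b"
  using Y.S.laplace_eq_sup(1)[OF b g w(1)] by simp
next
 obtain w where w: "w \<in> Y.S.form_dom"
  "2 * l2_inner C.\<mu> g w - b * l2_inner C.\<mu> w w - Y.S.form w w >= Y.S.laplace g b"
  using Y.S.laplace_eq_sup(2)[OF b g] by blast
 have gm: "g \<in> borel_measurable C.\<mu>" "w \<in> borel_measurable C.\<mu>"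
  using L2_measurable[OF g] L2_measurable[OF Y.S.form_dom_L2[OF w(1)]] by auto
 have "w \<circ> C.c \<in> constant_domain D K N" using w(1) unfolding Y_form(1) by blast
 thus "\<exists>w\<in>constant_domain D K N. Y.S.laplace g b \<le>
   2 * l2_inner (refm D) (g \<circ> C.c) w - b * l2_inner (refm D) w w - S.form w w"
  using w(2) unfolding C.inner_\<mu>[OF gm] C.inner_\<mu>[OF gm(2) gm(2)] Y_form(2)[OF w(1)] by blast
qed

text \<open>Inversion of the Laplace transforms; time 0 is separate because the autocorrelation is
  shown to be continuous at positive times, and at 0 both sides are the same squared norm.\<close>

lemma corr_tendsto:
 assumes g: "g \<in> L2 C.\<mu>" and t: "t >= 0"
 shows "(%n. Xn.S.corr n (g \<circ> C.c) t) ---> Y.S.corr g t"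
proof (cases "t = 0")
 case True
 have "g \<in> borel_measurable C.\<mu>" by (rule L2_measurable[OF g])
 thus ?thesis using True by (simp add: Xn.S.corr_0[OF C.L2_\<mu>_comp[OF g]] Y.S.corr_0[OF g] C.inner_\<mu>)
next
 case False
 note f = C.L2_\<mu>_comp[OF g]
 have gm: "g \<in> borel_measurable C.\<mu>" by (rule L2_measurable[OF g])
 show ?thesis
 proof (rule laplace_inversion[where B="l2_inner (refm D) (g \<circ> C.c) (g \<circ> C.c)"
    and \<phi>="%n. Xn.S.corr n (g \<circ> C.c)" and \<psi>="Y.S.corr g"])
  show "Xn.S.corr n (g \<circ> C.c) t \<in> {0..l2_inner (refm D) (g \<circ> C.c) (g \<circ> C.c)}" if "0 <= t" for n t
   using Xn.S.corr_nonneg[OF that f] Xn.S.corr_le[OF that f] by simp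
  show "Y.S.corr g t \<in> {0..l2_inner (refm D) (g \<circ> C.c) (g \<circ> C.c)}" if "0 <= t" for t
   using Y.S.corr_nonneg[OF that g] Y.S.corr_le[OF that g] by (simp add: C.inner_\<mu>[OF gm gm])
  show "(%n. LINT t:{0..}|lborel. exp (- real p * t) * Xn.S.corr n (g \<circ> C.c) t)
    ---> (LINT t:{0..}|lborel. exp (- real p * t) * Y.S.corr g t)" if "p > 0" for p
   using laplace_tendsto[OF g, of "real p"] that unfolding Xn.S.laplace_def Y.S.laplace_def by simp
  show "Xn.S.corr n (g \<circ> C.c) t <= Xn.S.corr n (g \<circ> C.c) s" if "0 <= s" "s <= t" for n s t
   by (rule Xn.S.corr_antimono[OF that f])
  show "Y.S.corr g t <= Y.S.corr g s" if "0 <= s" "s <= t" for s t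
   by (rule Y.S.corr_antimono[OF that g])
  show "t > 0" using t False by simp
  thus "isCont (Y.S.corr g) t" by (rule Y.S.corr_isCont[OF _ g])
 qed
qed

text \<open>Polarisation: symmetry of the operators recovers mixed terms from the autocorrelation of
  the sum.\<close>

lemma inner_tendsto:
 assumes g: "g \<in> L2 C.\<mu>" and h: "h \<in> L2 C.\<mu>" and t: "t >= 0"
 shows "(%n. l2_inner (refm D) (transition (Xn n) t (g \<circ> C.c)) (h \<circ> C.c)) ---> l2_inner C.\<mu> (transition Y t g) h"
proof -
 have gh: "(%x. 1 * g x + 1 * h x) \<in> L2 C.\<mu>" using g h by simp
 note gL = C.L2_\<mu>_comp[OF g] and hL = C.L2_\<mu>_comp[OF h]
 note PL = Xn.transition_L2(1)[OF t]
 have "l2_inner (refm D) (transition (Xn n) t (g \<circ> C.c)) (h \<circ> C.c) =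
   (Xn.S.corr n ((%x. 1 * g x + 1 * h x) \<circ> C.c) t - Xn.S.corr n (g \<circ> C.c) t - Xn.S.corr n (h \<circ> C.c) t) / 2" for n
  using Xn.S.P_linear[OF t gL hL, of _ n 1 1] Xn.S.P_symmetric[OF t gL hL, of n] gL hL PL[OF gL, of n] PL[OF hL, of n]
   l2_inner_commute[of "refm D" "g \<circ> C.c" "transition (Xn n) t (h \<circ> C.c)"]
  by (simp add: Xn.S.corr_def o_def)
 moreover have "l2_inner C.\<mu> (transition Y t g) h = (Y.S.corr (%x. 1 * g x + 1 * h x) t - Y.S.corr g t - Y.S.corr h t) / 2"
  using Y.S.P_linear[OF t g h, of _ 1 1] Y.S.P_symmetric[OF t g h] g h Y.transition_L2(1)[OF t g] Y.transition_L2(1)[OF t h]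
   l2_inner_commute[of C.\<mu> g "transition Y t h"]
  by (simp add: Y.S.corr_def)
 ultimately show ?thesis
  by (simp only:) (intro tendsto_divide tendsto_diff tendsto_const corr_tendsto gh g h t, simp)
qed

text \<open>Expanding the squared distance leaves the autocorrelation at 2 t and inner products, all
  of which converge; in the limit they cancel, because the autocorrelation for \<open>Y\<close> at 2
  t is the squared norm at t.\<close>

lemma transition_tendsto:
 assumes g: "g \<in> L2 C.\<mu>" and t: "t >= 0"
 shows "l2_tendsto (refm D) (%n. transition (Xn n) t (g \<circ> C.c)) (transition Y t g \<circ> C.c)"
proof -
 let ?m = "refm D" and ?P = "%n. transition (Xn n) t (g \<circ> C.c)" and ?Q = "transition Y t g"
 have QL: "?Q \<in> L2 C.\<mu>" by (rule Y.transition_L2(1)[OF t g])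
 have Qm: "?Q \<in> borel_measurable C.\<mu>" by (rule L2_measurable[OF QL])
 note gL = C.L2_\<mu>_comp[OF g] and QcL = C.L2_\<mu>_comp[OF QL]
 have PL: "?P n \<in> L2 ?m" for n by (rule Xn.transition_L2(1)[OF t gL])
 have t2: "2 * t >= 0" using t by simp
 have eq: "(l2_norm ?m (%x. ?P n x - (?Q \<circ> C.c) x))^2 =
   Xn.S.corr n (g \<circ> C.c) (2 * t) - 2 * l2_inner ?m (?P n) (?Q \<circ> C.c) + l2_inner C.\<mu> ?Q ?Q" for n
  using Xn.S.corr_half[OF t2 gL, of n] PL[of n] QcL
  by (simp add: l2_norm_square C.inner_\<mu>[OF Qm Qm] l2_inner_commute[of ?m "?Q \<circ> C.c" "?P n"] del: o_apply)
 have "(%n. (l2_norm ?m (%x. ?P n x - (?Q \<circ> C.c) x))^2) --->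
   Y.S.corr g (2 * t) - 2 * l2_inner C.\<mu> ?Q ?Q + l2_inner C.\<mu> ?Q ?Q"
  unfolding eq by (intro tendsto_add tendsto_diff tendsto_mult_left tendsto_const corr_tendsto[OF g t2] inner_tendsto[OF g QL t])
 hence "(%n. (l2_norm ?m (%x. ?P n x - (?Q \<circ> C.c) x))^2) ---> 0"
  using Y.S.corr_half[OF t2 g] by (simp add: l2_norm_square)
 from tendsto_real_sqrt[OF this] have "(%n. l2_norm ?m (%x. ?P n x - (?Q \<circ> C.c) x)) ---> 0" by simp
 thus ?thesis by (intro l2_tendstoI[OF PL QcL order.refl])
qed

text \<open>In the induction over the times the argument itself moves with n; contractivity, uniform
  in n, reduces this to a fixed argument.\<close>

lemma transition_tendsto_varying:
 assumes F: "l2_tendsto (refm D) F (g \<circ> C.c)" and g: "g \<in> L2 C.\<mu>" and t: "t >= 0"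
 shows "l2_tendsto (refm D) (%n. transition (Xn n) t (F n)) (transition Y t g \<circ> C.c)"
proof (rule l2_tendstoI)
 let ?m = "refm D" and ?P = "%n u. transition (Xn n) t u" and ?Q = "transition Y t g \<circ> C.c"
 note gL = C.L2_\<mu>_comp[OF g] and FL = l2_tendstoD(1)[OF F]
 note lim = transition_tendsto[OF g t]
 have PL: "?P n (F n) \<in> L2 ?m" for n by (rule Xn.transition_L2(1)[OF t FL])
 show "?P n (F n) \<in> L2 ?m" for n by (rule PL)
 show "?Q \<in> L2 ?m" by (rule l2_tendstoD(2)[OF lim])
 show "l2_norm ?m (%x. ?P n (F n) x - ?Q x) \<le>
   l2_norm ?m (%x. F n x - (g \<circ> C.c) x) + l2_norm ?m (%x. ?P n (g \<circ> C.c) x - ?Q x)" for n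
 proof -
  have "l2_norm ?m (%x. (?P n (F n) x - ?P n (g \<circ> C.c) x) + (?P n (g \<circ> C.c) x - ?Q x)) \<le>
   l2_norm ?m (%x. ?P n (F n) x - ?P n (g \<circ> C.c) x) + l2_norm ?m (%x. ?P n (g \<circ> C.c) x - ?Q x)"
   by (rule l2_norm_triangle; rule L2_diff; rule PL l2_tendstoD(1,2)[OF lim])
  thus ?thesis using Xn.S.P_norm_diff[OF t FL gL, of n n] by simp
 qed
 show "(%n. l2_norm ?m (%x. F n x - (g \<circ> C.c) x) + l2_norm ?m (%x. ?P n (g \<circ> C.c) x - ?Q x)) ---> 0"
  using tendsto_add[OF l2_tendstoD(3)[OF F] l2_tendstoD(3)[OF lim]] by simp
qed

text \<open>A transition of a convergent sequence converges, and multiplication by a bounded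
  function keeps mean-square convergence; the bound has to hold everywhere, which clipped
  representatives provide.\<close>

lemma nested_tendsto:
 assumes "!!j. j < k ==> t j <= t (Suc j)" and "!!j. j <= k ==> G j \<in> L2 C.\<mu>" and "!!j y. j <= k ==> \<bar>G j y\<bar> <= B j"
 shows "nested (transition Y) t k G \<in> L2 C.\<mu> \<and>
  l2_tendsto (refm D) (%n. nested (transition (Xn n)) t k (%j. G j \<circ> C.c)) (nested (transition Y) t k G \<circ> C.c)"
 using assms
proof (induction k arbitrary: t G B)
 case 0
 thus ?case using C.L2_\<mu>_comp[of "G 0"] by (simp del: o_apply)
next
 case (Suc k)
 let ?m = "refm D"
 let ?F = "%n. nested (transition (Xn n)) (%j. t (Suc j)) k (%j. G (Suc j) \<circ> C.c)"
 let ?G = "nested (transition Y) (%j. t (Suc j)) k (%j. G (Suc j))"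
 let ?s = "t (Suc 0) - t 0"
 have s: "?s >= 0" using Suc.prems(1)[of 0] by simp
 have "?G \<in> L2 C.\<mu> \<and> l2_tendsto ?m ?F (?G \<circ> C.c)"
  by (rule Suc.IH[where B="%j. B (Suc j)"]) (use Suc.prems in auto)
 note IH = conjunct1[OF this] conjunct2[OF this]
 have QL: "transition Y ?s ?G \<in> L2 C.\<mu>" by (rule Y.transition_L2(1)[OF s IH(1)])
 have lim: "l2_tendsto ?m (%n. transition (Xn n) ?s (?F n)) (transition Y ?s ?G \<circ> C.c)"
  by (rule transition_tendsto_varying[OF IH(2,1) s])
 have G0: "G 0 \<in> borel_measurable C.\<mu>" "!!y. \<bar>G 0 y\<bar> <= B 0" using Suc.prems(2,3)[of 0] by auto
 have G0c: "G 0 \<circ> C.c \<in> borel_measurable ?m" by (rule C.\<mu>_measurable_comp[OF G0(1)])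
 have 1: "(%y. G 0 y * transition Y ?s ?G y) \<in> L2 C.\<mu>" by (rule L2_bounded_times[OF QL G0])
 have 2: "l2_tendsto ?m (%n x. (G 0 \<circ> C.c) x * transition (Xn n) ?s (?F n) x)
   (%x. (G 0 \<circ> C.c) x * (transition Y ?s ?G \<circ> C.c) x)"
 proof (rule l2_tendsto_dominated[OF lim, where c="B 0"])
  show "(%x. (G 0 \<circ> C.c) x * transition (Xn n) ?s (?F n) x) \<in> L2 ?m" for n
   by (rule L2_bounded_times[OF l2_tendstoD(1)[OF lim] G0c, of "B 0"]) (simp add: G0)
  show "(%x. (G 0 \<circ> C.c) x * (transition Y ?s ?G \<circ> C.c) x) \<in> L2 ?m"
   by (rule L2_bounded_times[OF l2_tendstoD(2)[OF lim] G0c, of "B 0"]) (simp add: G0)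
  show "AE x in ?m. \<bar>(G 0 \<circ> C.c) x * transition (Xn n) ?s (?F n) x - (G 0 \<circ> C.c) x * (transition Y ?s ?G \<circ> C.c) x\<bar>
    <= B 0 * \<bar>transition (Xn n) ?s (?F n) x - (transition Y ?s ?G \<circ> C.c) x\<bar>" for n
   by (rule AE_I2) (auto simp: abs_mult right_diff_distrib[symmetric] intro!: mult_right_mono G0)
 qed
 show ?case unfolding nested_shift using 1 2 by (simp add: o_def)
qed

lemma closure_AE_const:
 assumes f: "f \<in> l2_closure (refm D) (constant_domain D K N)" and j: "j \<in> {1..N}"
 shows "\<exists>a. AE x in refm D. x \<in> K j --> f x = a"
proof -
 have "\<exists>g\<in>constant_domain D K N. (\<integral>x. (f x - g x)^2 \<partial>refm D) < 1 / real (Suc n)" for n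
 proof -
  have "1 / real (Suc n) > 0" by simp
  thus ?thesis using f unfolding l2_closure_def by blast
 qed
 then obtain g where g: "!!n. g n \<in> constant_domain D K N" "!!n. (\<integral>x. (f x - g n x)^2 \<partial>refm D) < 1 / real (Suc n)" by metis
 have fL: "f \<in> L2 (refm D)" using f by (simp add: l2_closure_def)
 have gL: "g n \<in> L2 (refm D)" for n using g(1)[of n] S.form_dom_L2 by (simp add: constant_domain_def dom)
 have "l2_tendsto (refm D) g f"
 proof (rule l2_tendstoI[OF gL fL])
  have "(\<integral>x. (f x - g n x)^2 \<partial>refm D) = l2_inner (refm D) (%x. g n x - f x) (%x. g n x - f x)" for n
   unfolding l2_inner_def by (rule Bochner_Integration.integral_cong) (simp_all add: power2_eq_square algebra_simps)
  thus "l2_norm (refm D) (%x. g n x - f x) <= sqrt (1 / real (Suc n))" for n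
   unfolding l2_norm_def using g(2)[of n] by (intro real_sqrt_le_mono) simp
  have "(%n. 1 / real (Suc n)) ---> 0" using LIMSEQ_inverse_real_of_nat by (simp add: inverse_eq_divide)
  from tendsto_real_sqrt[OF this] show "(%n. sqrt (1 / real (Suc n))) ---> 0" by simp
 qed
 thus ?thesis by (rule AE_const_on_limit) (rule constant_domain_AE_const[OF g(1) j])
qed

text \<open>Splitting off time 0 turns both sides into inner products of square-integrable
  functions, so mean-square convergence suffices even if the total mass is infinite.\<close>

theorem finite_dimensional_limit:
 assumes k: "k >= 1" and t0: "t 0 = 0" and tm: "!!j. j < k ==> t j <= t (Suc j)"
  and f: "!!j. j <= k ==> f j \<in> l2_closure (refm D) (constant_domain D K N)" "!!j. j <= k ==> ess_bounded (refm D) (f j)"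
 shows "(%n. \<integral>x. (\<integral>om. (\<Prod>j\<le>k. ext0 (f j) (path (Xn n) (t j) om)) \<partial>law (Xn n) (Some x)) \<partial>refm D)
  ---> (\<integral>y. (\<integral>om. (\<Prod>j\<le>k. ext0 (star_fun (refm D) K (f j)) (path Y (t j) om)) \<partial>law Y (Some y)) \<partial>C.\<mu>)"
proof -
 let ?m = "refm D"
 let ?S = "%j. star_fun ?m K (f j)"
 have "\<exists>B. \<forall>j. j <= k --> (AE x in ?m. \<bar>f j x\<bar> <= B j)"
  using f(2) unfolding ess_bounded_def by metis
 then obtain B where B: "!!j. j <= k ==> AE x in ?m. \<bar>f j x\<bar> <= B j" by blast
 \<comment> \<open>Essential bounds for the \<open>f j\<close> do not bound the starred functions at
   every point; clipping changes them on a null set only. The absolute value of \<open>B j\<close>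
   keeps the clipping interval nonempty.\<close>
 define G where "G j y = max (- \<bar>B j\<bar>) (min (?S j y) \<bar>B j\<bar>)" for j y
 have fL: "f j \<in> L2 ?m" if "j <= k" for j using f(1)[OF that] by (simp add: l2_closure_def)
 have fm: "f j \<in> borel_measurable ?m" if "j <= k" for j by (rule L2_measurable[OF fL[OF that]])
 have Sm: "?S j \<in> borel_measurable C.\<mu>" if "j <= k" for j by (rule C.star_fun_measurable[OF fm[OF that]])
 have Gm: "G j \<in> borel_measurable C.\<mu>" if "j <= k" for j
  unfolding G_def[abs_def] using Sm[OF that] by measurable
 have GB: "\<bar>G j y\<bar> <= \<bar>B j\<bar>" for j y unfolding G_def by auto
 have Sf: "AE x in ?m. (?S j \<circ> C.c) x = f j x" if "j <= k" for j
  by (rule C.star_fun_collapse[OF fm[OF that] closure_AE_const[OF f(1)[OF that]]])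
 have Gf: "AE x in ?m. (G j \<circ> C.c) x = f j x" if "j <= k" for j
  using Sf[OF that] B[OF that] by eventually_elim (auto simp: G_def)
 have GS: "AE y in C.\<mu>. G j y = ?S j y" if "j <= k" for j
 proof -
  have "{y \<in> space C.\<mu>. G j y = ?S j y} \<in> sets C.\<mu>" using Gm[OF that] Sm[OF that] by measurable
  hence "{y \<in> topspace C.Tc. G j y = ?S j y} \<in> sets C.\<mu>" by (simp only: C.space_\<mu>)
  moreover have "AE x in ?m. G j (C.c x) = ?S j (C.c x)" using Gf[OF that] Sf[OF that] by eventually_elim simp
  ultimately show ?thesis by (rule C.AE_\<mu>[THEN iffD2])
 qed
 have GL: "G j \<in> L2 C.\<mu>" if "j <= k" for j
  using C.L2_\<mu>[OF Gm[OF that]] L2_AE_cong[OF fL[OF that] C.\<mu>_measurable_comp[OF Gm[OF that]] Gf[OF that]] by blast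
 \<comment> \<open>A positive time is present, so there is a second factor to pair with the one at
   time 0.\<close>
 obtain i where i: "k = Suc i" using k by (cases k) auto
 let ?s = "t (Suc 0) - t 0"
 let ?F = "%n. nested (transition (Xn n)) (%j. t (Suc j)) i (%j. G (Suc j) \<circ> C.c)"
 let ?G = "nested (transition Y) (%j. t (Suc j)) i (%j. G (Suc j))"
 have s: "?s >= 0" using tm[of 0] k by simp
 have "?G \<in> L2 C.\<mu> \<and> l2_tendsto ?m ?F (?G \<circ> C.c)"
  by (rule nested_tendsto[where B="%j. \<bar>B (Suc j)\<bar>"]) (use tm GL GB i in auto)
 note IH = conjunct1[OF this] conjunct2[OF this]
 note lim = transition_tendsto_varying[OF IH(2,1) s]
 have G0: "G 0 \<circ> C.c \<in> L2 ?m" by (rule C.L2_\<mu>_comp[OF GL]) simp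
 have "(%n. l2_inner ?m (G 0 \<circ> C.c) (transition (Xn n) ?s (?F n))) ---> l2_inner ?m (G 0 \<circ> C.c) (transition Y ?s ?G \<circ> C.c)"
  by (intro l2_tendsto_inner lim l2_tendsto_const G0)
 moreover have "l2_inner ?m (G 0 \<circ> C.c) (transition Y ?s ?G \<circ> C.c) = l2_inner C.\<mu> (G 0) (transition Y ?s ?G)"
  using Gm[of 0] L2_measurable[OF Y.transition_L2(1)[OF s IH(1)]] by (simp add: C.inner_\<mu>)
 moreover have "(\<integral>x. (\<integral>om. (\<Prod>j\<le>k. ext0 (f j) (path (Xn n) (t j) om)) \<partial>law (Xn n) (Some x)) \<partial>refm D) =
   l2_inner ?m (G 0 \<circ> C.c) (transition (Xn n) ?s (?F n))" for n
 proof -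
  have "(\<integral>x. (\<integral>om. (\<Prod>j\<le>k. ext0 (f j) (path (Xn n) (t j) om)) \<partial>law (Xn n) (Some x)) \<partial>refm D) =
    (\<integral>x. nested (transition (Xn n)) t k (%j. G j \<circ> C.c) x \<partial>?m)"
   by (rule Xn.path_integral_eq_nested[OF t0 tm fm C.\<mu>_measurable_comp[OF Gm] Gf, where B="%j. \<bar>B j\<bar>"]) (simp_all add: GB)
  thus ?thesis by (simp add: i nested_shift l2_inner_def del: nested.simps)
 qed
 moreover have "(\<integral>y. (\<integral>om. (\<Prod>j\<le>k. ext0 (?S j) (path Y (t j) om)) \<partial>law Y (Some y)) \<partial>C.\<mu>) = l2_inner C.\<mu> (G 0) (transition Y ?s ?G)"
 proof -
  have "(\<integral>y. (\<integral>om. (\<Prod>j\<le>k. ext0 (?S j) (path Y (t j) om)) \<partial>law Y (Some y)) \<partial>C.\<mu>) = (\<integral>y. nested (transition Y) t k G y \<partial>C.\<mu>)"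
   by (rule Y.path_integral_eq_nested[OF t0 tm Sm Gm GS, where B="%j. \<bar>B j\<bar>"]) (simp_all add: GB)
  thus ?thesis by (simp add: i nested_shift l2_inner_def del: nested.simps)
 qed
 ultimately show ?thesis by simp
qed

end

section \<open>Countability from the topological hypotheses\<close>

lemma separable_metric_second_countable:
 fixes E :: "'a metric"
 assumes "separable_space (mtopology_of E)" shows "second_countable (mtopology_of E)"
proof -
 interpret Metric_space "mspace E" "mdist E" by simp
 have T: "mtopology_of E = mtopology" by (simp add: mtopology_of_def)
 obtain C where C: "countable C" "C \<subseteq> mspace E" "mtopology closure_of C = mspace E"
  using assms unfolding separable_space_def T by auto
 define \<B> where "\<B> = (%(y, n::nat). mball y (1 / real (Suc n))) ` (C \<times> UNIV)"
 have "\<exists>V\<in>\<B>. x \<in> V \<and> V \<subseteq> U" if U: "openin mtopology U" "x \<in> U" for U x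
 proof -
  obtain r where r: "r > 0" "mball x r \<subseteq> U" "x \<in> mspace E" using U unfolding openin_mtopology by blast
  \<comment> \<open>Radii below r / 2: a ball around y that contains x then stays inside the ball of
    radius r around x.\<close>
  obtain n :: nat where "1 / r * 2 < real n" using reals_Archimedean2 by blast
  hence n: "1 / real (Suc n) < r / 2" using r(1) by (simp add: field_simps)
  have "x \<in> mtopology closure_of C" "0 < 1 / real (Suc n)" using C(3) r(3) by simp_all
  hence "\<exists>y\<in>C. y \<in> mball x (1 / real (Suc n))" unfolding metric_closure_of by simp
  then obtain y where y: "y \<in> C" "y \<in> mball x (1 / real (Suc n))" by blast
  have "mball y (1 / real (Suc n)) \<subseteq> U"
  proof
   fix z assume z: "z \<in> mball y (1 / real (Suc n))"
   have "mdist E x z <= mdist E x y + mdist E y z" using r(3) y z by (intro triangle) auto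
   also have "... < r" using y(2) z n by (simp add: in_mball)
   finally have "z \<in> mball x r" using r(3) z by (simp add: in_mball)
   thus "z \<in> U" using r(2) by blast
  qed
  moreover have "x \<in> mball y (1 / real (Suc n))" using y(2) r(3) C(2) by (auto simp: in_mball commute)
  moreover have "mball y (1 / real (Suc n)) \<in> \<B>" using y(1) by (auto simp: \<B>_def)
  ultimately show ?thesis by blast
 qed
 moreover have "countable \<B>" unfolding \<B>_def using C(1) by simp
 moreover have "openin mtopology V" if "V \<in> \<B>" for V using that by (auto simp: \<B>_def)
 ultimately show ?thesis unfolding second_countable_def T by (intro exI[of _ \<B>]) simp
qed

text \<open>By local compactness the open sets of finite measure cover the space, and second
  countability extracts a countable subcover.\<close>

lemma radon_sigma_finite:
 assumes lc: "locally_compact_space T" and H: "Hausdorff_space T" and sc: "second_countable T" and m: "radon_measure T m"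
 shows "sigma_finite_measure m"
proof
 have sets: "sets m = sets (borel_of T)" using m by (simp add: radon_measure_def)
 have space: "space m = topspace T" using sets_eq_imp_space_eq[OF sets] by simp
 let ?U = "{U. openin T U \<and> emeasure m U < \<infinity>}"
 have "\<exists>U\<in>?U. x \<in> U" if x: "x \<in> topspace T" for x
 proof -
  obtain U C where U: "openin T U" "compactin T C" "x \<in> U" "U \<subseteq> C"
   using lc x unfolding locally_compact_space_def by blast
  have "closedin T C" by (rule compactin_imp_closedin[OF H U(2)])
  hence "emeasure m U <= emeasure m C" using U(4) by (intro emeasure_mono) (auto simp: sets closedin_borel_of)
  moreover have "emeasure m C < \<infinity>" using m U(2) by (simp add: radon_measure_def)
  ultimately have "emeasure m U < \<infinity>" by (rule le_less_trans)
  thus ?thesis using U(1,3) by blast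
 qed
 hence "\<Union>?U = topspace T" using openin_subset by blast
 then obtain \<V> where V: "countable \<V>" "\<V> \<subseteq> ?U" "\<Union>\<V> = topspace T"
  using Lindelof_spaceD[OF second_countable_imp_Lindelof_space[OF sc], of ?U] by auto
 have "\<V> \<subseteq> sets m" using V(2) by (auto simp: sets openin_borel_of)
 moreover have "\<forall>a\<in>\<V>. emeasure m a ~= \<infinity>" using V(2) by (auto simp: less_top)
 ultimately show "\<exists>A. countable A \<and> A \<subseteq> sets m \<and> \<Union>A = space m \<and> (\<forall>a\<in>A. emeasure m a ~= \<infinity>)"
  using V(1,3) unfolding space by (intro exI[of _ \<V>] conjI)
qed

theorem theorem4p3:
  fixes E :: "'a metric"
    and D :: "'a form_data"
    and X :: "('a, 'w0) process"
    and K :: "nat \<Rightarrow> 'a set" and N :: nat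
    and \<nu> :: "nat \<Rightarrow> 'a measure"
    and \<alpha> :: real
    and lam :: "nat \<Rightarrow> real"
    and Xn :: "nat \<Rightarrow> ('a, 'w1) process"
    and Y :: "('a + nat, 'w2) process"
    and k :: nat and t :: "nat \<Rightarrow> real" and f :: "nat \<Rightarrow> 'a \<Rightarrow> real"
  assumes "locally_compact_space (mtopology_of E)" and "separable_space (mtopology_of E)"
    and "base D = mtopology_of E"
    and "radon_measure (base D) (refm D)" and "full_support (base D) (refm D)"
    and "regular_dirichlet_form D"
    and "associated_hunt_process D X"
    and "N \<ge> 1"
    and "\<forall>j\<in>{1..N}. compactin (base D) (K j) \<and> \<not> polar D (K j)"
    and "\<forall>i\<in>{1..N}. \<forall>j\<in>{1..N}. i \<noteq> j \<longrightarrow> K i \<inter> K j = {}"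
    and "\<forall>j\<in>{1..N}. finite_measure (\<nu> j) \<and> smooth_measure D (\<nu> j) \<and>
           quasi_support D (\<nu> j) (K j) \<and> bounded_1_potential D (\<nu> j)"
    and "\<alpha> > 0"
    and "\<forall>n\<ge>1. lam n > 0 \<and> lam n \<le> lam (Suc n)" and "filterlim lam at_top sequentially"
    and "\<forall>n\<ge>1. associated_hunt_process (approx_form D K N \<nu> (lam n)) (Xn n)"
    and "associated_hunt_process (sticky_form D X K N \<alpha>) Y"
    and "k \<ge> 1" and "t 0 = 0" and "\<forall>j<k. t j < t (Suc j)"
    and "\<forall>j\<le>k. f j \<in> l2_closure (refm D) (constant_domain D K N) \<and> ess_bounded (refm D) (f j)"
  shows "(\<lambda>n. \<integral>x. (\<integral>\<omega>. (\<Prod>j\<le>k. ext0 (f j) (path (Xn n) (t j) \<omega>)) \<partial>law (Xn n) (Some x)) \<partial>refm D)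
    \<longlonglongrightarrow> (\<integral>y. (\<integral>\<omega>. (\<Prod>j\<le>k. ext0 (star_fun (refm D) K (f j)) (path Y (t j) \<omega>)) \<partial>law Y (Some y))
            \<partial>sticky_measure (base D) (refm D) K N)"
proof -
 let ?T = "base D" and ?m = "refm D"
 \<comment> \<open>The hypotheses on the approximating sequence begin at n = 1, so the locales are
   instantiated with the sequence shifted by one, and the limit is shifted back at the end.\<close>
 let ?lam = "%n. lam (Suc n)" and ?Xn = "%n. Xn (Suc n)"
 have lc: "locally_compact_space ?T" and radon: "radon_measure ?T ?m" using assms(1,3,4) by simp_all
 have H: "Hausdorff_space ?T" unfolding assms(3) mtopology_of_def
  by (rule Metric_space.Hausdorff_space_mtopology[OF Metric_space_mspace_mdist])
 have sc: "second_countable ?T" unfolding assms(3) by (rule separable_metric_second_countable[OF assms(2)])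
 have sf: "sigma_finite_measure ?m" by (rule radon_sigma_finite[OF lc H sc radon])
 have sets: "sets ?m = sets (borel_of ?T)" using radon by (simp add: radon_measure_def)
 have X: "hunt_process ?T X" "symmetric_process ?m X" using assms(7) by (simp_all add: associated_hunt_process_def)
 interpret dirichlet_hunt D X
  by unfold_locales (rule X sets sc sf assms(6,7) sigma_finite_measure.sigma_finite_countable[OF sf])+
 have K: "compactin ?T (K j)" if "j \<in> {1..N}" for j using assms(9) that by blast
 have Kc: "closedin ?T (K j)" if "j \<in> {1..N}" for j by (rule compactin_imp_closedin[OF H K[OF that]])
 have disj: "K i \<inter> K j = {}" if "i \<in> {1..N}" "j \<in> {1..N}" "i ~= j" for i j using assms(10) that by blast
 have \<nu>: "finite_measure (\<nu> j)" "smooth_measure D (\<nu> j)" "quasi_support D (\<nu> j) (K j)" if "j \<in> {1..N}" for j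
  using assms(11) that by blast+
 have lam: "?lam n > 0" "?lam n <= ?lam (Suc n)" for n using assms(13) by simp_all
 have top: "filterlim ?lam at_top sequentially" by (rule filterlim_compose[OF assms(14) filterlim_Suc])
 have Xn: "associated_hunt_process (approx_form D K N \<nu> (?lam n)) (?Xn n)" for n using assms(15) by simp
 \<comment> \<open>The empty set is polar, so each \<open>K j\<close> has a point; the selection on
   the collapsed space depends on this.\<close>
 have ne: "K j ~= {}" if "j \<in> {1..N}" for j
  using assms(9) that polar_empty by fastforce
 have fin: "emeasure ?m (K j) < \<infinity>" if "j \<in> {1..N}" for j
  using radon K[OF that] by (simp add: radon_measure_def)
 \<comment> \<open>Since the right side does not mention \<alpha>, the domain of the form of
   \<open>Y\<close> is the same for every positive \<alpha>.\<close>
 have darning: "darning_domain D X K N \<alpha> = constant_domain D K N"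
  by (rule darning_domain_eq[OF assms(3) lc K disj assms(12)])
 have approx: "approximation D X K N \<nu> ?lam ?Xn"
  by (rule approximation.intro[OF dirichlet_hunt_axioms approximation_axioms.intro[OF Kc \<nu> lam top Xn]])
 have coll: "collapsing ?T ?m K N" by (rule collapsing.intro[OF sets Kc ne disj fin])
 interpret L: darning_limit D X K N \<nu> ?lam ?Xn Y \<alpha>
  by (rule darning_limit.intro[OF approx coll darning_limit_axioms.intro[OF darning assms(16)]])
 have tm: "t j <= t (Suc j)" if "j < k" for j using assms(19) that by (simp add: less_imp_le)
 have f: "f j \<in> l2_closure ?m (constant_domain D K N)" "ess_bounded ?m (f j)" if "j <= k" for j
  using assms(20) that by blast+
 show ?thesis
  by (rule LIMSEQ_imp_Suc, rule L.finite_dimensional_limit[OF assms(17,18) tm f])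
qed

end
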